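(* Consider the hybrid system $\mathcal H$ described in the context (with state $\xi=(z,e,\epsilon,\widehat w,\tau,\eta)\in\mathbb X$ and input $\nu=(v,w)\in\mathbb V$, $\nu\in\mathcal L_\infty$), and suppose that assumptions (A1)-(A5) written out in the context hold. For each $i\in\mathcal N$, let the flow dynamics $\dot\eta_i\in\Psi_i$ of the trigger variable $\eta_i$ be given by $$\Psi_i:=\varrho_i(|q_i(z,e,w)|)-\omega_i(\tau_i)\,\overline\gamma_i\,\beta_i\,W_i^2(\widetilde\epsilon_i)-\sigma_i(\eta_i)+s_i,\qquad \widetilde\epsilon_i:=\epsilon_i+\widehat w_i-w_i,$$ where $\overline\gamma_i=2\gamma_i\lambda_iL_i+\gamma_i^2(1+\lambda_i^2)$, $\beta_i=2\overline\beta_i^2/\underline\beta_i^2$, $\sigma_i$ is any $\mathcal K_\infty$-function, $s_i\ge0$ is a tuning parameter, $\lambda_i\in(0,1)$ is the tuning parameter and $\omega_i$ the set-valued map described in the context, and $\varrho_i,q_i,L_i,\gamma_i,W_i,\underline\beta_i,\overline\beta_i$ come from (A3) and (A4). Let the reset value of $\eta_i$ at a transmission of node $i$ be $$\eta_i^0:=\gamma_i\lambda_i\Big(\underline\beta_i\max\big[|\widetilde\epsilon_i|-2\overline w_i,\,0\big]\Big)^2 .$$ Then $\mathcal H$ is persistently flowing, and the set $\mathcal A:=\{\xi\in\mathbb X: e=0\land\epsilon=0\land\eta=0\}$ is input-to-state stable (ISS) if $s_i=0$ for all $i\in\mathcal N$. It is input-to-state practically stable (ISpS) if $s_i>0$ for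 some $i\in\mathcal N$.
   Context: **Hybrid systems.** Hybrid systems with inputs are understood in the sense of Goebel–Sanfelice–Teel and Cai–Teel: $\dot\xi\in F(\xi,\nu)$ on the flow set $\mathcal C$ and $\xi^+\in G(\xi,\nu)$ on the jump set $\mathcal D$; in $\mathcal C\cap\mathcal D$ the system can either flow or jump, and flow is only allowed if it keeps the solution in $\mathcal C$. Solution pairs $(\xi,\nu)$, hybrid time domains, maximality and the $\mathcal L_\infty$-norm $\|\nu\|_\infty$ of hybrid signals are as in these references. For a closed nonempty set $\mathcal A$, $|\xi|_{\mathcal A}:=\min_{y\in\mathcal A}|\xi-y|$. *Persistently flowing.* Given a set $\mathcal V\subseteq\mathcal L_\infty$ of hybrid inputs, $\mathcal H$ is persistently flowing if every maximal solution pair $(\xi,\nu)$ with $\nu\in\mathcal V$ is complete in the $t$-direction, i.e. $\sup_t\operatorname{dom}\xi=\sup_t\operatorname{dom}\nu=\infty$. *ISpS and ISS.* When $\mathcal H$ is persistently flowing with $\mathcal V\subseteq\mathcal L_\infty$, a closed nonempty set $\mathcal A$ is ISpS if there exist $\gamma\in\mathcal K$, $\beta\in\mathcal{KL}$ and $d\in\mathbb R_{\ge0}$ such that for any solution pair $(\xi,\nu)$ with $\nu\in\mathcal V$, $|\xi(t,j)|_{\mathcal A}\le\beta(|\xi(0,0)|_{\mathcal A},t)+\gamma(\|\nu\|_\infty)+d$ for all $(t,j)\in\operatorname{dom}\xi$. It is ISS if this holds with $d=0$. Here $\mathcal V$ is the set of hybrid inputs $\nu=(v,w)\in\mathcal L_\infty$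 with values in $\mathbb V$ whose noise components satisfy (A5) below. **Plant, observer and data.** Let $N\in\mathbb N_{>0}$, $\mathcal N=\{1,\dots,N\}$, $m=\sum_{i\in\mathcal N} m_i$. The plant is $\dot x=f_p(x,v)$, $y_i=h_{p,i}(x)\in\mathbb R^{m_i}$, with measured outputs $\widetilde y_i=y_i+w_i$, $i\in\mathcal N$, where $x\in\mathbb R^n$, $v$ is a disturbance with values in $\mathbb R^p$ and $w=(w_1,\dots,w_N)$ is measurement noise, $w_i$ taking values in $\mathbb R^{m_i}$; $v$ and the $w_i$ are in $\mathcal L_\infty$. Here $f_p:\mathbb R^n\times\mathbb R^p\to\mathbb R^n$ and the $h_{p,i}:\mathbb R^n\to\mathbb R^{m_i}$ are continuously differentiable; $h_p:=(h_{p,1},\dots,h_{p,N})$ (continuous differentiability is assumed of the $h_{p,i}$ only). The plant is forward complete: for all $x(0)\in\mathbb R^n$ and all $v\in\mathcal L_\infty$ there is a unique solution $x$ for all $t\ge0$. The observer is $\dot z=f_o(z,\widehat{\widetilde y})$, $\chi=h_o(z)$, with $z\in\mathbb R^q$, $\chi\in\mathbb R^n$ the estimate of $x$, $f_o:\mathbb R^q\times\mathbb R^m\to\mathbb R^q$, $h_o:\mathbb R^q\to\mathbb R^n$, and $\widehat{\widetilde y}\in\mathbb R^m$ the held estimate of $\widetilde y=(\widetilde y_1,\dots,\widetilde y_N)$. Node $i$ broadcasts $\widetilde y_i$ at its transmission times $t^i_k$, $k\in\mathbb N$, at which $\widehat{\widetilde y}_i$ is reset to $\widetilde y_i$; between transmissions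 $\tfrac{d}{dt}\widehat{\widetilde y}_i=\frac{\partial h_{p,i}}{\partial x}(h_o(z))\,f_p(h_o(z),0)$. One writes $\widehat{\widetilde y}_i=\widehat y_i+\widehat w_i$, where $\widehat w_i$ is the sampled noise ($\widehat w_i((t^i_k)^+)=w_i(t^i_k)$, $\dot{\widehat w}_i=0$), $\epsilon_i=\widehat y_i-y_i$ and $e=\chi-x$. Then $\widehat{\widetilde y}=y+\epsilon+\widehat w$. The timer $\tau_i$ measures the time since the last transmission of node $i$. **The hybrid system $\mathcal H$.** The state is $\xi=(z,e,\epsilon,\widehat w,\tau,\eta)\in\mathbb X:=\mathbb R^q\times\mathbb R^n\times\mathbb R^m\times\mathbb R^m\times\mathbb R_{\ge0}^N\times\mathbb R_{\ge0}^N$ and the input is $\nu=(v,w)\in\mathbb V:=\mathbb R^p\times\mathbb R^m$, with $\tau=(\tau_1,\dots,\tau_N)$, $\eta=(\eta_1,\dots,\eta_N)$, $\epsilon=(\epsilon_1,\dots,\epsilon_N)$, $\widehat w=(\widehat w_1,\dots,\widehat w_N)$. Write $x:=h_o(z)-e$. Flow map: $F(\xi,\nu)=\big(f_z,\,f_e,\,g,\,\mathbf 0_m,\,\mathbf 1_N,\,\Psi\big)$, where $\Psi=(\Psi_1,\dots,\Psi_N)$ and - $f_z(z,e,\epsilon,\widehat w):=f_o\big(z,h_p(h_o(z)-e)+\epsilon+\widehat w\big)$, - $f_e(z,e,\epsilon,\widehat w,v):=\frac{\partial h_o(z)}{\partial z}\,f_z(z,e,\epsilon,\widehat w)-f_p(h_o(z)-e,v)$,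 - $g=(g_1,\dots,g_N)$ with $g_i(z,e,\epsilon,\widehat w,v):=\frac{\partial h_{p,i}}{\partial x}(h_o(z))\,f_p(h_o(z),0)-\frac{\partial h_{p,i}}{\partial x}(x)\,f_p(x,v)$. Flow set: $\mathcal C=\bigcap_{i\in\mathcal N}\mathcal C_i$, $\mathcal C_i=\{\xi\in\mathbb X:\eta_i\ge0\}$. Jump set: $\mathcal D=\bigcup_{i\in\mathcal N}\mathcal D_i$, $\mathcal D_i=\{\xi\in\mathbb X:\tau_i\ge\underline\tau_i\}$ with constants $\underline\tau_i\in(0,\tau^i_{\rm MIET}]$ (no restriction on $\nu$ in either set). Jump map: $G(\xi,\nu)=\bigcup_{i:\,\xi\in\mathcal D_i}\{\overline G_i(\xi,\nu)\}$, where $\overline G_i(\xi,\nu)$ leaves $z$, $e$ and all components with index $\ne i$ unchanged and sets $\epsilon_i\mapsto0$, $\widehat w_i\mapsto w_i$, $\tau_i\mapsto0$, $\eta_i\mapsto\eta_i^0$ (evaluated at the pre-jump values). **(A1)** Each sensor $i\in\mathcal N$ runs a copy of the observer and of the held outputs, with states $z_i,\widehat{\widetilde y}^{\,i}$, and the remote observer has states $z_0,\widehat{\widetilde y}^{\,0}$; at $t=0$, $z_i(0)=z_j(0)$ and $\widehat{\widetilde y}^{\,i}(0)=\widehat{\widetilde y}^{\,j}(0)$ for all $i,j\in\mathcal N\cup\{0\}$. (Hence all copies coincide for all times and a single $z$ and $\widehat{\widetilde y}$ are used.) **(A2)** The observer is forward complete: for all $z(0)\in\mathbb R^q$ and all measurable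 signals $\widehat{\widetilde y}$, there exists a unique solution $z$ of $\dot z=f_o(z,\widehat{\widetilde y})$ for all $t\ge0$. **(A3)** For all $i\in\mathcal N$ there exist a locally Lipschitz function $W_i:\mathbb R^{m_i}\to\mathbb R_{\ge0}$ and constants $\underline\beta_i,\overline\beta_i>0$ with $\underline\beta_i|\epsilon_i|\le W_i(\epsilon_i)\le\overline\beta_i|\epsilon_i|$ for all $\epsilon_i\in\mathbb R^{m_i}$, and there exist a constant $L_i\ge0$ and a continuous function $H_i:\mathbb R^q\times\mathbb R^n\times\mathbb R^m\times\mathbb R^p\to\mathbb R_{\ge0}$ such that for almost all $\epsilon_i$ and all $v\in\mathbb R^p$, $z\in\mathbb R^q$, $e\in\mathbb R^n$, $\widehat w\in\mathbb R^m$, $$\Big\langle\frac{\partial W_i(\epsilon_i)}{\partial\epsilon_i},g_i(z,e,\epsilon,\widehat w,v)\Big\rangle\le L_iW_i(\epsilon_i)+H_i(z,e,\widehat w,v).$$ **(A4)** There exist a locally Lipschitz $V:\mathbb R^n\to\mathbb R_{\ge0}$, functions $\alpha,\underline\alpha,\overline\alpha,\zeta\in\mathcal K_\infty$ and, for all $i\in\mathcal N$, positive semi-definite functions $\varrho_i:\mathbb R_{\ge0}\to\mathbb R_{\ge0}$ and constants $\mu_i,\gamma_i>0$ such that $\underline\alpha(|e|)\le V(e)\le\overline\alpha(|e|)$ for all $e\in\mathbb R^n$, and for almost all $e\in\mathbb R^n$ and all $z\in\mathbb R^q$, $\nu=(v,w)\in\mathbb V$, $\epsilon,\widehat w\in\mathbb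 R^m$, $$\langle\nabla V(e),f_e(z,e,\epsilon,\widehat w,v)\rangle\le-\alpha(|e|)+\zeta(|\nu|)+\sum_{i\in\mathcal N}\Big(-\varrho_i(|q_i(z,e,w)|)-H_i^2(z,e,\widehat w,v)+(\gamma_i^2-\mu_i)W_i^2(\epsilon_i)\Big),$$ where $q_i(z,e,w):=h_{p,i}(h_o(z))-h_{p,i}(h_o(z)-e)-w_i$. **(A5)** For each $i\in\mathcal N$, $w_i\in\mathcal L_\infty$ and $w_i(t,j)\in\mathcal W_i:=\{w_i\in\mathbb R^{m_i}:|w_i|\le\overline w_i\}$ for all $(t,j)\in\operatorname{dom}w_i$, for some $\overline w_i\in\mathbb R_{\ge0}$ (explicitly known). **The constants $\tau^i_{\rm MIET}$ and the maps $\omega_i$.** For the tuning parameter $\lambda_i\in(0,1)$, $\tau^i_{\rm MIET}>0$ is the time at which the solution of $\dot{\bar\phi}_i=-2L_i\bar\phi_i-\gamma_i(\bar\phi_i^2+1)$, $\bar\phi_i(0)=\lambda_i^{-1}$, satisfies $\bar\phi_i(\tau^i_{\rm MIET})=\lambda_i$. The set-valued map $\omega_i:\mathbb R_{\ge0}\rightrightarrows[0,1]$ is $\omega_i(s)=\{0\}$ for $s\in[0,\tau^i_{\rm MIET})$, $\omega_i(\tau^i_{\rm MIET})=[0,1]$ and $\omega_i(s)=\{1\}$ for $s>\tau^i_{\rm MIET}$.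
   Formalization: ISS and ISpS are proved for solutions whose initial sampled noise satisfies |ŵ_i(0,0)| ≤ w̄_i and ≤ ‖ν‖∞; for arbitrary ŵ(0,0) they fail (e=0, ε=-ŵ≠0, η=0, ν=0 keeps ε constant forever). Positive semi-definite functions are taken to be continuous. *)

theory Defs
  imports "HOL-Analysis.Analysis" "HOL-Probability.Essential_Supremum"
begin

section \<open>Comparison functions and regularity\<close>

definition class_K :: "(real \<Rightarrow> real) \<Rightarrow> bool" where
  "class_K f \<longleftrightarrow> continuous_on {0..} f \<and> strict_mono_on {0..} f \<and> f 0 = 0"

definition class_K_inf :: "(real \<Rightarrow> real) \<Rightarrow> bool" where
  "class_K_inf f \<longleftrightarrow> class_K f \<and> filterlim f at_top at_top"

definition class_KL :: "(real \<Rightarrow> real \<Rightarrow> real) \<Rightarrow> bool" where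
  "class_KL \<beta> \<longleftrightarrow>
     continuous_on ({0..} \<times> {0..}) (\<lambda>(r, t). \<beta> r t) \<and>
     (\<forall>t\<ge>0. class_K (\<lambda>r. \<beta> r t)) \<and>
     (\<forall>r\<ge>0. antimono_on {0..} (\<beta> r) \<and> (\<beta> r \<longlongrightarrow> 0) at_top)"

text \<open>Positive semi-definite functions are understood to be continuous.\<close>

definition pos_semidefinite :: "(real \<Rightarrow> real) \<Rightarrow> bool" where
  "pos_semidefinite f \<longleftrightarrow> continuous_on {0..} f \<and> f 0 = 0 \<and> (\<forall>r\<ge>0. 0 \<le> f r)"

definition locally_Lipschitz :: "('a::metric_space \<Rightarrow> 'b::metric_space) \<Rightarrow> bool" where
  "locally_Lipschitz f \<longleftrightarrow> (\<forall>x. \<exists>u>0. \<exists>L. L-lipschitz_on (cball x u) f)"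

definition cont_differentiable :: "('a::real_normed_vector \<Rightarrow> 'b::real_normed_vector) \<Rightarrow> bool" where
  "cont_differentiable f \<longleftrightarrow>
     (\<exists>f'. (\<forall>x. (f has_derivative blinfun_apply (f' x)) (at x)) \<and> continuous_on UNIV f')"

definition abs_cont_on :: "real set \<Rightarrow> (real \<Rightarrow> 'a::real_normed_vector) \<Rightarrow> bool" where
  "abs_cont_on I f \<longleftrightarrow>
     (\<forall>\<epsilon>>0. \<exists>\<delta>>0. \<forall>D. finite D \<and> (\<forall>(a, b)\<in>D. a \<le> b \<and> {a..b} \<subseteq> I) \<and>
        pairwise (\<lambda>(a, b) (c, d). {a<..<b} \<inter> {c<..<d} = {}) D \<and>
        (\<Sum>(a, b)\<in>D. b - a) < \<delta> \<longrightarrow> (\<Sum>(a, b)\<in>D. norm (f b - f a)) < \<epsilon>)"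

definition locally_abs_cont_on :: "real set \<Rightarrow> (real \<Rightarrow> 'a::real_normed_vector) \<Rightarrow> bool" where
  "locally_abs_cont_on I f \<longleftrightarrow> (\<forall>a b. {a..b} \<subseteq> I \<longrightarrow> abs_cont_on {a..b} f)"


section \<open>Differential equations with inputs\<close>

text \<open>Caratheodory solutions of \<open>x' = f (x, u t)\<close> on the interval \<open>I\<close>.\<close>

definition ode_solution ::
  "('a::real_normed_vector \<Rightarrow> 'u \<Rightarrow> 'a) \<Rightarrow> (real \<Rightarrow> 'u) \<Rightarrow> real set \<Rightarrow> (real \<Rightarrow> 'a) \<Rightarrow> bool" where
  "ode_solution f u I x \<longleftrightarrow> locally_abs_cont_on I x \<and>
     (AE t in lebesgue. t \<in> I \<longrightarrow> (x has_vector_derivative f (x t) (u t)) (at t within I))"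

text \<open>The solution exists for all \<open>t \<ge> 0\<close>, and every solution with the same initial
  value, on whatever interval \<open>[0, T)\<close> it is defined, is a restriction of it.\<close>

definition unique_global_solution ::
  "('a::real_normed_vector \<Rightarrow> 'u \<Rightarrow> 'a) \<Rightarrow> (real \<Rightarrow> 'u) \<Rightarrow> 'a \<Rightarrow> bool" where
  "unique_global_solution f u x0 \<longleftrightarrow>
     (\<exists>x. x 0 = x0 \<and> ode_solution f u {0..} x \<and>
        (\<forall>T>0. \<forall>x'. x' 0 = x0 \<and> ode_solution f u {0..<T} x' \<longrightarrow> (\<forall>t\<in>{0..<T}. x' t = x t)))"

definition Linf_signal :: "(real \<Rightarrow> 'u::euclidean_space) \<Rightarrow> bool" where
  "Linf_signal v \<longleftrightarrow> v \<in> borel_measurable (lebesgue_on {0..}) \<and>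
     (\<exists>M. AE t in lebesgue_on {0..}. norm (v t) \<le> M)"


section \<open>Hybrid systems with inputs\<close>

text \<open>A hybrid signal is a function of \<open>(t, j)\<close> together with a hybrid time domain \<open>E\<close>;
  its values outside \<open>E\<close> are irrelevant.\<close>

definition compact_hybrid_time_domain :: "(real \<times> nat) set \<Rightarrow> bool" where
  "compact_hybrid_time_domain E \<longleftrightarrow>
     (\<exists>J (t :: nat \<Rightarrow> real). t 0 = 0 \<and> (\<forall>j<J. t j \<le> t (Suc j)) \<and>
        E = (\<Union>j<J. {t j..t (Suc j)} \<times> {j}))"

definition hybrid_time_domain :: "(real \<times> nat) set \<Rightarrow> bool" where
  "hybrid_time_domain E \<longleftrightarrow> E \<noteq> {} \<and> E \<subseteq> {0..} \<times> UNIV \<and>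
     (\<forall>(T, J)\<in>E. compact_hybrid_time_domain (E \<inter> {0..T} \<times> {..J}))"

definition time_slice :: "(real \<times> nat) set \<Rightarrow> nat \<Rightarrow> real set" where
  "time_slice E j = {t. (t, j) \<in> E}"

definition hybrid_arc :: "(real \<times> nat) set \<Rightarrow> (real \<Rightarrow> nat \<Rightarrow> 's::real_normed_vector) \<Rightarrow> bool" where
  "hybrid_arc E \<xi> \<longleftrightarrow> hybrid_time_domain E \<and>
     (\<forall>j. locally_abs_cont_on (time_slice E j) (\<lambda>t. \<xi> t j))"

definition hybrid_input :: "(real \<times> nat) set \<Rightarrow> (real \<Rightarrow> nat \<Rightarrow> 'u::euclidean_space) \<Rightarrow> bool" where
  "hybrid_input E \<nu> \<longleftrightarrow> hybrid_time_domain E \<and>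
     (\<forall>j. (\<lambda>t. \<nu> t j) \<in> borel_measurable (lebesgue_on (time_slice E j)) \<and>
        (\<forall>K. compact K \<and> K \<subseteq> time_slice E j \<longrightarrow>
           (\<exists>M. AE t in lebesgue. t \<in> K \<longrightarrow> norm (\<nu> t j) \<le> M)))"

definition jump_instants :: "(real \<times> nat) set \<Rightarrow> (real \<times> nat) set" where
  "jump_instants E = {(t, j). (t, j) \<in> E \<and> (t, Suc j) \<in> E}"

text \<open>The values at jump instants count pointwise, all others only up to null sets.\<close>

definition hybrid_norm :: "(real \<times> nat) set \<Rightarrow> (real \<Rightarrow> nat \<Rightarrow> 'u::euclidean_space) \<Rightarrow> ennreal" where
  "hybrid_norm E \<nu> = max
     (SUP j. esssup (lebesgue_on (time_slice E j)) (\<lambda>t. ennreal (norm (\<nu> t j))))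
     (SUP (t, j)\<in>jump_instants E. ennreal (norm (\<nu> t j)))"

definition hybrid_Linf :: "(real \<times> nat) set \<Rightarrow> (real \<Rightarrow> nat \<Rightarrow> 'u::euclidean_space) \<Rightarrow> bool" where
  "hybrid_Linf E \<nu> \<longleftrightarrow> hybrid_input E \<nu> \<and> hybrid_norm E \<nu> < \<infinity>"

record ('s, 'u) hybrid_system =
  flow_set :: "('s \<times> 'u) set"
  flow_map :: "'s \<Rightarrow> 'u \<Rightarrow> 's set"
  jump_set :: "('s \<times> 'u) set"
  jump_map :: "'s \<Rightarrow> 'u \<Rightarrow> 's set"

definition solution_pair ::
  "('s::real_normed_vector, 'u::euclidean_space) hybrid_system \<Rightarrow>
   (real \<times> nat) set \<Rightarrow> (real \<Rightarrow> nat \<Rightarrow> 's) \<Rightarrow> (real \<Rightarrow> nat \<Rightarrow> 'u) \<Rightarrow> bool" where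
  "solution_pair \<H> E \<xi> \<nu> \<longleftrightarrow>
     hybrid_arc E \<xi> \<and> hybrid_input E \<nu> \<and>
     (\<xi> 0 0, \<nu> 0 0) \<in> flow_set \<H> \<union> jump_set \<H> \<and>
     (\<forall>j. AE t in lebesgue. t \<in> time_slice E j \<longrightarrow>
        (\<xi> t j, \<nu> t j) \<in> flow_set \<H> \<and>
        (\<exists>d\<in>flow_map \<H> (\<xi> t j) (\<nu> t j).
           ((\<lambda>s. \<xi> s j) has_vector_derivative d) (at t within time_slice E j))) \<and>
     (\<forall>(t, j)\<in>jump_instants E.
        (\<xi> t j, \<nu> t j) \<in> jump_set \<H> \<and> \<xi> t (Suc j) \<in> jump_map \<H> (\<xi> t j) (\<nu> t j))"

definition maximal_solution_pair ::
  "('s::real_normed_vector, 'u::euclidean_space) hybrid_system \<Rightarrow>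
   (real \<times> nat) set \<Rightarrow> (real \<Rightarrow> nat \<Rightarrow> 's) \<Rightarrow> (real \<Rightarrow> nat \<Rightarrow> 'u) \<Rightarrow> bool" where
  "maximal_solution_pair \<H> E \<xi> \<nu> \<longleftrightarrow> solution_pair \<H> E \<xi> \<nu> \<and>
     \<not> (\<exists>E' \<xi>' \<nu>'. solution_pair \<H> E' \<xi>' \<nu>' \<and> E \<subset> E' \<and>
          (\<forall>(t, j)\<in>E. \<xi>' t j = \<xi> t j \<and> \<nu>' t j = \<nu> t j))"

definition persistently_flowing ::
  "('s::real_normed_vector, 'u::euclidean_space) hybrid_system \<Rightarrow>
   ((real \<times> nat) set \<Rightarrow> (real \<Rightarrow> nat \<Rightarrow> 'u) \<Rightarrow> bool) \<Rightarrow> bool" where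
  "persistently_flowing \<H> \<V> \<longleftrightarrow>
     (\<forall>E \<xi> \<nu>. maximal_solution_pair \<H> E \<xi> \<nu> \<and> \<V> E \<nu> \<longrightarrow> \<not> bdd_above (fst ` E))"

text \<open>\<open>X0 E \<nu>\<close> is the set of initial states that are considered together with the
  input \<open>\<nu>\<close>; it is \<open>UNIV\<close> for the unrestricted notion.\<close>

definition stability_estimate ::
  "('s::real_normed_vector, 'u::euclidean_space) hybrid_system \<Rightarrow>
   ((real \<times> nat) set \<Rightarrow> (real \<Rightarrow> nat \<Rightarrow> 'u) \<Rightarrow> bool) \<Rightarrow>
   ((real \<times> nat) set \<Rightarrow> (real \<Rightarrow> nat \<Rightarrow> 'u) \<Rightarrow> 's set) \<Rightarrow> 's set \<Rightarrow> real \<Rightarrow> bool" where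
  "stability_estimate \<H> \<V> X0 \<A> d \<longleftrightarrow>
     (\<exists>\<gamma> \<beta>. class_K \<gamma> \<and> class_KL \<beta> \<and>
        (\<forall>E \<xi> \<nu>. solution_pair \<H> E \<xi> \<nu> \<and> \<V> E \<nu> \<and> \<xi> 0 0 \<in> X0 E \<nu> \<longrightarrow>
           (\<forall>(t, j)\<in>E. infdist (\<xi> t j) \<A>
              \<le> \<beta> (infdist (\<xi> 0 0) \<A>) t + \<gamma> (enn2real (hybrid_norm E \<nu>)) + d)))"

definition ISpS where
  "ISpS \<H> \<V> X0 \<A> \<longleftrightarrow> closed \<A> \<and> \<A> \<noteq> {} \<and> (\<exists>d\<ge>0. stability_estimate \<H> \<V> X0 \<A> d)"

definition ISS where
  "ISS \<H> \<V> X0 \<A> \<longleftrightarrow> closed \<A> \<and> \<A> \<noteq> {} \<and> stability_estimate \<H> \<V> X0 \<A> 0"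


section \<open>Plant, observer and triggering mechanism\<close>

text \<open>The nodes are the elements of \<open>'k\<close>. The output coordinates of all nodes are the
  elements of \<open>'m\<close>, and \<open>node k\<close> is the node that coordinate \<open>k\<close> belongs to; so
  \<open>m\<^sub>i = card {k. node k = i}\<close>, and the space of outputs of node \<open>i\<close> is the
  coordinate subspace of all \<open>y\<close> with \<open>block node i y = y\<close>.\<close>

definition block :: "('m \<Rightarrow> 'k) \<Rightarrow> 'k \<Rightarrow> real^'m \<Rightarrow> real^'m::finite" where
  "block nd i y = (\<chi> k. if nd k = i then y $ k else 0)"

record ('n, 'm, 'p, 'q, 'k) estimation_setup =
  node :: "'m \<Rightarrow> 'k"
  fp :: "real^'n \<Rightarrow> real^'p \<Rightarrow> real^'n"
  hp :: "real^'n \<Rightarrow> real^'m"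
  fo :: "real^'q \<Rightarrow> real^'m \<Rightarrow> real^'q"
  ho :: "real^'q \<Rightarrow> real^'n"

definition hpi ::
  "('n::finite, 'm::finite, 'p::finite, 'q::finite, 'k::finite) estimation_setup \<Rightarrow>
   'k \<Rightarrow> real^'n \<Rightarrow> real^'m" where
  "hpi S i x = block (node S) i (hp S x)"

definition plant_forward_complete where
  "plant_forward_complete S \<longleftrightarrow> (\<forall>v x0. Linf_signal v \<longrightarrow> unique_global_solution (fp S) v x0)"

definition observer_forward_complete where
  "observer_forward_complete S \<longleftrightarrow>
     (\<forall>y z0. y \<in> borel_measurable (lebesgue_on {0..}) \<longrightarrow> unique_global_solution (fo S) y z0)"

text \<open>Per node: the function \<open>W\<close>, the constants \<open>L\<close>, \<open>\<gamma>\<close>, \<open>\<lambda>\<close>, the lower and upper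
  bounds \<open>\<beta>\<close> of \<open>W\<close>, the functions \<open>\<rho>\<close> and \<open>\<sigma>\<close>, the parameter \<open>s\<close>, the noise
  bound, and the two times \<open>\<tau>\<close> (minimal timer value for a transmission, and MIET).\<close>

record ('m, 'k) trigger =
  Wf :: "'k \<Rightarrow> real^'m \<Rightarrow> real"
  Lc :: "'k \<Rightarrow> real"
  gam :: "'k \<Rightarrow> real"
  lam :: "'k \<Rightarrow> real"
  blow :: "'k \<Rightarrow> real"
  bup :: "'k \<Rightarrow> real"
  rho :: "'k \<Rightarrow> real \<Rightarrow> real"
  sig :: "'k \<Rightarrow> real \<Rightarrow> real"
  spar :: "'k \<Rightarrow> real"
  wbar :: "'k \<Rightarrow> real"
  tmin :: "'k \<Rightarrow> real"
  tMIET :: "'k \<Rightarrow> real"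

text \<open>\<open>T\<close> is the time at which the solution of
  \<open>\<phi>' = - 2 L \<phi> - \<gamma> (\<phi>\<^sup>2 + 1)\<close>, \<open>\<phi> 0 = 1 / l\<close> takes the value \<open>l\<close>.\<close>

definition is_MIET :: "real \<Rightarrow> real \<Rightarrow> real \<Rightarrow> real \<Rightarrow> bool" where
  "is_MIET L \<gamma> l T \<longleftrightarrow> T > 0 \<and>
     (\<exists>\<phi>. \<phi> 0 = 1 / l \<and> \<phi> T = l \<and>
        (\<forall>t\<in>{0..T}. (\<phi> has_real_derivative (- 2 * L * \<phi> t - \<gamma> * ((\<phi> t)\<^sup>2 + 1)))
                        (at t within {0..T})))"

definition omega :: "real \<Rightarrow> real \<Rightarrow> real set" where
  "omega T s = (if s < T then {0} else if s = T then {0..1} else {1})"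

definition gam_bar :: "('m::finite, 'k) trigger \<Rightarrow> 'k \<Rightarrow> real" where
  "gam_bar P i = 2 * gam P i * lam P i * Lc P i + (gam P i)\<^sup>2 * (1 + (lam P i)\<^sup>2)"

definition beta_ratio :: "('m::finite, 'k) trigger \<Rightarrow> 'k \<Rightarrow> real" where
  "beta_ratio P i = 2 * (bup P i)\<^sup>2 / (blow P i)\<^sup>2"


section \<open>The hybrid model\<close>

text \<open>The copies of the observer and of the held outputs that run at the nodes and at the
  remote location have equal initial values and receive the same data, hence coincide; the
  state therefore contains a single \<open>z\<close>, and the held outputs are
  \<open>y + \<epsilon> + wh\<close> with the sampling error \<open>\<epsilon>\<close> and the sampled noise \<open>wh\<close>.\<close>

type_synonym ('n, 'm, 'q, 'k) state =
  "(real^'q) \<times> (real^'n) \<times> (real^'m) \<times> (real^'m) \<times> (real^'k) \<times> (real^'k)"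

type_synonym ('m, 'p) input = "(real^'p) \<times> (real^'m)"

definition f_z ::
  "('n::finite, 'm::finite, 'p::finite, 'q::finite, 'k::finite) estimation_setup \<Rightarrow>
   real^'q \<Rightarrow> real^'n \<Rightarrow> real^'m \<Rightarrow> real^'m \<Rightarrow> real^'q" where
  "f_z S z e \<epsilon> wh = fo S z (hp S (ho S z - e) + \<epsilon> + wh)"

definition f_e ::
  "('n::finite, 'm::finite, 'p::finite, 'q::finite, 'k::finite) estimation_setup \<Rightarrow>
   real^'q \<Rightarrow> real^'n \<Rightarrow> real^'m \<Rightarrow> real^'m \<Rightarrow> real^'p \<Rightarrow> real^'n" where
  "f_e S z e \<epsilon> wh v =
     frechet_derivative (ho S) (at z) (f_z S z e \<epsilon> wh) - fp S (ho S z - e) v"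

text \<open>The maps \<open>g\<^sub>i\<close> do not depend on \<open>\<epsilon>\<close> and on the sampled noise.\<close>

definition g_i ::
  "('n::finite, 'm::finite, 'p::finite, 'q::finite, 'k::finite) estimation_setup \<Rightarrow>
   'k \<Rightarrow> real^'q \<Rightarrow> real^'n \<Rightarrow> real^'p \<Rightarrow> real^'m" where
  "g_i S i z e v =
     frechet_derivative (hpi S i) (at (ho S z)) (fp S (ho S z) 0)
     - frechet_derivative (hpi S i) (at (ho S z - e)) (fp S (ho S z - e) v)"

definition q_i ::
  "('n::finite, 'm::finite, 'p::finite, 'q::finite, 'k::finite) estimation_setup \<Rightarrow>
   'k \<Rightarrow> real^'q \<Rightarrow> real^'n \<Rightarrow> real^'m \<Rightarrow> real^'m" where
  "q_i S i z e w = hpi S i (ho S z) - hpi S i (ho S z - e) - block (node S) i w"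

definition Psi ::
  "('n::finite, 'm::finite, 'p::finite, 'q::finite, 'k::finite) estimation_setup \<Rightarrow> ('m, 'k) trigger \<Rightarrow>
   'k \<Rightarrow> ('n, 'm, 'q, 'k) state \<Rightarrow> ('m, 'p) input \<Rightarrow> real set" where
  "Psi S P i = (\<lambda>(z, e, \<epsilon>, wh, \<tau>, \<eta>) (v, w).
     {rho P i (norm (q_i S i z e w))
        - \<omega> * gam_bar P i * beta_ratio P i * (Wf P i (block (node S) i (\<epsilon> + wh - w)))\<^sup>2
        - sig P i (\<eta> $ i) + spar P i | \<omega>. \<omega> \<in> omega (tMIET P i) (\<tau> $ i)})"

definition eta_reset ::
  "('n::finite, 'm::finite, 'p::finite, 'q::finite, 'k::finite) estimation_setup \<Rightarrow> ('m, 'k) trigger \<Rightarrow>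
   'k \<Rightarrow> ('n, 'm, 'q, 'k) state \<Rightarrow> ('m, 'p) input \<Rightarrow> real" where
  "eta_reset S P i = (\<lambda>(z, e, \<epsilon>, wh, \<tau>, \<eta>) (v, w).
     gam P i * lam P i *
       (blow P i * max (norm (block (node S) i (\<epsilon> + wh - w)) - 2 * wbar P i) 0)\<^sup>2)"

definition state_space :: "('n::finite, 'm::finite, 'q::finite, 'k::finite) state set" where
  "state_space = {(z, e, \<epsilon>, wh, \<tau>, \<eta>). \<forall>i. 0 \<le> \<tau> $ i \<and> 0 \<le> \<eta> $ i}"

definition flow_set_i :: "'k \<Rightarrow> ('n::finite, 'm::finite, 'q::finite, 'k::finite) state set" where
  "flow_set_i i = {(z, e, \<epsilon>, wh, \<tau>, \<eta>) \<in> state_space. \<eta> $ i \<ge> 0}"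

definition jump_set_i ::
  "('m, 'k) trigger \<Rightarrow> 'k \<Rightarrow> ('n::finite, 'm::finite, 'q::finite, 'k::finite) state set" where
  "jump_set_i P i = {(z, e, \<epsilon>, wh, \<tau>, \<eta>) \<in> state_space. \<tau> $ i \<ge> tmin P i}"

definition flow_dyn ::
  "('n::finite, 'm::finite, 'p::finite, 'q::finite, 'k::finite) estimation_setup \<Rightarrow> ('m, 'k) trigger \<Rightarrow>
   ('n, 'm, 'q, 'k) state \<Rightarrow> ('m, 'p) input \<Rightarrow> ('n, 'm, 'q, 'k) state set" where
  "flow_dyn S P = (\<lambda>(z, e, \<epsilon>, wh, \<tau>, \<eta>) (v, w).
     {(f_z S z e \<epsilon> wh, f_e S z e \<epsilon> wh v, \<Sum>i\<in>UNIV. g_i S i z e v, 0, \<chi> i. 1, \<psi>) | \<psi>.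
        \<forall>i. \<psi> $ i \<in> Psi S P i (z, e, \<epsilon>, wh, \<tau>, \<eta>) (v, w)})"

definition jump_i ::
  "('n::finite, 'm::finite, 'p::finite, 'q::finite, 'k::finite) estimation_setup \<Rightarrow> ('m, 'k) trigger \<Rightarrow>
   'k \<Rightarrow> ('n, 'm, 'q, 'k) state \<Rightarrow> ('m, 'p) input \<Rightarrow> ('n, 'm, 'q, 'k) state" where
  "jump_i S P i = (\<lambda>(z, e, \<epsilon>, wh, \<tau>, \<eta>) (v, w).
     (z, e,
      \<chi> k. if node S k = i then 0 else \<epsilon> $ k,
      \<chi> k. if node S k = i then w $ k else wh $ k,
      \<chi> l. if l = i then 0 else \<tau> $ l,
      \<chi> l. if l = i then eta_reset S P i (z, e, \<epsilon>, wh, \<tau>, \<eta>) (v, w) else \<eta> $ l))"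

definition estimation_system ::
  "('n::finite, 'm::finite, 'p::finite, 'q::finite, 'k::finite) estimation_setup \<Rightarrow> ('m, 'k) trigger \<Rightarrow>
   (('n, 'm, 'q, 'k) state, ('m, 'p) input) hybrid_system" where
  "estimation_system S P = \<lparr>
     flow_set = (\<Inter>i. flow_set_i i) \<times> UNIV,
     flow_map = flow_dyn S P,
     jump_set = (\<Union>i. jump_set_i P i) \<times> UNIV,
     jump_map = (\<lambda>\<xi> \<nu>. {jump_i S P i \<xi> \<nu> | i. \<xi> \<in> jump_set_i P i})\<rparr>"

definition target_set :: "('n::finite, 'm::finite, 'q::finite, 'k::finite) state set" where
  "target_set = {(z, e, \<epsilon>, wh, \<tau>, \<eta>) \<in> state_space. e = 0 \<and> \<epsilon> = 0 \<and> \<eta> = 0}"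

definition admissible_input ::
  "('n::finite, 'm::finite, 'p::finite, 'q::finite, 'k::finite) estimation_setup \<Rightarrow> ('m, 'k) trigger \<Rightarrow>
   (real \<times> nat) set \<Rightarrow> (real \<Rightarrow> nat \<Rightarrow> ('m, 'p) input) \<Rightarrow> bool" where
  "admissible_input S P E \<nu> \<longleftrightarrow> hybrid_Linf E \<nu> \<and>
     (\<forall>(t, j)\<in>E. \<forall>i. norm (block (node S) i (snd (\<nu> t j))) \<le> wbar P i)"

text \<open>The component \<open>wh\<close> holds samples of the noise. Its initial value has not been
  produced by a jump, so that it is a sample, subject to the bounds that hold for the noise,
  has to be required separately. With arbitrary initial \<open>wh\<close> the stability estimates fail:
  \<open>e = 0\<close>, \<open>\<epsilon> = - wh \<noteq> 0\<close>, \<open>\<eta> = 0\<close> persists along a flow with zero input if the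
  parameters \<open>s\<close> vanish.\<close>

definition sampled_noise_init ::
  "('n::finite, 'm::finite, 'p::finite, 'q::finite, 'k::finite) estimation_setup \<Rightarrow> ('m, 'k) trigger \<Rightarrow>
   (real \<times> nat) set \<Rightarrow> (real \<Rightarrow> nat \<Rightarrow> ('m, 'p) input) \<Rightarrow> ('n, 'm, 'q, 'k) state set" where
  "sampled_noise_init S P E \<nu> = {(z, e, \<epsilon>, wh, \<tau>, \<eta>).
     \<forall>i. norm (block (node S) i wh) \<le> wbar P i \<and>
         ennreal (norm (block (node S) i wh)) \<le> hybrid_norm E \<nu>}"


section \<open>Assumptions\<close>

text \<open>The function \<open>W\<^sub>i\<close> of \<open>\<epsilon>\<^sub>i\<close> is treated as the function \<open>\<epsilon> \<mapsto> W\<^sub>i (\<epsilon>\<^sub>i)\<close>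
  of the whole vector; a set of blocks \<open>\<epsilon>\<^sub>i\<close> is a null set if and only if the set of all
  \<open>\<epsilon>\<close> having such a block is one. ``For almost all'' includes the existence of the
  gradient, which for locally Lipschitz functions is automatic by Rademacher's theorem.\<close>

definition assumption_W ::
  "('n::finite, 'm::finite, 'p::finite, 'q::finite, 'k::finite) estimation_setup \<Rightarrow> ('m, 'k) trigger \<Rightarrow>
   ('k \<Rightarrow> real^'q \<Rightarrow> real^'n \<Rightarrow> real^'m \<Rightarrow> real^'p \<Rightarrow> real) \<Rightarrow> bool" where
  "assumption_W S P H \<longleftrightarrow> (\<forall>i.
     locally_Lipschitz (\<lambda>\<epsilon>. Wf P i (block (node S) i \<epsilon>)) \<and>
     blow P i > 0 \<and> bup P i > 0 \<and> Lc P i \<ge> 0 \<and>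
     (\<forall>\<epsilon>. blow P i * norm (block (node S) i \<epsilon>) \<le> Wf P i (block (node S) i \<epsilon>) \<and>
          Wf P i (block (node S) i \<epsilon>) \<le> bup P i * norm (block (node S) i \<epsilon>)) \<and>
     continuous_on UNIV (\<lambda>(z, e, wh, v). H i z e wh v) \<and>
     (\<forall>z e wh v. 0 \<le> H i z e wh v) \<and>
     (AE \<epsilon> in lborel. \<exists>D. GDERIV (\<lambda>\<epsilon>. Wf P i (block (node S) i \<epsilon>)) \<epsilon> :> D \<and>
        (\<forall>z e wh v. D \<bullet> g_i S i z e v
           \<le> Lc P i * Wf P i (block (node S) i \<epsilon>) + H i z e wh v)))"

definition assumption_V ::
  "('n::finite, 'm::finite, 'p::finite, 'q::finite, 'k::finite) estimation_setup \<Rightarrow> ('m, 'k) trigger \<Rightarrow>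
   ('k \<Rightarrow> real^'q \<Rightarrow> real^'n \<Rightarrow> real^'m \<Rightarrow> real^'p \<Rightarrow> real) \<Rightarrow>
   (real^'n \<Rightarrow> real) \<Rightarrow> (real \<Rightarrow> real) \<Rightarrow> (real \<Rightarrow> real) \<Rightarrow> (real \<Rightarrow> real) \<Rightarrow> (real \<Rightarrow> real) \<Rightarrow>
   ('k \<Rightarrow> real) \<Rightarrow> bool" where
  "assumption_V S P H V \<alpha> \<alpha>l \<alpha>u \<zeta> \<mu> \<longleftrightarrow>
     locally_Lipschitz V \<and> (\<forall>e. 0 \<le> V e) \<and>
     class_K_inf \<alpha> \<and> class_K_inf \<alpha>l \<and> class_K_inf \<alpha>u \<and> class_K_inf \<zeta> \<and>
     (\<forall>i. pos_semidefinite (rho P i) \<and> \<mu> i > 0 \<and> gam P i > 0) \<and>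
     (\<forall>e. \<alpha>l (norm e) \<le> V e \<and> V e \<le> \<alpha>u (norm e)) \<and>
     (AE e in lborel. \<exists>D. GDERIV V e :> D \<and>
        (\<forall>z v w \<epsilon> wh. D \<bullet> f_e S z e \<epsilon> wh v
           \<le> - \<alpha> (norm e) + \<zeta> (norm (v, w)) +
             (\<Sum>i\<in>UNIV. - rho P i (norm (q_i S i z e w)) - (H i z e wh v)\<^sup>2
                + ((gam P i)\<^sup>2 - \<mu> i) * (Wf P i (block (node S) i \<epsilon>))\<^sup>2)))"

end

theory Submission
  imports Defs
begin

text \<open>
  The Lyapunov function is \<open>V(e) + \<Sum>\<^sub>i (\<gamma>\<^sub>i \<Phi>\<^sub>i(\<tau>\<^sub>i) W\<^sub>i(\<epsilon>\<^sub>i)\<^sup>2 + \<eta>\<^sub>i)\<close>, where \<open>\<Phi>\<^sub>i\<close> solves the MIET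
  equation and stays at \<open>\<lambda>\<^sub>i\<close> afterwards. Along flows it decreases at a rate \<open>\<psi>\<close> of its value, up to
  a term controlled by the input and the parameters \<open>s\<^sub>i\<close>; the part of \<open>W\<^sub>i(\<epsilon>\<^sub>i)\<^sup>2\<close> that \<open>\<Phi>\<^sub>i\<close> no longer
  compensates is paid for by \<open>\<eta>\<^sub>i\<close>. It does not increase at jumps. Since \<open>V\<close> and \<open>W\<^sub>i\<close> are only
  locally Lipschitz, their almost everywhere gradient bounds are turned into bounds on
  directional rates at every point.

  For persistent flow, the number of jumps is bounded on bounded time intervals, so a maximal
  solution of bounded duration has a last slice. If that slice is open at its end, the Lyapunov
  bound and the completeness of the observer bound all derivatives but that of \<open>z\<close>, and the
  solution extends to the end point. If it is closed, flow can always continue for suitably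
  chosen inputs. Both steps use that assumption (A4) forces \<open>ho z\<close> to follow the undisturbed plant.
\<close>

section \<open>Monotonicity from almost everywhere rates\<close>

text \<open>All that is assumed of \<open>fo\<close> by itself is that observer solutions exist and
  are unique; it need be neither continuous nor bounded. So the velocity of \<open>z\<close> has no
  a priori bound, and \<open>f_e\<close>, which contains \<open>fo\<close> through the derivative of
  \<open>ho\<close>, cannot be estimated directly. The substitute is the shape of
  \<open>assumption_V\<close>: one null set of errors serves all \<open>z\<close>,
  \<open>\<epsilon>\<close> and \<open>wh\<close>, and \<open>wh\<close> enters the right-hand side
  only through \<open>- H\<^sup>2\<close>, which is at most 0. By varying \<open>wh\<close> the
  observer can be fed any held output at no cost. Maximality compares a solution pair with all
  solution pairs, not only with those whose input is admissible. The input of a continuation may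
  thus violate the noise bounds, and it can be chosen so that the trigger variables stay
  nonnegative. Conversely, persistent flow is claimed for all initial states, so the estimates
  behind it have to cope with a \<open>wh\<close> that is no sample of the noise.\<close>

text \<open>Increments are taken over intervals that straddle \<open>t\<close>. The second notion replaces absolute
  continuity of \<open>u\<close>: it also covers \<open>u = F \<circ> g\<close> with \<open>F\<close> merely differentiable (as the output
  map \<open>ho\<close>), where \<open>K\<close> and \<open>\<delta>\<close> cannot be chosen uniformly in \<open>t\<close>.\<close>

definition upper_rate :: "real set \<Rightarrow> (real \<Rightarrow> real) \<Rightarrow> real \<Rightarrow> real \<Rightarrow> bool" where
  "upper_rate I u t m \<longleftrightarrow> (\<forall>\<eta>>0. \<exists>\<delta>>0. \<forall>p\<in>I. \<forall>q\<in>I. p \<le> t \<and> t \<le> q \<and> q - p < \<delta> \<longrightarrow>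
     u q - u p \<le> (m + \<eta>) * (q - p))"

definition dominated_at :: "real set \<Rightarrow> (real \<Rightarrow> 'a::real_normed_vector) \<Rightarrow> (real \<Rightarrow> real) \<Rightarrow> real \<Rightarrow> bool" where
  "dominated_at I g u t \<longleftrightarrow> (\<exists>K\<ge>0. \<exists>\<delta>>0. \<forall>p\<in>I. \<forall>q\<in>I. p \<le> t \<and> t \<le> q \<and> q - p < \<delta> \<longrightarrow>
     u q - u p \<le> K * (norm (g q - g t) + norm (g t - g p)))"

definition interval_family :: "real set \<Rightarrow> (real \<times> real) set \<Rightarrow> bool" where
  "interval_family I D \<longleftrightarrow> finite D \<and> (\<forall>(a, b)\<in>D. a \<le> b \<and> {a..b} \<subseteq> I) \<and>
     pairwise (\<lambda>(a, b) (c, d). {a<..<b} \<inter> {c<..<d} = {}) D"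

lemma abs_cont_on_alt:
  "abs_cont_on I f \<longleftrightarrow> (\<forall>\<epsilon>>0. \<exists>\<delta>>0. \<forall>D. interval_family I D \<and> (\<Sum>(a, b)\<in>D. b - a) < \<delta> \<longrightarrow>
     (\<Sum>(a, b)\<in>D. norm (f b - f a)) < \<epsilon>)"
  unfolding abs_cont_on_def interval_family_def by (simp add: conj_assoc)

lemma interval_familyD:
  assumes "interval_family I D"
  shows "finite D" "\<And>x. x \<in> D \<Longrightarrow> fst x \<le> snd x" "\<And>x. x \<in> D \<Longrightarrow> {fst x..snd x} \<subseteq> I"
    "\<And>x. x \<in> D \<Longrightarrow> fst x \<in> I" "\<And>x. x \<in> D \<Longrightarrow> snd x \<in> I"
    "\<And>x y. x \<in> D \<Longrightarrow> y \<in> D \<Longrightarrow> x \<noteq> y \<Longrightarrow> {fst x<..<snd x} \<inter> {fst y<..<snd y} = {}"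
proof -
  show 1: "\<And>x. x \<in> D \<Longrightarrow> fst x \<le> snd x" and 2: "\<And>x. x \<in> D \<Longrightarrow> {fst x..snd x} \<subseteq> I"
    using assms unfolding interval_family_def by fastforce+
  show "\<And>x. x \<in> D \<Longrightarrow> fst x \<in> I" "\<And>x. x \<in> D \<Longrightarrow> snd x \<in> I"
    using 1 2 by (meson atLeastAtMost_iff order_refl subsetD)+
qed (use assms in \<open>auto simp: interval_family_def pairwise_def case_prod_unfold\<close>)

text \<open>Cover the exceptional null set by open sets \<open>O\<^sub>n\<close> that are so small that \<open>g\<close> varies by at
  most \<open>\<epsilon> 2\<^sup>-\<^sup>n / n\<close> on them; intervals tagged by a point with constant \<open>K \<approx> n\<close> are charged to
  \<open>O\<^sub>n\<close>.\<close>

lemma increment_le_0: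
  fixes u :: "real \<Rightarrow> real"
  assumes ab: "a \<le> b" and ac: "abs_cont_on {a..b} g"
    and dom: "\<And>t. t \<in> {a..b} \<Longrightarrow> dominated_at {a..b} g u t"
    and ae: "AE t in lebesgue. t \<in> {a..b} \<longrightarrow> upper_rate {a..b} u t 0"
  shows "u b \<le> u a"
proof (rule field_le_epsilon)
  fix e :: real assume e: "e > 0"
  \<comment> \<open>Half of \<open>e\<close> pays for the error of the rate over the whole interval,
    the other half for the intervals tagged by exceptional points. The \<open>+ 1\<close> covers
    \<open>a = b\<close>.\<close>
  define \<eta> where "\<eta> = e / (2 * (b - a + 1))"
  have \<eta>: "\<eta> > 0" "\<eta> * (b - a) \<le> e / 2" using e ab by (auto simp: \<eta>_def field_simps)
  obtain N where N: "N \<in> null_sets lebesgue" "\<And>t. t \<in> {a..b} \<Longrightarrow> t \<notin> N \<Longrightarrow> upper_rate {a..b} u t 0"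
  proof -
    from AE_E3[OF ae] obtain N where "\<And>t. t \<in> space lebesgue - N \<Longrightarrow> t \<in> {a..b} \<longrightarrow> upper_rate {a..b} u t 0"
      "N \<in> null_sets lebesgue" by blast
    then show ?thesis by (intro that[of N]) auto
  qed
  \<comment> \<open>Rounding the domination constants up to integers splits the exceptional points
    into countably many classes, so that countably many open covers suffice.\<close>
  have "\<exists>k::nat. \<exists>\<delta>>0. \<forall>p\<in>{a..b}. \<forall>q\<in>{a..b}. p \<le> t \<and> t \<le> q \<and> q - p < \<delta> \<longrightarrow>
     u q - u p \<le> (real k + 1) * (norm (g q - g t) + norm (g t - g p))" if t: "t \<in> {a..b}" for t
  proof -
    obtain K \<delta> where K: "K \<ge> 0" "\<delta> > 0" "\<forall>p\<in>{a..b}. \<forall>q\<in>{a..b}. p \<le> t \<and> t \<le> q \<and> q - p < \<delta> \<longrightarrow>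
     u q - u p \<le> K * (norm (g q - g t) + norm (g t - g p))"
      using dom[OF t] unfolding dominated_at_def by meson
    have "K \<le> real (nat \<lceil>K\<rceil>) + 1" by linarith
    then have *: "K * (norm (g q - g t) + norm (g t - g p)) \<le> (real (nat \<lceil>K\<rceil>) + 1) * (norm (g q - g t) + norm (g t - g p))" for p q
      by (intro mult_right_mono) auto
    show ?thesis
      by (intro exI[of _ "nat \<lceil>K\<rceil>"] exI[of _ \<delta>] conjI K ballI impI) (use K(3) * in \<open>meson order.trans\<close>)
  qed
  then obtain k :: "real \<Rightarrow> nat" and dd where kk: "\<And>t. t \<in> {a..b} \<Longrightarrow> dd t > 0"
     "\<And>t p q. t \<in> {a..b} \<Longrightarrow> p \<in> {a..b} \<Longrightarrow> q \<in> {a..b} \<Longrightarrow> p \<le> t \<Longrightarrow> t \<le> q \<Longrightarrow> q - p < dd t \<Longrightarrow>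
     u q - u p \<le> (real (k t) + 1) * (norm (g q - g t) + norm (g t - g p))"
    by metis
  define ek where "ek n = e / 2 * (1/2) ^ (Suc n) / (real n + 1)" for n
  have ek: "ek n > 0" for n using e by (simp add: ek_def)
  have "\<exists>\<delta>>0. \<forall>D. interval_family {a..b} D \<and> (\<Sum>(a, b)\<in>D. b - a) < \<delta> \<longrightarrow>
     (\<Sum>(a, b)\<in>D. norm (g b - g a)) < ek n" for n
    using ac ek unfolding abs_cont_on_alt by blast
  then obtain dl where dl: "\<And>n. dl n > 0" "\<And>n D. interval_family {a..b} D \<Longrightarrow> (\<Sum>(a, b)\<in>D. b - a) < dl n \<Longrightarrow>
     (\<Sum>(a, b)\<in>D. norm (g b - g a)) < ek n"
    by metis
  have "\<exists>Op. open Op \<and> N \<subseteq> Op \<and> emeasure lebesgue Op < ennreal (dl n)" for n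
  proof -
    obtain T where T: "open T" "N \<subseteq> T" "emeasure lebesgue (T - N) < ennreal (dl n)"
      using sets_lebesgue_outer_open[of N "dl n"] N(1) dl(1) by (metis null_setsD2)
    have "emeasure lebesgue (T - N) = emeasure lebesgue T"
      using N(1) T(1) by (intro emeasure_Diff_null_set) (auto intro: borel_open sets_completionI_sets)
    then show ?thesis using T by auto
  qed
  then obtain Op where Op: "\<And>n. open (Op n)" "\<And>n. N \<subseteq> Op n" "\<And>n. emeasure lebesgue (Op n) < ennreal (dl n)"
    by metis
  \<comment> \<open>The first component records the cover \<open>Op n\<close> to which an interval
    is charged. Requiring \<open>c < d\<close> gives each member a nonempty interior, so members
    with disjoint interiors are different and gluing two families is a disjoint union.\<close>
  define fam where "fam p q T \<longleftrightarrow> finite T \<and> (\<forall>(n, c, d)\<in>T. c < d \<and> p \<le> c \<and> d \<le> q \<and> {c..d} \<subseteq> Op n) \<and>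
      pairwise (\<lambda>(n, c, d) (n', c', d'). {c<..<d} \<inter> {c'<..<d'} = {}) T"
    for p q and T :: "(nat \<times> real \<times> real) set"
  define w where "w = (\<lambda>(n::nat, c, d). (real n + 1) * norm (g d - g c))"
  have w0: "w x \<ge> 0" for x by (auto simp: w_def split: prod.splits)
  \<comment> \<open>Bolzano's lemma builds the partition: bounds are glued at common end points, and
    only short intervals around a given point remain to be treated. Those may leave
    \<open>{a..b}\<close>, where the premise makes the claim vacuous.\<close>
  define PP where "PP p q \<longleftrightarrow> (a \<le> p \<and> p \<le> q \<and> q \<le> b \<longrightarrow> (\<exists>T. fam p q T \<and> u q - u p \<le> \<eta> * (q - p) + sum w T))" for p q
  have "PP a b"
  proof (rule Bolzano[OF ab])
    fix p q r assume *: "PP p q" "PP q r" "p \<le> q" "q \<le> r"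
    show "PP p r" unfolding PP_def
    proof
      assume h: "a \<le> p \<and> p \<le> r \<and> r \<le> b"
      obtain T1 T2 where T: "fam p q T1" "fam q r T2" "u q - u p \<le> \<eta> * (q - p) + sum w T1" "u r - u q \<le> \<eta> * (r - q) + sum w T2"
        using * h unfolding PP_def by (meson order.trans)
      have disj: "T1 \<inter> T2 = {}"
      proof -
        have "d \<le> q" "c < d" if "(n, c, d) \<in> T1" for n c d using T(1) that unfolding fam_def by auto
        moreover have "q \<le> c" "c < d" if "(n, c, d) \<in> T2" for n c d using T(2) that unfolding fam_def by auto
        ultimately have "x \<notin> T2" if "x \<in> T1" for x using that by (metis leD order.trans prod_cases3 less_le_trans)
        then show ?thesis by blast
      qed
      have "fam p r (T1 \<union> T2)"
        unfolding fam_def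
      proof (intro conjI)
        show "finite (T1 \<union> T2)" using T unfolding fam_def by auto
        show "\<forall>(n, c, d)\<in>T1 \<union> T2. c < d \<and> p \<le> c \<and> d \<le> r \<and> {c..d} \<subseteq> Op n"
          using T *(3,4) unfolding fam_def by fastforce
        show "pairwise (\<lambda>(n, c, d) (n', c', d'). {c<..<d} \<inter> {c'<..<d'} = {}) (T1 \<union> T2)"
          unfolding pairwise_def
        proof (intro ballI impI)
          fix x y assume xy: "x \<in> T1 \<union> T2" "y \<in> T1 \<union> T2" "x \<noteq> y"
          obtain n c d n' c' d' where e: "x = (n, c, d)" "y = (n', c', d')" by (metis prod_cases3)
          have 1: "d \<le> q" if "(n, c, d) \<in> T1" for n c d using T(1) that unfolding fam_def by auto
          have 2: "q \<le> c" if "(n, c, d) \<in> T2" for n c d using T(2) that unfolding fam_def by auto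
          have 3: "{c<..<d} \<inter> {c'<..<d'} = {}" if "x \<in> T1" "y \<in> T1"
            using T(1) that xy e unfolding fam_def pairwise_def by fastforce
          have 4: "{c<..<d} \<inter> {c'<..<d'} = {}" if "x \<in> T2" "y \<in> T2"
            using T(2) that xy e unfolding fam_def pairwise_def by fastforce
          have "{c<..<d} \<inter> {c'<..<d'} = {}" if "x \<in> T1" "y \<in> T2"
            using 1[of n c d] 2[of n' c' d'] that e by auto
          moreover have "{c<..<d} \<inter> {c'<..<d'} = {}" if "x \<in> T2" "y \<in> T1"
            using 1[of n' c' d'] 2[of n c d] that e by auto
          ultimately show "(case x of (n, c, d) \<Rightarrow> \<lambda>(n', c', d'). {c<..<d} \<inter> {c'<..<d'} = {}) y"
            using 3 4 xy e by auto
        qed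
      qed
      moreover have "sum w (T1 \<union> T2) = sum w T1 + sum w T2"
        using T disj unfolding fam_def by (intro sum.union_disjoint) auto
      ultimately show "\<exists>T. fam p r T \<and> u r - u p \<le> \<eta> * (r - p) + sum w T"
        using T(3,4) by (intro exI[of _ "T1 \<union> T2"]) (auto simp: algebra_simps)
    qed
  next
    fix x assume x: "a \<le> x" "x \<le> b"
    show "\<exists>d>0. \<forall>p q. p \<le> x \<and> x \<le> q \<and> q - p < d \<longrightarrow> PP p q"
    proof (cases "x \<in> N")
      case False
      then obtain d where d: "d > 0" "\<forall>p\<in>{a..b}. \<forall>q\<in>{a..b}. p \<le> x \<and> x \<le> q \<and> q - p < d \<longrightarrow> u q - u p \<le> (0 + \<eta>) * (q - p)"
        using N(2)[of x] x \<eta>(1) unfolding upper_rate_def by (meson atLeastAtMost_iff)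
      show ?thesis
      proof (intro exI[of _ d] conjI allI impI)
        fix p q assume pq: "p \<le> x \<and> x \<le> q \<and> q - p < d"
        show "PP p q" unfolding PP_def
        proof
          assume "a \<le> p \<and> p \<le> q \<and> q \<le> b"
          then have "u q - u p \<le> \<eta> * (q - p)" using d(2) pq by auto
          then show "\<exists>T. fam p q T \<and> u q - u p \<le> \<eta> * (q - p) + sum w T"
            by (intro exI[of _ "{}"]) (auto simp: fam_def)
        qed
      qed fact
    next
      case True
      then have "x \<in> Op (k x)" using Op(2) by auto
      then obtain r where r: "r > 0" "ball x r \<subseteq> Op (k x)" using Op(1) openE by blast
      show ?thesis
      proof (intro exI[of _ "min r (dd x)"] conjI allI impI)
        show "0 < min r (dd x)" using r kk x by auto
        fix p q assume pq: "p \<le> x \<and> x \<le> q \<and> q - p < min r (dd x)"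
        show "PP p q" unfolding PP_def
        proof
          assume h: "a \<le> p \<and> p \<le> q \<and> q \<le> b"
          \<comment> \<open>The interval is split at its tag, matching the two terms of
            \<open>dominated_at\<close>. A half of length 0 is left out; its increment of
            \<open>g\<close> is 0 anyway.\<close>
          define T1 where "T1 = (if p < x then {(k x, p, x)} else {})"
          define T2 where "T2 = (if x < q then {(k x, x, q)} else {})"
          have s1: "sum w T1 = (real (k x) + 1) * norm (g x - g p)" using pq by (auto simp: T1_def w_def)
          have s2: "sum w T2 = (real (k x) + 1) * norm (g q - g x)" using pq by (auto simp: T2_def w_def)
          have "sum w (T1 \<union> T2) = sum w T1 + sum w T2"
            by (intro sum.union_disjoint) (auto simp: T1_def T2_def)
          moreover have "u q - u p \<le> (real (k x) + 1) * (norm (g q - g x) + norm (g x - g p))"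
            using kk(2)[of x p q] x h pq by auto
          moreover have "\<eta> * (q - p) \<ge> 0" using \<eta> h by auto
          moreover have sub: "{p..x} \<subseteq> Op (k x)" "{x..q} \<subseteq> Op (k x)"
            using r(2) pq by (auto simp: subset_iff dist_real_def)
          then have "fam p q (T1 \<union> T2)"
            using pq by (auto simp: fam_def T1_def T2_def pairwise_def)
          ultimately show "\<exists>T. fam p q T \<and> u q - u p \<le> \<eta> * (q - p) + sum w T"
            using s1 s2 by (intro exI[of _ "T1 \<union> T2"]) (auto simp: algebra_simps)
        qed
      qed
    qed
  qed
  then obtain T where T: "fam a b T" "u b - u a \<le> \<eta> * (b - a) + sum w T" using ab unfolding PP_def by auto
  have fT: "finite T" using T(1) by (auto simp: fam_def)
  have part: "sum w {x \<in> T. fst x = n} \<le> e / 2 * (1/2) ^ Suc n" for n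
  proof -
    define D where "D = snd ` {x \<in> T. fst x = n}"
    have D: "(c, d) \<in> D \<longleftrightarrow> (n, c, d) \<in> T" for c d by (force simp: D_def)
    have inj: "inj_on snd {x \<in> T. fst x = n}" by (auto simp: inj_on_def)
    have fD: "finite D" using fT by (auto simp: D_def)
    have Dprop: "c < d \<and> a \<le> c \<and> d \<le> b \<and> {c..d} \<subseteq> Op n" if "(c, d) \<in> D" for c d
      using that T(1) unfolding D fam_def by fastforce
    have pw: "pairwise (\<lambda>(a, b) (c, d). {a<..<b} \<inter> {c<..<d} = {}) D"
      unfolding pairwise_def
    proof (intro ballI impI)
      fix x y assume xy: "x \<in> D" "y \<in> D" "x \<noteq> y"
      obtain c d c' d' where e: "x = (c, d)" "y = (c', d')" by (metis surj_pair)
      then have "(n, c, d) \<in> T" "(n, c', d') \<in> T" "(n, c, d) \<noteq> (n, c', d')" using D xy by auto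
      then show "(case x of (a, b) \<Rightarrow> \<lambda>(c, d). {a<..<b} \<inter> {c<..<d} = {}) y"
        using T(1) e unfolding fam_def pairwise_def by fastforce
    qed
    \<comment> \<open>The intervals charged to \<open>n\<close> have disjoint interiors inside
      \<open>Op n\<close>, so their total length is below \<open>dl n\<close> and the absolute
      continuity of \<open>g\<close> applies to them as one family.\<close>
    have "ennreal (\<Sum>(c, d)\<in>D. d - c) = (\<Sum>(c, d)\<in>D. ennreal (d - c))"
      using Dprop by (subst sum_ennreal[symmetric]) (force simp: case_prod_unfold)+
    also have "\<dots> = (\<Sum>x\<in>D. emeasure lebesgue {fst x<..<snd x})"
      using Dprop by (intro sum.cong) (force simp: case_prod_unfold)+
    also have "\<dots> = emeasure lebesgue (\<Union>x\<in>D. {fst x<..<snd x})"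
      using pw fD by (intro sum_emeasure) (auto simp: disjoint_family_on_def pairwise_def case_prod_unfold)
    also have "\<dots> \<le> emeasure lebesgue (Op n)"
      using Dprop Op(1) by (intro emeasure_mono) (force simp: subset_iff intro: borel_open sets_completionI_sets)+
    also have "\<dots> < ennreal (dl n)" by (rule Op)
    finally have "(\<Sum>(c, d)\<in>D. d - c) < dl n" using dl(1) by (simp add: ennreal_less_iff[OF sum_nonneg] ennreal_less_iff case_prod_unfold Dprop less_imp_le)
    then have "(\<Sum>(c, d)\<in>D. norm (g d - g c)) < ek n"
      using Dprop fD pw by (intro dl(2)) (force simp: interval_family_def)+
    moreover have "sum w {x \<in> T. fst x = n} = (real n + 1) * (\<Sum>(c, d)\<in>D. norm (g d - g c))"
      unfolding D_def sum.reindex[OF inj] sum_distrib_left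
      by (intro sum.cong) (auto simp: w_def)
    ultimately have "sum w {x \<in> T. fst x = n} \<le> (real n + 1) * ek n" by (simp add: mult_left_mono)
    also have "\<dots> = e / 2 * (1/2) ^ Suc n" 
      unfolding ek_def by (subst times_divide_eq_right, rule nonzero_mult_div_cancel_left) simp
    finally show ?thesis .
  qed
  obtain M where M: "fst ` T \<subseteq> {..<M}" using fT by (metis finite_imageI finite_nat_iff_bounded)
  have "sum w T = (\<Sum>n<M. sum w {x \<in> T. fst x = n})"
    using sum.group[OF fT finite_lessThan M, of w] by simp
  also have "\<dots> \<le> (\<Sum>n<M. e / 2 * (1/2) ^ Suc n)" by (intro sum_mono part)
  also have "\<dots> = e / 2 * (\<Sum>n<M. (1/2) ^ Suc n)" by (simp add: sum_distrib_left)
  also have "\<dots> = e / 2 * (1 - (1/2)^M)" by (induction M) (auto simp: algebra_simps)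
  also have "\<dots> \<le> e / 2" using e by simp
  finally show "u b \<le> u a + e" using T(2) \<eta>(2) by linarith
qed


section \<open>Calculus of absolutely continuous functions\<close>

lemma abs_cont_on_id: "abs_cont_on I (\<lambda>t::real. t)"
  unfolding abs_cont_on_alt
proof (intro allI impI, rule_tac x=\<epsilon> in exI, intro conjI allI impI)
  fix \<epsilon> :: real and D assume "0 < \<epsilon>" and h: "interval_family I D \<and> (\<Sum>(a, b)\<in>D. b - a) < \<epsilon>"
  have "(\<Sum>(a, b)\<in>D. norm (b - a)) = (\<Sum>(a, b)\<in>D. b - a)"
    using interval_familyD(2)[OF conjunct1[OF h]] by (intro sum.cong) auto
  then show "(\<Sum>(a, b)\<in>D. norm (b - a)) < \<epsilon>" using h by simp
qed

lemma abs_cont_on_subset: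
  assumes f: "abs_cont_on I f" and J: "J \<subseteq> I"
  shows "abs_cont_on J f"
proof -
  have "interval_family I D" if "interval_family J D" for D
    using that J unfolding interval_family_def by (auto simp: case_prod_unfold)
  then show ?thesis using f unfolding abs_cont_on_alt by meson
qed

text \<open>Clipping or translating the intervals of a family can make several of them coincide in a
  degenerate interval. A set of pairs would merge these; an index set keeps the correspondence with
  the original family.\<close>

definition indexed_family :: "real set \<Rightarrow> 'i set \<Rightarrow> ('i \<Rightarrow> real) \<Rightarrow> ('i \<Rightarrow> real) \<Rightarrow> bool" where
  "indexed_family I A p q \<longleftrightarrow> finite A \<and> (\<forall>i\<in>A. p i \<le> q i \<and> {p i..q i} \<subseteq> I) \<and>
    (\<forall>i\<in>A. \<forall>j\<in>A. i \<noteq> j \<longrightarrow> {p i<..<q i} \<inter> {p j<..<q j} = {})"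

lemma abs_cont_on_indexed:
  fixes f :: "real \<Rightarrow> 'a::real_normed_vector"
  assumes ac: "abs_cont_on I f" and \<epsilon>: "\<epsilon> > 0"
  shows "\<exists>\<delta>>0. \<forall>(A :: 'i set) p q. indexed_family I A p q \<and> (\<Sum>i\<in>A. q i - p i) < \<delta> \<longrightarrow>
    (\<Sum>i\<in>A. norm (f (q i) - f (p i))) < \<epsilon>"
proof -
  obtain \<delta> where d: "\<delta> > 0" "\<And>D. interval_family I D \<Longrightarrow> (\<Sum>(a, b)\<in>D. b - a) < \<delta> \<Longrightarrow>
     (\<Sum>(a, b)\<in>D. norm (f b - f a)) < \<epsilon>"
    using ac \<epsilon> unfolding abs_cont_on_alt by blast
  have "(\<Sum>i\<in>A. norm (f (q i) - f (p i))) < \<epsilon>"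
    if h: "indexed_family I A p q" "(\<Sum>i\<in>A. q i - p i) < \<delta>" for A :: "'i set" and p q
  proof -
    define B where "B = {i \<in> A. p i < q i}"
    \<comment> \<open>Disjoint interiors separate the nondegenerate intervals, so on their indices
      the passage to pairs is injective. The discarded indices contribute 0 to both sums.\<close>
    have inj: "inj_on (\<lambda>i. (p i, q i)) B"
    proof (rule inj_onI, rule ccontr)
      fix i j assume ij: "i \<in> B" "j \<in> B" "(p i, q i) = (p j, q j)" "i \<noteq> j"
      then have "{p i<..<q i} \<inter> {p j<..<q j} = {}"
        using h(1) unfolding indexed_family_def B_def by blast
      moreover have "(p i + q i) / 2 \<in> {p i<..<q i} \<inter> {p j<..<q j}" using ij by (auto simp: B_def)
      ultimately show False by blast
    qed
    have sB: "sum g B = sum g A" if "\<And>i. i \<in> A \<Longrightarrow> p i = q i \<Longrightarrow> g i = 0" for g :: "'i \<Rightarrow> real"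
    proof (rule sum.mono_neutral_left)
      show "\<forall>i\<in>A - B. g i = 0"
      proof
        fix i assume i: "i \<in> A - B"
        then have "p i \<le> q i" "\<not> p i < q i" using h(1) by (auto simp: indexed_family_def B_def)
        then show "g i = 0" using that i by auto
      qed
    qed (use h(1) in \<open>auto simp: indexed_family_def B_def\<close>)
    have "(\<Sum>(a, b)\<in>(\<lambda>i. (p i, q i)) ` B. norm (f b - f a)) < \<epsilon>"
    proof (rule d(2))
      show "interval_family I ((\<lambda>i. (p i, q i)) ` B)"
        using h(1) unfolding interval_family_def indexed_family_def pairwise_def B_def by fastforce
      show "(\<Sum>(a, b)\<in>(\<lambda>i. (p i, q i)) ` B. b - a) < \<delta>"
        using h(2) sB[of "\<lambda>i. q i - p i"] by (simp add: sum.reindex[OF inj])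
    qed
    then show ?thesis
      using sB[of "\<lambda>i. norm (f (q i) - f (p i))"] by (simp add: sum.reindex[OF inj])
  qed
  then show ?thesis using d(1) by blast
qed

lemma abs_cont_on_bounded2:
  fixes h :: "real \<Rightarrow> 'c::real_normed_vector"
  assumes f: "abs_cont_on I f" and g: "abs_cont_on I g"
    and K: "\<And>p q. p \<in> I \<Longrightarrow> q \<in> I \<Longrightarrow> p \<le> q \<Longrightarrow> norm (h q - h p) \<le> K * (norm (f q - f p) + norm (g q - g p))"
  shows "abs_cont_on I h"
  unfolding abs_cont_on_alt
proof (intro allI impI)
  fix \<epsilon> :: real assume e: "\<epsilon> > 0"
  define e' where "e' = \<epsilon> / (2 * (\<bar>K\<bar> + 1))"
  have e': "e' > 0" using e by (auto simp: e'_def)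
  have e'': "\<bar>K\<bar> * (e' + e') < \<epsilon>"
  proof -
    have "(\<bar>K\<bar> + 1) * (e' + e') = \<epsilon>" unfolding e'_def by (simp add: divide_simps)
    then show ?thesis using e' by (simp add: algebra_simps)
  qed
  obtain d1 where d1: "d1 > 0" "\<And>D. interval_family I D \<Longrightarrow> (\<Sum>(a, b)\<in>D. b - a) < d1 \<Longrightarrow>
     (\<Sum>(a, b)\<in>D. norm (f b - f a)) < e'"
    using f e' unfolding abs_cont_on_alt by blast
  obtain d2 where d2: "d2 > 0" "\<And>D. interval_family I D \<Longrightarrow> (\<Sum>(a, b)\<in>D. b - a) < d2 \<Longrightarrow>
     (\<Sum>(a, b)\<in>D. norm (g b - g a)) < e'"
    using g e' unfolding abs_cont_on_alt by blast
  show "\<exists>\<delta>>0. \<forall>D. interval_family I D \<and> (\<Sum>(a, b)\<in>D. b - a) < \<delta> \<longrightarrow> (\<Sum>(a, b)\<in>D. norm (h b - h a)) < \<epsilon>"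
  proof (intro exI[of _ "min d1 d2"] conjI allI impI)
    fix D assume D: "interval_family I D \<and> (\<Sum>(a, b)\<in>D. b - a) < min d1 d2"
    note Df = interval_familyD[OF conjunct1[OF D]]
    have "(\<Sum>(a, b)\<in>D. norm (h b - h a)) \<le> (\<Sum>x\<in>D. \<bar>K\<bar> * (norm (f (snd x) - f (fst x)) + norm (g (snd x) - g (fst x))))"
    proof (rule sum_mono, unfold case_prod_unfold)
      fix x assume x: "x \<in> D"
      have "norm (h (snd x) - h (fst x)) \<le> K * (norm (f (snd x) - f (fst x)) + norm (g (snd x) - g (fst x)))"
        using Df x by (intro K) auto
      also have "\<dots> \<le> \<bar>K\<bar> * (norm (f (snd x) - f (fst x)) + norm (g (snd x) - g (fst x)))" by (intro mult_right_mono) auto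
      finally show "norm (h (snd x) - h (fst x)) \<le> \<bar>K\<bar> * (norm (f (snd x) - f (fst x)) + norm (g (snd x) - g (fst x)))" .
    qed
    also have "\<dots> = \<bar>K\<bar> * ((\<Sum>(a, b)\<in>D. norm (f b - f a)) + (\<Sum>(a, b)\<in>D. norm (g b - g a)))"
      by (simp add: sum_distrib_left[symmetric] sum.distrib case_prod_unfold)
    also have "\<dots> \<le> \<bar>K\<bar> * (e' + e')"
      by (rule mult_left_mono[OF add_mono[OF less_imp_le less_imp_le] abs_ge_zero])
        (use D d1(2)[of D] d2(2)[of D] in auto)
    also have "\<dots> < \<epsilon>" by (rule e'')
    finally show "(\<Sum>(a, b)\<in>D. norm (h b - h a)) < \<epsilon>" .
  qed (use d1 d2 in auto)
qed

lemma abs_cont_on_bounded: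
  assumes f: "abs_cont_on I f"
    and K: "\<And>p q. p \<in> I \<Longrightarrow> q \<in> I \<Longrightarrow> p \<le> q \<Longrightarrow> norm (h q - h p) \<le> K * norm (f q - f p)"
  shows "abs_cont_on I h"
  by (rule abs_cont_on_bounded2[OF f f, of h "K/2"]) (use K in auto)

lemma abs_cont_on_Pair:
  assumes f: "abs_cont_on I f" and g: "abs_cont_on I g"
  shows "abs_cont_on I (\<lambda>t. (f t, g t))"
  by (rule abs_cont_on_bounded2[OF f g, of _ 1]) (use norm_Pair_le in auto)

lemma abs_cont_on_diff:
  assumes f: "abs_cont_on I f" and g: "abs_cont_on I g"
  shows "abs_cont_on I (\<lambda>t. f t - g t)"
proof (rule abs_cont_on_bounded2[OF f g, of _ 1])
  fix p q
  have "norm (f q - g q - (f p - g p)) = norm ((f q - f p) - (g q - g p))" by (simp add: algebra_simps)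
  also have "\<dots> \<le> norm (f q - f p) + norm (g q - g p)" by (rule norm_triangle_ineq4)
  finally show "norm (f q - g q - (f p - g p)) \<le> 1 * (norm (f q - f p) + norm (g q - g p))" by simp
qed

lemma abs_cont_on_lipschitz:
  fixes f :: "real \<Rightarrow> 'a::real_normed_vector"
  assumes "K-lipschitz_on I f"
  shows "abs_cont_on I f"
proof (rule abs_cont_on_bounded[OF abs_cont_on_id, of _ _ K])
  show "norm (f q - f p) \<le> K * norm (q - p)" if "p \<in> I" "q \<in> I" "p \<le> q" for p q
    using lipschitz_onD[OF assms that(2,1)] by (simp add: dist_norm)
qed

lemma abs_cont_on_imp_continuous_on:
  fixes f :: "real \<Rightarrow> 'a::real_normed_vector"
  assumes ac: "abs_cont_on {a..b} f"
  shows "continuous_on {a..b} f"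
  unfolding continuous_on_iff
proof (intro ballI allI impI)
  fix x e :: real assume x: "x \<in> {a..b}" and e: "0 < e"
  obtain \<delta> where d: "\<delta> > 0" "\<And>D. interval_family {a..b} D \<Longrightarrow> (\<Sum>(a, b)\<in>D. b - a) < \<delta> \<Longrightarrow>
     (\<Sum>(a, b)\<in>D. norm (f b - f a)) < e"
    using ac e unfolding abs_cont_on_alt by blast
  show "\<exists>d>0. \<forall>x'\<in>{a..b}. dist x' x < d \<longrightarrow> dist (f x') (f x) < e"
  proof (intro exI[of _ \<delta>] conjI ballI impI d(1))
    fix y assume y: "y \<in> {a..b}" "dist y x < \<delta>"
    have "(\<Sum>(a, b)\<in>{(min x y, max x y)}. norm (f b - f a)) < e"
      using x y by (intro d) (auto simp: interval_family_def dist_real_def min_def max_def)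
    then show "dist (f y) (f x) < e" by (auto simp: dist_norm min_def max_def norm_minus_commute split: if_splits)
  qed
qed

text \<open>Each interval is cut at \<open>b\<close>: replacing its end points by
  \<open>min _ b\<close> gives a family in \<open>{a..b}\<close>, by \<open>max _ b\<close> one in
  \<open>{b..c}\<close>. Intervals on the wrong side collapse to the point \<open>b\<close>, whence
  the indexed families.\<close>

lemma abs_cont_on_concat:
  fixes f :: "real \<Rightarrow> 'a::real_normed_vector"
  assumes f: "abs_cont_on {a..b} f" and g: "abs_cont_on {b..c} f" and ab: "a \<le> b" "b \<le> c"
  shows "abs_cont_on {a..c} f"
  unfolding abs_cont_on_alt
proof (intro allI impI)
  fix \<epsilon> :: real assume "\<epsilon> > 0"
  then have e: "\<epsilon> / 2 > 0" by auto
  obtain d1 where d1: "d1 > 0" "\<And>(A :: (real \<times> real) set) p q. indexed_family {a..b} A p q \<Longrightarrow>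
    (\<Sum>i\<in>A. q i - p i) < d1 \<Longrightarrow> (\<Sum>i\<in>A. norm (f (q i) - f (p i))) < \<epsilon> / 2"
    using abs_cont_on_indexed[OF f e] by blast
  obtain d2 where d2: "d2 > 0" "\<And>(A :: (real \<times> real) set) p q. indexed_family {b..c} A p q \<Longrightarrow>
    (\<Sum>i\<in>A. q i - p i) < d2 \<Longrightarrow> (\<Sum>i\<in>A. norm (f (q i) - f (p i))) < \<epsilon> / 2"
    using abs_cont_on_indexed[OF g e] by blast
  show "\<exists>\<delta>>0. \<forall>D. interval_family {a..c} D \<and> (\<Sum>(a, b)\<in>D. b - a) < \<delta> \<longrightarrow> (\<Sum>(a, b)\<in>D. norm (f b - f a)) < \<epsilon>"
  proof (intro exI[of _ "min d1 d2"] conjI allI impI)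
    fix D assume D: "interval_family {a..c} D \<and> (\<Sum>(a, b)\<in>D. b - a) < min d1 d2"
    note Df = interval_familyD[OF conjunct1[OF D]]
    have Dac: "a \<le> fst x" "snd x \<le> c" if "x \<in> D" for x using Df(4,5)[OF that] by auto
    have len: "(\<Sum>x\<in>D. snd x - fst x) < min d1 d2" using D by (simp add: case_prod_unfold)
    have 1: "(\<Sum>x\<in>D. norm (f (min (snd x) b) - f (min (fst x) b))) < \<epsilon> / 2"
    proof (rule d1(2))
      have "(\<Sum>x\<in>D. min (snd x) b - min (fst x) b) \<le> (\<Sum>x\<in>D. snd x - fst x)"
        by (rule sum_mono, drule Df(2)) (auto simp: min_def)
      then show "(\<Sum>x\<in>D. min (snd x) b - min (fst x) b) < d1" using len by linarith
      have "{min (fst z) b<..<min (snd z) b} \<subseteq> {fst z<..<snd z}" for z by (auto simp: min_def split: if_splits)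
      then have "{min (fst x) b<..<min (snd x) b} \<inter> {min (fst y) b<..<min (snd y) b} = {}" if "x \<in> D" "y \<in> D" "x \<noteq> y" for x y
        using Df(6)[OF that] by blast
      moreover have "min (fst x) b \<le> min (snd x) b" "a \<le> min (fst x) b" if "x \<in> D" for x
        using Df(2)[OF that] Dac[OF that] ab by auto
      ultimately show "indexed_family {a..b} D (\<lambda>x. min (fst x) b) (\<lambda>x. min (snd x) b)"
        using Df(1) unfolding indexed_family_def by (auto simp del: Int_atLeastAtMost greaterThanLessThan_subseteq_greaterThanLessThan)
    qed
    have 2: "(\<Sum>x\<in>D. norm (f (max (snd x) b) - f (max (fst x) b))) < \<epsilon> / 2"
    proof (rule d2(2))
      have "(\<Sum>x\<in>D. max (snd x) b - max (fst x) b) \<le> (\<Sum>x\<in>D. snd x - fst x)"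
        by (rule sum_mono, drule Df(2)) (auto simp: max_def)
      then show "(\<Sum>x\<in>D. max (snd x) b - max (fst x) b) < d2" using len by linarith
      have "{max (fst z) b<..<max (snd z) b} \<subseteq> {fst z<..<snd z}" for z by (auto simp: max_def split: if_splits)
      then have "{max (fst x) b<..<max (snd x) b} \<inter> {max (fst y) b<..<max (snd y) b} = {}" if "x \<in> D" "y \<in> D" "x \<noteq> y" for x y
        using Df(6)[OF that] by blast
      moreover have "max (fst x) b \<le> max (snd x) b" "max (snd x) b \<le> c" if "x \<in> D" for x
        using Df(2)[OF that] Dac[OF that] ab by auto
      ultimately show "indexed_family {b..c} D (\<lambda>x. max (fst x) b) (\<lambda>x. max (snd x) b)"
        using Df(1) unfolding indexed_family_def by (auto simp del: Int_atLeastAtMost greaterThanLessThan_subseteq_greaterThanLessThan)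
    qed
    have "(\<Sum>(a, b)\<in>D. norm (f b - f a)) \<le> (\<Sum>x\<in>D. norm (f (min (snd x) b) - f (min (fst x) b)) + norm (f (max (snd x) b) - f (max (fst x) b)))"
    proof (rule sum_mono, unfold case_prod_unfold)
      fix x assume "x \<in> D"
      then have "fst x \<le> snd x" by (rule Df)
      then show "norm (f (snd x) - f (fst x)) \<le> norm (f (min (snd x) b) - f (min (fst x) b)) + norm (f (max (snd x) b) - f (max (fst x) b))"
        using norm_triangle_ineq[of "f (snd x) - f b" "f b - f (fst x)"] by (auto simp: min_def max_def)
    qed
    then show "(\<Sum>(a, b)\<in>D. norm (f b - f a)) < \<epsilon>" using 1 2 by (simp add: sum.distrib)
  qed (use d1 d2 in auto)
qed

lemma abs_cont_on_shift:
  fixes f :: "real \<Rightarrow> 'a::real_normed_vector"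
  assumes f: "abs_cont_on {a..b} f"
  shows "abs_cont_on {a - c..b - c} (\<lambda>s. f (c + s))"
  unfolding abs_cont_on_alt
proof (intro allI impI)
  fix \<epsilon> :: real assume e: "\<epsilon> > 0"
  obtain d1 where d1: "d1 > 0" "\<And>(A :: (real \<times> real) set) p q. indexed_family {a..b} A p q \<Longrightarrow>
    (\<Sum>i\<in>A. q i - p i) < d1 \<Longrightarrow> (\<Sum>i\<in>A. norm (f (q i) - f (p i))) < \<epsilon>"
    using abs_cont_on_indexed[OF f e] by blast
  show "\<exists>\<delta>>0. \<forall>D. interval_family {a - c..b - c} D \<and> (\<Sum>(a, b)\<in>D. b - a) < \<delta> \<longrightarrow>
      (\<Sum>(p, q)\<in>D. norm (f (c + q) - f (c + p))) < \<epsilon>"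
  proof (intro exI[of _ d1] conjI allI impI d1(1))
    fix D assume D: "interval_family {a - c..b - c} D \<and> (\<Sum>(a, b)\<in>D. b - a) < d1"
    note Df = interval_familyD[OF conjunct1[OF D]]
    have "(\<Sum>x\<in>D. norm (f (c + snd x) - f (c + fst x))) < \<epsilon>"
    proof (rule d1(2))
      have "r - c \<in> {fst z<..<snd z}" if "r \<in> {c + fst z<..<c + snd z}" for r z using that by auto
      then have "{c + fst x<..<c + snd x} \<inter> {c + fst y<..<c + snd y} = {}" if "x \<in> D" "y \<in> D" "x \<noteq> y" for x y
        using Df(6)[OF that] by blast
      then show "indexed_family {a..b} D (\<lambda>x. c + fst x) (\<lambda>x. c + snd x)"
        using Df(1,2,4,5) unfolding indexed_family_def by (fastforce simp del: Int_atLeastAtMost)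
    qed (use D in \<open>auto simp: case_prod_unfold\<close>)
    then show "(\<Sum>(p, q)\<in>D. norm (f (c + q) - f (c + p))) < \<epsilon>" by (simp add: case_prod_unfold)
  qed
qed


section \<open>Calculus of upper rates and of domination\<close>

lemma locally_LipschitzE:
  assumes "locally_Lipschitz f"
  obtains u L where "u > 0" "L \<ge> 0" "\<And>x y. x \<in> cball x0 u \<Longrightarrow> y \<in> cball x0 u \<Longrightarrow> dist (f x) (f y) \<le> L * dist x y"
  using assms unfolding locally_Lipschitz_def lipschitz_on_def by metis

lemma locally_Lipschitz_imp_continuous:
  assumes "locally_Lipschitz f"
  shows "continuous_on UNIV f"
proof (rule continuous_at_imp_continuous_on, rule ballI)
  fix x
  obtain u L where "u > 0" "L-lipschitz_on (cball x u) f" using assms unfolding locally_Lipschitz_def by blast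
  then have "continuous_on (ball x u) f" by (meson ball_subset_cball continuous_on_subset lipschitz_on_continuous_on)
  then show "isCont f x" using \<open>u > 0\<close> by (simp add: continuous_on_eq_continuous_at)
qed

lemma upper_rateE:
  assumes "upper_rate I u t m" "\<eta> > 0"
  obtains \<delta> where "\<delta> > 0" "\<And>p q. p \<in> I \<Longrightarrow> q \<in> I \<Longrightarrow> p \<le> t \<Longrightarrow> t \<le> q \<Longrightarrow> q - p < \<delta> \<Longrightarrow> u q - u p \<le> (m + \<eta>) * (q - p)"
  using assms unfolding upper_rate_def by metis

lemma dominated_atE:
  assumes "dominated_at I g u t"
  obtains K \<delta> where "K \<ge> 0" "\<delta> > 0" "\<And>p q. p \<in> I \<Longrightarrow> q \<in> I \<Longrightarrow> p \<le> t \<Longrightarrow> t \<le> q \<Longrightarrow> q - p < \<delta> \<Longrightarrow>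
     u q - u p \<le> K * (norm (g q - g t) + norm (g t - g p))"
  using assms unfolding dominated_at_def by metis

lemma dominated_atI:
  assumes "K \<ge> 0" "\<delta> > 0" "\<And>p q. p \<in> I \<Longrightarrow> q \<in> I \<Longrightarrow> p \<le> t \<Longrightarrow> t \<le> q \<Longrightarrow> q - p < \<delta> \<Longrightarrow>
     u q - u p \<le> K * (norm (g q - g t) + norm (g t - g p))"
  shows "dominated_at I g u t"
  using assms unfolding dominated_at_def by blast

lemma upper_rate_mono:
  assumes "upper_rate I u t m" "m \<le> m'"
  shows "upper_rate I u t m'"
  unfolding upper_rate_def
proof (intro allI impI)
  fix \<eta> :: real assume "\<eta> > 0"
  then obtain \<delta> where d: "\<delta> > 0" "\<And>p q. p \<in> I \<Longrightarrow> q \<in> I \<Longrightarrow> p \<le> t \<Longrightarrow> t \<le> q \<Longrightarrow> q - p < \<delta> \<Longrightarrow> u q - u p \<le> (m + \<eta>) * (q - p)"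
    using upper_rateE[OF assms(1)] by blast
  have "(m + \<eta>) * (q - p) \<le> (m' + \<eta>) * (q - p)" if "p \<le> t" "t \<le> q" for p q
    using that assms(2) by (intro mult_right_mono) auto
  then show "\<exists>\<delta>>0. \<forall>p\<in>I. \<forall>q\<in>I. p \<le> t \<and> t \<le> q \<and> q - p < \<delta> \<longrightarrow> u q - u p \<le> (m' + \<eta>) * (q - p)"
    using d by (intro exI[of _ \<delta>]) (meson order.trans)
qed

lemma upper_rate_add:
  assumes "upper_rate I u t m" "upper_rate I v t l"
  shows "upper_rate I (\<lambda>s. u s + v s) t (m + l)"
  unfolding upper_rate_def
proof (intro allI impI)
  fix \<eta> :: real assume "\<eta> > 0"
  then have e: "\<eta> / 2 > 0" by auto
  obtain d1 where d1: "d1 > 0" "\<And>p q. p \<in> I \<Longrightarrow> q \<in> I \<Longrightarrow> p \<le> t \<Longrightarrow> t \<le> q \<Longrightarrow> q - p < d1 \<Longrightarrow> u q - u p \<le> (m + \<eta>/2) * (q - p)"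
    using upper_rateE[OF assms(1) e] by blast
  obtain d2 where d2: "d2 > 0" "\<And>p q. p \<in> I \<Longrightarrow> q \<in> I \<Longrightarrow> p \<le> t \<Longrightarrow> t \<le> q \<Longrightarrow> q - p < d2 \<Longrightarrow> v q - v p \<le> (l + \<eta>/2) * (q - p)"
    using upper_rateE[OF assms(2) e] by blast
  show "\<exists>\<delta>>0. \<forall>p\<in>I. \<forall>q\<in>I. p \<le> t \<and> t \<le> q \<and> q - p < \<delta> \<longrightarrow> u q + v q - (u p + v p) \<le> (m + l + \<eta>) * (q - p)"
  proof (intro exI[of _ "min d1 d2"] conjI ballI impI)
    fix p q assume "p \<in> I" "q \<in> I" "p \<le> t \<and> t \<le> q \<and> q - p < min d1 d2"
    then have "u q - u p \<le> (m + \<eta>/2) * (q - p)" "v q - v p \<le> (l + \<eta>/2) * (q - p)" using d1 d2 by auto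
    moreover have "(m + \<eta>/2) * (q - p) + (l + \<eta>/2) * (q - p) = (m + l + \<eta>) * (q - p)"
      by (simp add: distrib_right[symmetric])
    ultimately show "u q + v q - (u p + v p) \<le> (m + l + \<eta>) * (q - p)" by linarith
  qed (use d1 d2 in auto)
qed

lemma upper_rate_const: "upper_rate I (\<lambda>s. c) t 0"
  unfolding upper_rate_def by (auto intro!: exI[of _ 1])

lemma upper_rate_sum:
  assumes "finite A" "\<And>i. i \<in> A \<Longrightarrow> upper_rate I (u i) t (m i)"
  shows "upper_rate I (\<lambda>s. \<Sum>i\<in>A. u i s) t (\<Sum>i\<in>A. m i)"
  using assms by (induction A rule: finite_induct) (auto intro: upper_rate_const upper_rate_add)

lemma dominated_at_add:
  assumes "dominated_at I g u t" "dominated_at I g v t"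
  shows "dominated_at I g (\<lambda>s. u s + v s) t"
proof -
  obtain K1 d1 where 1: "K1 \<ge> 0" "d1 > 0" "\<And>p q. p \<in> I \<Longrightarrow> q \<in> I \<Longrightarrow> p \<le> t \<Longrightarrow> t \<le> q \<Longrightarrow> q - p < d1 \<Longrightarrow>
     u q - u p \<le> K1 * (norm (g q - g t) + norm (g t - g p))" using dominated_atE[OF assms(1)] by blast
  obtain K2 d2 where 2: "K2 \<ge> 0" "d2 > 0" "\<And>p q. p \<in> I \<Longrightarrow> q \<in> I \<Longrightarrow> p \<le> t \<Longrightarrow> t \<le> q \<Longrightarrow> q - p < d2 \<Longrightarrow>
     v q - v p \<le> K2 * (norm (g q - g t) + norm (g t - g p))" using dominated_atE[OF assms(2)] by blast
  show ?thesis
  proof (rule dominated_atI[of "K1 + K2" "min d1 d2"])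
    fix p q assume "p \<in> I" "q \<in> I" "p \<le> t" "t \<le> q" "q - p < min d1 d2"
    then have "u q - u p \<le> K1 * (norm (g q - g t) + norm (g t - g p))" "v q - v p \<le> K2 * (norm (g q - g t) + norm (g t - g p))" using 1 2 by auto
    then show "u q + v q - (u p + v p) \<le> (K1 + K2) * (norm (g q - g t) + norm (g t - g p))" by (simp add: algebra_simps)
  qed (use 1 2 in auto)
qed

lemma dominated_at_const: "dominated_at I g (\<lambda>s. c) t"
  unfolding dominated_at_def by (auto intro!: exI[of _ 0] exI[of _ 1])

lemma dominated_at_sum:
  assumes "finite A" "\<And>i. i \<in> A \<Longrightarrow> dominated_at I g (u i) t"
  shows "dominated_at I g (\<lambda>s. \<Sum>i\<in>A. u i s) t"
  using assms by (induction A rule: finite_induct) (auto intro: dominated_at_const dominated_at_add)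

lemma dominated_at_abs:
  assumes "K \<ge> 0" "\<And>p q. p \<in> I \<Longrightarrow> q \<in> I \<Longrightarrow> u q - u p \<le> K * norm (g q - g p)"
  shows "dominated_at I g u t"
proof (rule dominated_atI[of K 1])
  fix p q assume "p \<in> I" "q \<in> I"
  then have "u q - u p \<le> K * norm (g q - g p)" by (rule assms)
  also have "\<dots> \<le> K * (norm (g q - g t) + norm (g t - g p))"
    using norm_triangle_ineq[of "g q - g t" "g t - g p"] assms(1) by (intro mult_left_mono) auto
  finally show "u q - u p \<le> K * (norm (g q - g t) + norm (g t - g p))" .
qed (use assms in auto)

text \<open>For an interval that contains \<open>t\<close> the errors
  \<open>\<eta> * (t - p)\<close> and \<open>\<eta> * (q - t)\<close> of the two halves add up to
  \<open>\<eta> * (q - p)\<close>. For intervals merely close to \<open>t\<close> differentiability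
  at \<open>t\<close> gives no such bound relative to the length; this is why all increments
  straddle.\<close>

lemma has_vector_derivative_straddle:
  assumes "(f has_vector_derivative d) (at t within I)" "t \<in> I" "\<eta> > 0"
  obtains \<delta> where "\<delta> > 0" "\<And>p q. p \<in> I \<Longrightarrow> q \<in> I \<Longrightarrow> p \<le> t \<Longrightarrow> t \<le> q \<Longrightarrow> q - p < \<delta> \<Longrightarrow>
      norm (f q - f p - (q - p) *\<^sub>R d) \<le> \<eta> * (q - p)"
proof -
  obtain \<delta> where d: "\<delta> > 0" "\<And>y. y \<in> I \<Longrightarrow> norm (y - t) < \<delta> \<Longrightarrow> norm (f y - f t - (y - t) *\<^sub>R d) \<le> \<eta> * norm (y - t)"
    using assms unfolding has_vector_derivative_def has_derivative_within_alt by blast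
  show ?thesis
  proof (rule that[OF d(1)])
    fix p q assume pq: "p \<in> I" "q \<in> I" "p \<le> t" "t \<le> q" "q - p < \<delta>"
    have "norm (f q - f p - (q - p) *\<^sub>R d) = norm ((f q - f t - (q - t) *\<^sub>R d) - (f p - f t - (p - t) *\<^sub>R d))"
      by (simp add: algebra_simps)
    also have "\<dots> \<le> norm (f q - f t - (q - t) *\<^sub>R d) + norm (f p - f t - (p - t) *\<^sub>R d)" by (rule norm_triangle_ineq4)
    also have "\<dots> \<le> \<eta> * norm (q - t) + \<eta> * norm (p - t)"
      using pq by (intro add_mono d) auto
    also have "\<dots> = \<eta> * (q - p)" using pq by (simp add: algebra_simps)
    finally show "norm (f q - f p - (q - p) *\<^sub>R d) \<le> \<eta> * (q - p)" .
  qed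
qed

lemma upper_rate_has_derivative:
  assumes "(u has_vector_derivative m) (at t within I)" "t \<in> I"
  shows "upper_rate I u t m"
  unfolding upper_rate_def
proof (intro allI impI)
  fix \<eta> :: real assume "\<eta> > 0"
  then obtain \<delta> where d: "\<delta> > 0" "\<And>p q. p \<in> I \<Longrightarrow> q \<in> I \<Longrightarrow> p \<le> t \<Longrightarrow> t \<le> q \<Longrightarrow> q - p < \<delta> \<Longrightarrow>
      norm (u q - u p - (q - p) *\<^sub>R m) \<le> \<eta> * (q - p)"
    using has_vector_derivative_straddle[OF assms] by blast
  show "\<exists>\<delta>>0. \<forall>p\<in>I. \<forall>q\<in>I. p \<le> t \<and> t \<le> q \<and> q - p < \<delta> \<longrightarrow> u q - u p \<le> (m + \<eta>) * (q - p)"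
  proof (intro exI[of _ \<delta>] conjI ballI impI d(1))
    fix p q assume "p \<in> I" "q \<in> I" "p \<le> t \<and> t \<le> q \<and> q - p < \<delta>"
    then have "norm (u q - u p - (q - p) *\<^sub>R m) \<le> \<eta> * (q - p)" using d by auto
    then show "u q - u p \<le> (m + \<eta>) * (q - p)" by (simp add: algebra_simps abs_le_iff)
  qed
qed

lemma continuous_within_closeE:
  fixes f :: "real \<Rightarrow> 'a::metric_space"
  assumes "continuous (at t within I) f" "e > 0"
  obtains d where "d > 0" "\<And>s. s \<in> I \<Longrightarrow> \<bar>s - t\<bar> < d \<Longrightarrow> dist (f s) (f t) < e"
  using assms unfolding continuous_within_eps_delta dist_real_def by blast

text \<open>Splitting the increment as \<open>v q * (u q - u p) + u p * (v q - v p)\<close>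
  multiplies one-sided bounds by function values only, which is legitimate because these are
  nonnegative. Continuity then replaces \<open>v q\<close> and \<open>u p\<close> by their values at
  \<open>t\<close>; the tolerance \<open>k\<close> for this is fixed after the slopes
  \<open>A\<close> and \<open>B\<close> are known.\<close>

lemma upper_rate_mult:
  fixes u v :: "real \<Rightarrow> real"
  assumes u: "upper_rate I u t m" and v: "upper_rate I v t l"
    and cu: "continuous (at t within I) u" and cv: "continuous (at t within I) v"
    and pos: "\<And>s. s \<in> I \<Longrightarrow> 0 \<le> u s" "\<And>s. s \<in> I \<Longrightarrow> 0 \<le> v s" and t: "t \<in> I"
  shows "upper_rate I (\<lambda>s. u s * v s) t (m * v t + u t * l)"
  unfolding upper_rate_def
proof (intro allI impI)
  fix \<eta> :: real assume eta: "\<eta> > 0"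
  define n1 where "n1 = \<eta> / (2 * (u t + v t + 1))"
  have p: "u t \<ge> 0" "v t \<ge> 0" using pos t by auto
  have n1: "n1 > 0" using eta p by (auto simp: n1_def)
  have n1': "n1 * (u t + v t) \<le> \<eta> / 2"
  proof -
    have "n1 * (u t + v t + 1) = \<eta> / 2" using p unfolding n1_def by (simp add: divide_simps)
    then show ?thesis using n1 by (simp add: algebra_simps)
  qed
  define A where "A = m + n1"
  define B where "B = l + n1"
  define k where "k = \<eta> / (2 * (\<bar>A\<bar> + \<bar>B\<bar> + 1))"
  have k: "k > 0" using eta by (auto simp: k_def)
  have k': "k * (\<bar>A\<bar> + \<bar>B\<bar>) \<le> \<eta> / 2"
  proof -
    have "k * (\<bar>A\<bar> + \<bar>B\<bar> + 1) = \<eta> / 2" unfolding k_def by (simp add: divide_simps)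
    then show ?thesis using k by (simp add: algebra_simps)
  qed
  obtain d1 where d1: "d1 > 0" "\<And>p q. p \<in> I \<Longrightarrow> q \<in> I \<Longrightarrow> p \<le> t \<Longrightarrow> t \<le> q \<Longrightarrow> q - p < d1 \<Longrightarrow> u q - u p \<le> A * (q - p)"
    using upper_rateE[OF u n1] unfolding A_def by blast
  obtain d2 where d2: "d2 > 0" "\<And>p q. p \<in> I \<Longrightarrow> q \<in> I \<Longrightarrow> p \<le> t \<Longrightarrow> t \<le> q \<Longrightarrow> q - p < d2 \<Longrightarrow> v q - v p \<le> B * (q - p)"
    using upper_rateE[OF v n1] unfolding B_def by blast
  obtain d3 where d3: "d3 > 0" "\<And>s. s \<in> I \<Longrightarrow> \<bar>s - t\<bar> < d3 \<Longrightarrow> dist (u s) (u t) < k"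
    using continuous_within_closeE[OF cu k] by blast
  obtain d4 where d4: "d4 > 0" "\<And>s. s \<in> I \<Longrightarrow> \<bar>s - t\<bar> < d4 \<Longrightarrow> dist (v s) (v t) < k"
    using continuous_within_closeE[OF cv k] by blast
  show "\<exists>\<delta>>0. \<forall>p\<in>I. \<forall>q\<in>I. p \<le> t \<and> t \<le> q \<and> q - p < \<delta> \<longrightarrow> u q * v q - u p * v p \<le> (m * v t + u t * l + \<eta>) * (q - p)"
  proof (intro exI[of _ "Min {d1, d2, d3, d4}"] conjI ballI impI)
    fix p q assume pq: "p \<in> I" "q \<in> I" "p \<le> t \<and> t \<le> q \<and> q - p < Min {d1, d2, d3, d4}"
    have 1: "u q - u p \<le> A * (q - p)" using pq by (intro d1) auto
    have 2: "v q - v p \<le> B * (q - p)" using pq by (intro d2) auto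
    have 3: "\<bar>u p - u t\<bar> < k" using d3(2)[of p] pq by (auto simp: dist_real_def)
    have 4: "\<bar>v q - v t\<bar> < k" using d4(2)[of q] pq by (auto simp: dist_real_def)
    have "(v q - v t) * A \<le> k * \<bar>A\<bar>"
      using 4 by (metis abs_ge_self abs_ge_zero abs_mult less_imp_le mult_right_mono order.trans)
    moreover have "(u p - u t) * B \<le> k * \<bar>B\<bar>"
      using 3 by (metis abs_ge_self abs_ge_zero abs_mult less_imp_le mult_right_mono order.trans)
    ultimately have 5: "v q * A + u p * B \<le> m * v t + u t * l + \<eta>"
      using n1' k' by (simp add: A_def B_def algebra_simps)
    have "u q * v q - u p * v p = v q * (u q - u p) + u p * (v q - v p)" by (simp add: algebra_simps)
    also have "\<dots> \<le> v q * (A * (q - p)) + u p * (B * (q - p))"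
      using 1 2 pos pq by (intro add_mono mult_left_mono) auto
    also have "\<dots> = (v q * A + u p * B) * (q - p)" by (simp add: algebra_simps)
    also have "\<dots> \<le> (m * v t + u t * l + \<eta>) * (q - p)" using 5 pq by (intro mult_right_mono) auto
    finally show "u q * v q - u p * v p \<le> (m * v t + u t * l + \<eta>) * (q - p)" .
  qed (use d1 d2 d3 d4 in auto)
qed

lemma upper_rate_scale:
  assumes "upper_rate I u t m" "c \<ge> 0"
  shows "upper_rate I (\<lambda>s. c * u s) t (c * m)"
  unfolding upper_rate_def
proof (intro allI impI)
  fix \<eta> :: real assume eta: "\<eta> > 0"
  define n where "n = \<eta> / (c + 1)"
  have n: "n > 0" using eta assms by (auto simp: n_def)
  have cn: "c * n \<le> \<eta>"
  proof -
    have "n * (c + 1) = \<eta>" using assms unfolding n_def by (simp add: divide_simps)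
    then show ?thesis using n by (simp add: algebra_simps)
  qed
  obtain d1 where d1: "d1 > 0" "\<And>p q. p \<in> I \<Longrightarrow> q \<in> I \<Longrightarrow> p \<le> t \<Longrightarrow> t \<le> q \<Longrightarrow> q - p < d1 \<Longrightarrow> u q - u p \<le> (m + n) * (q - p)"
    using upper_rateE[OF assms(1) n] by blast
  show "\<exists>\<delta>>0. \<forall>p\<in>I. \<forall>q\<in>I. p \<le> t \<and> t \<le> q \<and> q - p < \<delta> \<longrightarrow> c * u q - c * u p \<le> (c * m + \<eta>) * (q - p)"
  proof (intro exI[of _ d1] conjI ballI impI d1(1))
    fix p q assume pq: "p \<in> I" "q \<in> I" "p \<le> t \<and> t \<le> q \<and> q - p < d1"
    have "c * u q - c * u p = c * (u q - u p)" by (simp add: algebra_simps)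
    also have "\<dots> \<le> c * ((m + n) * (q - p))" using pq assms by (intro mult_left_mono d1) auto
    also have "\<dots> = (c * m + c * n) * (q - p)" by (simp add: algebra_simps)
    also have "\<dots> \<le> (c * m + \<eta>) * (q - p)" using pq cn by (intro mult_right_mono) auto
    finally show "c * u q - c * u p \<le> (c * m + \<eta>) * (q - p)" .
  qed
qed

lemma increment_le:
  fixes u :: "real \<Rightarrow> real"
  assumes ab: "a \<le> b" and ac: "abs_cont_on {a..b} g"
    and dom: "\<And>t. t \<in> {a..b} \<Longrightarrow> dominated_at {a..b} g u t"
    and ae: "AE t in lebesgue. t \<in> {a..b} \<longrightarrow> upper_rate {a..b} u t m"
  shows "u b - u a \<le> m * (b - a)"
proof -
  \<comment> \<open>Subtracting the line reduces to rate 0. The linear term need not be dominated by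
    \<open>g\<close>, so time is added to the controlling function.\<close>
  let ?u = "\<lambda>t. u t + - m * t" and ?g = "\<lambda>t. (g t, t)"
  have "?u b \<le> ?u a"
  proof (rule increment_le_0[OF ab abs_cont_on_Pair[OF ac abs_cont_on_id]])
    fix t assume t: "t \<in> {a..b}"
    obtain K \<delta> where K: "K \<ge> 0" "\<delta> > 0" "\<And>p q. p \<in> {a..b} \<Longrightarrow> q \<in> {a..b} \<Longrightarrow> p \<le> t \<Longrightarrow> t \<le> q \<Longrightarrow> q - p < \<delta> \<Longrightarrow>
     u q - u p \<le> K * (norm (g q - g t) + norm (g t - g p))" using dominated_atE[OF dom[OF t]] by blast
    have 1: "dominated_at {a..b} ?g u t"
    proof (rule dominated_atI[OF K(1,2)])
      fix p q assume "p \<in> {a..b}" "q \<in> {a..b}" "p \<le> t" "t \<le> q" "q - p < \<delta>"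
      then have "u q - u p \<le> K * (norm (g q - g t) + norm (g t - g p))" by (intro K) auto
      also have "\<dots> \<le> K * (norm ((g q, q) - (g t, t)) + norm ((g t, t) - (g p, p)))"
        using K(1) norm_fst_le[of "g q - g t" "q - t"] norm_fst_le[of "g t - g p" "t - p"]
        by (intro mult_left_mono add_mono) auto
      finally show "u q - u p \<le> K * (norm ((g q, q) - (g t, t)) + norm ((g t, t) - (g p, p)))" .
    qed
    have 2: "dominated_at {a..b} ?g (\<lambda>t. - m * t) t"
    proof (rule dominated_at_abs[of "\<bar>m\<bar>"])
      fix p q :: real
      have "- m * q - - m * p = - m * (q - p)" by (simp add: algebra_simps)
      also have "\<dots> \<le> \<bar>m\<bar> * \<bar>q - p\<bar>" by (metis abs_ge_self abs_mult abs_minus_cancel)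
      also have "\<dots> \<le> \<bar>m\<bar> * norm ((g q, q) - (g p, p))"
        using norm_snd_le[of "q - p" "g q - g p"] by (intro mult_left_mono) auto
      finally show "- m * q - - m * p \<le> \<bar>m\<bar> * norm ((g q, q) - (g p, p))" .
    qed simp
    show "dominated_at {a..b} ?g ?u t" by (rule dominated_at_add[OF 1 2])
  next
    show "AE t in lebesgue. t \<in> {a..b} \<longrightarrow> upper_rate {a..b} ?u t 0"
      using ae
    proof (eventually_elim, intro impI)
      fix t assume h: "t \<in> {a..b} \<longrightarrow> upper_rate {a..b} u t m" "t \<in> {a..b}"
      have "upper_rate {a..b} (\<lambda>t. - m * t) t (- m)"
        using h(2) by (intro upper_rate_has_derivative) (auto intro!: derivative_eq_intros)
      from upper_rate_add[OF _ this, of u m] h show "upper_rate {a..b} ?u t 0" by auto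
    qed
  qed
  then show ?thesis by (simp add: algebra_simps)
qed

text \<open>The scalar function \<open>norm (f t - f a)\<close> changes by at most the increment of
  \<open>f\<close>, so \<open>f\<close> itself dominates it and a bound on the speed of
  \<open>f\<close> bounds its rate.\<close>

lemma norm_increment_le:
  fixes f :: "real \<Rightarrow> 'a::real_normed_vector"
  assumes ab: "a \<le> b" and ac: "abs_cont_on {a..b} f"
    and ae: "AE t in lebesgue. t \<in> {a..b} \<longrightarrow> (\<exists>d. norm d \<le> C \<and> (f has_vector_derivative d) (at t within {a..b}))"
  shows "norm (f b - f a) \<le> C * (b - a)"
proof -
  have tri: "norm (f q - f a) - norm (f p - f a) \<le> norm (f q - f p)" for p q
    using norm_triangle_ineq2[of "f q - f a" "f p - f a"] by simp
  have "norm (f b - f a) - norm (f a - f a) \<le> C * (b - a)"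
  proof (rule increment_le[OF ab ac])
    fix t show "dominated_at {a..b} f (\<lambda>t. norm (f t - f a)) t"
      by (rule dominated_at_abs[of 1]) (use tri in auto)
  next
    show "AE t in lebesgue. t \<in> {a..b} \<longrightarrow> upper_rate {a..b} (\<lambda>t. norm (f t - f a)) t C"
      using ae
    proof (eventually_elim, intro impI)
      fix t assume h: "t \<in> {a..b} \<longrightarrow> (\<exists>d. norm d \<le> C \<and> (f has_vector_derivative d) (at t within {a..b}))" "t \<in> {a..b}"
      then obtain d where d: "norm d \<le> C" "(f has_vector_derivative d) (at t within {a..b})" by blast
      show "upper_rate {a..b} (\<lambda>t. norm (f t - f a)) t C" unfolding upper_rate_def
      proof (intro allI impI)
        fix \<eta> :: real assume "\<eta> > 0"
        then obtain \<delta> where de: "\<delta> > 0" "\<And>p q. p \<in> {a..b} \<Longrightarrow> q \<in> {a..b} \<Longrightarrow> p \<le> t \<Longrightarrow> t \<le> q \<Longrightarrow> q - p < \<delta> \<Longrightarrow>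
          norm (f q - f p - (q - p) *\<^sub>R d) \<le> \<eta> * (q - p)"
          using has_vector_derivative_straddle[OF d(2) h(2)] by blast
        show "\<exists>\<delta>>0. \<forall>p\<in>{a..b}. \<forall>q\<in>{a..b}. p \<le> t \<and> t \<le> q \<and> q - p < \<delta> \<longrightarrow>
          norm (f q - f a) - norm (f p - f a) \<le> (C + \<eta>) * (q - p)"
        proof (intro exI[of _ \<delta>] conjI ballI impI de(1))
          fix p q assume pq: "p \<in> {a..b}" "q \<in> {a..b}" "p \<le> t \<and> t \<le> q \<and> q - p < \<delta>"
          then have 1: "norm (f q - f p - (q - p) *\<^sub>R d) \<le> \<eta> * (q - p)" by (intro de) auto
          have "norm (f q - f p) \<le> norm (f q - f p - (q - p) *\<^sub>R d) + norm ((q - p) *\<^sub>R d)"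
            using norm_triangle_ineq[of "f q - f p - (q - p) *\<^sub>R d" "(q - p) *\<^sub>R d"] by simp
          also have "norm ((q - p) *\<^sub>R d) \<le> (q - p) * C" using pq d by (simp add: mult_left_mono)
          finally show "norm (f q - f a) - norm (f p - f a) \<le> (C + \<eta>) * (q - p)"
            using 1 tri[of q p] by (simp add: algebra_simps)
        qed
      qed
    qed
  qed
  then show ?thesis by simp
qed


section \<open>From almost everywhere gradients to directional rates\<close>

lemma GDERIV_norm_le:
  fixes V :: "'a::real_inner \<Rightarrow> real"
  assumes D: "GDERIV V e :> D" and L: "L \<ge> 0" and u: "u > 0"
    and lip: "\<And>x y. x \<in> cball e u \<Longrightarrow> y \<in> cball e u \<Longrightarrow> dist (V x) (V y) \<le> L * dist x y"
  shows "norm D \<le> L"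
proof (cases "D = 0")
  case False
  show ?thesis
  proof (rule field_le_epsilon)
    fix \<eta> :: real assume eta: "\<eta> > 0"
    have "(V has_derivative (\<lambda>h. h \<bullet> D)) (at e)" using D by (simp add: gderiv_def inner_commute)
    then obtain d where d: "d > 0" "\<And>y. norm (y - e) < d \<Longrightarrow> norm (V y - V e - (y - e) \<bullet> D) \<le> \<eta> * norm (y - e)"
      using eta unfolding has_derivative_within_alt by (auto simp: inner_commute)
    \<comment> \<open>A step along \<open>D\<close> itself: the increment of \<open>V\<close> is
      about \<open>s\<close> times the square of \<open>norm D\<close> by differentiability, but at
      most \<open>L * s * norm D\<close> by the Lipschitz bound. The length
      \<open>min u (d / 2)\<close> is small enough for both.\<close>
    define s where "s = min u (d / 2) / norm D"
    have s: "s > 0" using u d False by (auto simp: s_def)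
    have sD: "s * norm D = min u (d/2)" using False by (simp add: s_def)
    have n: "norm (e + s *\<^sub>R D - e) = s * norm D" using s by simp
    have "s * norm D < d" "s * norm D \<le> u" using sD d(1) by auto
    then have 1: "norm (V (e + s *\<^sub>R D) - V e - s * (D \<bullet> D)) \<le> \<eta> * (s * norm D)"
      using d(2)[of "e + s *\<^sub>R D"] n s by simp
    have "dist (V (e + s *\<^sub>R D)) (V e) \<le> L * dist (e + s *\<^sub>R D) e"
      using u s \<open>s * norm D \<le> u\<close> by (intro lip) (auto simp: dist_norm)
    then have 2: "V (e + s *\<^sub>R D) - V e \<le> L * (s * norm D)" using s by (simp add: dist_norm)
    have "s * (D \<bullet> D) \<le> (L + \<eta>) * (s * norm D)" using 1 2 by (simp add: algebra_simps abs_le_iff)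
    then have "(s * norm D) * norm D \<le> (s * norm D) * (L + \<eta>)"
      by (simp add: power2_norm_eq_inner[symmetric] power2_eq_square algebra_simps)
    then show "norm D \<le> L + \<eta>" using s False by simp
  qed
qed (use L in auto)

text \<open>For locally Lipschitz \<open>V\<close> this bounds Clarke's generalized directional
  derivative at \<open>e0\<close> in direction \<open>d\<close> by \<open>r\<close>. The base point
  varies near \<open>e0\<close>, which a plain one-sided derivative would not allow;
  \<open>upper_rate_compose\<close> depends on it.\<close>

definition dir_rate :: "('a::real_normed_vector \<Rightarrow> real) \<Rightarrow> 'a \<Rightarrow> 'a \<Rightarrow> real \<Rightarrow> bool" where
  "dir_rate V e0 d r \<longleftrightarrow> (\<forall>\<eta>>0. \<exists>\<delta>>0. \<forall>e h. dist e e0 < \<delta> \<and> 0 \<le> h \<and> h < \<delta> \<longrightarrow> V (e + h *\<^sub>R d) - V e \<le> h * (r + \<eta>))"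

text \<open>By Fubini, almost every line in direction \<open>k e0\<close> meets the exceptional null set in a null
  set; on such a line the bound can be integrated, and it extends to all lines by continuity.\<close>

lemma dir_rate_of_AE:
  fixes V :: "'a::euclidean_space \<Rightarrow> real"
  assumes V: "locally_Lipschitz V" and ae: "AE e in lborel. \<exists>D. GDERIV V e :> D \<and> D \<bullet> k e \<le> r e"
    and k: "isCont k e0" and r: "isCont r e0"
  shows "dir_rate V e0 (k e0) (r e0)"
  unfolding dir_rate_def
proof (intro allI impI)
  fix \<eta> :: real assume eta: "\<eta> > 0"
  let ?d = "k e0"
  obtain u L where L: "u > 0" "L \<ge> 0" "\<And>x y. x \<in> cball e0 u \<Longrightarrow> y \<in> cball e0 u \<Longrightarrow> dist (V x) (V y) \<le> L * dist x y"
    using locally_LipschitzE[OF V] by blast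
  have contV: "continuous_on UNIV V" by (rule locally_Lipschitz_imp_continuous[OF V])
  \<comment> \<open>Near \<open>e0\<close> gradients have norm at most \<open>L\<close>, so
    replacing the direction \<open>k e\<close> by the fixed \<open>k e0\<close> costs at most
    \<open>L * n\<close>, half of \<open>\<eta>\<close>. The variation of \<open>r\<close> takes the
    other half.\<close>
  define n where "n = \<eta> / (2 * (L + 1))"
  have n: "n > 0" using eta L by (auto simp: n_def)
  have Ln: "L * n \<le> \<eta> / 2"
  proof -
    have "n * (L + 1) = \<eta> / 2" using L unfolding n_def by (simp add: divide_simps)
    then show ?thesis using n by (simp add: algebra_simps)
  qed
  obtain d1 where d1: "d1 > 0" "\<And>e. dist e e0 < d1 \<Longrightarrow> dist (k e) ?d < n"
    using k n unfolding continuous_at_eps_delta by blast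
  obtain d2 where d2: "d2 > 0" "\<And>e. dist e e0 < d2 \<Longrightarrow> dist (r e) (r e0) < \<eta> / 2"
    using r eta unfolding continuous_at_eps_delta by (metis half_gt_zero)
  define d0 where "d0 = Min {u, d1, d2}"
  have d0: "d0 > 0" "d0 \<le> u" "d0 \<le> d1" "d0 \<le> d2" using L d1 d2 by (auto simp: d0_def)
  \<comment> \<open>With base point and step length both below \<open>\<delta>\<close>, the whole
    segment stays within \<open>d0\<close> of \<open>e0\<close>.\<close>
  define \<delta> where "\<delta> = d0 / (1 + norm ?d)"
  have dpos: "\<delta> > 0" using d0 by (auto simp: \<delta>_def add_pos_nonneg)
  have close: "dist (e + s *\<^sub>R ?d) e0 < d0" if "dist e e0 < \<delta>" "0 \<le> s" "s \<le> h" "h < \<delta>" for e s h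
  proof -
    have "dist (e + s *\<^sub>R ?d) e0 \<le> dist e e0 + s * norm ?d"
      using norm_triangle_ineq[of "e - e0" "s *\<^sub>R ?d"] that by (simp add: dist_norm algebra_simps)
    also have "\<dots> < \<delta> + \<delta> * norm ?d" using that by (intro add_less_le_mono mult_right_mono) auto
    also have "\<dots> = \<delta> * (1 + norm ?d)" by (simp add: algebra_simps)
    also have "\<dots> = d0"
    proof -
      have "1 + norm ?d \<noteq> 0" using norm_ge_zero[of ?d] by linarith
      then show ?thesis by (simp add: \<delta>_def)
    qed
    finally show ?thesis .
  qed
  obtain N where N: "N \<in> null_sets lborel" "\<And>e. e \<notin> N \<Longrightarrow> \<exists>D. GDERIV V e :> D \<and> D \<bullet> k e \<le> r e"
  proof -
    from AE_E3[OF ae] obtain N where "\<And>e. e \<in> space lborel - N \<Longrightarrow> \<exists>D. GDERIV V e :> D \<and> D \<bullet> k e \<le> r e"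
      "N \<in> null_sets lborel" by blast
    then show ?thesis by (intro that[of N]) auto
  qed
  have Nb: "N \<in> sets borel" using N(1) by auto
  have "AE e in lborel. e + c \<notin> N" for c
  proof -
    have "AE e in distr lborel borel ((+) c). e \<notin> N"
      unfolding lborel_distr_plus using N(1) by (rule AE_not_in)
    then show ?thesis using Nb by (subst (asm) AE_distr_iff) (auto simp: add.commute)
  qed
  then have "AE s in lborel. AE e in lborel. e + s *\<^sub>R ?d \<notin> N" by simp
  then have aee: "AE e in lborel. AE s in lborel. e + s *\<^sub>R ?d \<notin> N"
  proof (subst (asm) lborel_pair.AE_commute)
    have "(\<lambda>x::real \<times> 'a. snd x + fst x *\<^sub>R ?d) \<in> lborel \<Otimes>\<^sub>M lborel \<rightarrow>\<^sub>M borel"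
      by measurable
    from measurable_sets[OF this, of "- N"] Nb show "{x \<in> space (lborel \<Otimes>\<^sub>M lborel). snd x + fst x *\<^sub>R ?d \<notin> N} \<in> sets (lborel \<Otimes>\<^sub>M (lborel::'a measure))"
      by (simp add: vimage_def Int_def conj_commute)
  qed
  have main: "V (e + h *\<^sub>R ?d) - V e \<le> h * (r e0 + \<eta>)"
    if e: "dist e e0 < \<delta>" and h: "0 \<le> h" "h < \<delta>" and as: "AE s in lborel. e + s *\<^sub>R ?d \<notin> N" for e h
  proof -
    let ?u = "\<lambda>s. V (e + s *\<^sub>R ?d)"
    have cl: "dist (e + s *\<^sub>R ?d) e0 < d0" if "s \<in> {0..h}" for s using close[OF e _ _ h(2)] that by auto
    have "?u h - ?u 0 \<le> (r e0 + \<eta>) * (h - 0)"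
    proof (rule increment_le[OF h(1) abs_cont_on_id])
      fix t
      show "dominated_at {0..h} (\<lambda>t. t) ?u t"
      proof (rule dominated_at_abs[of "L * norm ?d"])
        fix p q assume pq: "p \<in> {0..h}" "q \<in> {0..h}"
        have "dist (?u q) (?u p) \<le> L * dist (e + q *\<^sub>R ?d) (e + p *\<^sub>R ?d)"
          using cl[OF pq(1)] cl[OF pq(2)] d0 by (intro L) (auto simp: dist_commute)
        also have "dist (e + q *\<^sub>R ?d) (e + p *\<^sub>R ?d) = \<bar>q - p\<bar> * norm ?d"
          by (simp add: dist_norm algebra_simps flip: scaleR_diff_left)
        finally show "?u q - ?u p \<le> L * norm ?d * norm (q - p)" by (simp add: dist_real_def algebra_simps)
      qed (use L in auto)
    next
      show "AE t in lebesgue. t \<in> {0..h} \<longrightarrow> upper_rate {0..h} ?u t (r e0 + \<eta>)"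
        using AE_completion[OF as]
      proof (eventually_elim, intro impI)
        fix t assume t: "e + t *\<^sub>R ?d \<notin> N" "t \<in> {0..h}"
        let ?e = "e + t *\<^sub>R ?d"
        have c: "dist ?e e0 < d0" by (rule cl[OF t(2)])
        obtain D where D: "GDERIV V ?e :> D" "D \<bullet> k ?e \<le> r ?e" using N(2)[OF t(1)] by blast
        have nD: "norm D \<le> L"
        proof (rule GDERIV_norm_le[OF D(1) L(2), of "u - dist ?e e0"])
          show "u - dist ?e e0 > 0" using c d0 by auto
          fix x y assume "x \<in> cball ?e (u - dist ?e e0)" "y \<in> cball ?e (u - dist ?e e0)"
          moreover have "dist e0 x \<le> dist ?e e0 + dist ?e x" "dist e0 y \<le> dist ?e e0 + dist ?e y"
            by (metis dist_commute dist_triangle)+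
          ultimately show "dist (V x) (V y) \<le> L * dist x y" by (intro L) auto
        qed
        have h1: "(V has_derivative (\<lambda>h. h \<bullet> D)) (at ?e)" using D(1) by (simp add: gderiv_def inner_commute)
        have h2: "((\<lambda>s. e + s *\<^sub>R ?d) has_derivative (\<lambda>s. s *\<^sub>R ?d)) (at t within {0..h})"
          by (auto intro!: derivative_eq_intros)
        have "(?u has_derivative (\<lambda>s. (s *\<^sub>R ?d) \<bullet> D)) (at t within {0..h})"
          by (rule has_derivative_compose[OF h2 h1])
        then have "(?u has_vector_derivative (D \<bullet> ?d)) (at t within {0..h})"
          by (simp add: has_vector_derivative_def inner_commute)
        then have 1: "upper_rate {0..h} ?u t (D \<bullet> ?d)" by (rule upper_rate_has_derivative[OF _ t(2)])
        have "D \<bullet> ?d = D \<bullet> k ?e + D \<bullet> (?d - k ?e)" by (simp add: inner_diff_right)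
        also have "D \<bullet> (?d - k ?e) \<le> norm D * norm (?d - k ?e)" by (rule norm_cauchy_schwarz)
        also have "\<dots> \<le> L * n" using nD L(2) d1(2)[of ?e] c d0 by (intro mult_mono) (auto simp: dist_norm norm_minus_commute)
        also have "D \<bullet> k ?e + L * n \<le> r e0 + \<eta>"
        proof -
          have "dist (r ?e) (r e0) < \<eta> / 2" using d2(2)[of ?e] c d0 by auto
          then show ?thesis using D(2) Ln unfolding dist_real_def by linarith
        qed
        finally show "upper_rate {0..h} ?u t (r e0 + \<eta>)" using upper_rate_mono[OF 1] by simp
      qed
    qed
    then show ?thesis by (simp add: algebra_simps)
  qed
  show "\<exists>\<delta>>0. \<forall>e h. dist e e0 < \<delta> \<and> 0 \<le> h \<and> h < \<delta> \<longrightarrow> V (e + h *\<^sub>R k e0) - V e \<le> h * (r e0 + \<eta>)"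
  proof (intro exI[of _ \<delta>] conjI allI impI dpos)
    fix e h assume eh: "dist e e0 < \<delta> \<and> 0 \<le> h \<and> h < \<delta>"
    show "V (e + h *\<^sub>R k e0) - V e \<le> h * (r e0 + \<eta>)"
    proof (rule ccontr)
      assume neg: "\<not> V (e + h *\<^sub>R k e0) - V e \<le> h * (r e0 + \<eta>)"
      \<comment> \<open>The base points that violate the bound near \<open>e0\<close> form an open
        set, because \<open>V\<close> is continuous. It is a null set as well, hence empty.\<close>
      define A where "A = {e. h * (r e0 + \<eta>) < V (e + h *\<^sub>R ?d) - V e} \<inter> ball e0 \<delta>"
      have cV: "continuous_on UNIV (\<lambda>e. V (e + h *\<^sub>R ?d) - V e)"
        by (intro continuous_intros continuous_on_compose2[OF contV]) auto
      have "open A" unfolding A_def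
        by (intro open_Int open_ball open_Collect_less continuous_on_const cV)
      moreover have "e \<in> A" using neg eh by (auto simp: A_def dist_commute)
      ultimately have "A \<notin> null_sets lborel"
        by (metis empty_iff negligible_iff_null_sets open_not_negligible null_sets_completionI)
      moreover have "AE e in lborel. e \<notin> A"
        using aee
      proof eventually_elim
        fix x assume "AE s in lborel. x + s *\<^sub>R ?d \<notin> N"
        then show "x \<notin> A" using main[of x h] eh by (force simp: A_def dist_commute)
      qed
      then have "A \<in> null_sets lborel" using \<open>open A\<close> by (subst AE_iff_null_sets) auto
      ultimately show False by blast
    qed
  qed
qed

text \<open>Over a short interval \<open>e q\<close> differs from
  \<open>e p + (q - p) *\<^sub>R d\<close> by a small multiple of \<open>q - p\<close>, which a
  locally Lipschitz \<open>V\<close> does not magnify beyond its constant. What remains is an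
  increment in direction \<open>d\<close> that starts at \<open>e p\<close>, not at
  \<open>e t\<close>.\<close>

lemma upper_rate_compose:
  fixes e :: "real \<Rightarrow> 'a::real_normed_vector"
  assumes V: "locally_Lipschitz V" and e: "(e has_vector_derivative d) (at t within I)" and t: "t \<in> I"
    and dr: "dir_rate V (e t) d r"
  shows "upper_rate I (\<lambda>s. V (e s)) t r"
  unfolding upper_rate_def
proof (intro allI impI)
  fix \<eta> :: real assume eta: "\<eta> > 0"
  then have eta2: "\<eta> / 2 > 0" by auto
  obtain u L where L: "u > 0" "L \<ge> 0" "\<And>x y. x \<in> cball (e t) u \<Longrightarrow> y \<in> cball (e t) u \<Longrightarrow> dist (V x) (V y) \<le> L * dist x y"
    using locally_LipschitzE[OF V] by blast
  define n where "n = \<eta> / (2 * (L + 1))"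
  have n: "n > 0" using eta L by (auto simp: n_def)
  have Ln: "L * n \<le> \<eta> / 2"
  proof -
    have "n * (L + 1) = \<eta> / 2" using L unfolding n_def by (simp add: divide_simps)
    then show ?thesis using n by (simp add: algebra_simps)
  qed
  obtain d1 where d1: "d1 > 0" "\<And>x h. dist x (e t) < d1 \<Longrightarrow> 0 \<le> h \<Longrightarrow> h < d1 \<Longrightarrow> V (x + h *\<^sub>R d) - V x \<le> h * (r + \<eta> / 2)"
    using dr eta2 unfolding dir_rate_def by meson
  obtain d2 where d2: "d2 > 0" "\<And>p q. p \<in> I \<Longrightarrow> q \<in> I \<Longrightarrow> p \<le> t \<Longrightarrow> t \<le> q \<Longrightarrow> q - p < d2 \<Longrightarrow>
      norm (e q - e p - (q - p) *\<^sub>R d) \<le> n * (q - p)"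
    using has_vector_derivative_straddle[OF e t n] by blast
  have ce: "continuous (at t within I) e" using e by (rule has_vector_derivative_continuous)
  obtain d3 where d3: "d3 > 0" "\<And>s. s \<in> I \<Longrightarrow> \<bar>s - t\<bar> < d3 \<Longrightarrow> dist (e s) (e t) < min d1 (u / 2)"
    using continuous_within_closeE[OF ce, of "min d1 (u/2)"] d1(1) L(1) by auto
  \<comment> \<open>Bounds \<open>(q - p) * norm d\<close> by \<open>u / 2\<close>, so that the
    auxiliary point \<open>e p + (q - p) *\<^sub>R d\<close> stays in the ball on which
    \<open>V\<close> is Lipschitz.\<close>
  define d4 where "d4 = u / (2 * (norm d + 1))"
  have d4: "d4 > 0" using L(1) by (auto simp: d4_def add_nonneg_pos)
  have d4': "d4 * norm d \<le> u / 2"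
  proof -
    have "norm d + 1 \<noteq> 0" using norm_ge_zero[of d] by linarith
    then have "d4 * (norm d + 1) = u / 2" unfolding d4_def by (simp add: divide_simps)
    then show ?thesis using d4 by (simp add: algebra_simps)
  qed
  show "\<exists>\<delta>>0. \<forall>p\<in>I. \<forall>q\<in>I. p \<le> t \<and> t \<le> q \<and> q - p < \<delta> \<longrightarrow> V (e q) - V (e p) \<le> (r + \<eta>) * (q - p)"
  proof (intro exI[of _ "Min {d1, d2, d3, d4}"] conjI ballI impI)
    fix p q assume pq: "p \<in> I" "q \<in> I" "p \<le> t \<and> t \<le> q \<and> q - p < Min {d1, d2, d3, d4}"
    have 0: "0 \<le> q - p" "q - p < d1" "q - p < d2" "q - p < d3" "q - p < d4" using pq by auto
    have p1: "dist (e p) (e t) < min d1 (u / 2)" "dist (e q) (e t) < min d1 (u / 2)"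
      using d3(2)[of p] d3(2)[of q] pq 0 by auto
    have 1: "V (e p + (q - p) *\<^sub>R d) - V (e p) \<le> (q - p) * (r + \<eta> / 2)" using p1 0 by (intro d1) auto
    have "(q - p) * norm d \<le> d4 * norm d" using 0 by (intro mult_right_mono) auto
    moreover have "dist (e p + (q - p) *\<^sub>R d) (e t) \<le> dist (e p) (e t) + (q - p) * norm d"
    proof -
      have eq: "e p + (q - p) *\<^sub>R d - e t = (e p - e t) + (q - p) *\<^sub>R d" by simp
      show ?thesis unfolding dist_norm eq
        using norm_triangle_ineq[of "e p - e t" "(q - p) *\<^sub>R d"] 0(1) by simp
    qed
    ultimately have "dist (e p + (q - p) *\<^sub>R d) (e t) \<le> u" using p1 d4' by linarith
    then have "dist (V (e q)) (V (e p + (q - p) *\<^sub>R d)) \<le> L * dist (e q) (e p + (q - p) *\<^sub>R d)"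
      using p1 L(1) by (intro L) (auto simp: dist_commute)
    also have "dist (e q) (e p + (q - p) *\<^sub>R d) \<le> n * (q - p)"
      using d2(2)[of p q] pq 0 by (simp add: dist_norm algebra_simps)
    also have "L * (n * (q - p)) \<le> \<eta> / 2 * (q - p)"
      using mult_right_mono[OF Ln 0(1)] by (simp add: mult.assoc)
    finally have "dist (V (e q)) (V (e p + (q - p) *\<^sub>R d)) \<le> \<eta> / 2 * (q - p)" using L(2) by (simp add: mult_left_mono)
    then have "V (e q) - V (e p + (q - p) *\<^sub>R d) \<le> \<eta> / 2 * (q - p)" unfolding dist_real_def by linarith
    then show "V (e q) - V (e p) \<le> (r + \<eta>) * (q - p)" using 1 by (simp add: field_simps)
  qed (use d1 d2 d3 d4 in auto)
qed

lemma dominated_at_compose: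
  fixes e :: "real \<Rightarrow> 'a::real_normed_vector"
  assumes V: "locally_Lipschitz V" and ce: "continuous (at t within I) e" and t: "t \<in> I"
    and g: "\<And>p q. p \<in> I \<Longrightarrow> q \<in> I \<Longrightarrow> norm (e q - e p) \<le> norm (g q - g p)"
  shows "dominated_at I g (\<lambda>s. V (e s)) t"
proof -
  obtain u L where L: "u > 0" "L \<ge> 0" "\<And>x y. x \<in> cball (e t) u \<Longrightarrow> y \<in> cball (e t) u \<Longrightarrow> dist (V x) (V y) \<le> L * dist x y"
    using locally_LipschitzE[OF V] by blast
  obtain d where d: "d > 0" "\<And>s. s \<in> I \<Longrightarrow> \<bar>s - t\<bar> < d \<Longrightarrow> dist (e s) (e t) < u"
    using continuous_within_closeE[OF ce L(1)] by blast
  show ?thesis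
  proof (rule dominated_atI[OF L(2) d(1)])
    fix p q assume pq: "p \<in> I" "q \<in> I" "p \<le> t" "t \<le> q" "q - p < d"
    have "dist (V (e q)) (V (e p)) \<le> L * dist (e q) (e p)"
      using d(2)[of p] d(2)[of q] pq by (intro L) (auto simp: dist_commute)
    also have "dist (e q) (e p) \<le> norm (g q - g p)" using g[OF pq(1,2)] by (simp add: dist_norm)
    also have "\<dots> \<le> norm (g q - g t) + norm (g t - g p)" using norm_triangle_ineq[of "g q - g t" "g t - g p"] by simp
    finally show "V (e q) - V (e p) \<le> L * (norm (g q - g t) + norm (g t - g p))"
      using L(2) by (simp add: dist_real_def mult_left_mono)
  qed
qed

section \<open>Comparison functions\<close>

lemma class_K_nonneg: "class_K f \<Longrightarrow> 0 \<le> x \<Longrightarrow> 0 \<le> f x"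
  unfolding class_K_def strict_mono_on_def by (metis atLeast_iff less_eq_real_def order_refl)

lemma class_K_mono: "class_K f \<Longrightarrow> 0 \<le> x \<Longrightarrow> x \<le> y \<Longrightarrow> f x \<le> f y"
  unfolding class_K_def strict_mono_on_def by (metis atLeast_iff less_eq_real_def order.trans)

lemma class_K_strict: "class_K f \<Longrightarrow> 0 \<le> x \<Longrightarrow> x < y \<Longrightarrow> f x < f y"
  unfolding class_K_def strict_mono_on_def by (metis atLeast_iff less_imp_le order.trans)

lemma class_K_pos: "class_K f \<Longrightarrow> 0 < x \<Longrightarrow> 0 < f x"
  using class_K_strict[of f 0 x] by (simp add: class_K_def)

lemma class_K_0: "class_K f \<Longrightarrow> f 0 = 0" by (simp add: class_K_def)

lemma class_KI:
  assumes "continuous_on {0..} f" "f 0 = 0" "\<And>x y. 0 \<le> x \<Longrightarrow> x < y \<Longrightarrow> f x < f y"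
  shows "class_K f"
  using assms unfolding class_K_def strict_mono_on_def by auto

lemma class_K_compose:
  assumes "class_K f" "class_K g"
  shows "class_K (\<lambda>x. f (g x))"
proof (rule class_KI)
  show "continuous_on {0..} (\<lambda>x. f (g x))"
  proof (rule continuous_on_compose2[of "{0..}" f])
    show "g ` {0..} \<subseteq> {0..}" using class_K_nonneg[OF assms(2)] by auto
  qed (use assms in \<open>simp_all add: class_K_def\<close>)
  show "f (g 0) = 0" using assms by (simp add: class_K_0)
  show "f (g x) < f (g y)" if "0 \<le> x" "x < y" for x y
    by (rule class_K_strict[OF assms(1) class_K_nonneg[OF assms(2) that(1)] class_K_strict[OF assms(2) that]])
qed

lemma class_K_add:
  assumes "class_K f" "class_K g"
  shows "class_K (\<lambda>x. f x + g x)"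
proof (rule class_KI)
  show "continuous_on {0..} (\<lambda>x. f x + g x)" using assms unfolding class_K_def by (intro continuous_intros) auto
  show "f 0 + g 0 = 0" using assms by (simp add: class_K_0)
  show "f x + g x < f y + g y" if "0 \<le> x" "x < y" for x y
    by (rule add_strict_mono[OF class_K_strict[OF assms(1) that] class_K_strict[OF assms(2) that]])
qed

lemma class_K_scale:
  assumes "class_K f" "c > 0"
  shows "class_K (\<lambda>x. c * f x)"
proof (rule class_KI)
  show "continuous_on {0..} (\<lambda>x. c * f x)" using assms unfolding class_K_def by (intro continuous_intros) auto
qed (use assms in \<open>auto simp: class_K_0 class_K_strict\<close>)

lemma class_K_add_sum:
  assumes "finite A" "class_K f" "\<And>i. i \<in> A \<Longrightarrow> class_K (g i)"
  shows "class_K (\<lambda>x. f x + (\<Sum>i\<in>A. g i x))"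
  using assms(1,3)
proof (induction A rule: finite_induct)
  case empty then show ?case using assms(2) by simp
next
  case (insert i A)
  have "class_K (\<lambda>x. g i x + (f x + (\<Sum>i\<in>A. g i x)))"
    by (rule class_K_add) (use insert in auto)
  then show ?case using insert(1,2) by (simp add: algebra_simps)
qed

lemma class_K_id: "class_K (\<lambda>x. x)"
  by (rule class_KI) (auto intro: continuous_intros)

lemma class_K_linear: "c > 0 \<Longrightarrow> class_K (\<lambda>x. c * x)"
  by (rule class_K_scale[OF class_K_id])

lemma class_K_power2: "class_K (\<lambda>x. x\<^sup>2)"
  by (rule class_KI) (auto intro!: continuous_intros power_strict_mono)

lemma class_K_sqrt: "class_K sqrt"
  by (rule class_KI) (auto intro!: continuous_intros)

lemma class_K_infD: "class_K_inf f \<Longrightarrow> class_K f" by (simp add: class_K_inf_def)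

lemma class_K_inf_compose:
  assumes "class_K_inf f" "class_K_inf g"
  shows "class_K_inf (\<lambda>x. f (g x))"
  using assms unfolding class_K_inf_def by (auto intro: class_K_compose filterlim_compose)

lemma class_K_inf_linear: "c > 0 \<Longrightarrow> class_K_inf (\<lambda>x. c * x)"
  unfolding class_K_inf_def
  by (auto intro: class_K_linear filterlim_tendsto_pos_mult_at_top[OF tendsto_const _ filterlim_ident])

lemma continuous_on_atLeastI:
  fixes g :: "real \<Rightarrow> 'a::topological_space"
  assumes "\<And>b. b \<ge> a \<Longrightarrow> continuous_on {a..b} g"
  shows "continuous_on {a..} g"
proof (rule continuous_on_eq_continuous_within[THEN iffD2], rule ballI)
  fix x assume x: "x \<in> {a..}"
  have "continuous_on {a..x+1} g" using x by (intro assms) auto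
  then have "continuous (at x within {a..x+1}) g" using x by (auto simp: continuous_on_eq_continuous_within)
  moreover have "at x within {a..x+1} = at x within {a..}"
    by (rule at_within_nhd[of x "{..<x+1}"]) auto
  ultimately show "continuous (at x within {a..}) g" by (simp add: continuous_within)
qed

text \<open>Growth to infinity makes \<open>f\<close> surjective onto the nonnegative reals.
  Continuity of the inverse is obtained on bounded intervals, where it inverts a continuous
  injection of a compact interval.\<close>

lemma class_K_inf_inverse:
  assumes f: "class_K_inf f"
  obtains g where "class_K_inf g" "\<And>x. 0 \<le> x \<Longrightarrow> g (f x) = x" "\<And>x. 0 \<le> x \<Longrightarrow> f (g x) = x"
proof -
  have K: "class_K f" and lim: "filterlim f at_top at_top" using f by (auto simp: class_K_inf_def)
  have cont: "continuous_on {0..} f" using K by (simp add: class_K_def)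
  have ex: "\<exists>x\<ge>0. f x = y" if "y \<ge> 0" for y
  proof -
    obtain b where b: "\<And>x. x \<ge> b \<Longrightarrow> f x \<ge> y" using lim unfolding filterlim_at_top eventually_at_top_linorder by meson
    have "\<exists>x. 0 \<le> x \<and> x \<le> max b 0 \<and> f x = y"
      using b[of "max b 0"] that class_K_0[OF K] by (intro IVT' continuous_on_subset[OF cont]) auto
    then show ?thesis by blast
  qed
  define g where "g y = (SOME x. x \<ge> 0 \<and> f x = y)" for y
  have g: "g y \<ge> 0" "f (g y) = y" if "y \<ge> 0" for y
    using someI_ex[OF ex[OF that, unfolded Bex_def]] unfolding g_def by auto
  have gf: "g (f x) = x" if "x \<ge> 0" for x
    using g[of "f x"] that class_K_nonneg[OF K that] class_K_strict[OF K] by (metis linorder_less_linear order_less_irrefl)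
  have smono: "g x < g y" if "0 \<le> x" "x < y" for x y
    using that g[of x] g[of y] class_K_mono[OF K, of "g y" "g x"] by (metis less_le_not_le linorder_not_le order.trans)
  have "continuous_on {0..} g"
  proof (rule continuous_on_atLeastI)
    fix b :: real assume b: "b \<ge> 0"
    have "continuous_on (f ` {0..g b}) g"
      by (rule continuous_on_inv) (auto intro: continuous_on_subset[OF cont] gf)
    moreover have "{0..b} \<subseteq> f ` {0..g b}"
    proof
      fix y assume y: "y \<in> {0..b}"
      then have "g y \<le> g b" using smono[of y b] by (cases "y = b") auto
      then show "y \<in> f ` {0..g b}" using y g[of y] by (intro image_eqI[of _ _ "g y"]) auto
    qed
    ultimately show "continuous_on {0..b} g" by (rule continuous_on_subset)
  qed
  moreover have "g 0 = 0" using gf[of 0] class_K_0[OF K] by simp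
  ultimately have gK: "class_K g" by (intro class_KI smono) auto
  have "filterlim g at_top at_top"
    unfolding filterlim_at_top_ge[of _ _ "0::real"]
  proof (intro allI impI)
    fix Z :: real assume Z: "Z \<ge> 0"
    have "Z \<le> g x" if "x \<ge> f Z" for x
      using gf[OF Z] class_K_mono[OF gK class_K_nonneg[OF K Z] that] by simp
    then show "eventually (\<lambda>x. Z \<le> g x) at_top" by (auto simp: eventually_at_top_linorder)
  qed
  then show ?thesis using gK gf g by (intro that[of g]) (auto simp: class_K_inf_def)
qed

lemma class_K_inf_lower_bound:
  assumes "finite A" "\<And>i. i \<in> A \<Longrightarrow> class_K_inf (f i)"
  obtains g where "class_K_inf g" "\<And>i x. i \<in> A \<Longrightarrow> 0 \<le> x \<Longrightarrow> g x \<le> f i x"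
proof -
  have "\<exists>g. class_K_inf g \<and> (\<forall>i\<in>A. \<forall>x\<ge>0. g x \<le> f i x)"
    using assms
  proof (induction A rule: finite_induct)
    case empty then show ?case using class_K_inf_linear[of 1] by auto
  next
    case (insert i A)
    then obtain g where g: "class_K_inf g" "\<forall>i\<in>A. \<forall>x\<ge>0. g x \<le> f i x" by auto
    have fi: "class_K_inf (f i)" using insert by auto
    have "class_K (\<lambda>x. min (f i x) (g x))"
    proof (rule class_KI)
      show "continuous_on {0..} (\<lambda>x. min (f i x) (g x))"
        using g(1) fi by (intro continuous_intros) (auto simp: class_K_inf_def class_K_def)
      show "min (f i 0) (g 0) = 0" using g(1) fi by (simp add: class_K_0 class_K_infD)
      show "min (f i x) (g x) < min (f i y) (g y)" if "0 \<le> x" "x < y" for x y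
        using class_K_strict[OF class_K_infD[OF fi] that] class_K_strict[OF class_K_infD[OF g(1)] that] by auto
    qed
    moreover have "filterlim (\<lambda>x. min (f i x) (g x)) at_top at_top"
      unfolding filterlim_at_top
    proof
      fix Z
      have "eventually (\<lambda>x. Z \<le> f i x) at_top" "eventually (\<lambda>x. Z \<le> g x) at_top"
        using fi g(1) unfolding class_K_inf_def filterlim_at_top by auto
      then show "eventually (\<lambda>x. Z \<le> min (f i x) (g x)) at_top" by eventually_elim auto
    qed
    ultimately show ?case using g(2)
      by (intro exI[of _ "\<lambda>x. min (f i x) (g x)"]) (auto simp: class_K_inf_def min_le_iff_disj)
  qed
  then show ?thesis using that by blast
qed

text \<open>A quantity that decreases at rate at least \<open>\<psi> s\<close> as long as it exceeds \<open>s\<close>, and that starts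
  from \<open>r\<close>, is at most \<open>s\<close> at time \<open>t\<close> if \<open>s + t * \<psi> s = r\<close>. Reading this equation as the
  definition of \<open>s\<close> gives a function of class KL without solving a comparison equation.\<close>

lemma implicit_decay_KL:
  assumes K: "class_K \<psi>"
  obtains b where "class_KL b" "\<And>r t. 0 \<le> r \<Longrightarrow> 0 \<le> t \<Longrightarrow> 0 \<le> b r t"
    "\<And>r t. 0 \<le> r \<Longrightarrow> 0 \<le> t \<Longrightarrow> b r t + t * \<psi> (b r t) = r"
proof -
  have cont: "continuous_on {0..} \<psi>" using K by (simp add: class_K_def)
  have ex: "\<exists>s. 0 \<le> s \<and> s + t * \<psi> s = r" if "0 \<le> r" "0 \<le> t" for r t
  proof -
    have "\<exists>s. 0 \<le> s \<and> s \<le> r \<and> s + t * \<psi> s = r"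
      using that class_K_0[OF K] class_K_nonneg[OF K that(1)]
      by (intro IVT' continuous_intros continuous_on_subset[OF cont]) auto
    then show ?thesis by blast
  qed
  define b where "b r t = (SOME s. 0 \<le> s \<and> s + t * \<psi> s = r)" for r t
  have b: "0 \<le> b r t" "b r t + t * \<psi> (b r t) = r" if "0 \<le> r" "0 \<le> t" for r t
    using someI_ex[OF ex[OF that]] unfolding b_def by auto
  have le: "s' \<le> s" if "0 \<le> s" "0 \<le> t" "s' + t * \<psi> s' \<le> s + t * \<psi> s" for s s' t
  proof (rule ccontr)
    assume "\<not> s' \<le> s"
    then have "s < s'" "t * \<psi> s \<le> t * \<psi> s'" using that(2) class_K_mono[OF K that(1), of s'] by (auto intro: mult_left_mono)
    then show False using that(3) by linarith
  qed
  have bmono: "b r t < b r' t" if "0 \<le> r" "r < r'" "0 \<le> t" for r r' t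
  proof (rule ccontr)
    assume "\<not> b r t < b r' t"
    then have "b r' t \<le> b r t" "t * \<psi> (b r' t) \<le> t * \<psi> (b r t)"
      using b[of r' t] that class_K_mono[OF K, of "b r' t" "b r t"] by (auto intro: mult_left_mono)
    then show False using b[of r' t] b[of r t] that by linarith
  qed
  have bt: "b r t' \<le> b r t" if "0 \<le> r" "0 \<le> t" "t \<le> t'" for r t t'
  proof (rule le[of _ t])
    have "t * \<psi> (b r t') \<le> t' * \<psi> (b r t')" using that b[of r t'] by (intro mult_right_mono class_K_nonneg[OF K]) auto
    then show "b r t' + t * \<psi> (b r t') \<le> b r t + t * \<psi> (b r t)" using b[of r t] b[of r t'] that by simp
  qed (use b that in auto)
  have ble: "b r t \<le> r" if "0 \<le> r" "0 \<le> t" for r t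
    using b[OF that] mult_nonneg_nonneg[OF that(2) class_K_nonneg[OF K b(1)[OF that]]] by linarith
  \<comment> \<open>Subtracting the two defining equations and using monotonicity of
    \<open>\<psi>\<close> gives an explicit modulus in \<open>r\<close> and \<open>t\<close>
    together, hence joint continuity.\<close>
  have diff: "b r1 t1 - b r2 t2 \<le> \<bar>r1 - r2\<bar> + \<bar>t1 - t2\<bar> * \<psi> r2" if "0 \<le> r1" "0 \<le> r2" "0 \<le> t1" "0 \<le> t2" for r1 r2 t1 t2
  proof (cases "b r1 t1 \<le> b r2 t2")
    case True
    moreover have "\<bar>t1 - t2\<bar> * \<psi> r2 \<ge> 0" using class_K_nonneg[OF K that(2)] by simp
    ultimately show ?thesis by linarith
  next
    case False
    have "t1 * \<psi> (b r2 t2) \<le> t1 * \<psi> (b r1 t1)"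
      using False that b by (intro mult_left_mono class_K_mono[OF K]) auto
    then have "b r1 t1 - b r2 t2 \<le> (r1 - r2) + (t2 - t1) * \<psi> (b r2 t2)"
      using b[OF that(1,3)] b[OF that(2,4)] by (simp add: algebra_simps)
    also have "(t2 - t1) * \<psi> (b r2 t2) \<le> \<bar>t1 - t2\<bar> * \<psi> r2"
      using that b ble by (intro mult_mono class_K_mono[OF K] class_K_nonneg[OF K]) auto
    finally show ?thesis by linarith
  qed
  have cont_b: "continuous_on ({0..} \<times> {0..}) (\<lambda>(r, t). b r t)"
    unfolding continuous_on_def
  proof (rule ballI)
    fix x :: "real \<times> real" assume x: "x \<in> {0..} \<times> {0..}"
    obtain r t where xrt: "x = (r, t)" by (metis surj_pair)
    have rt: "r \<in> {0..}" "t \<in> {0..}" using x xrt by auto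
    let ?F = "at (r, t) within {0..} \<times> {0..}"
    have fst': "((\<lambda>x. fst x) \<longlongrightarrow> r) ?F" and snd': "((\<lambda>x. snd x) \<longlongrightarrow> t) ?F"
      by (auto intro!: tendsto_eq_intros)
    have "((\<lambda>x. \<psi> (fst x)) \<longlongrightarrow> \<psi> r) ?F"
    proof -
      have "continuous_on ({0..} \<times> {0..}) (\<lambda>x::real\<times>real. \<psi> (fst x))"
        by (intro continuous_on_compose2[OF cont] continuous_intros) auto
      then show ?thesis using rt unfolding continuous_on_def by auto
    qed
    then have "((\<lambda>x. \<bar>r - fst x\<bar> + \<bar>t - snd x\<bar> * (\<psi> r + \<psi> (fst x))) \<longlongrightarrow> \<bar>r - r\<bar> + \<bar>t - t\<bar> * (\<psi> r + \<psi> r)) ?F"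
      by (intro tendsto_intros fst' snd')
    then have lim: "((\<lambda>x. \<bar>r - fst x\<bar> + \<bar>t - snd x\<bar> * (\<psi> r + \<psi> (fst x))) \<longlongrightarrow> 0) ?F" by simp
    have "((\<lambda>x. b (fst x) (snd x) - b r t) \<longlongrightarrow> 0) ?F"
    proof (rule Lim_null_comparison[OF _ lim])
      have "norm (b (fst x) (snd x) - b r t) \<le> \<bar>r - fst x\<bar> + \<bar>t - snd x\<bar> * (\<psi> r + \<psi> (fst x))"
        if "x \<in> {0..} \<times> {0..}" for x
      proof -
        have n: "\<psi> r \<ge> 0" "\<psi> (fst x) \<ge> 0" using that rt by (auto intro: class_K_nonneg[OF K])
        have "b (fst x) (snd x) - b r t \<le> \<bar>fst x - r\<bar> + \<bar>snd x - t\<bar> * \<psi> r"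
          "b r t - b (fst x) (snd x) \<le> \<bar>r - fst x\<bar> + \<bar>t - snd x\<bar> * \<psi> (fst x)"
          using that rt by (auto intro!: diff)
        moreover have "\<bar>t - snd x\<bar> * \<psi> r \<ge> 0" "\<bar>t - snd x\<bar> * \<psi> (fst x) \<ge> 0" using n by auto
        ultimately show ?thesis by (auto simp: abs_le_iff algebra_simps abs_minus_commute)
      qed
      then show "\<forall>\<^sub>F x in ?F. norm (b (fst x) (snd x) - b r t) \<le> \<bar>r - fst x\<bar> + \<bar>t - snd x\<bar> * (\<psi> r + \<psi> (fst x))"
        by (auto simp: eventually_at_topological)
    qed
    then show "((\<lambda>(r, t). b r t) \<longlongrightarrow> (\<lambda>(r, t). b r t) x) (at x within {0..} \<times> {0..})"
      by (subst (asm) LIM_zero_iff) (simp add: case_prod_unfold xrt)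
  qed
  have "class_KL b" unfolding class_KL_def
  proof (intro conjI allI impI cont_b)
    fix t :: real assume t: "t \<ge> 0"
    show "class_K (\<lambda>r. b r t)"
    proof (rule class_KI)
      show "continuous_on {0..} (\<lambda>r. b r t)"
      proof -
        have "continuous_on {0..} (\<lambda>r. (r, t))" by (intro continuous_on_Pair continuous_on_id continuous_on_const)
        from continuous_on_compose2[OF cont_b this] t show ?thesis by auto
      qed
      show "b 0 t = 0" using b[of 0 t] ble[of 0 t] t by auto
    qed (use bmono t in auto)
  next
    fix r :: real assume r: "r \<ge> 0"
    show "antimono_on {0..} (b r)" by (rule monotone_onI) (use bt r in auto)
    show "(b r \<longlongrightarrow> 0) at_top"
    proof (rule tendstoI)
      fix e :: real assume e: "e > 0"
      \<comment> \<open>If \<open>b r t\<close> were at least \<open>e\<close>, its equation would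
        force \<open>t * \<psi> e \<le> r\<close>, which bounds the time.\<close>
      have "dist (b r t) 0 < e" if "t > r / \<psi> e" "t \<ge> 0" for t
      proof (rule ccontr)
        assume "\<not> dist (b r t) 0 < e"
        then have "e \<le> b r t" using b[OF r that(2)] by simp
        then have "t * \<psi> e \<le> t * \<psi> (b r t)" using e that by (intro mult_left_mono class_K_mono[OF K]) auto
        moreover have "r < t * \<psi> e" using that(1) class_K_pos[OF K e] by (simp add: field_simps)
        ultimately show False using b[OF r that(2)] by linarith
      qed
      then show "eventually (\<lambda>t. dist (b r t) 0 < e) at_top"
        by (intro eventually_at_top_linorderI[of "max 0 (r / \<psi> e + 1)"]) auto
    qed
  qed
  then show ?thesis using b by (intro that[of b]) auto
qed

lemma class_KL_compose:
  assumes \<theta>: "class_K \<theta>" and b: "class_KL b" and \<Theta>: "class_K \<Theta>"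
  shows "class_KL (\<lambda>r t. \<theta> (b (\<Theta> r) t))"
proof -
  have bK: "class_K (\<lambda>r. b r t)" if "t \<ge> 0" for t using b that by (simp add: class_KL_def)
  have b0: "b r t \<ge> 0" if "r \<ge> 0" "t \<ge> 0" for r t using class_K_nonneg[OF bK] that by auto
  have c1: "continuous_on ({0..} \<times> {0..}) (\<lambda>(r, t). b r t)" using b by (simp add: class_KL_def)
  have c2: "continuous_on ({0..} \<times> {0..}) (\<lambda>x::real\<times>real. (\<Theta> (fst x), snd x))"
  proof -
    have "continuous_on ({0..} \<times> {0..}) (\<lambda>x::real\<times>real. \<Theta> (fst x))"
      by (rule continuous_on_compose2[of "{0..}" \<Theta>]) (use \<Theta> in \<open>auto simp: class_K_def intro!: continuous_on_fst continuous_on_id\<close>)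
    then show ?thesis by (intro continuous_on_Pair continuous_on_snd continuous_on_id)
  qed
  have "continuous_on ({0..} \<times> {0..}) (\<lambda>x. b (\<Theta> (fst x)) (snd x))"
  proof -
    have "(\<lambda>x::real\<times>real. (\<Theta> (fst x), snd x)) ` ({0..} \<times> {0..}) \<subseteq> {0..} \<times> {0..}"
    proof (rule image_subsetI)
      fix x :: "real \<times> real" assume "x \<in> {0..} \<times> {0..}"
      then show "(\<Theta> (fst x), snd x) \<in> {0..} \<times> {0..}"
        using class_K_nonneg[OF \<Theta>, of "fst x"] by (simp add: mem_Times_iff)
    qed
    from continuous_on_compose2[OF c1 c2 this] show ?thesis by simp
  qed
  then have "continuous_on ({0..} \<times> {0..}) (\<lambda>x. \<theta> (b (\<Theta> (fst x)) (snd x)))"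
  proof (rule continuous_on_compose2[of "{0..}" \<theta>, rotated])
    show "continuous_on {0..} \<theta>" using \<theta> by (simp add: class_K_def)
    show "(\<lambda>x. b (\<Theta> (fst x)) (snd x)) ` ({0..} \<times> {0..}) \<subseteq> {0..}"
      using b0 class_K_nonneg[OF \<Theta>] by auto
  qed
  moreover have "class_K (\<lambda>r. \<theta> (b (\<Theta> r) t))" if "t \<ge> 0" for t
    by (rule class_K_compose[OF \<theta> class_K_compose[OF bK[OF that] \<Theta>]])
  moreover have "antimono_on {0..} (\<lambda>t. \<theta> (b (\<Theta> r) t))" if r: "r \<ge> 0" for r
  proof (rule monotone_onI)
    fix t t' :: real assume t: "t \<in> {0..}" "t' \<in> {0..}" "t \<le> t'"
    have R: "\<Theta> r \<ge> 0" using class_K_nonneg[OF \<Theta> r] .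
    then have "b (\<Theta> r) t' \<le> b (\<Theta> r) t" using b t unfolding class_KL_def monotone_on_def by blast
    then show "\<theta> (b (\<Theta> r) t') \<le> \<theta> (b (\<Theta> r) t)" using t by (intro class_K_mono[OF \<theta>] b0 R) auto
  qed
  moreover have "((\<lambda>t. \<theta> (b (\<Theta> r) t)) \<longlongrightarrow> 0) at_top" if r: "r \<ge> 0" for r
  proof -
    have R: "\<Theta> r \<ge> 0" using class_K_nonneg[OF \<Theta> r] .
    have l: "(b (\<Theta> r) \<longlongrightarrow> 0) at_top" using b R unfolding class_KL_def by blast
    have "eventually (\<lambda>t. b (\<Theta> r) t \<in> {0..}) at_top"
      using b0[OF R] by (intro eventually_at_top_linorderI[of 0]) auto
    with l \<theta> have "((\<lambda>t. \<theta> (b (\<Theta> r) t)) \<longlongrightarrow> \<theta> 0) at_top"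
      by (intro continuous_on_tendsto_compose[of "{0..}" \<theta>]) (auto simp: class_K_def)
    then show ?thesis using class_K_0[OF \<theta>] by simp
  qed
  ultimately show ?thesis unfolding class_KL_def by (auto simp: case_prod_unfold)
qed

text \<open>Look at the last time at which \<open>u\<close> is at most \<open>M\<close>. If it is
  the end point, the bound holds trivially; otherwise \<open>u\<close> decays from then on, starting
  from \<open>M\<close>. If there is no such time, \<open>u\<close> decays on the whole
  interval.\<close>

lemma decay_on_interval:
  fixes u :: "real \<Rightarrow> real"
  assumes c: "continuous_on {a..b} u" and ab: "a \<le> b"
    and dec: "\<And>p q. a \<le> p \<Longrightarrow> p \<le> q \<Longrightarrow> q \<le> b \<Longrightarrow> (\<And>t. t \<in> {p..q} \<Longrightarrow> M \<le> u t) \<Longrightarrow> u q - u p \<le> - k * (q - p)"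
    and k: "k \<ge> 0"
  shows "u b \<le> max M (u a - k * (b - a))"
proof (cases "\<exists>t\<in>{a..b}. u t \<le> M")
  case False
  then have "u b - u a \<le> - k * (b - a)" using ab by (intro dec) force+
  then show ?thesis by (simp add: algebra_simps)
next
  case True
  define S where "S = {t \<in> {a..b}. u t \<le> M}"
  have "closed S" unfolding S_def using c by (intro continuous_on_closed_Collect_le continuous_on_const) auto
  then have S: "closed S" "S \<noteq> {}" "bdd_above S" using True by (auto simp: S_def bdd_above_def)
  define p where "p = Sup S"
  have p: "p \<in> S" unfolding p_def by (rule closed_contains_Sup[OF S(2,3,1)])
  have gt: "M < u t" if "t \<in> {p<..b}" for t
  proof (rule ccontr)
    assume "\<not> M < u t"
    then have "t \<in> S" using that p by (auto simp: S_def)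
    then have "t \<le> p" unfolding p_def using S(3) by (rule cSup_upper)
    then show False using that by auto
  qed
  show ?thesis
  proof (cases "p = b")
    case True then show ?thesis using p by (auto simp: S_def)
  next
    case False
    then have pb: "p < b" using p by (auto simp: S_def)
    \<comment> \<open>The decay hypothesis asks for \<open>M \<le> u\<close> at the left end point
      too. A smaller value there would, by the intermediate value theorem, produce a later time in
      the set of which \<open>p\<close> is the supremum.\<close>
    have "M \<le> u p"
    proof (rule ccontr)
      assume "\<not> M \<le> u p"
      then have "\<exists>x\<ge>p. x \<le> b \<and> u x = (M + u p) / 2 \<and> True"
        using gt[of b] pb p IVT'[of u p "(M + u p)/2" b] continuous_on_subset[OF c, of "{p..b}"] by (auto simp: S_def)
      then obtain x where x: "x \<ge> p" "x \<le> b" "u x = (M + u p) / 2" by blast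
      then show False using gt[of x] \<open>\<not> M \<le> u p\<close> by (cases "x = p") auto
    qed
    then have "M \<le> u t" if "t \<in> {p..b}" for t using gt[of t] that by (cases "t = p") auto
    then have "u b - u p \<le> - k * (b - p)" using p pb by (intro dec) (auto simp: S_def)
    moreover have "k * (b - p) \<ge> 0" using k pb by auto
    ultimately show ?thesis using p by (auto simp: S_def)
  qed
qed


section \<open>Hybrid time domains and extension of solutions\<close>

text \<open>Every slice of a compact domain contains its own right end point, so a slice number
  \<open>Suc J\<close> or higher would stick out of the truncation at \<open>J\<close>. This fixes
  the number of slices, and \<open>(T, J)\<close> then fixes the last end point.\<close>

lemma compact_hybrid_time_domain_eq:
  assumes E: "hybrid_time_domain E" and TJ: "(T, J) \<in> E"
  shows "\<exists>t. t 0 = 0 \<and> (\<forall>j\<le>J. t j \<le> t (Suc j)) \<and> t (Suc J) = T \<and>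
    E \<inter> {0..T} \<times> {..J} = (\<Union>j\<le>J. {t j..t (Suc j)} \<times> {j})"
proof -
  have "compact_hybrid_time_domain (E \<inter> {0..T} \<times> {..J})"
    using E TJ unfolding hybrid_time_domain_def by blast
  then obtain K t where t: "t 0 = 0" "\<forall>j<K. t j \<le> t (Suc j)"
    "E \<inter> {0..T} \<times> {..J} = (\<Union>j<K. {t j..t (Suc j)} \<times> {j})"
    unfolding compact_hybrid_time_domain_def by blast
  have T0: "0 \<le> T" using E TJ unfolding hybrid_time_domain_def by auto
  then have TJ': "(T, J) \<in> E \<inter> {0..T} \<times> {..J}" using TJ by auto
  then have JK: "J < K" "T \<le> t (Suc J)" unfolding t(3) by auto
  have mem: "(t (Suc j), j) \<in> E \<inter> {0..T} \<times> {..J}" if "j < K" for j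
    unfolding t(3) using that t(2) by auto
  have "K = Suc J"
  proof (rule ccontr)
    assume "K \<noteq> Suc J"
    then have "Suc J < K" using JK by simp
    from mem[OF this] show False by auto
  qed
  moreover have "t (Suc J) = T" using mem[OF JK(1)] JK(2) by auto
  ultimately show ?thesis using t by (intro exI[of _ t]) (auto simp: lessThan_Suc_atMost)
qed

lemma hybrid_time_domain_nonneg: "hybrid_time_domain E \<Longrightarrow> (t, j) \<in> E \<Longrightarrow> 0 \<le> t"
  unfolding hybrid_time_domain_def by auto

text \<open>Only finitely many slices precede \<open>(T, J)\<close>, so induction over them
  suffices. The flow step speaks of a compact interval inside one slice, which is the form in which
  facts about flows are available.\<close>

lemma hybrid_time_domain_induct:
  assumes E: "hybrid_time_domain E" and TJ: "(T, J) \<in> E"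
    and init: "P 0 0"
    and flow: "\<And>a b j. a \<le> b \<Longrightarrow> {a..b} \<times> {j} \<subseteq> E \<Longrightarrow> P a j \<Longrightarrow> P b j"
    and jump: "\<And>t j. (t, j) \<in> E \<Longrightarrow> (t, Suc j) \<in> E \<Longrightarrow> P t j \<Longrightarrow> P t (Suc j)"
  shows "P T J"
proof -
  obtain t where t: "t 0 = 0" "\<forall>j\<le>J. t j \<le> t (Suc j)" "t (Suc J) = T"
    "E \<inter> {0..T} \<times> {..J} = (\<Union>j\<le>J. {t j..t (Suc j)} \<times> {j})"
    using compact_hybrid_time_domain_eq[OF E TJ] by blast
  have sub: "{t j..t (Suc j)} \<times> {j} \<subseteq> E" if "j \<le> J" for j using t(4) that by blast
  have "\<forall>r\<in>{t j..t (Suc j)}. P r j" if "j \<le> J" for j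
    using that
  proof (induction j)
    case 0
    then show ?case using flow[of 0 _ 0] init sub[of 0] t(1) by fastforce
  next
    case (Suc j)
    have "(t (Suc j), j) \<in> E" "(t (Suc j), Suc j) \<in> E"
      using sub[of j] sub[of "Suc j"] t(2)[rule_format, of j] t(2)[rule_format, of "Suc j"] Suc.prems by auto
    moreover have "P (t (Suc j)) j" using Suc t(2)[rule_format, of j] by auto
    ultimately have "P (t (Suc j)) (Suc j)" by (rule jump)
    then show ?case using flow[of "t (Suc j)" _ "Suc j"] sub[OF Suc.prems] by fastforce
  qed
  then show ?thesis using t(2)[rule_format, of J] t(3) by auto
qed

lemma hybrid_time_domain_0: "hybrid_time_domain E \<Longrightarrow> (0, 0) \<in> E"
proof -
  assume E: "hybrid_time_domain E"
  then obtain T J where TJ: "(T, J) \<in> E" unfolding hybrid_time_domain_def by auto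
  obtain t where t: "t 0 = 0" "\<forall>j\<le>J. t j \<le> t (Suc j)" "t (Suc J) = T"
    "E \<inter> {0..T} \<times> {..J} = (\<Union>j\<le>J. {t j..t (Suc j)} \<times> {j})"
    using compact_hybrid_time_domain_eq[OF E TJ] by blast
  have "(0, 0) \<in> (\<Union>j\<le>J. {t j..t (Suc j)} \<times> {j})" using t(1) t(2)[rule_format, of 0] by force
  then show ?thesis using t(4) by blast
qed

lemma time_slice_interval:
  assumes E: "hybrid_time_domain E" and "(a, j) \<in> E" "(b, j) \<in> E"
  shows "{a..b} \<subseteq> time_slice E j"
proof -
  obtain t where t: "t (Suc j) = b" "E \<inter> {0..b} \<times> {..j} = (\<Union>i\<le>j. {t i..t (Suc i)} \<times> {i})"
    using compact_hybrid_time_domain_eq[OF E assms(3)] by blast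
  have "{a..b} \<times> {j} \<subseteq> E"
  proof (cases "a \<le> b")
    case True
    have "a \<ge> 0" using hybrid_time_domain_nonneg[OF E assms(2)] .
    then have "(a, j) \<in> E \<inter> {0..b} \<times> {..j}" using assms True by auto
    then have "t j \<le> a" unfolding t(2) by auto
    then have "{a..b} \<times> {j} \<subseteq> (\<Union>i\<le>j. {t i..t (Suc i)} \<times> {i})" using t(1) by auto
    then show ?thesis using t(2) by blast
  qed auto
  then show ?thesis by (auto simp: time_slice_def)
qed

lemma time_slice_borel: "hybrid_time_domain E \<Longrightarrow> time_slice E j \<in> sets borel"
  by (rule real_interval_borel_measurable)
     (use time_slice_interval[of E] in \<open>fastforce simp: is_interval_1 time_slice_def\<close>)

text \<open>The definition of hybrid time domains admits branches: a slice may continue beyond a time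
  \<open>s\<close> although \<open>(s, j + 1)\<close> belongs to the domain; all later slices are then \<open>{s}\<close> or empty. This
  is why a second point of the slice is needed here.\<close>

lemma earlier_slices_le:
  assumes E: "hybrid_time_domain E" and a: "(a0, j) \<in> E" "(a, j) \<in> E" "a0 < a" and s: "(s, i) \<in> E" "i < j"
  shows "s \<le> a"
proof (rule ccontr)
  assume "\<not> s \<le> a"
  obtain t where t: "\<forall>i\<le>j. t i \<le> t (Suc i)" "t (Suc j) = a"
    "E \<inter> {0..a} \<times> {..j} = (\<Union>i\<le>j. {t i..t (Suc i)} \<times> {i})"
    using compact_hybrid_time_domain_eq[OF E a(2)] by blast
  have a0: "0 \<le> a0" using hybrid_time_domain_nonneg[OF E a(1)] .
  then have "(a0, j) \<in> E \<inter> {0..a} \<times> {..j}" using a by auto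
  then have tj: "t j \<le> a0" unfolding t(3) by auto
  have "t (Suc i) \<le> t k" if "Suc i \<le> k" "k \<le> j" for k
    using that
  proof (induction k rule: dec_induct)
    case (step n) then show ?case using t(1)[rule_format, of n] by simp
  qed simp
  then have ti: "t (Suc i) \<le> t j" using s(2) by auto
  have "(t i, i) \<in> E" using t(3) t(1)[rule_format, of i] s(2) by fastforce
  \<comment> \<open>If \<open>s\<close> exceeded \<open>a\<close>, slice \<open>i\<close> would
    contain the time \<open>a\<close>. But the truncation at \<open>(a, j)\<close> ends slice
    \<open>i\<close> no later than slice \<open>j\<close> begins, hence no later than
    \<open>a0 < a\<close>; this uses the second point.\<close>
  then have "{t i..s} \<subseteq> time_slice E i" by (rule time_slice_interval[OF E _ s(1)])
  moreover have "a \<in> {t i..s}"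
    using \<open>\<not> s \<le> a\<close> t(1)[rule_format, of i] ti tj a s(2) by auto
  ultimately have "(a, i) \<in> E \<inter> {0..a} \<times> {..j}"
    using a a0 s(2) by (auto simp: time_slice_def)
  then have "a \<le> t (Suc i)" unfolding t(3) by auto
  then show False using ti tj a by linarith
qed

text \<open>The two conditions control the truncations. By \<open>new\<close> a truncation at an old
  point acquires no new points. By \<open>before\<close> a truncation at a new point
  \<open>(T, j)\<close> is the old one at \<open>(a, j)\<close> with its last slice prolonged to
  \<open>T\<close>.\<close>

lemma hybrid_time_domain_extend:
  assumes E: "hybrid_time_domain E" and a: "(a, j) \<in> E" and ab: "a \<le> b"
    and before: "\<And>s i. (s, i) \<in> E \<Longrightarrow> i < j \<Longrightarrow> s \<le> a"
    and new: "\<And>s r i. s \<in> {a..b} \<Longrightarrow> (s, j) \<notin> E \<Longrightarrow> (r, i) \<in> E \<Longrightarrow> j \<le> i \<Longrightarrow> r < s"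
  shows "hybrid_time_domain (E \<union> {a..b} \<times> {j})"
  unfolding hybrid_time_domain_def
proof (intro conjI)
  have a0: "0 \<le> a" using hybrid_time_domain_nonneg[OF E a] .
  show "E \<union> {a..b} \<times> {j} \<noteq> {}" using a by auto
  show "E \<union> {a..b} \<times> {j} \<subseteq> {0..} \<times> UNIV" using E a0 unfolding hybrid_time_domain_def by auto
  let ?E = "E \<union> {a..b} \<times> {j}"
  have "compact_hybrid_time_domain (?E \<inter> {0..T} \<times> {..J})" if TJ: "(T, J) \<in> ?E" for T J
  proof (cases "(T, J) \<in> E")
    case True
    have "(s, j) \<in> E" if "s \<in> {a..b}" "s \<le> T" "j \<le> J" for s
    proof (rule ccontr)
      assume "(s, j) \<notin> E"
      from new[OF that(1) this True that(3)] that(2) show False by simp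
    qed
    then have "?E \<inter> {0..T} \<times> {..J} = E \<inter> {0..T} \<times> {..J}" by auto
    then show ?thesis using E True unfolding hybrid_time_domain_def by auto
  next
    case False
    then have J: "J = j" and T: "T \<in> {a..b}" using TJ by auto
    obtain t where t: "t 0 = 0" "\<forall>i\<le>j. t i \<le> t (Suc i)" "t (Suc j) = a"
      "E \<inter> {0..a} \<times> {..j} = (\<Union>i\<le>j. {t i..t (Suc i)} \<times> {i})"
      using compact_hybrid_time_domain_eq[OF E a] by blast
    define t' where "t' = t(Suc j := T)"
    have "?E \<inter> {0..T} \<times> {..j} = (\<Union>i<Suc j. {t' i..t' (Suc i)} \<times> {i})" (is "?L = ?R")
    proof (intro set_eqI iffI)
      fix x assume x: "x \<in> ?L"
      obtain s i where si: "x = (s, i)" by (metis surj_pair)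
      have i: "i \<le> j" "0 \<le> s" "s \<le> T" using x si by auto
      show "x \<in> ?R"
      proof (cases "i < j")
        case True
        then have "(s, i) \<in> E" using x si by auto
        then have "(s, i) \<in> E \<inter> {0..a} \<times> {..j}" using before True i by auto
        then have "t i \<le> s" "s \<le> t (Suc i)" unfolding t(4) by auto
        then show ?thesis using True si by (auto simp: t'_def)
      next
        case False
        then have ij: "i = j" using i by simp
        have "t j \<le> s"
        proof (cases "s \<ge> a")
          case True then show ?thesis using t(2)[rule_format, of j] t(3) by simp
        next
          case False
          then have "(s, j) \<in> E \<inter> {0..a} \<times> {..j}" using x si ij i by auto
          then show ?thesis unfolding t(4) by auto
        qed
        then show ?thesis using si ij i by (auto simp: t'_def)
      qed
    next
      fix x assume x: "x \<in> ?R"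
      obtain s i where si: "x = (s, i)" by (metis surj_pair)
      have i: "i \<le> j" "t i \<le> s" "s \<le> t' (Suc i)" using x si by (auto simp: t'_def split: if_splits)
      show "x \<in> ?L"
      proof (cases "s \<le> t (Suc i)")
        case True
        then have "(s, i) \<in> E \<inter> {0..a} \<times> {..j}" unfolding t(4) using i by auto
        then show ?thesis using si T by auto
      next
        case False
        then have "i = j" using i by (auto simp: t'_def split: if_splits)
        then show ?thesis using False i si t(3) T a0 by (auto simp: t'_def)
      qed
    qed
    moreover have "t' 0 = 0" "\<forall>i<Suc j. t' i \<le> t' (Suc i)"
      using t T by (auto simp: t'_def less_Suc_eq intro: order.trans[OF t(2)[rule_format]])
    ultimately show ?thesis unfolding J compact_hybrid_time_domain_def by blast
  qed
  then show "\<forall>(T, J)\<in>?E. compact_hybrid_time_domain (?E \<inter> {0..T} \<times> {..J})" by auto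
qed

section \<open>Gluing a flow to a solution pair\<close>

lemma abs_cont_on_cong:
  assumes "abs_cont_on I f" "\<And>t. t \<in> I \<Longrightarrow> g t = f t"
  shows "abs_cont_on I g"
  by (rule abs_cont_on_bounded[OF assms(1), of _ 1]) (use assms(2) in auto)

lemma locally_abs_cont_onD: "locally_abs_cont_on I f \<Longrightarrow> {a..b} \<subseteq> I \<Longrightarrow> abs_cont_on {a..b} f"
  unfolding locally_abs_cont_on_def by blast

lemma AE_lebesgue_neq: "AE t in lebesgue. t \<noteq> (c::real)"
proof -
  have "AE t in lborel. t \<noteq> c" by (rule AE_lborel_singleton)
  then show ?thesis by (rule AE_completion)
qed

lemma borel_measurable_lebesgue_on_Un_if:
  fixes f g :: "real \<Rightarrow> 'b::euclidean_space"
  assumes f: "f \<in> borel_measurable (lebesgue_on S)" and g: "g \<in> borel_measurable (lebesgue_on T)"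
    and S: "S \<in> sets lebesgue" and T: "T \<in> sets lebesgue"
  shows "(\<lambda>t. if t \<in> T then g t else f t) \<in> borel_measurable (lebesgue_on (S \<union> T))"
proof -
  have mf: "(\<lambda>t. if t \<in> S then f t else 0) \<in> borel_measurable lebesgue"
    and mg: "(\<lambda>t. if t \<in> T then g t else 0) \<in> borel_measurable lebesgue"
    using f g S T by (auto simp: borel_measurable_if)
  have "(\<lambda>t. if t \<in> T then (if t \<in> T then g t else 0) else (if t \<in> S then f t else 0)) \<in> borel_measurable lebesgue"
    by (rule measurable_If_set[OF mg mf]) (use T in auto)
  then have "(\<lambda>t. if t \<in> S \<union> T then (if t \<in> T then g t else f t) else 0) \<in> borel_measurable lebesgue"
    by (rule measurable_cong[THEN iffD1, rotated]) auto
  then show ?thesis using S T by (subst (asm) borel_measurable_if) auto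
qed

text \<open>One statement for both ways in which a slice can end. If the slice is open at its end,
  \<open>{a..b}\<close> overlaps it and adds only the point \<open>b\<close>; if it has a last
  point, this point is \<open>a\<close>. The one-sided derivatives at \<open>a\<close> may disagree,
  but a single time is a null set.\<close>

lemma solution_pair_extend:
  assumes sp: "solution_pair \<H> E \<xi> \<nu>" and a: "(a, j) \<in> E" and ab: "a \<le> b" and bE: "(b, j) \<notin> E"
    and before: "\<And>s i. (s, i) \<in> E \<Longrightarrow> i < j \<Longrightarrow> s \<le> a"
    and new: "\<And>s r i. s \<in> {a..b} \<Longrightarrow> (s, j) \<notin> E \<Longrightarrow> (r, i) \<in> E \<Longrightarrow> j \<le> i \<Longrightarrow> r < s"
    and ac: "abs_cont_on {a..b} x" and agree: "\<And>s. s \<in> {a..b} \<Longrightarrow> (s, j) \<in> E \<Longrightarrow> x s = \<xi> s j"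
    and agree': "\<And>s. s \<in> {a..b} \<Longrightarrow> (s, j) \<in> E \<Longrightarrow> u s = \<nu> s j"
    and flow: "AE t in lebesgue. t \<in> {a..b} \<longrightarrow> (x t, u t) \<in> flow_set \<H> \<and>
       (\<exists>d\<in>flow_map \<H> (x t) (u t). (x has_vector_derivative d) (at t within {a..b}))"
    and um: "u \<in> borel_measurable (lebesgue_on {a..b})" and ub: "AE t in lebesgue. t \<in> {a..b} \<longrightarrow> norm (u t) \<le> B"
  shows "solution_pair \<H> (E \<union> {a..b} \<times> {j}) (\<lambda>t i. if i = j \<and> t \<in> {a..b} then x t else \<xi> t i)
     (\<lambda>t i. if i = j \<and> t \<in> {a..b} then u t else \<nu> t i)"
proof -
  let ?E = "E \<union> {a..b} \<times> {j}"
  define x' where "x' = (\<lambda>t i. if i = j \<and> t \<in> {a..b} then x t else \<xi> t i)"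
  define u' where "u' = (\<lambda>t i. if i = j \<and> t \<in> {a..b} then u t else \<nu> t i)"
  have E: "hybrid_time_domain E" using sp unfolding solution_pair_def hybrid_arc_def by blast
  have E': "hybrid_time_domain ?E" by (rule hybrid_time_domain_extend[OF E a ab before new])
  have slice: "time_slice ?E i = (if i = j then time_slice E j \<union> {a..b} else time_slice E i)" for i
    by (auto simp: time_slice_def)
  have bmax: "t \<le> b" if "t \<in> time_slice E j" for t
    using new[of b t j] that bE ab by (auto simp: time_slice_def)
  have agx: "x' t i = \<xi> t i" if "(t, i) \<in> E" for t i using that agree by (auto simp: x'_def)
  have agu: "u' t i = \<nu> t i" if "(t, i) \<in> E" for t i using that agree' by (auto simp: u'_def)
  have lac: "locally_abs_cont_on (time_slice E i) (\<lambda>t. \<xi> t i)" for i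
    using sp unfolding solution_pair_def hybrid_arc_def by blast
  have old: "t \<in> time_slice E j" if "t \<in> time_slice ?E j" "t \<le> a" for t
    using that a slice[of j] by (auto simp: time_slice_def)
  have "hybrid_arc ?E x'"
    unfolding hybrid_arc_def locally_abs_cont_on_def
  proof (intro conjI E' allI impI)
    fix i c d assume cd: "{c..d} \<subseteq> time_slice ?E i"
    show "abs_cont_on {c..d} (\<lambda>t. x' t i)"
    proof (cases "i = j")
      case False
      then have "{c..d} \<subseteq> time_slice E i" using cd slice by auto
      from locally_abs_cont_onD[OF lac this] show ?thesis
        by (rule abs_cont_on_cong) (use False in \<open>auto simp: x'_def\<close>)
    next
      case True
      have 1: "abs_cont_on {c..d} (\<lambda>t. x' t j)" if "{c..d} \<subseteq> time_slice E j" for c d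
        using locally_abs_cont_onD[OF lac that]
        by (rule abs_cont_on_cong) (use that agx in \<open>auto simp: time_slice_def\<close>)
      have 2: "abs_cont_on {c..d} (\<lambda>t. x' t j)" if "{c..d} \<subseteq> {a..b}" for c d
        using abs_cont_on_subset[OF ac that] by (rule abs_cont_on_cong) (use that in \<open>auto simp: x'_def\<close>)
      have d: "t \<le> b" if "t \<in> {c..d}" for t using cd bmax that slice[of i] True by auto
      consider "d \<le> a" | "a \<le> c" | "c < a" "a < d" by linarith
      then have "abs_cont_on {c..d} (\<lambda>t. x' t j)"
      proof cases
        case 1
        then show ?thesis using cd old True by (intro \<open>\<And>d c. {c..d} \<subseteq> time_slice E j \<Longrightarrow> _\<close>) force
      next
        case 2
        then show ?thesis using d by (intro \<open>\<And>d c. {c..d} \<subseteq> {a..b} \<Longrightarrow> _\<close>) force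
      next
        case 3
        have "{c..a} \<subseteq> time_slice E j" using cd old True 3 by force
        moreover have "{a..d} \<subseteq> {a..b}" using d[of d] 3 by auto
        ultimately show ?thesis using 1 2 3 by (intro abs_cont_on_concat[of c a _ d]) auto
      qed
      then show ?thesis using True by simp
    qed
  qed
  moreover have "hybrid_input ?E u'"
    unfolding hybrid_input_def
  proof (intro conjI E' allI impI)
    have hi: "hybrid_input E \<nu>" using sp unfolding solution_pair_def by blast
    fix i
    have nm: "(\<lambda>t. \<nu> t i) \<in> borel_measurable (lebesgue_on (time_slice E i))" using hi unfolding hybrid_input_def by blast
    show "(\<lambda>t. u' t i) \<in> borel_measurable (lebesgue_on (time_slice ?E i))"
    proof (cases "i = j")
      case False
      then show ?thesis using nm slice by (simp add: u'_def)
    next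
      case True
      have "(\<lambda>t. if t \<in> {a..b} then u t else \<nu> t j) \<in> borel_measurable (lebesgue_on (time_slice E j \<union> {a..b}))"
        using nm um time_slice_borel[OF E, of j] True by (intro borel_measurable_lebesgue_on_Un_if) auto
      then show ?thesis using True slice by (simp add: u'_def)
    qed
    fix K assume K: "compact K \<and> K \<subseteq> time_slice ?E i"
    show "\<exists>M. AE t in lebesgue. t \<in> K \<longrightarrow> norm (u' t i) \<le> M"
    proof (cases "i = j")
      case False
      then have "\<exists>M. AE t in lebesgue. t \<in> K \<longrightarrow> norm (\<nu> t i) \<le> M"
        using hi K slice unfolding hybrid_input_def by auto
      then show ?thesis using False by (simp add: u'_def)
    next
      case True
      \<comment> \<open>A compact subset of the enlarged slice need not meet the old slice in a
        compact set. Cutting at \<open>a\<close> repairs this: the lower part is compact in the old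
        slice, and the bound \<open>B\<close> takes care of the rest.\<close>
      have "compact (K \<inter> {..a})" using K by (intro compact_Int_closed) auto
      moreover have "K \<inter> {..a} \<subseteq> time_slice E j" using K old True by auto
      ultimately obtain M where M: "AE t in lebesgue. t \<in> K \<inter> {..a} \<longrightarrow> norm (\<nu> t j) \<le> M"
        using hi unfolding hybrid_input_def by blast
      have "AE t in lebesgue. t \<in> K \<longrightarrow> norm (u' t i) \<le> max M B"
        using M ub AE_lebesgue_neq[of a]
      proof eventually_elim
        case (elim t)
        then show ?case using True K slice[of j] bmax[of t] by (auto simp: u'_def le_max_iff_disj)
      qed
      then show ?thesis by blast
    qed
  qed
  moreover have "(x' 0 0, u' 0 0) \<in> flow_set \<H> \<union> jump_set \<H>"
    using sp agx agu hybrid_time_domain_0[OF E] unfolding solution_pair_def by simp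
  moreover have "AE t in lebesgue. t \<in> time_slice ?E i \<longrightarrow>
        (x' t i, u' t i) \<in> flow_set \<H> \<and>
        (\<exists>d\<in>flow_map \<H> (x' t i) (u' t i). ((\<lambda>s. x' s i) has_vector_derivative d) (at t within time_slice ?E i))" for i
  proof -
    have o: "AE t in lebesgue. t \<in> time_slice E i \<longrightarrow> (\<xi> t i, \<nu> t i) \<in> flow_set \<H> \<and>
        (\<exists>d\<in>flow_map \<H> (\<xi> t i) (\<nu> t i). ((\<lambda>s. \<xi> s i) has_vector_derivative d) (at t within time_slice E i))"
      using sp unfolding solution_pair_def by blast
    show ?thesis
    proof (cases "i = j")
      case False then show ?thesis using o slice by (simp add: x'_def u'_def)
    next
      case True
      show ?thesis unfolding True
        using o[unfolded True] flow AE_lebesgue_neq[of a] AE_lebesgue_neq[of b]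
      proof (eventually_elim, intro impI)
        fix t
        assume o: "t \<in> time_slice E j \<longrightarrow> (\<xi> t j, \<nu> t j) \<in> flow_set \<H> \<and>
          (\<exists>d\<in>flow_map \<H> (\<xi> t j) (\<nu> t j). ((\<lambda>s. \<xi> s j) has_vector_derivative d) (at t within time_slice E j))"
          and f: "t \<in> {a..b} \<longrightarrow> (x t, u t) \<in> flow_set \<H> \<and>
       (\<exists>d\<in>flow_map \<H> (x t) (u t). (x has_vector_derivative d) (at t within {a..b}))" and n: "t \<noteq> a" "t \<noteq> b"
          and t: "t \<in> time_slice ?E j"
        show "(x' t j, u' t j) \<in> flow_set \<H> \<and>
        (\<exists>d\<in>flow_map \<H> (x' t j) (u' t j). ((\<lambda>s. x' s j) has_vector_derivative d) (at t within time_slice ?E j))"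
        proof (cases "t < a")
          case True
          then have tE: "t \<in> time_slice E j" using old[OF t] by simp
          then have eq: "x' t j = \<xi> t j" "u' t j = \<nu> t j" using agx agu by (auto simp: time_slice_def)
          obtain d where d: "d \<in> flow_map \<H> (\<xi> t j) (\<nu> t j)" "((\<lambda>s. \<xi> s j) has_vector_derivative d) (at t within time_slice E j)"
            using o tE by blast
          have w: "at t within time_slice E j = at t within time_slice ?E j"
            by (rule at_within_nhd[of t "{..<a}"]) (use True slice[of j] in auto)
          have "((\<lambda>s. x' s j) has_vector_derivative d) (at t within time_slice ?E j)"
          proof (rule has_vector_derivative_transform_within[OF d(2)[unfolded w], of "a - t"])
            show "\<xi> s j = x' s j" if "s \<in> time_slice ?E j" "dist s t < a - t" for s
              using old[OF that(1)] that(2) agx[of s j] by (auto simp: dist_real_def time_slice_def)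
          qed (use True t in auto)
          then show ?thesis using d(1) o tE eq by auto
        next
          case False
          then have tab: "t \<in> {a<..<b}" using t slice[of j] bmax[of t] n by auto
          then have eq: "x' t j = x t" "u' t j = u t" by (auto simp: x'_def u'_def)
          obtain d where d: "d \<in> flow_map \<H> (x t) (u t)" "(x has_vector_derivative d) (at t within {a..b})"
            using f tab by auto
          have w: "at t within {a..b} = at t within time_slice ?E j"
            by (rule at_within_nhd[of t "{a<..<b}"]) (use tab slice[of j] in auto)
          have "((\<lambda>s. x' s j) has_vector_derivative d) (at t within time_slice ?E j)"
          proof (rule has_vector_derivative_transform_within[OF d(2)[unfolded w], of "min (t - a) (b - t)"])
            show "x s = x' s j" if "s \<in> time_slice ?E j" "dist s t < min (t - a) (b - t)" for s
              using that(2) tab by (auto simp: dist_real_def x'_def)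
          qed (use tab t in auto)
          then show ?thesis using d(1) f tab eq by auto
        qed
      qed
    qed
  qed
  \<comment> \<open>No jump is created: by \<open>new\<close> the later slices end before a new
    point, and by \<open>before\<close> an earlier slice meets \<open>{a..b}\<close> at most in
    \<open>a\<close>, where \<open>(a, j)\<close> is an old point.\<close>
  moreover have "jump_instants ?E = jump_instants E"
  proof (intro equalityI subsetI)
    fix x assume x: "x \<in> jump_instants ?E"
    obtain s i where si: "x = (s, i)" by (metis surj_pair)
    have h: "(s, i) \<in> ?E" "(s, Suc i) \<in> ?E" using x si by (auto simp: jump_instants_def)
    have 1: "(s, i) \<in> E"
    proof (rule ccontr)
      assume n: "(s, i) \<notin> E"
      then have "i = j" "s \<in> {a..b}" using h by auto
      then show False using new[of s s "Suc j"] n h by auto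
    qed
    have "(s, Suc i) \<in> E"
    proof (rule ccontr)
      assume n: "(s, Suc i) \<notin> E"
      then have "Suc i = j" "s \<in> {a..b}" using h by auto
      then show False using before[OF 1] a n by auto
    qed
    then show "x \<in> jump_instants E" using 1 si by (auto simp: jump_instants_def)
  qed (auto simp: jump_instants_def)
  moreover have "\<forall>(t, i)\<in>jump_instants E. (x' t i, u' t i) \<in> jump_set \<H> \<and> x' t (Suc i) \<in> jump_map \<H> (x' t i) (u' t i)"
  proof clarify
    fix t i assume ti: "(t, i) \<in> jump_instants E"
    then have "(t, i) \<in> E" "(t, Suc i) \<in> E" by (auto simp: jump_instants_def)
    then show "(x' t i, u' t i) \<in> jump_set \<H> \<and> x' t (Suc i) \<in> jump_map \<H> (x' t i) (u' t i)"
      using sp ti agx agu unfolding solution_pair_def by auto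
  qed
  ultimately show ?thesis unfolding solution_pair_def x'_def[symmetric] u'_def[symmetric] by auto
qed

section \<open>The model and its Lyapunov function\<close>

text \<open>The integrating factor \<open>exp (2 * L * t)\<close> removes the linear term, and the
  remaining derivative is negative whatever the sign of the solution. So \<open>G\<close> decreases,
  which yields positivity of \<open>\<phi>\<close>, its bounds and finally its monotonicity. The
  constant continuation by \<open>l\<close> is continuous because
  \<open>\<phi> T = l\<close>.\<close>

lemma MIET_function:
  assumes M: "is_MIET L \<gamma> l T" and L: "L \<ge> 0" and \<gamma>: "\<gamma> > 0" and l: "0 < l" "l < 1"
  shows "\<exists>\<Phi>. (\<forall>s\<ge>0. l \<le> \<Phi> s \<and> \<Phi> s \<le> 1 / l) \<and> antimono_on {0..} \<Phi> \<and> continuous_on {0..} \<Phi> \<and>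
     (\<forall>s. 0 < s \<and> s < T \<longrightarrow> (\<Phi> has_real_derivative (- 2 * L * \<Phi> s - \<gamma> * ((\<Phi> s)\<^sup>2 + 1))) (at s)) \<and>
     (\<forall>s>T. (\<Phi> has_real_derivative 0) (at s) \<and> \<Phi> s = l)"
proof -
  obtain \<phi> where T: "T > 0" and \<phi>: "\<phi> 0 = 1 / l" "\<phi> T = l"
    "\<And>t. t \<in> {0..T} \<Longrightarrow> (\<phi> has_real_derivative (- 2 * L * \<phi> t - \<gamma> * ((\<phi> t)\<^sup>2 + 1))) (at t within {0..T})"
    using M unfolding is_MIET_def by blast
  have c\<phi>: "continuous_on {0..T} \<phi>" using \<phi>(3) by (meson DERIV_continuous continuous_on_eq_continuous_within)
  define G where "G t = exp (2 * L * t) * \<phi> t" for t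
  have G: "G s \<le> G t" if "0 \<le> t" "t \<le> s" "s \<le> T" for s t
  proof (rule DERIV_nonpos_imp_decreasing_open[of t s G])
    fix r assume r: "t < r" "r < s"
    have "(\<phi> has_real_derivative (- 2 * L * \<phi> r - \<gamma> * ((\<phi> r)\<^sup>2 + 1))) (at r)"
      using \<phi>(3)[of r] r that at_within_interior[of r "{0..T}"] by (simp add: interior_atLeastAtMost_real)
    then have "(G has_real_derivative (- exp (2 * L * r) * \<gamma> * ((\<phi> r)\<^sup>2 + 1))) (at r)"
      unfolding G_def by (auto intro!: derivative_eq_intros simp: algebra_simps)
    moreover have "- exp (2 * L * r) * \<gamma> * ((\<phi> r)\<^sup>2 + 1) \<le> 0"
      using \<gamma> by (simp add: mult_nonneg_nonneg)
    ultimately show "\<exists>y. (G has_real_derivative y) (at r) \<and> y \<le> 0" by blast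
  next
    have "continuous_on {t..s} \<phi>" by (rule continuous_on_subset[OF c\<phi>]) (use that in auto)
    then show "continuous_on {t..s} G" unfolding G_def by (intro continuous_intros)
  qed (use that in auto)
  have bnd: "l \<le> \<phi> t \<and> \<phi> t \<le> 1 / l" if "t \<in> {0..T}" for t
  proof
    have "exp (2 * L * t) * l \<le> exp (2 * L * T) * l"
      using that L l by (auto intro!: mult_left_mono)
    also have "\<dots> \<le> exp (2 * L * t) * \<phi> t" using G[of t T] that \<phi>(2) by (simp add: G_def)
    finally show "l \<le> \<phi> t" by simp
    have "\<phi> t * 1 \<le> \<phi> t * exp (2 * L * t)" using that L l \<open>l \<le> \<phi> t\<close> by (intro mult_left_mono) auto
    also have "\<dots> \<le> 1 / l" using G[of 0 t] that \<phi>(1) by (simp add: G_def mult.commute)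
    finally show "\<phi> t \<le> 1 / l" by simp
  qed
  have mono: "\<phi> s \<le> \<phi> t" if "0 \<le> t" "t \<le> s" "s \<le> T" for s t
  proof -
    have "exp (2 * L * t) * \<phi> s \<le> exp (2 * L * s) * \<phi> s"
      using that L l bnd[of s] by (intro mult_right_mono) (auto intro: mult_left_mono)
    also have "\<dots> \<le> exp (2 * L * t) * \<phi> t" using G[OF that] by (simp add: G_def)
    finally show ?thesis by simp
  qed
  define \<Phi> where "\<Phi> s = (if s \<le> T then \<phi> s else l)" for s
  have "continuous_on ({0..T} \<union> {T..}) (\<lambda>s. if s \<le> T then \<phi> s else l)"
    using c\<phi> \<phi>(2) by (intro continuous_on_cases) auto
  moreover have "{0..T} \<union> {T..} = {0..}" using T by auto
  ultimately have c: "continuous_on {0..} \<Phi>" unfolding \<Phi>_def by simp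
  have "antimono_on {0..} \<Phi>"
    by (rule monotone_onI) (use mono bnd in \<open>auto simp: \<Phi>_def\<close>)
  moreover have "(\<Phi> has_real_derivative (- 2 * L * \<Phi> s - \<gamma> * ((\<Phi> s)\<^sup>2 + 1))) (at s)" if "0 < s" "s < T" for s
  proof -
    have "(\<phi> has_real_derivative (- 2 * L * \<phi> s - \<gamma> * ((\<phi> s)\<^sup>2 + 1))) (at s)"
      using \<phi>(3)[of s] that at_within_interior[of s "{0..T}"] by (simp add: interior_atLeastAtMost_real)
    then have "(\<Phi> has_real_derivative (- 2 * L * \<phi> s - \<gamma> * ((\<phi> s)\<^sup>2 + 1))) (at s)"
      by (rule has_field_derivative_transform_within_open[of _ _ _ "{..<T}"]) (use that in \<open>auto simp: \<Phi>_def\<close>)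
    then show ?thesis using that by (simp add: \<Phi>_def)
  qed
  moreover have "(\<Phi> has_real_derivative 0) (at s) \<and> \<Phi> s = l" if "s > T" for s
  proof -
    have "((\<lambda>s. l) has_real_derivative 0) (at s)" by auto
    then have "(\<Phi> has_real_derivative 0) (at s)"
      by (rule has_field_derivative_transform_within_open[of _ _ _ "{T<..}"]) (use that in \<open>auto simp: \<Phi>_def\<close>)
    then show ?thesis using that by (simp add: \<Phi>_def)
  qed
  moreover have "\<forall>s\<ge>0. l \<le> \<Phi> s \<and> \<Phi> s \<le> 1 / l" 
  proof -
    have "l \<le> 1 / l" using l mult_le_one[of l l] by (simp add: field_simps)
    then show ?thesis using bnd T by (auto simp: \<Phi>_def)
  qed
  ultimately show ?thesis using c by blast
qed

section \<open>Coordinate blocks and components of the state\<close>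

lemma bounded_linear_block: "bounded_linear (block nd i)"
  unfolding linear_linear by (rule linearI) (auto simp: block_def vec_eq_iff)

lemma block_block: "block nd i (block nd j y) = (if i = j then block nd i y else 0)"
  by (auto simp: block_def vec_eq_iff)

lemma block_0 [simp]: "block nd i 0 = 0" by (simp add: block_def vec_eq_iff)
lemma block_add: "block nd i (x + y) = block nd i x + block nd i y" by (simp add: block_def vec_eq_iff)
lemma block_diff: "block nd i (x - y) = block nd i x - block nd i y" by (simp add: block_def vec_eq_iff)

lemma sum_block: "(\<Sum>i\<in>UNIV. block nd (i :: 'k::finite) y) = y"
proof -
  have "(\<Sum>i\<in>UNIV. if nd k = i then y $ k else 0) = y $ k" for k
    by (subst sum.delta') auto
  then show ?thesis by (auto simp: block_def vec_eq_iff sum_component)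
qed

lemma norm_block_le: "norm (block nd i y) \<le> norm y"
  by (rule norm_le_componentwise_cart) (auto simp: block_def)

lemma norm_le_sum_block: "norm y \<le> (\<Sum>i\<in>UNIV. norm (block nd (i :: 'k::finite) y))"
  using norm_sum[of "\<lambda>i. block nd (i::'k) y" UNIV] by (simp add: sum_block)

abbreviation "st_z x \<equiv> fst x"
abbreviation "st_e x \<equiv> fst (snd x)"
abbreviation "st_eps x \<equiv> fst (snd (snd x))"
abbreviation "st_wh x \<equiv> fst (snd (snd (snd x)))"
abbreviation "st_tau x \<equiv> fst (snd (snd (snd (snd x))))"
abbreviation "st_eta x \<equiv> snd (snd (snd (snd (snd x))))"

lemma norm_le_norm_fst: "norm (fst x) \<le> norm x"
  by (metis norm_fst_le prod.collapse)

lemma norm_le_norm_snd: "norm (snd x) \<le> norm x"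
  by (metis norm_snd_le prod.collapse)

lemma state_norms:
  "norm (st_z x) \<le> norm x" "norm (st_e x) \<le> norm x" "norm (st_eps x) \<le> norm x"
  "norm (st_wh x) \<le> norm x" "norm (st_tau x) \<le> norm x" "norm (st_eta x) \<le> norm x"
proof -
  note l = norm_le_norm_fst norm_le_norm_snd
  show "norm (st_z x) \<le> norm x" by (rule l)
  show "norm (st_e x) \<le> norm x" by (rule order.trans[OF l(1)], rule l)
  show "norm (st_eps x) \<le> norm x" by (rule order.trans[OF l(1)], rule order.trans[OF l(2)], rule l)
  show "norm (st_wh x) \<le> norm x" by (rule order.trans[OF l(1)], rule order.trans[OF l(2)], rule order.trans[OF l(2)], rule l)
  show "norm (st_tau x) \<le> norm x"
    by (rule order.trans[OF l(1)], rule order.trans[OF l(2)], rule order.trans[OF l(2)], rule order.trans[OF l(2)], rule l)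
  show "norm (st_eta x) \<le> norm x"
    by (rule order.trans[OF l(2)], rule order.trans[OF l(2)], rule order.trans[OF l(2)], rule order.trans[OF l(2)], rule l)
qed

lemma has_vector_derivative_fst:
  "(f has_vector_derivative d) F \<Longrightarrow> ((\<lambda>t. fst (f t)) has_vector_derivative fst d) F"
  by (rule bounded_linear.has_vector_derivative[OF bounded_linear_fst])

lemma has_vector_derivative_snd:
  "(f has_vector_derivative d) F \<Longrightarrow> ((\<lambda>t. snd (f t)) has_vector_derivative snd d) F"
  by (rule bounded_linear.has_vector_derivative[OF bounded_linear_snd])

lemma state_space_iff: "x \<in> state_space \<longleftrightarrow> (\<forall>i. 0 \<le> st_tau x $ i \<and> 0 \<le> st_eta x $ i)"
  by (auto simp: state_space_def split: prod.splits)

lemma target_set_iff: "x \<in> target_set \<longleftrightarrow> x \<in> state_space \<and> st_e x = 0 \<and> st_eps x = 0 \<and> st_eta x = 0"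
  by (auto simp: target_set_def split: prod.splits)

lemma closed_state_space: "closed (state_space :: ('n::finite, 'm::finite, 'q::finite, 'k::finite) state set)"
proof -
  have "state_space = (\<Inter>i. {x. 0 \<le> st_tau x $ i}) \<inter> (\<Inter>i. {x :: ('n, 'm, 'q, 'k) state. 0 \<le> st_eta x $ i})"
    by (auto simp: state_space_iff)
  also have "closed \<dots>"
    by (intro closed_Int closed_INT ballI closed_Collect_le continuous_intros)
  finally show ?thesis .
qed

section \<open>Flow on a compact interval\<close>

definition flow_arc :: "('s::real_normed_vector, 'u) hybrid_system \<Rightarrow> real \<Rightarrow> real \<Rightarrow> (real \<Rightarrow> 's) \<Rightarrow> (real \<Rightarrow> 'u) \<Rightarrow> bool" where
  "flow_arc \<H> a b x u \<longleftrightarrow> abs_cont_on {a..b} x \<and> (AE t in lebesgue. t \<in> {a..b} \<longrightarrow> (x t, u t) \<in> flow_set \<H> \<and>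
       (\<exists>d\<in>flow_map \<H> (x t) (u t). (x has_vector_derivative d) (at t within {a..b})))"

lemma flow_arc_of_solution_pair:
  assumes sp: "solution_pair \<H> E \<xi> \<nu>" and ab: "{a..b} \<subseteq> time_slice E j"
  shows "flow_arc \<H> a b (\<lambda>t. \<xi> t j) (\<lambda>t. \<nu> t j)"
  unfolding flow_arc_def
proof
  show "abs_cont_on {a..b} (\<lambda>t. \<xi> t j)"
    using sp ab unfolding solution_pair_def hybrid_arc_def by (meson locally_abs_cont_onD)
  have "AE t in lebesgue. t \<in> time_slice E j \<longrightarrow>
        (\<xi> t j, \<nu> t j) \<in> flow_set \<H> \<and>
        (\<exists>d\<in>flow_map \<H> (\<xi> t j) (\<nu> t j).
           ((\<lambda>s. \<xi> s j) has_vector_derivative d) (at t within time_slice E j))"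
    using sp unfolding solution_pair_def by blast
  then show "AE t in lebesgue. t \<in> {a..b} \<longrightarrow> (\<xi> t j, \<nu> t j) \<in> flow_set \<H> \<and>
        (\<exists>d\<in>flow_map \<H> (\<xi> t j) (\<nu> t j). ((\<lambda>s. \<xi> s j) has_vector_derivative d) (at t within {a..b}))"
    by eventually_elim (use ab in \<open>blast intro: has_vector_derivative_within_subset\<close>)
qed

lemma flow_arc_subset:
  assumes "flow_arc \<H> a b x u" "{c..d} \<subseteq> {a..b}"
  shows "flow_arc \<H> c d x u"
  unfolding flow_arc_def
proof
  show "abs_cont_on {c..d} x" using assms abs_cont_on_subset unfolding flow_arc_def by blast
  have "AE t in lebesgue. t \<in> {a..b} \<longrightarrow> (x t, u t) \<in> flow_set \<H> \<and>
       (\<exists>d\<in>flow_map \<H> (x t) (u t). (x has_vector_derivative d) (at t within {a..b}))"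
    using assms(1) unfolding flow_arc_def by blast
  then show "AE t in lebesgue. t \<in> {c..d} \<longrightarrow> (x t, u t) \<in> flow_set \<H> \<and>
       (\<exists>d'\<in>flow_map \<H> (x t) (u t). (x has_vector_derivative d') (at t within {c..d}))"
    by eventually_elim (use assms(2) in \<open>blast intro: has_vector_derivative_within_subset\<close>)
qed

text \<open>By continuity a violation of a closed condition persists on an interval of positive
  length. It is needed because the flow set is prescribed only at almost every time.\<close>

lemma AE_closed_interval:
  fixes x :: "real \<Rightarrow> 'a::metric_space"
  assumes c: "continuous_on {a..b} x" and C: "closed C" and ab: "a < b"
    and ae: "AE t in lebesgue. t \<in> {a..b} \<longrightarrow> x t \<in> C" and t: "t \<in> {a..b}"
  shows "x t \<in> C"
proof (rule ccontr)
  assume n: "x t \<notin> C"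
  then obtain e where e: "e > 0" "ball (x t) e \<inter> C = {}"
    using C by (metis Compl_iff disjoint_eq_subset_Compl open_Compl open_contains_ball_eq inf_commute)
  obtain d where d: "d > 0" "\<And>s. s \<in> {a..b} \<Longrightarrow> dist s t < d \<Longrightarrow> dist (x s) (x t) < e"
    using c t e(1) unfolding continuous_on_iff by blast
  define p where "p = max a (t - d / 2)"
  define q where "q = min b (t + d / 2)"
  have pq: "p < q" "{p..q} \<subseteq> {a..b}" "\<And>s. s \<in> {p..q} \<Longrightarrow> dist s t < d"
    using t ab d(1) by (auto simp: p_def q_def dist_real_def)
  have "AE s in lebesgue. s \<notin> {p..q}"
    using ae
  proof eventually_elim
    case (elim s)
    show ?case
    proof
      assume s: "s \<in> {p..q}"
      then have "x s \<in> ball (x t) e" using pq d(2)[of s] by (auto simp: dist_commute)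
      then show False using elim s pq e(2) by blast
    qed
  qed
  then have "{p..q} \<in> null_sets lebesgue" by (subst AE_iff_null_sets) auto
  then show False using pq(1) by (auto simp: null_sets_def)
qed

lemma locally_Lipschitz_square:
  fixes f :: "'a::real_normed_vector \<Rightarrow> real"
  assumes f: "locally_Lipschitz f"
  shows "locally_Lipschitz (\<lambda>x. f x * f x)"
  unfolding locally_Lipschitz_def
proof
  fix x
  obtain u L where L: "u > 0" "L \<ge> 0" "\<And>y z. y \<in> cball x u \<Longrightarrow> z \<in> cball x u \<Longrightarrow> dist (f y) (f z) \<le> L * dist y z"
    using locally_LipschitzE[OF f] by blast
  define B where "B = \<bar>f x\<bar> + L * u"
  have B0: "B \<ge> 0" using L by (simp add: B_def)
  have B: "\<bar>f y\<bar> \<le> B" if "y \<in> cball x u" for y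
  proof -
    have "dist (f y) (f x) \<le> L * dist y x" using that L(1) by (intro L) auto
    also have "\<dots> \<le> L * u" using that L(2) by (intro mult_left_mono) (auto simp: dist_commute)
    finally show ?thesis unfolding B_def dist_real_def by linarith
  qed
  have "(2 * B * L)-lipschitz_on (cball x u) (\<lambda>x. f x * f x)"
  proof (rule lipschitz_onI)
    fix y z assume yz: "y \<in> cball x u" "z \<in> cball x u"
    have "dist (f y * f y) (f z * f z) = \<bar>f y + f z\<bar> * dist (f y) (f z)"
      by (simp add: dist_real_def abs_mult[symmetric] algebra_simps)
    also have "\<dots> \<le> (2 * B) * (L * dist y z)"
      using B[OF yz(1)] B[OF yz(2)] B0 L yz by (intro mult_mono) auto
    finally show "dist (f y * f y) (f z * f z) \<le> 2 * B * L * dist y z" by (simp add: mult.assoc)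
  qed (use B0 L in auto)
  then show "\<exists>u>0. \<exists>L. L-lipschitz_on (cball x u) (\<lambda>x. f x * f x)" using L(1) by blast
qed

text \<open>The difference of the two sides is the square of \<open>g * p * W - h\<close>; the MIET
  equation is what makes the square complete. Here \<open>p\<close> stands for the value of
  \<open>Phi\<close>, \<open>h\<close> for that of \<open>H\<close>, and the parentheses collect the
  derivative of \<open>g * p * W\<^sup>2\<close> and the share of the node in the bound on
  \<open>V\<close>.\<close>

lemma trigger_inequality_before:
  fixes g :: real
  shows "g * ((- 2 * L * p - g * (p\<^sup>2 + 1)) * (W * W) + p * ((L * W + h) * W + W * (L * W + h))) +
    (- h\<^sup>2 + (g\<^sup>2 - m) * W\<^sup>2) \<le> - m * W\<^sup>2"
proof -
  have "- m * W\<^sup>2 - (g * ((- 2 * L * p - g * (p\<^sup>2 + 1)) * (W * W) + p * ((L * W + h) * W + W * (L * W + h))) +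
    (- h\<^sup>2 + (g\<^sup>2 - m) * W\<^sup>2)) = (g * p * W - h)\<^sup>2"
    by (simp add: power2_eq_square algebra_simps)
  then show ?thesis by (metis diff_ge_0_iff_ge zero_le_power2)
qed

text \<open>With \<open>p\<close> frozen at \<open>l\<close> the square lacks exactly
  \<open>c * W\<^sup>2\<close>, which explains the constant \<open>gam_bar\<close>. As
  \<open>W\<close> itself is unknown to the node, \<open>R\<close> is a bound on its square by known
  quantities and the noise.\<close>

lemma trigger_inequality_after:
  fixes g :: real
  assumes "c = 2 * g * l * L + g\<^sup>2 * (1 + l\<^sup>2)" "W\<^sup>2 \<le> R" "c \<ge> 0"
  shows "g * (0 * (W * W) + l * ((L * W + h) * W + W * (L * W + h))) + (- h\<^sup>2 + (g\<^sup>2 - m) * W\<^sup>2) \<le> - m * W\<^sup>2 + c * R"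
proof -
  have "- m * W\<^sup>2 + c * W\<^sup>2 - (g * (0 * (W * W) + l * ((L * W + h) * W + W * (L * W + h))) + (- h\<^sup>2 + (g\<^sup>2 - m) * W\<^sup>2)) = (g * l * W - h)\<^sup>2"
    unfolding assms(1) by (simp add: power2_eq_square algebra_simps)
  then have "g * (0 * (W * W) + l * ((L * W + h) * W + W * (L * W + h))) + (- h\<^sup>2 + (g\<^sup>2 - m) * W\<^sup>2) \<le> - m * W\<^sup>2 + c * W\<^sup>2"
    by (metis diff_ge_0_iff_ge zero_le_power2)
  also have "\<dots> \<le> - m * W\<^sup>2 + c * R" using assms by (simp add: mult_left_mono)
  finally show ?thesis .
qed

section \<open>Standing assumptions and directional rates of \<open>V\<close> and
  \<open>W\<close>\<close>

locale estimation_model =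
  fixes S :: "('n::finite, 'm::finite, 'p::finite, 'q::finite, 'k::finite) estimation_setup"
    and P :: "('m, 'k) trigger"
    and H :: "'k \<Rightarrow> real^'q \<Rightarrow> real^'n \<Rightarrow> real^'m \<Rightarrow> real^'p \<Rightarrow> real"
    and V :: "real^'n \<Rightarrow> real"
    and \<alpha> \<alpha>l \<alpha>u \<zeta> :: "real \<Rightarrow> real"
    and \<mu> :: "'k \<Rightarrow> real"
  assumes fp_C1: "cont_differentiable (\<lambda>(x, v). fp S x v)"
    and hp_C1: "\<And>i. cont_differentiable (hpi S i)"
    and ho_diff: "\<And>z. ho S differentiable (at z)"
    and plant: "plant_forward_complete S"
    and observer: "observer_forward_complete S"
    and assm_W: "assumption_W S P H"
    and assm_V: "assumption_V S P H V \<alpha> \<alpha>l \<alpha>u \<zeta> \<mu>"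
    and wbar: "\<And>i. 0 \<le> wbar P i"
    and lam: "\<And>i. 0 < lam P i \<and> lam P i < 1"
    and MIET: "\<And>i. is_MIET (Lc P i) (gam P i) (lam P i) (tMIET P i)"
    and tmin: "\<And>i. 0 < tmin P i \<and> tmin P i \<le> tMIET P i"
    and sig: "\<And>i. class_K_inf (sig P i)"
    and spar: "\<And>i. 0 \<le> spar P i"
begin

abbreviation "\<H> \<equiv> estimation_system S P"
abbreviation "blk \<equiv> block (node S)"
abbreviation "Wi i \<epsilon> \<equiv> Wf P i (blk i \<epsilon>)"

lemma W_facts: "locally_Lipschitz (\<lambda>\<epsilon>. Wi i \<epsilon>)" "blow P i > 0" "bup P i > 0" "Lc P i \<ge> 0"
  "blow P i * norm (blk i \<epsilon>) \<le> Wi i \<epsilon>" "Wi i \<epsilon> \<le> bup P i * norm (blk i \<epsilon>)"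
  "continuous_on UNIV (\<lambda>(z, e, wh, v). H i z e wh v)" "0 \<le> H i z e wh v"
  "AE \<epsilon> in lborel. \<exists>D. GDERIV (\<lambda>\<epsilon>. Wi i \<epsilon>) \<epsilon> :> D \<and>
        (\<forall>z e wh v. D \<bullet> g_i S i z e v \<le> Lc P i * Wi i \<epsilon> + H i z e wh v)"
  using assm_W unfolding assumption_W_def by blast+

lemma W_nonneg: "0 \<le> Wi i \<epsilon>"
  by (rule order.trans[OF _ W_facts(5)]) (use W_facts(2)[of i] in auto)

lemma W_0: "Wf P i 0 = 0"
  using W_facts(6)[of i 0] W_nonneg[of i 0] by simp

lemma V_facts: "locally_Lipschitz V" "0 \<le> V e" "class_K_inf \<alpha>" "class_K_inf \<alpha>l" "class_K_inf \<alpha>u" "class_K_inf \<zeta>"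
  "pos_semidefinite (rho P i)" "\<mu> i > 0" "gam P i > 0" "\<alpha>l (norm e) \<le> V e" "V e \<le> \<alpha>u (norm e)"
  "AE e in lborel. \<exists>D. GDERIV V e :> D \<and>
        (\<forall>z v w \<epsilon> wh. D \<bullet> f_e S z e \<epsilon> wh v
           \<le> - \<alpha> (norm e) + \<zeta> (norm (v, w)) +
             (\<Sum>i\<in>UNIV. - rho P i (norm (q_i S i z e w)) - (H i z e wh v)\<^sup>2
                + ((gam P i)\<^sup>2 - \<mu> i) * (Wi i \<epsilon>)\<^sup>2))"
  using assm_V unfolding assumption_V_def by blast+

lemma V_0: "V 0 = 0"
  using V_facts(2)[of 0] V_facts(11)[of 0] class_K_0[OF class_K_infD[OF V_facts(5)]] by simp

lemma cont_fp: "continuous_on UNIV (\<lambda>x. fp S (fst x) (snd x))"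
proof -
  obtain f' where "\<And>x. ((\<lambda>x. fp S (fst x) (snd x)) has_derivative blinfun_apply (f' x)) (at x)"
    using fp_C1 unfolding cont_differentiable_def case_prod_unfold by blast
  then show ?thesis by (intro continuous_at_imp_continuous_on ballI has_derivative_continuous)
qed

lemma cont_hpi: "continuous_on UNIV (hpi S i)"
proof -
  obtain f' where "\<And>x. (hpi S i has_derivative blinfun_apply (f' x)) (at x)"
    using hp_C1[of i] unfolding cont_differentiable_def by blast
  then show ?thesis by (intro continuous_at_imp_continuous_on ballI has_derivative_continuous)
qed

lemma hp_sum: "hp S x = (\<Sum>i\<in>UNIV. hpi S i x)"
  unfolding hpi_def by (simp add: sum_block)

lemma cont_hp: "continuous_on UNIV (hp S)"
  unfolding hp_sum[abs_def] by (intro continuous_intros cont_hpi)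

lemma cont_ho: "continuous_on UNIV (ho S)"
  using ho_diff by (meson continuous_at_imp_continuous_on differentiable_imp_continuous_within)

lemma ho_deriv: "(ho S has_derivative frechet_derivative (ho S) (at z)) (at z)"
  using ho_diff frechet_derivative_works by blast

lemma hpi_deriv:
  obtains D where "\<And>x. (hpi S i has_derivative blinfun_apply (D x)) (at x)" "continuous_on UNIV D"
    "\<And>x. frechet_derivative (hpi S i) (at x) = blinfun_apply (D x)"
proof -
  obtain D where D: "\<forall>x. (hpi S i has_derivative blinfun_apply (D x)) (at x)" "continuous_on UNIV D"
    using hp_C1[of i] unfolding cont_differentiable_def by blast
  show ?thesis
  proof (rule that[of D])
    show "frechet_derivative (hpi S i) (at x) = blinfun_apply (D x)" for x
      using frechet_derivative_at[OF D(1)[rule_format, of x]] by simp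
  qed (use D in auto)
qed

text \<open>\<open>hpi S j\<close> takes values in the coordinate subspace of node \<open>j\<close>,
  so its derivatives do too. Projecting the derivative of \<open>\<epsilon>\<close> to a block
  therefore leaves the term of one node.\<close>

lemma blk_g: "blk i (g_i S j z e v) = (if i = j then g_i S i z e v else 0)"
proof -
  have "blk i (frechet_derivative (hpi S j) (at x) d) = (if i = j then frechet_derivative (hpi S i) (at x) d else 0)" for x d
  proof -
    have h: "(hpi S j has_derivative frechet_derivative (hpi S j) (at x)) (at x)" for j
      using hpi_deriv[of j] by metis
    have c: "(\<lambda>x. blk i (hpi S j x)) = (if i = j then hpi S i else (\<lambda>x. 0))"
      by (auto simp: hpi_def block_block)
    have "((\<lambda>x. blk i (hpi S j x)) has_derivative (\<lambda>d. blk i (frechet_derivative (hpi S j) (at x) d))) (at x)"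
      by (rule bounded_linear.has_derivative[OF bounded_linear_block h])
    then have d: "((if i = j then hpi S i else (\<lambda>x. 0)) has_derivative (\<lambda>d. blk i (frechet_derivative (hpi S j) (at x) d))) (at x)"
      unfolding c .
    show ?thesis
    proof (cases "i = j")
      case True
      from d True have "(hpi S j has_derivative (\<lambda>d. blk j (frechet_derivative (hpi S j) (at x) d))) (at x)" by simp
      from has_derivative_unique[OF this h[of j]] True show ?thesis by (auto dest: fun_cong)
    next
      case False
      have "((\<lambda>x::real^'n. 0::real^'m) has_derivative (\<lambda>d. 0)) (at x)" by simp
      moreover from d False have "((\<lambda>x. 0) has_derivative (\<lambda>d. blk i (frechet_derivative (hpi S j) (at x) d))) (at x)" by simp
      ultimately show ?thesis using has_derivative_unique False by (fastforce dest: fun_cong)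
    qed
  qed
  then show ?thesis unfolding g_i_def by (simp add: block_diff)
qed

lemma cont_K_norm:
  fixes f :: "'a::topological_space \<Rightarrow> 'b::real_normed_vector"
  assumes "continuous_on {0..} a" "continuous_on A f"
  shows "continuous_on A (\<lambda>x. a (norm (f x)))"
  by (rule continuous_on_compose2[OF assms(1) continuous_on_norm[OF assms(2)]]) auto

lemma V_dir_rate:
  "dir_rate V e (f_e S z e \<epsilon> wh v) (- \<alpha> (norm e) + \<zeta> (norm (v, w)) +
     (\<Sum>i\<in>UNIV. - rho P i (norm (q_i S i z e w)) - (H i z e wh v)\<^sup>2 + ((gam P i)\<^sup>2 - \<mu> i) * (Wi i \<epsilon>)\<^sup>2))"
proof -
  txt \<open>\<open>fo\<close> need not be continuous; the noise sample is shifted along with the error so that the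
    argument of \<open>fo\<close> stays fixed.\<close>
  define wh' where "wh' e' = wh + hp S (ho S z - e) - hp S (ho S z - e')" for e'
  define k where "k e' = f_e S z e' \<epsilon> (wh' e') v" for e'
  define r where "r e' = - \<alpha> (norm e') + \<zeta> (norm (v, w)) +
     (\<Sum>i\<in>UNIV. - rho P i (norm (q_i S i z e' w)) - (H i z e' (wh' e') v)\<^sup>2 + ((gam P i)\<^sup>2 - \<mu> i) * (Wi i \<epsilon>)\<^sup>2)" for e'
  have k_eq: "k e' = frechet_derivative (ho S) (at z) (fo S z (hp S (ho S z - e) + \<epsilon> + wh)) - fp S (ho S z - e') v" for e'
    by (simp add: k_def f_e_def f_z_def wh'_def algebra_simps)
  have cs: "continuous_on UNIV (\<lambda>e'. ho S z - e')" by (intro continuous_intros)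
  have c1: "continuous_on UNIV (\<lambda>e'. fp S (ho S z - e') v)"
    using continuous_on_compose2[OF cont_fp, of UNIV "\<lambda>e'. (ho S z - e', v)"] by (simp add: continuous_on_Pair cs)
  have "continuous_on UNIV k" unfolding k_eq[abs_def] by (intro continuous_intros c1)
  then have ck: "isCont k e" by (simp add: continuous_on_eq_continuous_at)
  have cw: "continuous_on UNIV wh'"
  proof -
    have "continuous_on UNIV (\<lambda>e'. hp S (ho S z - e'))" by (rule continuous_on_compose2[OF cont_hp cs]) auto
    then show ?thesis unfolding wh'_def by (intro continuous_intros)
  qed
  have cH: "continuous_on UNIV (\<lambda>e'. H i z e' (wh' e') v)" for i
    using continuous_on_compose2[OF W_facts(7)[of i], of UNIV "\<lambda>e'. (z, e', wh' e', v)"]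
    by (simp add: continuous_on_Pair cw)
  have cq: "continuous_on UNIV (\<lambda>e'. rho P i (norm (q_i S i z e' w)))" for i
  proof -
    have "continuous_on UNIV (\<lambda>e'. hpi S i (ho S z - e'))" by (rule continuous_on_compose2[OF cont_hpi cs]) auto
    then have "continuous_on UNIV (\<lambda>e'. q_i S i z e' w)" unfolding q_i_def by (intro continuous_intros)
    then show ?thesis using V_facts(7)[of i] unfolding pos_semidefinite_def by (intro cont_K_norm) auto
  qed
  have ca: "continuous_on UNIV (\<lambda>e'::real^'n. \<alpha> (norm e'))"
    using V_facts(3) by (intro cont_K_norm continuous_on_id) (simp add: class_K_inf_def class_K_def)
  have "continuous_on UNIV r" unfolding r_def by (intro continuous_intros ca cq cH)
  then have cr: "isCont r e" by (simp add: continuous_on_eq_continuous_at)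
  \<comment> \<open>The other variables are quantified inside the almost everywhere statement, so
    its null set does not depend on the sample and \<open>wh' e'\<close> may be inserted.\<close>
  have "AE e' in lborel. \<exists>D. GDERIV V e' :> D \<and> D \<bullet> k e' \<le> r e'"
    using V_facts(12) by eventually_elim (auto simp: k_def r_def)
  from dir_rate_of_AE[OF V_facts(1) this ck cr] show ?thesis
    by (simp add: k_def r_def wh'_def)
qed

lemma W_dir_rate: "dir_rate (\<lambda>\<epsilon>. Wi i \<epsilon>) \<epsilon> (g_i S i z e v) (Lc P i * Wi i \<epsilon> + H i z e wh v)"
proof -
  have "AE \<epsilon> in lborel. \<exists>D. GDERIV (\<lambda>\<epsilon>. Wi i \<epsilon>) \<epsilon> :> D \<and> D \<bullet> g_i S i z e v \<le> Lc P i * Wi i \<epsilon> + H i z e wh v"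
    using W_facts(9)[of i] by eventually_elim blast
  moreover have "isCont (\<lambda>\<epsilon>. Lc P i * Wi i \<epsilon> + H i z e wh v) \<epsilon>"
    using locally_Lipschitz_imp_continuous[OF W_facts(1)[of i]]
    by (intro continuous_intros) (simp add: continuous_on_eq_continuous_at)
  ultimately show ?thesis using dir_rate_of_AE[OF W_facts(1)[of i], of "\<lambda>_. g_i S i z e v"] by auto
qed


section \<open>Lyapunov function, dissipation and supply rate\<close>

definition Phi :: "'k \<Rightarrow> real \<Rightarrow> real" where
  "Phi i = (SOME \<Phi>. (\<forall>s\<ge>0. lam P i \<le> \<Phi> s \<and> \<Phi> s \<le> 1 / lam P i) \<and> antimono_on {0..} \<Phi> \<and> continuous_on {0..} \<Phi> \<and>
     (\<forall>s. 0 < s \<and> s < tMIET P i \<longrightarrow> (\<Phi> has_real_derivative (- 2 * Lc P i * \<Phi> s - gam P i * ((\<Phi> s)\<^sup>2 + 1))) (at s)) \<and>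
     (\<forall>s>tMIET P i. (\<Phi> has_real_derivative 0) (at s) \<and> \<Phi> s = lam P i))"

lemma Phi_props: "(\<forall>s\<ge>0. lam P i \<le> Phi i s \<and> Phi i s \<le> 1 / lam P i) \<and> antimono_on {0..} (Phi i) \<and> continuous_on {0..} (Phi i) \<and>
     (\<forall>s. 0 < s \<and> s < tMIET P i \<longrightarrow> (Phi i has_real_derivative (- 2 * Lc P i * Phi i s - gam P i * ((Phi i s)\<^sup>2 + 1))) (at s)) \<and>
     (\<forall>s>tMIET P i. (Phi i has_real_derivative 0) (at s) \<and> Phi i s = lam P i)"
  unfolding Phi_def
  by (rule someI_ex[OF MIET_function[OF MIET W_facts(4) V_facts(9)]]) (use lam in auto)

lemma Phi_bounds: "0 \<le> s \<Longrightarrow> lam P i \<le> Phi i s" "0 \<le> s \<Longrightarrow> Phi i s \<le> 1 / lam P i" "0 \<le> s \<Longrightarrow> 0 \<le> Phi i s"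
  using Phi_props[of i] lam[of i] by (auto intro: order.trans[of 0 "lam P i"])

lemma Phi_antimono: "0 \<le> s \<Longrightarrow> s \<le> t \<Longrightarrow> Phi i t \<le> Phi i s"
  using Phi_props[of i] unfolding monotone_on_def by auto

lemma gam_bar_nonneg: "0 \<le> gam_bar P i"
  unfolding gam_bar_def using W_facts(4)[of i] V_facts(9)[of i] lam[of i] by auto

definition lyap_node :: "'k \<Rightarrow> ('n, 'm, 'q, 'k) state \<Rightarrow> real" where
  "lyap_node i x = gam P i * (Phi i (st_tau x $ i) * (Wi i (st_eps x) * Wi i (st_eps x))) + st_eta x $ i"

definition lyap :: "('n, 'm, 'q, 'k) state \<Rightarrow> real" where
  "lyap x = V (st_e x) + (\<Sum>i\<in>UNIV. lyap_node i x)"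

definition diss :: "('n, 'm, 'q, 'k) state \<Rightarrow> real" where
  "diss x = \<alpha> (norm (st_e x)) + (\<Sum>i\<in>UNIV. \<mu> i * (Wi i (st_eps x))\<^sup>2 + sig P i (st_eta x $ i))"

text \<open>The distance between the sampling error of node \<open>i\<close> and the quantity
  \<open>\<epsilon> + wh - w\<close> that the node can evaluate.\<close>

definition noise_gap :: "'k \<Rightarrow> ('n, 'm, 'q, 'k) state \<Rightarrow> ('m, 'p) input \<Rightarrow> real" where
  "noise_gap i x u = norm (blk i (st_wh x) - blk i (snd u))"

text \<open>What is left on the right of the flow inequality besides dissipation. The coefficient of
  the squared gap is \<open>gam_bar\<close> times the one in \<open>W_split\<close>.\<close>

definition supply_rate :: "('n, 'm, 'q, 'k) state \<Rightarrow> ('m, 'p) input \<Rightarrow> real" where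
  "supply_rate x u = \<zeta> (norm u) + (\<Sum>i\<in>UNIV. spar P i + gam_bar P i * (2 * (bup P i)\<^sup>2 * (noise_gap i x u)\<^sup>2))"

lemma flow_set_iff: "(x, u) \<in> flow_set \<H> \<longleftrightarrow> x \<in> state_space"
  by (cases x) (auto simp: estimation_system_def flow_set_i_def state_space_def)

lemma jump_set_i_iff: "x \<in> jump_set_i P i \<longleftrightarrow> x \<in> state_space \<and> tmin P i \<le> st_tau x $ i"
  by (cases x) (auto simp: jump_set_i_def)

lemma jump_set_iff: "(x, u) \<in> jump_set \<H> \<longleftrightarrow> (\<exists>i. x \<in> jump_set_i P i)"
  by (auto simp: estimation_system_def)

lemma jump_map_iff: "y \<in> jump_map \<H> x u \<longleftrightarrow> (\<exists>i. y = jump_i S P i x u \<and> x \<in> jump_set_i P i)"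
  by (auto simp: estimation_system_def)

definition eta_flow :: "'k \<Rightarrow> ('n, 'm, 'q, 'k) state \<Rightarrow> ('m, 'p) input \<Rightarrow> real \<Rightarrow> real" where
  "eta_flow i x u \<omega> = rho P i (norm (q_i S i (st_z x) (st_e x) (snd u)))
     - \<omega> * gam_bar P i * beta_ratio P i * (Wi i (st_eps x + st_wh x - snd u))\<^sup>2
     - sig P i (st_eta x $ i) + spar P i"

lemma flow_map_iff: "d \<in> flow_map \<H> x u \<longleftrightarrow>
    st_z d = f_z S (st_z x) (st_e x) (st_eps x) (st_wh x) \<and>
    st_e d = f_e S (st_z x) (st_e x) (st_eps x) (st_wh x) (fst u) \<and>
    st_eps d = (\<Sum>i\<in>UNIV. g_i S i (st_z x) (st_e x) (fst u)) \<and> st_wh d = 0 \<and> st_tau d = (\<chi> i. 1) \<and>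
    (\<forall>i. \<exists>\<omega>\<in>omega (tMIET P i) (st_tau x $ i). st_eta d $ i = eta_flow i x u \<omega>)"
  by (cases x, cases u, cases d) (auto simp: estimation_system_def flow_dyn_def Psi_def eta_flow_def)

lemma omega_cases:
  assumes "\<omega> \<in> omega T s"
  shows "0 \<le> \<omega>" "\<omega> \<le> 1" "s < T \<Longrightarrow> \<omega> = 0" "s > T \<Longrightarrow> \<omega> = 1"
  using assms by (auto simp: omega_def split: if_splits)

text \<open>The error equals the measurable one minus the noise gap. The square of a sum is at most
  twice the sum of the squares, which accounts for the 2 in \<open>beta_ratio\<close>; its quotient
  comes from passing from \<open>W\<close> to the norm with \<open>bup\<close> and back with
  \<open>blow\<close>.\<close>

lemma W_split: "(Wi i \<epsilon>)\<^sup>2 \<le> beta_ratio P i * (Wi i (\<epsilon> + wh - w))\<^sup>2 + 2 * (bup P i)\<^sup>2 * (norm (blk i wh - blk i w))\<^sup>2"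
proof -
  let ?t = "blk i (\<epsilon> + wh - w)" and ?n = "norm (blk i wh - blk i w)"
  have "blk i \<epsilon> = ?t - (blk i wh - blk i w)" by (simp add: block_add block_diff)
  then have "norm (blk i \<epsilon>) \<le> norm ?t + ?n" using norm_triangle_ineq4[of ?t "blk i wh - blk i w"] by simp
  then have "(norm (blk i \<epsilon>))\<^sup>2 \<le> (norm ?t + ?n)\<^sup>2" by (intro power_mono) auto
  also have "\<dots> \<le> 2 * (norm ?t)\<^sup>2 + 2 * ?n\<^sup>2"
    using sum_squares_bound[of "norm ?t" ?n] by (simp add: power2_sum)
  finally have 1: "(norm (blk i \<epsilon>))\<^sup>2 \<le> 2 * (norm ?t)\<^sup>2 + 2 * ?n\<^sup>2" .
  have "(blow P i * norm ?t)\<^sup>2 \<le> (Wi i (\<epsilon> + wh - w))\<^sup>2"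
    using W_facts(2)[of i] by (intro power_mono W_facts(5)) auto
  then have 2: "(norm ?t)\<^sup>2 \<le> (Wi i (\<epsilon> + wh - w))\<^sup>2 / (blow P i)\<^sup>2"
    using W_facts(2)[of i] by (simp add: field_simps power_mult_distrib)
  have "(Wi i \<epsilon>)\<^sup>2 \<le> (bup P i * norm (blk i \<epsilon>))\<^sup>2" by (intro power_mono W_facts(6) W_nonneg)
  also have "\<dots> = (bup P i)\<^sup>2 * (norm (blk i \<epsilon>))\<^sup>2" by (simp add: power_mult_distrib)
  also have "\<dots> \<le> (bup P i)\<^sup>2 * (2 * ((Wi i (\<epsilon> + wh - w))\<^sup>2 / (blow P i)\<^sup>2) + 2 * ?n\<^sup>2)"
    using 1 2 by (intro mult_left_mono) auto
  also have "\<dots> = beta_ratio P i * (Wi i (\<epsilon> + wh - w))\<^sup>2 + 2 * (bup P i)\<^sup>2 * ?n\<^sup>2"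
    by (simp add: beta_ratio_def algebra_simps)
  finally show ?thesis .
qed

section \<open>Rates along flows\<close>

lemma flow_tau:
  assumes x: "flow_arc \<H> a b x u" and t: "t \<in> {a..b}"
  shows "st_tau (x t) $ i = st_tau (x a) $ i + (t - a)"
proof -
  let ?f = "\<lambda>t. st_tau (x t) $ i - t"
  have x': "flow_arc \<H> a t x u" by (rule flow_arc_subset[OF x]) (use t in auto)
  have "abs_cont_on {a..t} (\<lambda>t. st_tau (x t) $ i)"
  proof (rule abs_cont_on_bounded[of "{a..t}" x _ 1])
    show "abs_cont_on {a..t} x" using x' by (simp add: flow_arc_def)
    fix p q
    have "norm (st_tau (x q) $ i - st_tau (x p) $ i) \<le> norm (st_tau (x q - x p))"
      using component_le_norm_cart[of "st_tau (x q - x p)" i] by simp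
    then show "norm (st_tau (x q) $ i - st_tau (x p) $ i) \<le> 1 * norm (x q - x p)"
      using state_norms(5)[of "x q - x p"] by linarith
  qed
  then have ac: "abs_cont_on {a..t} ?f" by (intro abs_cont_on_diff abs_cont_on_id)
  have "norm (?f t - ?f a) \<le> 0 * (t - a)"
  proof (rule norm_increment_le[OF _ ac])
    have "AE s in lebesgue. s \<in> {a..t} \<longrightarrow> (x s, u s) \<in> flow_set \<H> \<and>
       (\<exists>d\<in>flow_map \<H> (x s) (u s). (x has_vector_derivative d) (at s within {a..t}))" using x' by (simp add: flow_arc_def)
    then show "AE s in lebesgue. s \<in> {a..t} \<longrightarrow> (\<exists>d. norm d \<le> 0 \<and> (?f has_vector_derivative d) (at s within {a..t}))"
    proof (eventually_elim, intro impI)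
      fix s assume "s \<in> {a..t} \<longrightarrow> (x s, u s) \<in> flow_set \<H> \<and>
       (\<exists>d\<in>flow_map \<H> (x s) (u s). (x has_vector_derivative d) (at s within {a..t}))" "s \<in> {a..t}"
      then obtain d where d: "d \<in> flow_map \<H> (x s) (u s)" "(x has_vector_derivative d) (at s within {a..t})" by blast
      have "((\<lambda>t. st_tau (x t)) has_vector_derivative st_tau d) (at s within {a..t})"
        by (intro has_vector_derivative_fst has_vector_derivative_snd d)
      then have "((\<lambda>t. st_tau (x t) $ i) has_vector_derivative st_tau d $ i) (at s within {a..t})"
        by (rule bounded_linear.has_vector_derivative[OF bounded_linear_vec_nth])
      then have "(?f has_vector_derivative (st_tau d $ i - 1)) (at s within {a..t})"
        by (intro has_vector_derivative_diff has_vector_derivative_id)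
      then show "\<exists>d. norm d \<le> 0 \<and> (?f has_vector_derivative d) (at s within {a..t})"
        using d(1) by (intro exI[of _ 0]) (simp add: flow_map_iff)
    qed
  qed (use t in auto)
  then show ?thesis by simp
qed

text \<open>The terms \<open>- rho\<close> in the bound on \<open>V\<close> and \<open>+ rho\<close>
  in the dynamics of \<open>\<eta>\<close> cancel, so only the quadratic terms in \<open>W\<close>
  and \<open>H\<close> have to be balanced, separately for each node.\<close>

lemma lyap_rate:
  assumes x: "flow_arc \<H> a b x u" and st: "\<And>t. t \<in> {a..b} \<Longrightarrow> x t \<in> state_space"
  shows "AE t in lebesgue. t \<in> {a..b} \<longrightarrow> upper_rate {a..b} (\<lambda>s. lyap (x s)) t (- diss (x t) + supply_rate (x t) (u t))"
proof -
  have ae1: "AE t in lebesgue. t \<in> {a..b} \<longrightarrow> (x t, u t) \<in> flow_set \<H> \<and>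
       (\<exists>d\<in>flow_map \<H> (x t) (u t). (x has_vector_derivative d) (at t within {a..b}))"
    using x by (simp add: flow_arc_def)
  \<comment> \<open>Timers have slope 1, so on this arc each of them passes 0 and
    \<open>tMIET\<close> at most once. Discarding these finitely many times leaves
    \<open>Phi\<close> differentiable and \<open>omega\<close> single-valued.\<close>
  have ae2: "AE t in lebesgue. \<forall>i::'k. t \<noteq> a - st_tau (x a) $ i"
    by (intro eventually_all_finite AE_lebesgue_neq)
  have ae3: "AE t in lebesgue. \<forall>i::'k. t \<noteq> a + tMIET P i - st_tau (x a) $ i"
    by (intro eventually_all_finite AE_lebesgue_neq)
  show ?thesis
    using ae1 ae2 ae3
  proof (eventually_elim, intro impI)
    fix t
    assume 1: "t \<in> {a..b} \<longrightarrow> (x t, u t) \<in> flow_set \<H> \<and>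
       (\<exists>d\<in>flow_map \<H> (x t) (u t). (x has_vector_derivative d) (at t within {a..b}))"
      and 2: "\<forall>i::'k. t \<noteq> a - st_tau (x a) $ i" and 3: "\<forall>i::'k. t \<noteq> a + tMIET P i - st_tau (x a) $ i"
      and t: "t \<in> {a..b}"
    let ?I = "{a..b}"
    obtain d where d: "d \<in> flow_map \<H> (x t) (u t)" and xd: "(x has_vector_derivative d) (at t within ?I)" using 1 t by blast
    have dd: "st_e d = f_e S (st_z (x t)) (st_e (x t)) (st_eps (x t)) (st_wh (x t)) (fst (u t))"
      "st_eps d = (\<Sum>i\<in>UNIV. g_i S i (st_z (x t)) (st_e (x t)) (fst (u t)))" "st_tau d = (\<chi> i. 1)"
      using d by (simp_all add: flow_map_iff)
    define z e \<epsilon> wh v w where defs: "z = st_z (x t)" "e = st_e (x t)" "\<epsilon> = st_eps (x t)" "wh = st_wh (x t)" "v = fst (u t)" "w = snd (u t)"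
    have cx: "continuous (at t within ?I) x" by (rule has_vector_derivative_continuous[OF xd])
    have tau_ne: "st_tau (x t) $ i > 0 \<and> st_tau (x t) $ i \<noteq> tMIET P i" for i
    proof -
      have A: "st_tau (x t) $ i = st_tau (x a) $ i + (t - a)" by (rule flow_tau[OF x t])
      have "0 \<le> st_tau (x t) $ i" using st[OF t] by (simp add: state_space_iff)
      moreover have "st_tau (x t) $ i \<noteq> 0" "st_tau (x t) $ i \<noteq> tMIET P i"
        using A 2[rule_format, of i] 3[rule_format, of i] by auto
      ultimately show ?thesis by simp
    qed
    define RV where "RV = - \<alpha> (norm e) + \<zeta> (norm (u t)) +
     (\<Sum>i\<in>UNIV. - rho P i (norm (q_i S i z e w)) - (H i z e wh v)\<^sup>2 + ((gam P i)\<^sup>2 - \<mu> i) * (Wi i \<epsilon>)\<^sup>2)"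
    have rV: "upper_rate ?I (\<lambda>s. V (st_e (x s))) t RV"
    proof (rule upper_rate_compose[OF V_facts(1) _ t])
      show "((\<lambda>s. st_e (x s)) has_vector_derivative st_e d) (at t within ?I)"
        by (intro has_vector_derivative_fst has_vector_derivative_snd xd)
      show "dir_rate V (st_e (x t)) (st_e d) RV"
        using V_dir_rate[of e z \<epsilon> wh v w] unfolding dd RV_def defs by simp
    qed
    define m where "m i = Lc P i * Wi i \<epsilon> + H i z e wh v" for i
    have rW: "upper_rate ?I (\<lambda>s. Wi i (st_eps (x s))) t (m i)" for i
    proof -
      \<comment> \<open>The projection, inserted once more, changes nothing in the value, but
        reduces the direction of motion to \<open>g_i S i\<close> alone. Only for this direction is
        a rate of \<open>Wi i\<close> known.\<close>
      have "upper_rate ?I (\<lambda>s. Wi i (blk i (st_eps (x s)))) t (m i)"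
      proof (rule upper_rate_compose[OF W_facts(1) _ t])
        have "((\<lambda>s. st_eps (x s)) has_vector_derivative st_eps d) (at t within ?I)"
          by (intro has_vector_derivative_fst has_vector_derivative_snd xd)
        then have "((\<lambda>s. blk i (st_eps (x s))) has_vector_derivative blk i (st_eps d)) (at t within ?I)"
          by (rule bounded_linear.has_vector_derivative[OF bounded_linear_block])
        moreover have "blk i (st_eps d) = g_i S i z e v"
          unfolding dd defs linear_sum[OF bounded_linear.linear[OF bounded_linear_block]] by (simp add: blk_g)
        ultimately show "((\<lambda>s. blk i (st_eps (x s))) has_vector_derivative g_i S i z e v) (at t within ?I)" by simp
        show "dir_rate (\<lambda>\<epsilon>. Wi i \<epsilon>) (blk i (st_eps (x t))) (g_i S i z e v) (m i)"
          using W_dir_rate[of i "blk i \<epsilon>" z e v wh] by (simp add: m_def block_block defs)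
      qed
      then show ?thesis by (simp add: block_block)
    qed
    define p' where "p' i = (if st_tau (x t) $ i < tMIET P i then - 2 * Lc P i * Phi i (st_tau (x t) $ i) - gam P i * ((Phi i (st_tau (x t) $ i))\<^sup>2 + 1) else 0)" for i
    have dPhi: "((\<lambda>s. Phi i (st_tau (x s) $ i)) has_vector_derivative p' i) (at t within ?I)" for i
    proof -
      have "(Phi i has_real_derivative p' i) (at (st_tau (x t) $ i))"
        using Phi_props[of i] tau_ne[of i] by (auto simp: p'_def)
      moreover have "((\<lambda>t. st_tau (x t)) has_vector_derivative st_tau d) (at t within ?I)"
        by (intro has_vector_derivative_fst has_vector_derivative_snd xd)
      then have "((\<lambda>t. st_tau (x t) $ i) has_vector_derivative st_tau d $ i) (at t within ?I)"
        by (rule bounded_linear.has_vector_derivative[OF bounded_linear_vec_nth])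
      then have "((\<lambda>t. st_tau (x t) $ i) has_real_derivative 1) (at t within ?I)"
        unfolding dd by (simp add: has_real_derivative_iff_has_vector_derivative)
      ultimately show ?thesis
        using DERIV_chain2[of "Phi i" "p' i" "\<lambda>t. st_tau (x t) $ i" t 1 ?I] by (simp add: has_real_derivative_iff_has_vector_derivative)
    qed
    have cW: "continuous (at t within ?I) (\<lambda>s. Wi i (st_eps (x s)))" for i
    proof -
      have "isCont (\<lambda>\<epsilon>. Wi i \<epsilon>) (st_eps (x t))"
        using locally_Lipschitz_imp_continuous[OF W_facts(1)[of i]] by (simp add: continuous_on_eq_continuous_at)
      moreover have "continuous (at t within ?I) (\<lambda>s. st_eps (x s))" by (intro continuous_intros cx)
      ultimately show ?thesis
        by (rule continuous_within_compose3[where g = "\<lambda>\<epsilon>. Wi i \<epsilon>" and f = "\<lambda>s. st_eps (x s)"])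
    qed
    have rWW: "upper_rate ?I (\<lambda>s. Wi i (st_eps (x s)) * Wi i (st_eps (x s))) t (m i * Wi i \<epsilon> + Wi i \<epsilon> * m i)" for i
      using upper_rate_mult[OF rW[of i] rW[of i] cW[of i] cW[of i] _ _ t] W_nonneg by (simp add: defs)
    have rPWW: "upper_rate ?I (\<lambda>s. Phi i (st_tau (x s) $ i) * (Wi i (st_eps (x s)) * Wi i (st_eps (x s)))) t
       (p' i * (Wi i \<epsilon> * Wi i \<epsilon>) + Phi i (st_tau (x t) $ i) * (m i * Wi i \<epsilon> + Wi i \<epsilon> * m i))" for i
    proof -
      have "upper_rate ?I (\<lambda>s. Phi i (st_tau (x s) $ i)) t (p' i)" by (rule upper_rate_has_derivative[OF dPhi t])
      moreover have "continuous (at t within ?I) (\<lambda>s. Phi i (st_tau (x s) $ i))" by (rule has_vector_derivative_continuous[OF dPhi])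
      moreover have "0 \<le> Phi i (st_tau (x s) $ i)" if "s \<in> ?I" for s
        using st[OF that] by (intro Phi_bounds(3)) (simp add: state_space_iff)
      ultimately show ?thesis
        using upper_rate_mult[OF _ rWW[of i] _ _ _ _ t, of "\<lambda>s. Phi i (st_tau (x s) $ i)" "p' i"] cW[of i] W_nonneg
        by (simp add: defs continuous_mult)
    qed
    have reta: "upper_rate ?I (\<lambda>s. st_eta (x s) $ i) t (st_eta d $ i)" for i
      by (intro upper_rate_has_derivative[OF _ t] bounded_linear.has_vector_derivative[OF bounded_linear_vec_nth]
          has_vector_derivative_snd xd)
    define M where "M i = gam P i * (p' i * (Wi i \<epsilon> * Wi i \<epsilon>) + Phi i (st_tau (x t) $ i) * (m i * Wi i \<epsilon> + Wi i \<epsilon> * m i)) + st_eta d $ i" for i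
    have "upper_rate ?I (\<lambda>s. lyap (x s)) t (RV + (\<Sum>i\<in>UNIV. M i))"
      unfolding lyap_def lyap_node_def M_def
      by (intro upper_rate_add rV upper_rate_sum finite upper_rate_scale rPWW reta) (use V_facts(9) in \<open>simp add: less_imp_le\<close>)
    moreover have "RV + (\<Sum>i\<in>UNIV. M i) \<le> - diss (x t) + supply_rate (x t) (u t)"
    proof -
      \<comment> \<open>Before \<open>tMIET\<close> the factor \<open>\<omega>\<close> is 0 and the
        decrease of \<open>Phi\<close> completes the square. Afterwards \<open>\<omega>\<close> is
        1, and the negative term of the trigger dynamics supplies \<open>gam_bar\<close> times the
        measurable part of \<open>W_split\<close>.\<close>
      have key: "(- rho P i (norm (q_i S i z e w)) - (H i z e wh v)\<^sup>2 + ((gam P i)\<^sup>2 - \<mu> i) * (Wi i \<epsilon>)\<^sup>2) + M i \<le>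
        - (\<mu> i * (Wi i \<epsilon>)\<^sup>2 + sig P i (st_eta (x t) $ i)) + (spar P i + gam_bar P i * (2 * (bup P i)\<^sup>2 * (noise_gap i (x t) (u t))\<^sup>2))" for i
      proof -
        obtain \<omega> where om: "\<omega> \<in> omega (tMIET P i) (st_tau (x t) $ i)" "st_eta d $ i = eta_flow i (x t) (u t) \<omega>"
          using d by (auto simp: flow_map_iff)
        have eta: "st_eta d $ i = rho P i (norm (q_i S i z e w)) - \<omega> * (gam_bar P i * (beta_ratio P i * (Wi i (\<epsilon> + wh - w))\<^sup>2))
          - sig P i (st_eta (x t) $ i) + spar P i" by (simp add: om(2) eta_flow_def defs mult.assoc)
        have ng: "gam_bar P i * (2 * (bup P i)\<^sup>2 * (noise_gap i (x t) (u t))\<^sup>2) \<ge> 0" using gam_bar_nonneg[of i] by simp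
        show ?thesis
        proof (cases "st_tau (x t) $ i < tMIET P i")
          case True
          then have "\<omega> = 0" using omega_cases[OF om(1)] by simp
          then show ?thesis
            using trigger_inequality_before[of "gam P i" "Lc P i" "Phi i (st_tau (x t) $ i)" "Wi i \<epsilon>" "H i z e wh v" "\<mu> i"] True ng
            unfolding M_def eta p'_def m_def by simp
        next
          case False
          then have gt: "tMIET P i < st_tau (x t) $ i" using tau_ne[of i] by simp
          then have om1: "\<omega> = 1" using omega_cases[OF om(1)] by simp
          have ph: "Phi i (st_tau (x t) $ i) = lam P i" using Phi_props[of i] gt by blast
          have sp: "(Wi i \<epsilon>)\<^sup>2 \<le> beta_ratio P i * (Wi i (\<epsilon> + wh - w))\<^sup>2 + 2 * (bup P i)\<^sup>2 * (noise_gap i (x t) (u t))\<^sup>2"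
            using W_split[of i \<epsilon> wh w] by (simp add: noise_gap_def defs)
          show ?thesis
            using trigger_inequality_after[OF gam_bar_def[of P i] sp gam_bar_nonneg[of i], where h = "H i z e wh v" and m = "\<mu> i"] False
            unfolding M_def eta p'_def m_def om1 ph by (simp add: algebra_simps)
        qed
      qed
      have "RV + (\<Sum>i\<in>UNIV. M i) = - \<alpha> (norm e) + \<zeta> (norm (u t)) +
        (\<Sum>i\<in>UNIV. (- rho P i (norm (q_i S i z e w)) - (H i z e wh v)\<^sup>2 + ((gam P i)\<^sup>2 - \<mu> i) * (Wi i \<epsilon>)\<^sup>2) + M i)"
        unfolding RV_def by (simp add: sum.distrib)
      also have "\<dots> \<le> - \<alpha> (norm e) + \<zeta> (norm (u t)) + (\<Sum>i\<in>UNIV. - (\<mu> i * (Wi i \<epsilon>)\<^sup>2 + sig P i (st_eta (x t) $ i)) +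
         (spar P i + gam_bar P i * (2 * (bup P i)\<^sup>2 * (noise_gap i (x t) (u t))\<^sup>2)))"
        by (intro add_left_mono sum_mono key)
      also have "\<dots> = - diss (x t) + supply_rate (x t) (u t)"
        unfolding diss_def supply_rate_def defs sum.distrib sum_negf by simp
      finally show ?thesis .
    qed
    ultimately show "upper_rate ?I (\<lambda>s. lyap (x s)) t (- diss (x t) + supply_rate (x t) (u t))" by (rule upper_rate_mono)
  qed
qed


lemma lyap_continuous:
  assumes x: "continuous_on A x" and st: "\<And>t. t \<in> A \<Longrightarrow> x t \<in> state_space"
  shows "continuous_on A (\<lambda>t. lyap (x t))"
proof -
  have 1: "continuous_on A (\<lambda>t. V (st_e (x t)))"
    by (rule continuous_on_compose2[OF locally_Lipschitz_imp_continuous[OF V_facts(1)]]) (intro continuous_intros x, auto)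
  have 2: "continuous_on A (\<lambda>t. Wi i (st_eps (x t)))" for i
    by (rule continuous_on_compose2[OF locally_Lipschitz_imp_continuous[OF W_facts(1)[of i]]]) (intro continuous_intros x, auto)
  have 3: "continuous_on A (\<lambda>t. Phi i (st_tau (x t) $ i))" for i
  proof (rule continuous_on_compose2[of "{0..}" "Phi i"])
    show "continuous_on {0..} (Phi i)" using Phi_props[of i] by blast
    show "continuous_on A (\<lambda>t. st_tau (x t) $ i)" by (intro continuous_intros x)
    show "(\<lambda>t. st_tau (x t) $ i) ` A \<subseteq> {0..}" using st by (auto simp: state_space_iff)
  qed
  show ?thesis unfolding lyap_def lyap_node_def by (intro continuous_intros 1 2 3 x)
qed

text \<open>At 0 and \<open>tMIET\<close> nothing is known of \<open>Phi\<close> beyond continuity,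
  monotonicity and bounds. This suffices because domination is one-sided: timers increase, so
  \<open>Phi\<close> decreases along the flow, and its variation can only lower the increment of
  \<open>Phi\<close> times the square of \<open>W\<close>.\<close>

lemma lyap_dominated:
  assumes x: "flow_arc \<H> a b x u" and st: "\<And>t. t \<in> {a..b} \<Longrightarrow> x t \<in> state_space" and t: "t \<in> {a..b}"
  shows "dominated_at {a..b} x (\<lambda>s. lyap (x s)) t"
proof -
  have cx: "continuous_on {a..b} x" using x by (auto simp: flow_arc_def intro: abs_cont_on_imp_continuous_on)
  have c: "continuous (at t within {a..b}) (\<lambda>s. st_e (x s))" "continuous (at t within {a..b}) (\<lambda>s. st_eps (x s))"
    using cx t by (auto simp: continuous_on_eq_continuous_within intro!: continuous_intros)
  have 1: "dominated_at {a..b} x (\<lambda>s. V (st_e (x s))) t"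
    by (rule dominated_at_compose[OF V_facts(1) c(1) t]) (metis fst_diff snd_diff state_norms(2))
  have 2: "dominated_at {a..b} x (\<lambda>s. st_eta (x s) $ i) t" for i
  proof (rule dominated_at_abs[of 1])
    fix p q
    have "st_eta (x q) $ i - st_eta (x p) $ i \<le> norm (st_eta (x q - x p))"
      using component_le_norm_cart[of "st_eta (x q - x p)" i] by simp
    then show "st_eta (x q) $ i - st_eta (x p) $ i \<le> 1 * norm (x q - x p)"
      using state_norms(6)[of "x q - x p"] by linarith
  qed simp
  have 3: "dominated_at {a..b} x (\<lambda>s. gam P i * (Phi i (st_tau (x s) $ i) * (Wi i (st_eps (x s)) * Wi i (st_eps (x s))))) t" for i
  proof -
    have "dominated_at {a..b} x (\<lambda>s. Wi i (st_eps (x s)) * Wi i (st_eps (x s))) t"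
      by (rule dominated_at_compose[OF locally_Lipschitz_square[OF W_facts(1)] c(2) t]) (metis fst_diff snd_diff state_norms(3))
    then obtain K \<delta> where K: "K \<ge> 0" "\<delta> > 0" "\<And>p q. p \<in> {a..b} \<Longrightarrow> q \<in> {a..b} \<Longrightarrow> p \<le> t \<Longrightarrow> t \<le> q \<Longrightarrow> q - p < \<delta> \<Longrightarrow>
      Wi i (st_eps (x q)) * Wi i (st_eps (x q)) - Wi i (st_eps (x p)) * Wi i (st_eps (x p)) \<le> K * (norm (x q - x t) + norm (x t - x p))"
      by (rule dominated_atE) blast
    have g: "gam P i \<ge> 0" using V_facts(9)[of i] by simp
    show ?thesis
    proof (rule dominated_atI[of "gam P i * (1 / lam P i * K)", OF _ K(2)])
      show "0 \<le> gam P i * (1 / lam P i * K)" using g lam[of i] K(1) by simp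
      fix p q assume pq: "p \<in> {a..b}" "q \<in> {a..b}" "p \<le> t" "t \<le> q" "q - p < \<delta>"
      let ?W = "\<lambda>s. Wi i (st_eps (x s)) * Wi i (st_eps (x s))" and ?P = "\<lambda>s. Phi i (st_tau (x s) $ i)"
      let ?X = "norm (x q - x t) + norm (x t - x p)"
      have tau: "0 \<le> st_tau (x s) $ i" if "s \<in> {a..b}" for s using st[OF that] by (simp add: state_space_iff)
      have "st_tau (x p) $ i \<le> st_tau (x q) $ i"
        using flow_tau[OF x pq(1), of i] flow_tau[OF x pq(2), of i] pq by simp
      then have "?P q \<le> ?P p" by (intro Phi_antimono tau pq)
      then have "?P q * ?W p \<le> ?P p * ?W p" by (intro mult_right_mono) auto
      then have "?P q * ?W q - ?P p * ?W p \<le> ?P q * (?W q - ?W p)" by (simp add: algebra_simps)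
      also have "\<dots> \<le> ?P q * (K * ?X)" using K(3)[OF pq] Phi_bounds(3)[OF tau[OF pq(2)]] by (intro mult_left_mono) auto
      also have "\<dots> \<le> 1 / lam P i * (K * ?X)" using K(1) Phi_bounds(2)[OF tau[OF pq(2)]] by (intro mult_right_mono) auto
      finally have "gam P i * (?P q * ?W q - ?P p * ?W p) \<le> gam P i * (1 / lam P i * (K * ?X))" using g by (rule mult_left_mono)
      then show "gam P i * (?P q * ?W q) - gam P i * (?P p * ?W p) \<le> gam P i * (1 / lam P i * K) * ?X"
        by (simp add: algebra_simps)
    qed
  qed
  show ?thesis unfolding lyap_def lyap_node_def
    by (intro dominated_at_add 1 dominated_at_sum 2 3 finite)
qed

lemma lyap_increment:
  assumes x: "flow_arc \<H> a b x u" and st: "\<And>t. t \<in> {a..b} \<Longrightarrow> x t \<in> state_space" and ab: "a \<le> b"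
    and M: "AE t in lebesgue. t \<in> {a..b} \<longrightarrow> - diss (x t) + supply_rate (x t) (u t) \<le> M"
  shows "lyap (x b) - lyap (x a) \<le> M * (b - a)"
proof (rule increment_le[OF ab])
  show "abs_cont_on {a..b} x" using x by (simp add: flow_arc_def)
  show "AE t in lebesgue. t \<in> {a..b} \<longrightarrow> upper_rate {a..b} (\<lambda>s. lyap (x s)) t M"
  proof -
    have "AE t in lebesgue. t \<in> {a..b} \<longrightarrow> upper_rate {a..b} (\<lambda>s. lyap (x s)) t (- diss (x t) + supply_rate (x t) (u t))"
      by (rule lyap_rate[OF x st])
    with M show ?thesis by eventually_elim (auto intro: upper_rate_mono)
  qed
qed (rule lyap_dominated[OF x st])

section \<open>Bounds of the Lyapunov function by the state and by the dissipation\<close>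

lemma lyap_lower:
  assumes x: "x \<in> state_space"
  shows "0 \<le> lyap_node i x" "V (st_e x) \<le> lyap x" "lyap_node i x \<le> lyap x"
    "gam P i * (lam P i * (Wi i (st_eps x))\<^sup>2) \<le> lyap_node i x" "st_eta x $ i \<le> lyap_node i x" "0 \<le> lyap x"
    "lyap_node i x \<le> gam P i / lam P i * (Wi i (st_eps x))\<^sup>2 + st_eta x $ i"
proof -
  have tau: "0 \<le> st_tau x $ i" and eta: "0 \<le> st_eta x $ i" for i using x by (simp_all add: state_space_iff)
  have g: "gam P i \<ge> 0" for i using V_facts(9)[of i] by simp
  have l: "lam P i \<ge> 0" for i using lam[of i] by simp
  have 1: "gam P i * (lam P i * (Wi i (st_eps x))\<^sup>2) \<le> gam P i * (Phi i (st_tau x $ i) * (Wi i (st_eps x) * Wi i (st_eps x)))" for i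
    unfolding power2_eq_square using Phi_bounds(1)[OF tau] g by (intro mult_left_mono mult_right_mono) auto
  have 2: "0 \<le> gam P i * (lam P i * (Wi i (st_eps x))\<^sup>2)" for i using g l by simp
  have 3: "0 \<le> lyap_node i x" for i unfolding lyap_node_def using 1[of i] 2[of i] eta[of i] by linarith
  show "0 \<le> lyap_node i x" by (rule 3)
  show "gam P i * (lam P i * (Wi i (st_eps x))\<^sup>2) \<le> lyap_node i x" "st_eta x $ i \<le> lyap_node i x"
    unfolding lyap_node_def using 1[of i] 2[of i] eta[of i] by linarith+
  have "gam P i * (Phi i (st_tau x $ i) * (Wi i (st_eps x) * Wi i (st_eps x))) \<le> gam P i * (1 / lam P i * (Wi i (st_eps x))\<^sup>2)"
    unfolding power2_eq_square using Phi_bounds(2)[OF tau] g by (intro mult_left_mono mult_right_mono) auto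
  then show "lyap_node i x \<le> gam P i / lam P i * (Wi i (st_eps x))\<^sup>2 + st_eta x $ i" by (simp add: lyap_node_def)
  have s: "0 \<le> (\<Sum>i\<in>UNIV. lyap_node i x)" by (intro sum_nonneg 3)
  then show "V (st_e x) \<le> lyap x" "0 \<le> lyap x" using V_facts(2)[of "st_e x"] by (simp_all add: lyap_def)
  have "lyap_node i x \<le> (\<Sum>i\<in>UNIV. lyap_node i x)" by (intro member_le_sum 3) auto
  then show "lyap_node i x \<le> lyap x" using V_facts(2)[of "st_e x"] by (simp add: lyap_def)
qed

lemma lyap_bounds:
  obtains \<theta> \<Theta> where "class_K \<theta>" "class_K \<Theta>"
    "\<And>x. x \<in> state_space \<Longrightarrow> norm (st_e x) + norm (st_eps x) + norm (st_eta x) \<le> \<theta> (lyap x)"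
    "\<And>x r. x \<in> state_space \<Longrightarrow> norm (st_e x) \<le> r \<Longrightarrow> norm (st_eps x) \<le> r \<Longrightarrow> norm (st_eta x) \<le> r \<Longrightarrow> lyap x \<le> \<Theta> r"
proof -
  obtain ai where ai: "class_K_inf ai" "\<And>x. 0 \<le> x \<Longrightarrow> ai (\<alpha>l x) = x"
    using class_K_inf_inverse[OF V_facts(4)] by metis
  \<comment> \<open>Each block satisfies
    \<open>gam * lam * (blow * norm)\<^sup>2 \<le> lyap\<close>, since \<open>Phi\<close> is at
    least \<open>lam\<close>; \<open>c i\<close> inverts this factor. Correspondingly
    \<open>c' i\<close> below comes from \<open>Phi \<le> 1 / lam\<close> and the upper bound of
    \<open>W\<close>.\<close>
  define c where "c i = 1 / (gam P i * lam P i * (blow P i)\<^sup>2)" for i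
  have cpos: "c i > 0" for i using V_facts(9)[of i] lam[of i] W_facts(2)[of i] by (simp add: c_def)
  define \<theta> where "\<theta> s = ai s + (\<Sum>i\<in>UNIV. sqrt (c i * s) + s)" for s
  have K1: "class_K \<theta>" unfolding \<theta>_def
    by (intro class_K_add_sum finite class_K_infD[OF ai(1)] class_K_add class_K_id class_K_compose[OF class_K_sqrt] class_K_linear cpos)
  define c' where "c' i = gam P i / lam P i * (bup P i)\<^sup>2" for i
  have c'pos: "c' i > 0" for i using V_facts(9)[of i] lam[of i] W_facts(3)[of i] by (simp add: c'_def)
  define \<Theta> where "\<Theta> r = \<alpha>u r + (\<Sum>i\<in>UNIV. c' i * r\<^sup>2 + r)" for r
  have K2: "class_K \<Theta>" unfolding \<Theta>_def
    by (intro class_K_add_sum finite class_K_infD[OF V_facts(5)] class_K_add class_K_id class_K_scale class_K_power2 c'pos)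
  show ?thesis
  proof (rule that[OF K1 K2])
    fix x :: "('n, 'm, 'q, 'k) state" assume x: "x \<in> state_space"
    have "norm (st_e x) = ai (\<alpha>l (norm (st_e x)))" by (simp add: ai(2))
    also have "\<dots> \<le> ai (lyap x)"
      using V_facts(10)[of "st_e x"] lyap_lower(2)[OF x] class_K_nonneg[OF class_K_infD[OF V_facts(4)], of "norm (st_e x)"]
      by (intro class_K_mono[OF class_K_infD[OF ai(1)]]) auto
    finally have 1: "norm (st_e x) \<le> ai (lyap x)" .
    have 2: "norm (blk i (st_eps x)) \<le> sqrt (c i * lyap x)" for i
    proof (rule real_le_rsqrt)
      have g: "gam P i * lam P i \<ge> 0" using V_facts(9)[of i] lam[of i] by simp
      have "(blow P i * norm (blk i (st_eps x)))\<^sup>2 \<le> (Wi i (st_eps x))\<^sup>2"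
        using W_facts(2)[of i] by (intro power_mono W_facts(5)) auto
      then have "gam P i * lam P i * (blow P i * norm (blk i (st_eps x)))\<^sup>2 \<le> gam P i * lam P i * (Wi i (st_eps x))\<^sup>2"
        using g by (rule mult_left_mono)
      also have "\<dots> \<le> lyap x" using lyap_lower(3,4)[OF x, of i] by (simp add: mult.assoc)
      finally have "c i * (gam P i * lam P i * (blow P i * norm (blk i (st_eps x)))\<^sup>2) \<le> c i * lyap x"
        using cpos[of i] by (intro mult_left_mono) auto
      moreover have "c i * (gam P i * lam P i * (blow P i * norm (blk i (st_eps x)))\<^sup>2) = (norm (blk i (st_eps x)))\<^sup>2"
        using V_facts(9)[of i] lam[of i] W_facts(2)[of i] by (simp add: c_def power_mult_distrib)
      ultimately show "(norm (blk i (st_eps x)))\<^sup>2 \<le> c i * lyap x" by simp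
    qed
    have "norm (st_eps x) \<le> (\<Sum>i\<in>UNIV. norm (blk i (st_eps x)))" by (rule norm_le_sum_block)
    also have "\<dots> \<le> (\<Sum>i\<in>UNIV. sqrt (c i * lyap x))" by (intro sum_mono 2)
    finally have 3: "norm (st_eps x) \<le> (\<Sum>i\<in>UNIV. sqrt (c i * lyap x))" .
    have "norm (st_eta x) \<le> (\<Sum>i\<in>UNIV. \<bar>st_eta x $ i\<bar>)" by (rule norm_le_l1_cart)
    also have "\<dots> \<le> (\<Sum>i\<in>(UNIV::'k set). lyap x)"
      using lyap_lower(3,5)[OF x] x by (intro sum_mono) (auto simp: state_space_iff intro: order.trans)
    finally show "norm (st_e x) + norm (st_eps x) + norm (st_eta x) \<le> \<theta> (lyap x)"
      using 1 3 by (simp add: \<theta>_def sum.distrib)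
  next
    fix x :: "('n, 'm, 'q, 'k) state" and r
    assume x: "x \<in> state_space" and r: "norm (st_e x) \<le> r" "norm (st_eps x) \<le> r" "norm (st_eta x) \<le> r"
    have "V (st_e x) \<le> \<alpha>u (norm (st_e x))" by (rule V_facts)
    also have "\<dots> \<le> \<alpha>u r" using r by (intro class_K_mono[OF class_K_infD[OF V_facts(5)]]) auto
    finally have 1: "V (st_e x) \<le> \<alpha>u r" .
    have 2: "lyap_node i x \<le> c' i * r\<^sup>2 + r" for i
    proof -
      have "Wi i (st_eps x) \<le> bup P i * norm (blk i (st_eps x))" by (rule W_facts)
      also have "\<dots> \<le> bup P i * r"
        using W_facts(3)[of i] norm_block_le[of "node S" i "st_eps x"] r(2) by (intro mult_left_mono) auto
      finally have "(Wi i (st_eps x))\<^sup>2 \<le> (bup P i * r)\<^sup>2" by (intro power_mono W_nonneg)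
      then have "gam P i / lam P i * (Wi i (st_eps x))\<^sup>2 \<le> gam P i / lam P i * (bup P i * r)\<^sup>2"
        using V_facts(9)[of i] lam[of i] by (intro mult_left_mono) auto
      also have "\<dots> = c' i * r\<^sup>2" by (simp add: c'_def power_mult_distrib)
      finally show ?thesis
        using lyap_lower(7)[OF x, of i] component_le_norm_cart[of "st_eta x" i] r(3) by linarith
    qed
    have "(\<Sum>i\<in>UNIV. lyap_node i x) \<le> (\<Sum>i\<in>UNIV. c' i * r\<^sup>2 + r)" by (intro sum_mono 2)
    then show "lyap x \<le> \<Theta> r" using 1 by (simp add: lyap_def \<Theta>_def)
  qed
qed

text \<open>Pigeonhole: \<open>lyap\<close> is at most a sum of \<open>1 + 2 * CARD('k)\<close>
  terms, one for \<open>e\<close> and two for each node, so one of them is at least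
  \<open>lyap / K\<close>. The corresponding term of \<open>diss\<close> is then bounded below by a
  class K-infinity function of \<open>lyap\<close>, and \<open>\<psi>\<close> is a common lower
  bound of these finitely many functions.\<close>

lemma diss_bound:
  obtains \<psi> where "class_K_inf \<psi>" "\<And>x. x \<in> state_space \<Longrightarrow> \<psi> (lyap x) \<le> diss x"
proof -
  obtain ai where ai: "class_K_inf ai" "\<And>x. 0 \<le> x \<Longrightarrow> ai (\<alpha>u x) = x"
    using class_K_inf_inverse[OF V_facts(5)] by metis
  define K where "K = 1 + 2 * real CARD('k)"
  have K: "K > 0" by (simp add: K_def)
  define fa where "fa s = \<alpha> (ai (1 / K * s))" for s
  \<comment> \<open>The factor \<open>lam / gam\<close> undoes the \<open>gam / lam\<close> with
    which the square of \<open>W\<close> enters the upper bound of \<open>lyap\<close>.\<close>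
  define fw where "fw i s = \<mu> i * lam P i / gam P i / K * s" for i s
  define fs where "fs i s = sig P i (1 / K * s)" for i s
  have "class_K_inf fa" unfolding fa_def
    using K by (intro class_K_inf_compose[OF V_facts(3)] class_K_inf_compose[OF ai(1)] class_K_inf_linear) auto
  moreover have "class_K_inf (fw i)" for i
    unfolding fw_def using K V_facts(8,9)[of i] lam[of i] by (intro class_K_inf_linear) auto
  moreover have "class_K_inf (fs i)" for i
    unfolding fs_def using K by (intro class_K_inf_compose[OF sig] class_K_inf_linear) auto
  ultimately have "class_K_inf f" if "f \<in> insert fa (range fw \<union> range fs)" for f using that by auto
  moreover have "finite (insert fa (range fw \<union> range fs))" by simp
  ultimately obtain \<psi> where \<psi>: "class_K_inf \<psi>" "\<And>f s. f \<in> insert fa (range fw \<union> range fs) \<Longrightarrow> 0 \<le> s \<Longrightarrow> \<psi> s \<le> f s"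
    using class_K_inf_lower_bound[of "insert fa (range fw \<union> range fs)" "\<lambda>f. f"] by metis
  show ?thesis
  proof (rule that[OF \<psi>(1)])
    fix x :: "('n, 'm, 'q, 'k) state" assume x: "x \<in> state_space"
    let ?U = "lyap x"
    have U: "0 \<le> ?U" by (rule lyap_lower[OF x])
    have eta: "0 \<le> st_eta x $ i" for i using x by (simp add: state_space_iff)
    have sn: "0 \<le> sig P i (st_eta x $ i)" for i by (rule class_K_nonneg[OF class_K_infD[OF sig] eta])
    have mn: "0 \<le> \<mu> i * (Wi i (st_eps x))\<^sup>2" for i using V_facts(8)[of i] by simp
    have an: "0 \<le> \<alpha> (norm (st_e x))" by (rule class_K_nonneg[OF class_K_infD[OF V_facts(3)]]) simp
    have tn: "0 \<le> \<mu> i * (Wi i (st_eps x))\<^sup>2 + sig P i (st_eta x $ i)" for i using mn[of i] sn[of i] by simp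
    have term_le: "\<mu> i * (Wi i (st_eps x))\<^sup>2 + sig P i (st_eta x $ i) \<le> (\<Sum>i\<in>UNIV. \<mu> i * (Wi i (st_eps x))\<^sup>2 + sig P i (st_eta x $ i))" for i
      by (rule member_le_sum) (use tn in auto)
    have sumn: "0 \<le> (\<Sum>i\<in>UNIV. \<mu> i * (Wi i (st_eps x))\<^sup>2 + sig P i (st_eta x $ i))" by (intro sum_nonneg tn)
    consider "1 / K * ?U \<le> \<alpha>u (norm (st_e x))" | i where "1 / K * ?U \<le> gam P i / lam P i * (Wi i (st_eps x))\<^sup>2"
      | i where "1 / K * ?U \<le> st_eta x $ i" | "\<alpha>u (norm (st_e x)) < 1 / K * ?U" "\<And>i. gam P i / lam P i * (Wi i (st_eps x))\<^sup>2 \<le> 1 / K * ?U"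
      "\<And>i. st_eta x $ i \<le> 1 / K * ?U"
      by (meson linorder_le_less_linear linorder_linear)
    then show "\<psi> ?U \<le> diss x"
    proof cases
      case 1
      have "\<psi> ?U \<le> fa ?U" by (rule \<psi>(2)[OF _ U]) simp
      also have "\<dots> \<le> \<alpha> (norm (st_e x))" unfolding fa_def
      proof (rule class_K_mono[OF class_K_infD[OF V_facts(3)]])
        show "0 \<le> ai (1 / K * ?U)" using U K by (intro class_K_nonneg[OF class_K_infD[OF ai(1)]]) auto
        have "ai (1 / K * ?U) \<le> ai (\<alpha>u (norm (st_e x)))" using 1 U K by (intro class_K_mono[OF class_K_infD[OF ai(1)]]) auto
        then show "ai (1 / K * ?U) \<le> norm (st_e x)" by (simp add: ai(2))
      qed
      finally show ?thesis using sumn by (simp add: diss_def)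
    next
      case (2 i)
      have "\<psi> ?U \<le> fw i ?U" by (rule \<psi>(2)[OF _ U]) auto
      also have "\<dots> = \<mu> i * lam P i / gam P i * (1 / K * ?U)" by (simp add: fw_def)
      also have "\<dots> \<le> \<mu> i * lam P i / gam P i * (gam P i / lam P i * (Wi i (st_eps x))\<^sup>2)"
        using 2 V_facts(8,9)[of i] lam[of i] by (intro mult_left_mono) auto
      also have "\<dots> = \<mu> i * (Wi i (st_eps x))\<^sup>2" using V_facts(9)[of i] lam[of i] by simp
      finally show ?thesis using term_le[of i] sn[of i] an by (simp add: diss_def)
    next
      case (3 i)
      have "\<psi> ?U \<le> fs i ?U" by (rule \<psi>(2)[OF _ U]) auto
      also have "\<dots> \<le> sig P i (st_eta x $ i)" unfolding fs_def
        using 3 U K by (intro class_K_mono[OF class_K_infD[OF sig]]) auto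
      finally show ?thesis using term_le[of i] mn[of i] an by (simp add: diss_def)
    next
      case 4
      have gen: "y + real CARD('k) * (2 * y) = K * y" for y by (simp add: K_def algebra_simps)
      have "lyap_node i x \<le> 2 * (1 / K * ?U)" for i using lyap_lower(7)[OF x, of i] 4(2)[of i] 4(3)[of i] by linarith
      then have "(\<Sum>i\<in>UNIV. lyap_node i x) \<le> (\<Sum>i\<in>(UNIV::'k set). 2 * (1 / K * ?U))" by (intro sum_mono) auto
      then have "?U < 1 / K * ?U + real CARD('k) * (2 * (1 / K * ?U))"
        using 4(1) V_facts(11)[of "st_e x"] unfolding lyap_def by simp
      also have "\<dots> = K * (1 / K * ?U)" by (rule gen)
      also have "\<dots> = ?U" using K by simp
      finally show ?thesis by simp
    qed
  qed
qed

section \<open>Jumps\<close>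

lemma jump_state_space: "x \<in> jump_set_i P i \<Longrightarrow> jump_i S P i x u \<in> state_space"
  using V_facts(9)[of i] lam[of i]
  by (cases x, cases u) (auto simp: jump_set_i_def jump_i_def state_space_def eta_reset_def)

lemma jump_components:
  "st_wh (jump_i S P i x u) = (\<chi> k. if node S k = i then snd u $ k else st_wh x $ k)"
  "st_tau (jump_i S P i x u) = (\<chi> l. if l = i then 0 else st_tau x $ l)"
  "st_e (jump_i S P i x u) = st_e x"
  "st_eps (jump_i S P i x u) = (\<chi> k. if node S k = i then 0 else st_eps x $ k)"
  "st_eta (jump_i S P i x u) = (\<chi> l. if l = i then gam P i * lam P i *
       (blow P i * max (norm (blk i (st_eps x + st_wh x - snd u)) - 2 * wbar P i) 0)\<^sup>2 else st_eta x $ l)"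
proof -
  obtain z e \<epsilon> wh \<tau> \<eta> v w where "x = (z, e, \<epsilon>, wh, \<tau>, \<eta>)" "u = (v, w)" by (metis prod_cases6 surj_pair)
  note eqs = this
  show "st_wh (jump_i S P i x u) = (\<chi> k. if node S k = i then snd u $ k else st_wh x $ k)"
    "st_tau (jump_i S P i x u) = (\<chi> l. if l = i then 0 else st_tau x $ l)"
    "st_e (jump_i S P i x u) = st_e x"
    "st_eps (jump_i S P i x u) = (\<chi> k. if node S k = i then 0 else st_eps x $ k)"
    "st_eta (jump_i S P i x u) = (\<chi> l. if l = i then gam P i * lam P i *
       (blow P i * max (norm (blk i (st_eps x + st_wh x - snd u)) - 2 * wbar P i) 0)\<^sup>2 else st_eta x $ l)"
    unfolding eqs jump_i_def eta_reset_def by (simp_all cong: if_cong)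
qed

text \<open>Two noise bounds are subtracted in the reset value, so it is at most
  \<open>\<gamma> \<lambda> W\<^sup>2\<close>, which the reset of \<open>\<epsilon>\<close> releases.\<close>

lemma lyap_jump:
  assumes x: "x \<in> jump_set_i P i" and w: "norm (blk i (snd u)) \<le> wbar P i" and wh: "norm (blk i (st_wh x)) \<le> wbar P i"
  shows "lyap (jump_i S P i x u) \<le> lyap x"
proof -
  let ?y = "jump_i S P i x u"
  have xs: "x \<in> state_space" using x by (simp add: jump_set_i_iff)
  have "lyap_node l ?y \<le> lyap_node l x" for l
  proof (cases "l = i")
    case False
    then have "blk l (st_eps ?y) = blk l (st_eps x)" by (auto simp: jump_components block_def vec_eq_iff)
    then show ?thesis using False by (simp add: lyap_node_def jump_components)
  next
    case True
    \<comment> \<open>Resetting the timer may raise \<open>Phi i\<close>, but the new error of the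
      node is 0, so only the reset value of \<open>\<eta>\<close> remains in its term.\<close>
    have b0: "blk i (st_eps ?y) = 0" by (simp add: jump_components block_def vec_eq_iff)
    let ?m = "max (norm (blk i (st_eps x + st_wh x - snd u)) - 2 * wbar P i) 0"
    have "norm (blk i (st_eps x + st_wh x - snd u)) \<le> norm (blk i (st_eps x)) + norm (blk i (st_wh x)) + norm (blk i (snd u))"
      using norm_triangle_ineq4[of "blk i (st_eps x) + blk i (st_wh x)" "blk i (snd u)"]
        norm_triangle_ineq[of "blk i (st_eps x)" "blk i (st_wh x)"] unfolding block_add block_diff by linarith
    then have "?m \<le> norm (blk i (st_eps x))" using w wh by simp
    then have "blow P i * ?m \<le> Wi i (st_eps x)"
      using W_facts(2)[of i] W_facts(5)[of i "st_eps x"] by (meson less_imp_le mult_left_mono order.trans)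
    then have "(blow P i * ?m)\<^sup>2 \<le> (Wi i (st_eps x))\<^sup>2" using W_facts(2)[of i] by (intro power_mono) auto
    then have "gam P i * lam P i * (blow P i * ?m)\<^sup>2 \<le> gam P i * lam P i * (Wi i (st_eps x))\<^sup>2"
      using V_facts(9)[of i] lam[of i] by (intro mult_left_mono) auto
    also have "\<dots> \<le> lyap_node i x" using lyap_lower(4)[OF xs, of i] by (simp add: mult.assoc)
    finally show ?thesis using True unfolding lyap_node_def[of _ ?y] by (simp add: b0 W_0 jump_components(5))
  qed
  then have "(\<Sum>l\<in>UNIV. lyap_node l ?y) \<le> (\<Sum>l\<in>UNIV. lyap_node l x)" by (intro sum_mono)
  then show ?thesis by (simp add: lyap_def jump_components)
qed

end

section \<open>Input-to-state stability\<close>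

lemma hybrid_Linf_bound:
  assumes L: "hybrid_Linf E \<nu>"
  shows "AE t in lebesgue. t \<in> time_slice E j \<longrightarrow> norm (\<nu> t j) \<le> enn2real (hybrid_norm E \<nu>)"
    "(t, i) \<in> jump_instants E \<Longrightarrow> norm (\<nu> t i) \<le> enn2real (hybrid_norm E \<nu>)"
proof -
  have fin: "hybrid_norm E \<nu> < top" using L by (simp add: hybrid_Linf_def)
  have E: "hybrid_time_domain E" using L by (simp add: hybrid_Linf_def hybrid_input_def)
  have conv: "norm x \<le> enn2real (hybrid_norm E \<nu>)" if "ennreal (norm x) \<le> hybrid_norm E \<nu>" for x :: 'a
    using enn2real_mono[OF that fin] by simp
  have "esssup (lebesgue_on (time_slice E j)) (\<lambda>t. ennreal (norm (\<nu> t j))) \<le> hybrid_norm E \<nu>"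
    unfolding hybrid_norm_def by (intro max.coboundedI1 SUP_upper) auto
  then have "AE t in lebesgue_on (time_slice E j). norm (\<nu> t j) \<le> enn2real (hybrid_norm E \<nu>)"
    using esssup_AE[of "\<lambda>t. ennreal (norm (\<nu> t j))" "lebesgue_on (time_slice E j)"]
    by (elim eventually_mono) (rule conv, rule order.trans)
  then show "AE t in lebesgue. t \<in> time_slice E j \<longrightarrow> norm (\<nu> t j) \<le> enn2real (hybrid_norm E \<nu>)"
    using time_slice_borel[OF E, of j] by (subst (asm) AE_restrict_space_iff) auto
  show "norm (\<nu> t i) \<le> enn2real (hybrid_norm E \<nu>)" if "(t, i) \<in> jump_instants E"
  proof (rule conv)
    have "ennreal (norm (\<nu> t i)) \<le> (SUP (t, j)\<in>jump_instants E. ennreal (norm (\<nu> t j)))"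
      by (rule SUP_upper2[OF that]) simp
    then show "ennreal (norm (\<nu> t i)) \<le> hybrid_norm E \<nu>" unfolding hybrid_norm_def by (rule max.coboundedI2)
  qed
qed

lemma infdist_target_le:
  fixes x :: "('n::finite, 'm::finite, 'q::finite, 'k::finite) state"
  assumes "x \<in> state_space"
  shows "infdist x target_set \<le> norm (st_e x) + norm (st_eps x) + norm (st_eta x)"
proof -
  let ?y = "(st_z x, 0, 0, st_wh x, st_tau x, 0)"
  have "?y \<in> target_set" using assms by (simp add: target_set_iff state_space_iff)
  then have "infdist x target_set \<le> dist x ?y" by (rule infdist_le)
  also have "dist x ?y = norm (0 :: real^'q, st_e x, st_eps x, 0 :: real^'m, 0 :: real^'k, st_eta x)"
    unfolding dist_norm by (rule arg_cong[where f = norm]) (simp add: prod_eq_iff)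
  also have "\<dots> \<le> norm (st_e x) + norm (st_eps x) + norm (st_eta x)"
  proof -
    have "norm (0 :: real^'q, st_e x, st_eps x, 0 :: real^'m, 0 :: real^'k, st_eta x) \<le> norm (st_e x, st_eps x, 0 :: real^'m, 0 :: real^'k, st_eta x)"
      by (rule order.trans[OF norm_Pair_le]) simp
    also have "\<dots> \<le> norm (st_e x) + norm (st_eps x, 0 :: real^'m, 0 :: real^'k, st_eta x)" by (rule norm_Pair_le)
    also have "norm (st_eps x, 0 :: real^'m, 0 :: real^'k, st_eta x) \<le> norm (st_eps x) + norm (0 :: real^'m, 0 :: real^'k, st_eta x)" by (rule norm_Pair_le)
    also have "norm (0 :: real^'m, 0 :: real^'k, st_eta x) \<le> norm (0 :: real^'k, st_eta x)" by (rule order.trans[OF norm_Pair_le]) simp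
    also have "norm (0 :: real^'k, st_eta x) \<le> norm (st_eta x)" by (rule order.trans[OF norm_Pair_le]) simp
    finally show ?thesis by simp
  qed
  finally show ?thesis .
qed

lemma target_set_nonempty: "target_set \<noteq> {}"
proof -
  have "(0, 0, 0, 0, 0, 0) \<in> target_set" by (simp add: target_set_iff state_space_iff)
  then show ?thesis by blast
qed

lemma infdist_target_ge:
  fixes x :: "('n::finite, 'm::finite, 'q::finite, 'k::finite) state"
  shows
  "norm (st_e x) \<le> infdist x target_set" "norm (st_eps x) \<le> infdist x target_set" "norm (st_eta x) \<le> infdist x target_set"
proof -
  have g: "c \<le> infdist x target_set" if "\<And>y :: ('n, 'm, 'q, 'k) state. y \<in> target_set \<Longrightarrow> c \<le> dist x y" for c
    unfolding infdist_notempty[OF target_set_nonempty] by (rule cINF_greatest[OF target_set_nonempty that])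
  show "norm (st_e x) \<le> infdist x target_set"
  proof (rule g)
    fix y :: "('n, 'm, 'q, 'k) state" assume "y \<in> target_set"
    then have "st_e (x - y) = st_e x" by (simp add: target_set_iff)
    then show "norm (st_e x) \<le> dist x y" unfolding dist_norm by (metis state_norms(2))
  qed
  show "norm (st_eps x) \<le> infdist x target_set"
  proof (rule g)
    fix y :: "('n, 'm, 'q, 'k) state" assume "y \<in> target_set"
    then have "st_eps (x - y) = st_eps x" by (simp add: target_set_iff)
    then show "norm (st_eps x) \<le> dist x y" unfolding dist_norm by (metis state_norms(3))
  qed
  show "norm (st_eta x) \<le> infdist x target_set"
  proof (rule g)
    fix y :: "('n, 'm, 'q, 'k) state" assume "y \<in> target_set"
    then have "st_eta (x - y) = st_eta x" by (simp add: target_set_iff)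
    then show "norm (st_eta x) \<le> dist x y" unfolding dist_norm by (metis state_norms(6))
  qed
qed

lemma closed_target_set: "closed (target_set :: ('n::finite, 'm::finite, 'q::finite, 'k::finite) state set)"
proof -
  have "target_set = state_space \<inter> {x. st_e x = 0} \<inter> {x. st_eps x = 0} \<inter> {x :: ('n, 'm, 'q, 'k) state. st_eta x = 0}"
    by (auto simp: target_set_iff)
  also have "closed \<dots>"
    by (intro closed_Int closed_state_space closed_Collect_eq continuous_intros)
  finally show ?thesis .
qed

context estimation_model
begin

section \<open>Invariants along solution pairs\<close>

lemma state_space_invariant:
  assumes sp: "solution_pair \<H> E \<xi> \<nu>" and tj: "(t, j) \<in> E"
  shows "\<xi> t j \<in> state_space"
proof -
  have E: "hybrid_time_domain E" using sp by (simp add: solution_pair_def hybrid_arc_def)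
  show ?thesis
  proof (rule hybrid_time_domain_induct[OF E tj, of "\<lambda>t j. \<xi> t j \<in> state_space"])
    have "(\<xi> 0 0, \<nu> 0 0) \<in> flow_set \<H> \<union> jump_set \<H>" using sp by (simp add: solution_pair_def)
    then show "\<xi> 0 0 \<in> state_space" by (auto simp: flow_set_iff jump_set_iff jump_set_i_iff)
  next
    fix a b :: real and j assume ab: "a \<le> b" "{a..b} \<times> {j} \<subseteq> E" "\<xi> a j \<in> state_space"
    show "\<xi> b j \<in> state_space"
    proof (cases "a = b")
      case False
      have f: "flow_arc \<H> a b (\<lambda>t. \<xi> t j) (\<lambda>t. \<nu> t j)"
        by (rule flow_arc_of_solution_pair[OF sp]) (use ab in \<open>auto simp: time_slice_def\<close>)
      show ?thesis
      proof (rule AE_closed_interval[OF _ closed_state_space, of a b "\<lambda>t. \<xi> t j"])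
        show "continuous_on {a..b} (\<lambda>t. \<xi> t j)" using f by (auto simp: flow_arc_def intro: abs_cont_on_imp_continuous_on)
        have "AE t in lebesgue. t \<in> {a..b} \<longrightarrow> (\<xi> t j, \<nu> t j) \<in> flow_set \<H> \<and>
          (\<exists>d\<in>flow_map \<H> (\<xi> t j) (\<nu> t j). ((\<lambda>t. \<xi> t j) has_vector_derivative d) (at t within {a..b}))"
          using f by (simp add: flow_arc_def)
        then show "AE t in lebesgue. t \<in> {a..b} \<longrightarrow> \<xi> t j \<in> state_space"
          by eventually_elim (auto simp: flow_set_iff)
      qed (use ab False in auto)
    qed (use ab in simp)
  next
    fix t j assume h: "(t, j) \<in> E" "(t, Suc j) \<in> E" "\<xi> t j \<in> state_space"
    then have "\<xi> t (Suc j) \<in> jump_map \<H> (\<xi> t j) (\<nu> t j)"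
      using sp unfolding solution_pair_def jump_instants_def by auto
    then show "\<xi> t (Suc j) \<in> state_space" by (auto simp: jump_map_iff intro: jump_state_space)
  qed
qed

lemma flow_wh:
  assumes x: "flow_arc \<H> a b x u" and ab: "a \<le> b"
  shows "st_wh (x b) = st_wh (x a)"
proof -
  have ac: "abs_cont_on {a..b} (\<lambda>t. st_wh (x t))"
  proof (rule abs_cont_on_bounded[of "{a..b}" x _ 1])
    show "abs_cont_on {a..b} x" using x by (simp add: flow_arc_def)
    show "norm (st_wh (x q) - st_wh (x p)) \<le> 1 * norm (x q - x p)" for p q
      using state_norms(4)[of "x q - x p"] by simp
  qed
  have "norm (st_wh (x b) - st_wh (x a)) \<le> 0 * (b - a)"
  proof (rule norm_increment_le[OF ab ac])
    have "AE s in lebesgue. s \<in> {a..b} \<longrightarrow> (x s, u s) \<in> flow_set \<H> \<and>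
       (\<exists>d\<in>flow_map \<H> (x s) (u s). (x has_vector_derivative d) (at s within {a..b}))" using x by (simp add: flow_arc_def)
    then show "AE s in lebesgue. s \<in> {a..b} \<longrightarrow> (\<exists>d. norm d \<le> 0 \<and> ((\<lambda>t. st_wh (x t)) has_vector_derivative d) (at s within {a..b}))"
    proof (eventually_elim, intro impI)
      fix s assume "s \<in> {a..b} \<longrightarrow> (x s, u s) \<in> flow_set \<H> \<and>
       (\<exists>d\<in>flow_map \<H> (x s) (u s). (x has_vector_derivative d) (at s within {a..b}))" "s \<in> {a..b}"
      then obtain d where d: "d \<in> flow_map \<H> (x s) (u s)" "(x has_vector_derivative d) (at s within {a..b})" by blast
      have "((\<lambda>t. st_wh (x t)) has_vector_derivative st_wh d) (at s within {a..b})"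
        by (intro has_vector_derivative_fst has_vector_derivative_snd d)
      then show "\<exists>d. norm d \<le> 0 \<and> ((\<lambda>t. st_wh (x t)) has_vector_derivative d) (at s within {a..b})"
        using d(1) by (intro exI[of _ 0]) (simp add: flow_map_iff)
    qed
  qed
  then show ?thesis by simp
qed

text \<open>The sample is constant along flows and replaced at jumps by the current noise. The
  values of the input at jump instants are therefore essential: they count pointwise in
  \<open>hybrid_norm\<close>, and the noise bounds hold pointwise in
  \<open>admissible_input\<close>.\<close>

lemma wh_invariant:
  assumes sp: "solution_pair \<H> E \<xi> \<nu>" and ad: "admissible_input S P E \<nu>"
    and init: "\<xi> 0 0 \<in> sampled_noise_init S P E \<nu>" and tj: "(t, j) \<in> E"
  shows "norm (blk i (st_wh (\<xi> t j))) \<le> wbar P i \<and> norm (blk i (st_wh (\<xi> t j))) \<le> enn2real (hybrid_norm E \<nu>)"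
proof -
  have E: "hybrid_time_domain E" using sp by (simp add: solution_pair_def hybrid_arc_def)
  have L: "hybrid_Linf E \<nu>" using ad by (simp add: admissible_input_def)
  have fin: "hybrid_norm E \<nu> < top" using L by (simp add: hybrid_Linf_def)
  show ?thesis
  proof (rule hybrid_time_domain_induct[OF E tj, of "\<lambda>t j. norm (blk i (st_wh (\<xi> t j))) \<le> wbar P i \<and> norm (blk i (st_wh (\<xi> t j))) \<le> enn2real (hybrid_norm E \<nu>)"])
    have "norm (blk i (st_wh (\<xi> 0 0))) \<le> wbar P i" "ennreal (norm (blk i (st_wh (\<xi> 0 0)))) \<le> hybrid_norm E \<nu>"
      using init by (auto simp: sampled_noise_init_def split: prod.splits)
    then show "norm (blk i (st_wh (\<xi> 0 0))) \<le> wbar P i \<and> norm (blk i (st_wh (\<xi> 0 0))) \<le> enn2real (hybrid_norm E \<nu>)"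
      using enn2real_mono[OF _ fin, of "ennreal (norm (blk i (st_wh (\<xi> 0 0))))"] by simp
  next
    fix a b :: real and j assume ab: "a \<le> b" "{a..b} \<times> {j} \<subseteq> E"
      "norm (blk i (st_wh (\<xi> a j))) \<le> wbar P i \<and> norm (blk i (st_wh (\<xi> a j))) \<le> enn2real (hybrid_norm E \<nu>)"
    have f: "flow_arc \<H> a b (\<lambda>t. \<xi> t j) (\<lambda>t. \<nu> t j)"
      by (rule flow_arc_of_solution_pair[OF sp]) (use ab in \<open>auto simp: time_slice_def\<close>)
    from flow_wh[OF f ab(1)] ab(3)
    show "norm (blk i (st_wh (\<xi> b j))) \<le> wbar P i \<and> norm (blk i (st_wh (\<xi> b j))) \<le> enn2real (hybrid_norm E \<nu>)" by simp
  next
    fix t j assume h: "(t, j) \<in> E" "(t, Suc j) \<in> E"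
      "norm (blk i (st_wh (\<xi> t j))) \<le> wbar P i \<and> norm (blk i (st_wh (\<xi> t j))) \<le> enn2real (hybrid_norm E \<nu>)"
    have ji: "(t, j) \<in> jump_instants E" using h by (simp add: jump_instants_def)
    then have "\<xi> t (Suc j) \<in> jump_map \<H> (\<xi> t j) (\<nu> t j)" using sp unfolding solution_pair_def by auto
    then obtain l where l: "\<xi> t (Suc j) = jump_i S P l (\<xi> t j) (\<nu> t j)" by (auto simp: jump_map_iff)
    have "blk i (st_wh (\<xi> t (Suc j))) = (if i = l then blk i (snd (\<nu> t j)) else blk i (st_wh (\<xi> t j)))"
      unfolding l jump_components by (auto simp: block_def vec_eq_iff)
    moreover have "norm (blk i (snd (\<nu> t j))) \<le> wbar P i" using ad h(1) unfolding admissible_input_def by blast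
    moreover have "norm (blk i (snd (\<nu> t j))) \<le> enn2real (hybrid_norm E \<nu>)"
      using norm_block_le[of "node S" i "snd (\<nu> t j)"] norm_le_norm_snd[of "\<nu> t j"] hybrid_Linf_bound(2)[OF L ji] by linarith
    ultimately show "norm (blk i (st_wh (\<xi> t (Suc j)))) \<le> wbar P i \<and> norm (blk i (st_wh (\<xi> t (Suc j)))) \<le> enn2real (hybrid_norm E \<nu>)"
      using h(3) by (cases "i = l") simp_all
  qed
qed

text \<open>The 8 is 2 times the square of 2: sample and current noise are both at most
  \<open>r\<close>, so \<open>noise_gap\<close> is at most \<open>2 * r\<close>.\<close>

definition noise_gain :: "real \<Rightarrow> real" where
  "noise_gain r = \<zeta> r + (\<Sum>i\<in>UNIV. (gam_bar P i * (8 * (bup P i)\<^sup>2)) * r\<^sup>2)"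

lemma noise_gain_K: "class_K noise_gain"
proof -
  have "gam_bar P i > 0" for i
    unfolding gam_bar_def using W_facts(4)[of i] V_facts(9)[of i] lam[of i] by (intro add_nonneg_pos) (auto intro!: mult_pos_pos add_pos_nonneg)
  then have "gam_bar P i * (8 * (bup P i)\<^sup>2) > 0" for i using W_facts(3)[of i] by simp
  then have "class_K (\<lambda>r. \<zeta> r + (\<Sum>i\<in>UNIV. (gam_bar P i * (8 * (bup P i)\<^sup>2)) * r\<^sup>2))"
    by (intro class_K_add_sum finite class_K_infD[OF V_facts(6)] class_K_scale class_K_power2)
  then show ?thesis unfolding noise_gain_def[abs_def] .
qed

lemma supply_rate_le:
  assumes u: "norm u \<le> r" and wh: "\<And>i. norm (blk i (st_wh x)) \<le> r"
  shows "supply_rate x u \<le> noise_gain r + (\<Sum>i\<in>UNIV. spar P i)"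
proof -
  have 1: "\<zeta> (norm u) \<le> \<zeta> r" using u by (intro class_K_mono[OF class_K_infD[OF V_facts(6)]]) auto
  have 2: "gam_bar P i * (2 * (bup P i)\<^sup>2 * (noise_gap i x u)\<^sup>2) \<le> (gam_bar P i * (8 * (bup P i)\<^sup>2)) * r\<^sup>2" for i
  proof -
    have "noise_gap i x u \<le> norm (blk i (st_wh x)) + norm (blk i (snd u))" unfolding noise_gap_def by (rule norm_triangle_ineq4)
    also have "\<dots> \<le> 2 * r" using wh[of i] norm_block_le[of "node S" i "snd u"] norm_le_norm_snd[of u] u by linarith
    finally have "(noise_gap i x u)\<^sup>2 \<le> (2 * r)\<^sup>2" by (intro power_mono) (auto simp: noise_gap_def)
    then have "gam_bar P i * (2 * (bup P i)\<^sup>2 * (noise_gap i x u)\<^sup>2) \<le> gam_bar P i * (2 * (bup P i)\<^sup>2 * (2 * r)\<^sup>2)"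
      using gam_bar_nonneg[of i] by (intro mult_left_mono) auto
    then show ?thesis by (simp add: power_mult_distrib algebra_simps)
  qed
  have "(\<Sum>i\<in>UNIV. spar P i + gam_bar P i * (2 * (bup P i)\<^sup>2 * (noise_gap i x u)\<^sup>2))
    \<le> (\<Sum>i\<in>UNIV. spar P i + (gam_bar P i * (8 * (bup P i)\<^sup>2)) * r\<^sup>2)"
    by (intro sum_mono add_left_mono 2)
  then show ?thesis using 1 unfolding supply_rate_def noise_gain_def sum.distrib by linarith
qed

text \<open>Let \<open>c\<close> bound the supply. If \<open>\<psi> M \<ge> 2 * c\<close>, then
  above the level \<open>M\<close> the rate of \<open>lyap\<close> is at most
  \<open>- \<psi> M + c \<le> - \<psi> M / 2\<close>; half of the dissipation absorbs the input.
  This gives a family of affine bounds, one for each \<open>M\<close>, and \<open>M\<close> may be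
  chosen depending on the time at which the estimate is wanted. Keeping track of when
  \<open>d\<close> is 0 covers ISS and ISpS together.\<close>

lemma stability:
  "\<exists>d\<ge>0. stability_estimate \<H> (admissible_input S P) (sampled_noise_init S P) target_set d \<and> ((\<forall>i. spar P i = 0) \<longrightarrow> d = 0)"
proof -
  obtain \<psi> where \<psi>: "class_K_inf \<psi>" "\<And>x. x \<in> state_space \<Longrightarrow> \<psi> (lyap x) \<le> diss x" using diss_bound by metis
  have \<psi>K: "class_K \<psi>" by (rule class_K_infD[OF \<psi>(1)])
  obtain pii where pii: "class_K_inf pii" "\<And>x. 0 \<le> x \<Longrightarrow> \<psi> (pii x) = x" using class_K_inf_inverse[OF \<psi>(1)] by metis
  have pK: "class_K pii" by (rule class_K_infD[OF pii(1)])
  obtain \<theta> \<Theta> where \<theta>: "class_K \<theta>" "class_K \<Theta>"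
    "\<And>x. x \<in> state_space \<Longrightarrow> norm (st_e x) + norm (st_eps x) + norm (st_eta x) \<le> \<theta> (lyap x)"
    "\<And>x r. x \<in> state_space \<Longrightarrow> norm (st_e x) \<le> r \<Longrightarrow> norm (st_eps x) \<le> r \<Longrightarrow> norm (st_eta x) \<le> r \<Longrightarrow> lyap x \<le> \<Theta> r"
    using lyap_bounds by metis
  obtain b where b: "class_KL b" "\<And>r t. 0 \<le> r \<Longrightarrow> 0 \<le> t \<Longrightarrow> 0 \<le> b r t"
    "\<And>r t. 0 \<le> r \<Longrightarrow> 0 \<le> t \<Longrightarrow> b r t + t * (1 / 2 * \<psi> (b r t)) = r"
    using implicit_decay_KL[OF class_K_scale[OF \<psi>K, of "1/2"]] by auto
  define sp where "sp = (\<Sum>i\<in>UNIV. spar P i)"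
  have sp0: "sp \<ge> 0" unfolding sp_def using spar by (intro sum_nonneg) auto
  \<comment> \<open>Separates the parameters from the input: \<open>2 * c\<close> is twice the sum
    of \<open>noise_gain\<close> and \<open>sp\<close>, hence at most 4 times the larger one. The
    part with \<open>sp\<close> becomes the offset and vanishes with it.\<close>
  define d where "d = \<theta> (pii (4 * sp))"
  have d0: "d \<ge> 0" unfolding d_def using sp0 by (intro class_K_nonneg[OF \<theta>(1)] class_K_nonneg[OF pK]) auto
  define \<gamma> where "\<gamma> r = \<theta> (pii (4 * noise_gain r))" for r
  have \<gamma>K: "class_K \<gamma>" unfolding \<gamma>_def
    by (intro class_K_compose[OF \<theta>(1)] class_K_compose[OF pK] class_K_scale noise_gain_K) simp
  have bKL: "class_KL (\<lambda>r t. \<theta> (b (\<Theta> r) t))" by (rule class_KL_compose[OF \<theta>(1) b(1) \<theta>(2)])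
  have "infdist (\<xi> t j) target_set \<le> \<theta> (b (\<Theta> (infdist (\<xi> 0 0) target_set)) t) + \<gamma> (enn2real (hybrid_norm E \<nu>)) + d"
    if sol: "solution_pair \<H> E \<xi> \<nu>" and ad: "admissible_input S P E \<nu>"
    and init: "\<xi> 0 0 \<in> sampled_noise_init S P E \<nu>" and tj: "(t, j) \<in> E" for E \<xi> \<nu> t j
  proof -
    have E: "hybrid_time_domain E" using sol by (simp add: solution_pair_def hybrid_arc_def)
    have L: "hybrid_Linf E \<nu>" using ad by (simp add: admissible_input_def)
    let ?N = "enn2real (hybrid_norm E \<nu>)"
    note st = state_space_invariant[OF sol]
    have t0: "t \<ge> 0" by (rule hybrid_time_domain_nonneg[OF E tj])
    define c where "c = noise_gain ?N + sp"
    have ng0: "noise_gain ?N \<ge> 0" by (rule class_K_nonneg[OF noise_gain_K]) simp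
    have c0: "c \<ge> 0" using ng0 sp0 by (simp add: c_def)
    let ?U = "\<lambda>t j. lyap (\<xi> t j)"
    have s00: "\<xi> 0 0 \<in> state_space" by (rule st[OF hybrid_time_domain_0[OF E]])
    have U0: "0 \<le> ?U 0 0" by (rule lyap_lower(6)[OF s00])
    have main: "?U t j \<le> max M (?U 0 0 - \<psi> M / 2 * t)" if M: "M \<ge> 0" "\<psi> M \<ge> 2 * c" for M
    proof (rule hybrid_time_domain_induct[OF E tj, of "\<lambda>t j. ?U t j \<le> max M (?U 0 0 - \<psi> M / 2 * t)"])
      fix a b' :: real and j
      assume ab: "a \<le> b'" "{a..b'} \<times> {j} \<subseteq> E" "?U a j \<le> max M (?U 0 0 - \<psi> M / 2 * a)"
      have f: "flow_arc \<H> a b' (\<lambda>t. \<xi> t j) (\<lambda>t. \<nu> t j)"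
        by (rule flow_arc_of_solution_pair[OF sol]) (use ab in \<open>auto simp: time_slice_def\<close>)
      have st': "\<xi> t j \<in> state_space" if "t \<in> {a..b'}" for t by (rule st) (use that ab in auto)
      have "?U b' j \<le> max M (?U a j - \<psi> M / 2 * (b' - a))"
      proof (rule decay_on_interval[OF _ ab(1)])
        show "continuous_on {a..b'} (\<lambda>t. ?U t j)"
          by (rule lyap_continuous[OF _ st']) (use f in \<open>auto simp: flow_arc_def intro: abs_cont_on_imp_continuous_on\<close>)
        show "0 \<le> \<psi> M / 2" using class_K_nonneg[OF \<psi>K M(1)] by simp
        fix p q assume pq: "a \<le> p" "p \<le> q" "q \<le> b'" "\<And>t. t \<in> {p..q} \<Longrightarrow> M \<le> ?U t j"
        have f': "flow_arc \<H> p q (\<lambda>t. \<xi> t j) (\<lambda>t. \<nu> t j)" by (rule flow_arc_subset[OF f]) (use pq in auto)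
        show "?U q j - ?U p j \<le> - (\<psi> M / 2) * (q - p)"
        proof (rule lyap_increment[OF f' _ pq(2)])
          show "\<xi> t j \<in> state_space" if "t \<in> {p..q}" for t by (rule st') (use that pq in auto)
          show "AE t in lebesgue. t \<in> {p..q} \<longrightarrow> - diss (\<xi> t j) + supply_rate (\<xi> t j) (\<nu> t j) \<le> - (\<psi> M / 2)"
            using hybrid_Linf_bound(1)[OF L, of j]
          proof (eventually_elim, intro impI)
            fix t assume h: "t \<in> time_slice E j \<longrightarrow> norm (\<nu> t j) \<le> ?N" "t \<in> {p..q}"
            then have tE: "(t, j) \<in> E" using ab pq by auto
            have "supply_rate (\<xi> t j) (\<nu> t j) \<le> c" unfolding c_def sp_def
              by (rule supply_rate_le) (use h tE wh_invariant[OF sol ad init tE] in \<open>auto simp: time_slice_def\<close>)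
            moreover have "\<psi> M \<le> \<psi> (?U t j)" using pq(4)[OF h(2)] by (rule class_K_mono[OF \<psi>K M(1)])
            moreover have "\<psi> (?U t j) \<le> diss (\<xi> t j)" by (rule \<psi>(2)[OF st[OF tE]])
            ultimately show "- diss (\<xi> t j) + supply_rate (\<xi> t j) (\<nu> t j) \<le> - (\<psi> M / 2)" using M(2) by linarith
          qed
        qed
      qed
      also have "\<dots> \<le> max M (?U 0 0 - \<psi> M / 2 * b')"
      proof -
        have "\<psi> M / 2 * (b' - a) \<ge> 0" using ab(1) class_K_nonneg[OF \<psi>K M(1)] by simp
        moreover have "\<psi> M / 2 * (b' - a) = \<psi> M / 2 * b' - \<psi> M / 2 * a" by (simp add: right_diff_distrib)
        ultimately show ?thesis using ab(3) by linarith
      qed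
      finally show "?U b' j \<le> max M (?U 0 0 - \<psi> M / 2 * b')" .
    next
      fix t j assume h: "(t, j) \<in> E" "(t, Suc j) \<in> E" "?U t j \<le> max M (?U 0 0 - \<psi> M / 2 * t)"
      have "\<xi> t (Suc j) \<in> jump_map \<H> (\<xi> t j) (\<nu> t j)" using sol h unfolding solution_pair_def jump_instants_def by auto
      then obtain l where l: "\<xi> t (Suc j) = jump_i S P l (\<xi> t j) (\<nu> t j)" "\<xi> t j \<in> jump_set_i P l" by (auto simp: jump_map_iff)
      have "?U t (Suc j) \<le> ?U t j" unfolding l(1)
      proof (rule lyap_jump[OF l(2)])
        show "norm (blk l (snd (\<nu> t j))) \<le> wbar P l" using ad h(1) unfolding admissible_input_def by blast
        show "norm (blk l (st_wh (\<xi> t j))) \<le> wbar P l" using wh_invariant[OF sol ad init h(1)] by blast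
      qed
      then show "?U t (Suc j) \<le> max M (?U 0 0 - \<psi> M / 2 * t)" using h(3) by linarith
    qed simp
    \<comment> \<open>The level is \<open>max ?s ?k\<close>. By the equation of \<open>b\<close> the
      affine bound at level \<open>?s\<close> takes the value \<open>?s\<close> at time
      \<open>t\<close>, and a higher level only steepens the descent; \<open>?k\<close> is the least
      level at which dissipation is twice the supply.\<close>
    let ?s = "b (?U 0 0) t" and ?k = "pii (2 * c)"
    have s0: "?s \<ge> 0" by (rule b(2)[OF U0 t0])
    have k0: "?k \<ge> 0" using c0 by (intro class_K_nonneg[OF pK]) simp
    have "\<psi> (max ?s ?k) \<ge> 2 * c"
      using class_K_mono[OF \<psi>K k0, of "max ?s ?k"] pii(2)[of "2 * c"] c0 by simp
    then have "?U t j \<le> max (max ?s ?k) (?U 0 0 - \<psi> (max ?s ?k) / 2 * t)" using s0 by (intro main) auto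
    moreover have "?U 0 0 - \<psi> (max ?s ?k) / 2 * t \<le> ?s"
    proof -
      have "t * (1 / 2 * \<psi> ?s) \<le> t * (1 / 2 * \<psi> (max ?s ?k))"
        using t0 class_K_mono[OF \<psi>K s0, of "max ?s ?k"] by (intro mult_left_mono) auto
      then show ?thesis using b(3)[OF U0 t0] by (simp add: algebra_simps)
    qed
    ultimately have Ub: "?U t j \<le> max ?s ?k" by simp
    have U1: "0 \<le> ?U t j" by (rule lyap_lower(6)[OF st[OF tj]])
    have "infdist (\<xi> t j) target_set \<le> \<theta> (?U t j)"
      using infdist_target_le[OF st[OF tj]] \<theta>(3)[OF st[OF tj]] by linarith
    also have "\<dots> \<le> \<theta> (max ?s ?k)" by (rule class_K_mono[OF \<theta>(1) U1 Ub])
    also have "\<dots> \<le> \<theta> ?s + \<theta> ?k"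
      using class_K_nonneg[OF \<theta>(1) s0] class_K_nonneg[OF \<theta>(1) k0] by (simp add: max_def)
    also have "\<theta> ?s \<le> \<theta> (b (\<Theta> (infdist (\<xi> 0 0) target_set)) t)"
    proof (rule class_K_mono[OF \<theta>(1) s0])
      have "?U 0 0 \<le> \<Theta> (infdist (\<xi> 0 0) target_set)" by (rule \<theta>(4)[OF s00]) (rule infdist_target_ge)+
      moreover have "class_K (\<lambda>r. b r t)" using b(1) t0 unfolding class_KL_def by blast
      ultimately show "?s \<le> b (\<Theta> (infdist (\<xi> 0 0) target_set)) t" using class_K_mono[of "\<lambda>r. b r t", OF _ U0] by blast
    qed
    also have "\<theta> ?k \<le> \<gamma> ?N + d"
    proof -
      let ?a = "pii (4 * noise_gain ?N)" and ?b = "pii (4 * sp)"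
      have n: "?a \<ge> 0" "?b \<ge> 0" using ng0 sp0 by (auto intro!: class_K_nonneg[OF pK])
      have "?k \<le> max ?a ?b"
      proof (cases "noise_gain ?N \<le> sp")
        case True
        then have "?k \<le> ?b" using c0 by (intro class_K_mono[OF pK]) (auto simp: c_def)
        then show ?thesis by simp
      next
        case False
        then have "?k \<le> ?a" using c0 by (intro class_K_mono[OF pK]) (auto simp: c_def)
        then show ?thesis by simp
      qed
      then have "\<theta> ?k \<le> \<theta> (max ?a ?b)" by (rule class_K_mono[OF \<theta>(1) k0])
      also have "\<dots> \<le> \<theta> ?a + \<theta> ?b"
        using class_K_nonneg[OF \<theta>(1) n(1)] class_K_nonneg[OF \<theta>(1) n(2)] by (simp add: max_def)
      finally show ?thesis by (simp add: \<gamma>_def d_def)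
    qed
    finally show ?thesis by simp
  qed
  then have "stability_estimate \<H> (admissible_input S P) (sampled_noise_init S P) target_set d"
    unfolding stability_estimate_def using \<gamma>K bKL
    by (intro exI[of _ \<gamma>] exI[of _ "\<lambda>r t. \<theta> (b (\<Theta> r) t)"]) auto
  moreover have "d = 0" if "\<forall>i. spar P i = 0"
    using that by (simp add: d_def sp_def class_K_0[OF pK] class_K_0[OF \<theta>(1)])
  ultimately show ?thesis using d0 by blast
qed

text \<open>The potential \<open>\<Sum>\<^sub>i min (\<tau>\<^sub>i) c\<close> grows at rate at most \<open>N\<close> and drops by \<open>c\<close> at every jump.\<close>

lemma jumps_bounded:
  assumes sp: "solution_pair \<H> E \<xi> \<nu>"
  obtains c where "c > 0" "\<And>t j. (t, j) \<in> E \<Longrightarrow> c * real j \<le> real CARD('k) * (c + t)"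
proof -
  have E: "hybrid_time_domain E" using sp by (simp add: solution_pair_def hybrid_arc_def)
  define c where "c = Min (range (tmin P))"
  have c: "c > 0" "\<And>i. c \<le> tmin P i" unfolding c_def using tmin by (auto simp: Min_gr_iff)
  note st = state_space_invariant[OF sp]
  have "c * real j + (\<Sum>i\<in>UNIV. min (st_tau (\<xi> t j) $ i) c) \<le> real CARD('k) * (c + t)" if "(t, j) \<in> E" for t j
  proof (rule hybrid_time_domain_induct[OF E that, of "\<lambda>t j. c * real j + (\<Sum>i\<in>UNIV. min (st_tau (\<xi> t j) $ i) c) \<le> real CARD('k) * (c + t)"])
    have "(\<Sum>i\<in>UNIV. min (st_tau (\<xi> 0 0) $ i) c) \<le> (\<Sum>i\<in>(UNIV::'k set). c)" by (intro sum_mono) simp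
    then show "c * real 0 + (\<Sum>i\<in>UNIV. min (st_tau (\<xi> 0 0) $ i) c) \<le> real CARD('k) * (c + 0)" by simp
  next
    fix a b :: real and j assume ab: "a \<le> b" "{a..b} \<times> {j} \<subseteq> E"
      "c * real j + (\<Sum>i\<in>UNIV. min (st_tau (\<xi> a j) $ i) c) \<le> real CARD('k) * (c + a)"
    have f: "flow_arc \<H> a b (\<lambda>t. \<xi> t j) (\<lambda>t. \<nu> t j)"
      by (rule flow_arc_of_solution_pair[OF sp]) (use ab in \<open>auto simp: time_slice_def\<close>)
    have "(\<Sum>i\<in>UNIV. min (st_tau (\<xi> b j) $ i) c) \<le> (\<Sum>i\<in>UNIV. min (st_tau (\<xi> a j) $ i) c + (b - a))"
      using ab(1) by (intro sum_mono) (simp add: flow_tau[OF f, of b])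
    also have "\<dots> = (\<Sum>i\<in>UNIV. min (st_tau (\<xi> a j) $ i) c) + real CARD('k) * (b - a)" by (simp add: sum.distrib)
    finally show "c * real j + (\<Sum>i\<in>UNIV. min (st_tau (\<xi> b j) $ i) c) \<le> real CARD('k) * (c + b)"
      using ab(3) by (simp add: algebra_simps)
  next
    fix t j assume h: "(t, j) \<in> E" "(t, Suc j) \<in> E"
      "c * real j + (\<Sum>i\<in>UNIV. min (st_tau (\<xi> t j) $ i) c) \<le> real CARD('k) * (c + t)"
    have "\<xi> t (Suc j) \<in> jump_map \<H> (\<xi> t j) (\<nu> t j)" using sp h unfolding solution_pair_def jump_instants_def by auto
    then obtain l where l: "\<xi> t (Suc j) = jump_i S P l (\<xi> t j) (\<nu> t j)" "\<xi> t j \<in> jump_set_i P l" by (auto simp: jump_map_iff)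
    have tl: "st_tau (\<xi> t j) $ l \<ge> c" using l(2) c(2)[of l] by (simp add: jump_set_i_iff)
    have "(\<Sum>i\<in>UNIV. min (st_tau (\<xi> t (Suc j)) $ i) c) = (\<Sum>i\<in>UNIV. min (st_tau (\<xi> t j) $ i) c - (if i = l then c else 0))"
      using tl c(1) by (intro sum.cong) (auto simp: l(1) jump_components)
    also have "\<dots> = (\<Sum>i\<in>UNIV. min (st_tau (\<xi> t j) $ i) c) - c" by (simp add: sum_subtractf)
    finally show "c * real (Suc j) + (\<Sum>i\<in>UNIV. min (st_tau (\<xi> t (Suc j)) $ i) c) \<le> real CARD('k) * (c + t)"
      using h(3) by (simp add: algebra_simps)
  qed
  moreover have "0 \<le> (\<Sum>i\<in>UNIV. min (st_tau (\<xi> t j) $ i) c)" if "(t, j) \<in> E" for t j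
    using st[OF that] c(1) by (intro sum_nonneg) (auto simp: state_space_iff)
  ultimately show ?thesis using c(1) by (intro that[of c]) (meson le_add_same_cancel1 order.trans)+
qed

end

section \<open>Persistent flow\<close>

lemma autonomous_increasing:
  fixes f :: "real \<Rightarrow> real"
  assumes f: "continuous_on {u0..u0 + r} f" and pos: "\<And>u. u \<in> {u0..u0 + r} \<Longrightarrow> 0 < f u" and r: "0 < r"
  obtains \<delta> h B where "0 < \<delta>" "h 0 = u0" "\<And>t. t \<in> {0..\<delta>} \<Longrightarrow> h t \<in> {u0..u0 + r}" "B-lipschitz_on {0..\<delta>} h"
    "\<And>t. t \<in> {0<..<\<delta>} \<Longrightarrow> (h has_real_derivative f (h t)) (at t)"
proof -
  let ?I = "{u0..u0 + r}"
  have cg: "continuous_on ?I (\<lambda>u. 1 / f u)" using f pos by (intro continuous_intros) force+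
  \<comment> \<open>Separation of variables: \<open>G u\<close> is the time needed to move from
    \<open>u0\<close> to \<open>u\<close>, and the solution is its inverse. The application has
    \<open>f = r + s - sig P i\<close> with \<open>sig P i\<close> merely continuous, so a Lipschitz
    condition cannot be invoked.\<close>
  define G where "G u = integral {u0..u} (\<lambda>u. 1 / f u)" for u
  have dG: "(G has_real_derivative 1 / f u) (at u within ?I)" if "u \<in> ?I" for u
    unfolding G_def by (rule integral_has_real_derivative[OF cg that])
  have cG: "continuous_on ?I G" by (rule DERIV_continuous_on[OF dG])
  have dG': "(G has_real_derivative 1 / f u) (at u)" if "u0 < u" "u < u0 + r" for u
    using dG[of u] that at_within_interior[of u ?I] by (simp add: interior_atLeastAtMost_real)
  have "compact (f ` ?I)" by (intro compact_continuous_image f compact_Icc)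
  then have "bounded (f ` ?I)" by (rule compact_imp_bounded)
  then obtain B' where "\<forall>y\<in>f ` ?I. norm y \<le> B'" unfolding bounded_iff by blast
  then have B': "norm (f u) \<le> B'" if "u \<in> ?I" for u using that by blast
  define B where "B = max B' 1"
  have B: "f u \<le> B" if "u \<in> ?I" for u using B'[OF that] by (simp add: B_def)
  have B0: "B > 0" by (simp add: B_def)
  \<comment> \<open>As \<open>f\<close> is at most \<open>B\<close>, the travel time
    \<open>G\<close> has slope at least \<open>1 / B\<close>. This makes it injective and its
    inverse \<open>B\<close>-Lipschitz.\<close>
  have grow: "u2 - u1 \<le> B * (G u2 - G u1)" if "u0 \<le> u1" "u1 \<le> u2" "u2 \<le> u0 + r" for u1 u2
  proof -
    have "B * G u1 - u1 \<le> B * G u2 - u2"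
    proof (rule DERIV_nonneg_imp_increasing_open[of u1 u2 "\<lambda>u. B * G u - u"])
      fix u assume u: "u1 < u" "u < u2"
      have "((\<lambda>u. B * G u - u) has_real_derivative B * (1 / f u) - 1) (at u)"
        using dG'[of u] u that by (auto intro!: derivative_eq_intros)
      moreover have "B * (1 / f u) - 1 \<ge> 0" using B[of u] pos[of u] u that by (simp add: field_simps)
      ultimately show "\<exists>y. ((\<lambda>u. B * G u - u) has_real_derivative y) (at u) \<and> 0 \<le> y" by blast
    next
      show "continuous_on {u1..u2} (\<lambda>u. B * G u - u)"
        by (intro continuous_intros continuous_on_subset[OF cG]) (use that in auto)
    qed (use that in auto)
    then show ?thesis by (simp add: algebra_simps)
  qed
  define \<delta> where "\<delta> = G (u0 + r)"
  have G0: "G u0 = 0" by (simp add: G_def)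
  have dpos: "\<delta> > 0"
  proof -
    have "B * (G (u0 + r) - G u0) > 0" using grow[of u0 "u0 + r"] r by linarith
    then show ?thesis using B0 by (simp add: G0 \<delta>_def zero_less_mult_iff)
  qed
  have ex: "\<exists>u. u \<in> ?I \<and> G u = t" if "t \<in> {0..\<delta>}" for t
    using IVT'[of G u0 t "u0 + r"] that G0 cG r by (auto simp: \<delta>_def)
  define h where "h t = (SOME u. u \<in> ?I \<and> G u = t)" for t
  have h: "h t \<in> ?I" "G (h t) = t" if "t \<in> {0..\<delta>}" for t
    using someI_ex[OF ex[OF that]] unfolding h_def by auto
  have hdiff: "\<bar>h t1 - h t2\<bar> \<le> B * \<bar>t1 - t2\<bar>" if "t1 \<in> {0..\<delta>}" "t2 \<in> {0..\<delta>}" for t1 t2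
  proof (cases "h t1 \<le> h t2")
    case True
    have "h t2 - h t1 \<le> B * (t2 - t1)" using grow[of "h t1" "h t2"] h[OF that(1)] h[OF that(2)] True by auto
    moreover have "B * (t2 - t1) \<le> B * \<bar>t1 - t2\<bar>" using B0 by (intro mult_left_mono) auto
    ultimately show ?thesis using True by linarith
  next
    case False
    have "h t1 - h t2 \<le> B * (t1 - t2)" using grow[of "h t2" "h t1"] h[OF that(1)] h[OF that(2)] False by auto
    moreover have "B * (t1 - t2) \<le> B * \<bar>t1 - t2\<bar>" using B0 by (intro mult_left_mono) auto
    ultimately show ?thesis using False by linarith
  qed
  have lip: "B-lipschitz_on {0..\<delta>} h"
    by (rule lipschitz_onI) (use hdiff B0 in \<open>auto simp: dist_real_def\<close>)
  have h0: "h 0 = u0"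
    using grow[of u0 "h 0"] h[of 0] G0 dpos by auto
  show ?thesis
  proof (rule that[OF dpos h0 h(1) lip])
    fix t assume t: "t \<in> {0<..<\<delta>}"
    have ht: "u0 < h t" "h t < u0 + r"
      using h[of t] t G0 by (auto simp: \<delta>_def less_le)
    have cont: "continuous_on {0<..<\<delta>} h"
      using lipschitz_on_continuous_on[OF lip] by (rule continuous_on_subset) auto
    have "(h has_real_derivative inverse (1 / f (h t))) (at t)"
    proof (rule DERIV_inverse_function[of G _ h t 0 \<delta>])
      show "(G has_real_derivative 1 / f (h t)) (at (h t))" by (rule dG'[OF ht])
      show "1 / f (h t) \<noteq> 0" using pos[of "h t"] ht by auto
      show "isCont h t" using cont t by (simp add: continuous_on_eq_continuous_at)
    qed (use t h in auto)
    then show "(h has_real_derivative f (h t)) (at t)" by simp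
  qed
qed

text \<open>According to the sign of \<open>f u0\<close> the solution stays put, increases or
  decreases. It decreases only if \<open>u0 > 0\<close>, because \<open>f 0\<close> is nonnegative;
  then there is room below \<open>u0\<close>.\<close>

lemma autonomous_nonneg:
  fixes f :: "real \<Rightarrow> real"
  assumes f: "continuous_on {0..} f" and f0: "0 \<le> f 0" and u0: "0 \<le> u0"
  shows "\<exists>\<delta> h B. 0 < \<delta> \<and> h 0 = u0 \<and> (\<forall>t\<in>{0..\<delta>}. 0 \<le> h t) \<and> B-lipschitz_on {0..\<delta>} h \<and>
    (\<forall>t\<in>{0<..<\<delta>}. (h has_real_derivative f (h t)) (at t))"
proof -
  consider "f u0 = 0" | "f u0 > 0" | "f u0 < 0" by linarith
  then show ?thesis
  proof cases
    case 1
    then show ?thesis using u0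
      by (intro exI[of _ "1::real"] exI[of _ "\<lambda>t. u0"] exI[of _ "0::real"]) (auto simp: lipschitz_on_def)
  next
    case 2
    obtain d where d: "d > 0" "\<And>u. u \<in> {0..} \<Longrightarrow> dist u u0 < d \<Longrightarrow> dist (f u) (f u0) < f u0"
      using f u0 2 unfolding continuous_on_iff by (metis atLeast_iff)
    have "0 < f u" if "u \<in> {u0..u0 + d / 2}" for u
      using d(2)[of u] that u0 d(1) unfolding dist_real_def by auto
    moreover have "continuous_on {u0..u0 + d / 2} f" by (rule continuous_on_subset[OF f]) (use u0 in auto)
    ultimately obtain \<delta> h B where h: "0 < \<delta>" "h 0 = u0" "\<And>t. t \<in> {0..\<delta>} \<Longrightarrow> h t \<in> {u0..u0 + d / 2}" "B-lipschitz_on {0..\<delta>} h"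
      "\<And>t. t \<in> {0<..<\<delta>} \<Longrightarrow> (h has_real_derivative f (h t)) (at t)"
      using autonomous_increasing[of u0 "d / 2" f] d(1) by (metis half_gt_zero)
    have "\<forall>t\<in>{0..\<delta>}. 0 \<le> h t" using h(3) u0 by fastforce
    then show ?thesis using h by blast
  next
    case 3
    then have u0': "u0 > 0" using f0 u0 by (cases "u0 = 0") auto
    obtain d where d: "d > 0" "\<And>u. u \<in> {0..} \<Longrightarrow> dist u u0 < d \<Longrightarrow> dist (f u) (f u0) < - f u0"
      using f u0 3 unfolding continuous_on_iff by (metis atLeast_iff neg_0_less_iff_less)
    define r where "r = min (d / 2) (u0 / 2)"
    have r: "0 < r" "r < d" "r < u0" using d(1) u0' by (auto simp: r_def)
    \<comment> \<open>Reflection turns the decreasing case into the increasing one. Here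
      \<open>r < d\<close> keeps the sign of \<open>f\<close>, and \<open>r < u0\<close> keeps the
      solution positive.\<close>
    let ?g = "\<lambda>u. - f (- u)"
    have "0 < ?g u" if "u \<in> {- u0..- u0 + r}" for u
    proof -
      have "dist (f (- u)) (f u0) < - f u0" using that r by (intro d(2)) (auto simp: dist_real_def)
      then show ?thesis unfolding dist_real_def by linarith
    qed
    moreover have "continuous_on {- u0..- u0 + r} ?g"
      by (intro continuous_intros continuous_on_compose2[OF f]) (use r in auto)
    ultimately obtain \<delta> h B where h: "0 < \<delta>" "h 0 = - u0" "\<And>t. t \<in> {0..\<delta>} \<Longrightarrow> h t \<in> {- u0..- u0 + r}" "B-lipschitz_on {0..\<delta>} h"
      "\<And>t. t \<in> {0<..<\<delta>} \<Longrightarrow> (h has_real_derivative ?g (h t)) (at t)"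
      using autonomous_increasing[of "- u0" r ?g] r(1) by metis
    show ?thesis
    proof (rule exI[of _ \<delta>], rule exI[of _ "\<lambda>t. - h t"], rule exI[of _ B], intro conjI ballI h(1))
      show "- h 0 = u0" using h(2) by simp
      show "0 \<le> - h t" if "t \<in> {0..\<delta>}" for t using h(3)[OF that] r by auto
      show "B-lipschitz_on {0..\<delta>} (\<lambda>t. - h t)" using h(4) by (auto simp: lipschitz_on_def dist_real_def abs_minus_commute)
      show "((\<lambda>t. - h t) has_real_derivative f (- h t)) (at t)" if "t \<in> {0<..<\<delta>}" for t
        using DERIV_minus[OF h(5)[OF that]] by simp
    qed
  qed
qed

section \<open>Bounds on balls and translation in time\<close>

lemma norm_le_fst_snd: "norm x \<le> norm (fst x) + norm (snd x)"
  by (metis norm_Pair_le prod.collapse)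

lemma bounded_on_cball:
  fixes f :: "'a::euclidean_space \<Rightarrow> 'b::real_normed_vector"
  assumes "continuous_on UNIV f"
  obtains B where "B \<ge> 0" "\<And>x. norm x \<le> R \<Longrightarrow> norm (f x) \<le> B"
proof -
  have "bounded (f ` cball 0 R)"
    by (intro compact_imp_bounded compact_continuous_image continuous_on_subset[OF assms] compact_cball) auto
  then obtain B where "\<forall>y\<in>f ` cball 0 R. norm y \<le> B" unfolding bounded_iff by blast
  then show ?thesis by (intro that[of "max B 0"]) (auto simp: le_max_iff_disj)
qed

lemma AE_lebesgue_shift:
  assumes "AE t in lebesgue. P (t :: real)"
  shows "AE t in lebesgue. P (t + c)"
proof -
  obtain N where N: "N \<in> null_sets lebesgue" "\<And>t. t \<notin> N \<Longrightarrow> P t"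
  proof -
    from AE_E3[OF assms] obtain N where "\<And>t. t \<in> space lebesgue - N \<Longrightarrow> P t" "N \<in> null_sets lebesgue" by blast
    then show ?thesis by (intro that[of N]) auto
  qed
  have "negligible ((+) (- c) ` N)" using N(1) by (intro negligible_translation) (simp add: negligible_iff_null_sets)
  then have "(+) (- c) ` N \<in> null_sets lebesgue" by (simp add: negligible_iff_null_sets)
  then show ?thesis
  proof (rule AE_I')
    show "{t \<in> space lebesgue. \<not> P (t + c)} \<subseteq> (+) (- c) ` N"
    proof
      fix t assume "t \<in> {t \<in> space lebesgue. \<not> P (t + c)}"
      then have "t + c \<in> N" using N(2) by auto
      then show "t \<in> (+) (- c) ` N" by (intro image_eqI[of _ _ "t + c"]) auto
    qed
  qed
qed

lemma has_vector_derivative_shift: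
  fixes f :: "real \<Rightarrow> 'a::real_normed_vector"
  assumes "(f has_vector_derivative d) (at (t + c) within S)"
  shows "((\<lambda>s. f (s + c)) has_vector_derivative d) (at t within (\<lambda>s. s - c) ` S)"
proof -
  have im: "(\<lambda>s. s + c) ` (\<lambda>s. s - c) ` S = S" by (auto simp: image_image)
  have 1: "((\<lambda>s. s + c) has_vector_derivative 1) (at t within (\<lambda>s. s - c) ` S)"
    by (auto intro!: derivative_eq_intros)
  have "(f \<circ> (\<lambda>s. s + c) has_vector_derivative 1 *\<^sub>R d) (at t within (\<lambda>s. s - c) ` S)"
    by (rule vector_diff_chain_within[OF 1]) (use assms in \<open>simp add: im\<close>)
  then show ?thesis by (simp add: o_def)
qed

lemma flow_arc_shift:
  assumes x: "flow_arc \<H> a b x u"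
  shows "flow_arc \<H> (a - c) (b - c) (\<lambda>t. x (t + c)) (\<lambda>t. u (t + c))"
  unfolding flow_arc_def
proof
  have "abs_cont_on {a..b} x" using x by (simp add: flow_arc_def)
  from abs_cont_on_shift[OF this, of c] show "abs_cont_on {a - c..b - c} (\<lambda>t. x (t + c))" by (simp add: add.commute)
  have im: "(\<lambda>s. s - c) ` {a..b} = {a - c..b - c}" by simp
  have "AE t in lebesgue. t \<in> {a..b} \<longrightarrow> (x t, u t) \<in> flow_set \<H> \<and>
       (\<exists>d\<in>flow_map \<H> (x t) (u t). (x has_vector_derivative d) (at t within {a..b}))"
    using x by (simp add: flow_arc_def)
  from AE_lebesgue_shift[OF this, of c]
  show "AE t in lebesgue. t \<in> {a - c..b - c} \<longrightarrow> (x (t + c), u (t + c)) \<in> flow_set \<H> \<and>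
       (\<exists>d\<in>flow_map \<H> (x (t + c)) (u (t + c)). ((\<lambda>t. x (t + c)) has_vector_derivative d) (at t within {a - c..b - c}))"
  proof (eventually_elim, intro impI)
    fix t assume h: "t + c \<in> {a..b} \<longrightarrow> (x (t + c), u (t + c)) \<in> flow_set \<H> \<and>
       (\<exists>d\<in>flow_map \<H> (x (t + c)) (u (t + c)). (x has_vector_derivative d) (at (t + c) within {a..b}))" "t \<in> {a - c..b - c}"
    then obtain d where "(x (t + c), u (t + c)) \<in> flow_set \<H>" "d \<in> flow_map \<H> (x (t + c)) (u (t + c))"
      "(x has_vector_derivative d) (at (t + c) within {a..b})" by auto
    moreover from has_vector_derivative_shift[OF this(3)]
    have "((\<lambda>t. x (t + c)) has_vector_derivative d) (at t within {a - c..b - c})" unfolding im .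
    ultimately show "(x (t + c), u (t + c)) \<in> flow_set \<H> \<and>
       (\<exists>d\<in>flow_map \<H> (x (t + c)) (u (t + c)). ((\<lambda>t. x (t + c)) has_vector_derivative d) (at t within {a - c..b - c}))" by blast
  qed
qed

lemma ode_solution_subset:
  assumes "ode_solution f u I x" "J \<subseteq> I"
  shows "ode_solution f u J x"
  unfolding ode_solution_def
proof
  show "locally_abs_cont_on J x" using assms unfolding ode_solution_def locally_abs_cont_on_def by blast
  have "AE t in lebesgue. t \<in> I \<longrightarrow> (x has_vector_derivative f (x t) (u t)) (at t within I)"
    using assms(1) by (simp add: ode_solution_def)
  then show "AE t in lebesgue. t \<in> J \<longrightarrow> (x has_vector_derivative f (x t) (u t)) (at t within J)"
    by eventually_elim (use assms(2) in \<open>blast intro: has_vector_derivative_within_subset\<close>)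
qed

lemma ode_solution_abs_cont: "ode_solution f u I x \<Longrightarrow> {a..b} \<subseteq> I \<Longrightarrow> abs_cont_on {a..b} x"
  unfolding ode_solution_def by (meson locally_abs_cont_onD)

lemma continuous_on_half_openI:
  fixes g :: "real \<Rightarrow> 'a::topological_space"
  assumes "\<And>r. r < T \<Longrightarrow> continuous_on {a..r} g"
  shows "continuous_on {a..<T} g"
proof (rule continuous_on_eq_continuous_within[THEN iffD2], rule ballI)
  fix x assume x: "x \<in> {a..<T}"
  let ?r = "(x + T) / 2"
  have "continuous_on {a..?r} g" using x by (intro assms) auto
  then have "continuous (at x within {a..?r}) g" using x by (auto simp: continuous_on_eq_continuous_within)
  moreover have "at x within {a..?r} = at x within {a..<T}"
    by (rule at_within_nhd[of x "{..<?r}"]) (use x in auto)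
  ultimately show "continuous (at x within {a..<T}) g" by (simp add: continuous_within)
qed

lemma at_within_neq_bot_half_open: "t \<in> {a..<T} \<Longrightarrow> at t within {a..<T::real} \<noteq> bot"
  by (simp add: trivial_limit_within islimpt_Ico)

section \<open>The estimate as a trajectory of the undisturbed plant\<close>

context estimation_model
begin

text \<open>The bound on \<open>V\<close> holds for every sampled noise, hence for every held output \<open>y\<close>; with
  \<open>\<epsilon> = 0\<close>, \<open>v = 0\<close>, \<open>w = 0\<close> it makes \<open>V\<close> nonincreasing along the error, which starts at \<open>0\<close>.
  So the estimate follows the undisturbed plant whatever the observer receives.\<close>

lemma observer_tracks_plant:
  assumes z: "ode_solution (fo S) y {0..<T} z" and x: "ode_solution (fp S) (\<lambda>_. 0) {0..} x"
    and x0: "x 0 = ho S (z 0)" and t: "t \<in> {0..<T}"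
  shows "ho S (z t) = x t"
proof -
  let ?I = "{0..t}" and ?g = "\<lambda>s. (z s, x s)" and ?e = "\<lambda>s. ho S (z s) - x s"
  have sub: "?I \<subseteq> {0..<T}" "?I \<subseteq> {0..}" using t by auto
  have acz: "abs_cont_on ?I z" by (rule ode_solution_abs_cont[OF z sub(1)])
  have acx: "abs_cont_on ?I x" by (rule ode_solution_abs_cont[OF x sub(2)])
  have ac: "abs_cont_on ?I ?g" by (rule abs_cont_on_Pair[OF acz acx])
  have cz: "continuous_on ?I z" by (rule abs_cont_on_imp_continuous_on[OF acz])
  have cx: "continuous_on ?I x" by (rule abs_cont_on_imp_continuous_on[OF acx])
  have ce: "continuous_on ?I ?e"
    by (intro continuous_intros cx continuous_on_compose2[OF cont_ho cz]) auto
  have "V (?e t) - V (?e 0) \<le> 0 * (t - 0)"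
  proof (rule increment_le[OF _ ac])
    fix s assume s: "s \<in> ?I"
    \<comment> \<open>Mere differentiability of \<open>ho\<close> bounds its increments from the
      base point \<open>z s\<close> only, with constants that depend on \<open>s\<close>. The
      increment from \<open>p\<close> to \<open>q\<close> is therefore compared through
      \<open>s\<close>.\<close>
    obtain \<delta>1 L1 where L1: "\<delta>1 > 0" "L1 \<ge> 0" "\<And>z'. norm (z' - z s) < \<delta>1 \<Longrightarrow> norm (ho S z' - ho S (z s)) \<le> L1 * norm (z' - z s)"
    proof -
      let ?D = "frechet_derivative (ho S) (at (z s))"
      have D: "(ho S has_derivative ?D) (at (z s))" by (rule ho_deriv)
      then obtain K where K: "K \<ge> 0" "\<And>x. norm (?D x) \<le> norm x * K"
        using bounded_linear.nonneg_bounded[OF has_derivative_bounded_linear[OF D]] by blast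
      obtain d where d: "d > 0" "\<And>y. norm (y - z s) < d \<Longrightarrow> norm (ho S y - ho S (z s) - ?D (y - z s)) \<le> 1 * norm (y - z s)"
        using D unfolding has_derivative_within_alt by (metis UNIV_I zero_less_one)
      show ?thesis
      proof (rule that[of d "K + 1"])
        fix z' assume "norm (z' - z s) < d"
        then have "norm (ho S z' - ho S (z s) - ?D (z' - z s)) \<le> 1 * norm (z' - z s)" by (rule d)
        then show "norm (ho S z' - ho S (z s)) \<le> (K + 1) * norm (z' - z s)"
          using norm_triangle_ineq[of "ho S z' - ho S (z s) - ?D (z' - z s)" "?D (z' - z s)"] K(2)[of "z' - z s"]
          by (simp add: algebra_simps)
      qed (use d K in auto)
    qed
    obtain \<delta>2 L2 where L2: "\<delta>2 > 0" "L2 \<ge> 0" "\<And>p q. p \<in> cball (?e s) \<delta>2 \<Longrightarrow> q \<in> cball (?e s) \<delta>2 \<Longrightarrow> dist (V p) (V q) \<le> L2 * dist p q"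
      using locally_LipschitzE[OF V_facts(1)] by blast
    obtain d1 where d1: "d1 > 0" "\<And>r. r \<in> ?I \<Longrightarrow> dist r s < d1 \<Longrightarrow> dist (z r) (z s) < \<delta>1"
      using cz s L1(1) unfolding continuous_on_iff by blast
    obtain d2 where d2: "d2 > 0" "\<And>r. r \<in> ?I \<Longrightarrow> dist r s < d2 \<Longrightarrow> dist (?e r) (?e s) < \<delta>2"
      using ce s L2(1) unfolding continuous_on_iff by blast
    show "dominated_at ?I ?g (\<lambda>s. V (?e s)) s"
    proof (rule dominated_atI[of "L2 * (L1 + 1)" "min d1 d2"])
      fix p q assume pq: "p \<in> ?I" "q \<in> ?I" "p \<le> s" "s \<le> q" "q - p < min d1 d2"
      let ?X = "norm (?g q - ?g s) + norm (?g s - ?g p)"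
      have "dist (V (?e q)) (V (?e p)) \<le> L2 * dist (?e q) (?e p)"
        using d2(2)[of p] d2(2)[of q] pq by (intro L2) (auto simp: dist_real_def dist_commute)
      moreover have "dist (?e q) (?e p) \<le> (L1 + 1) * ?X"
      proof -
        have zq: "norm (ho S (z q) - ho S (z s)) \<le> L1 * norm (z q - z s)"
          using d1(2)[of q] pq by (intro L1) (auto simp: dist_real_def dist_norm)
        have zp: "norm (ho S (z p) - ho S (z s)) \<le> L1 * norm (z s - z p)"
          using d1(2)[of p] pq L1(3)[of "z p"] by (auto simp: dist_real_def dist_norm norm_minus_commute)
        have g1: "norm (z q - z s) \<le> norm (?g q - ?g s)" "norm (x q - x s) \<le> norm (?g q - ?g s)"
          "norm (z s - z p) \<le> norm (?g s - ?g p)" "norm (x s - x p) \<le> norm (?g s - ?g p)"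
          using norm_fst_le[of "z q - z s" "x q - x s"] norm_snd_le[of "x q - x s" "z q - z s"]
            norm_fst_le[of "z s - z p" "x s - x p"] norm_snd_le[of "x s - x p" "z s - z p"] by simp_all
        have eq: "?e q - ?e p = (ho S (z q) - ho S (z s)) - (ho S (z p) - ho S (z s)) - (x q - x s) - (x s - x p)" by simp
        have "dist (?e q) (?e p) \<le> norm (ho S (z q) - ho S (z s)) + norm (ho S (z p) - ho S (z s)) + norm (x q - x s) + norm (x s - x p)"
          unfolding dist_norm eq
          using norm_triangle_ineq4[of "ho S (z q) - ho S (z s)" "ho S (z p) - ho S (z s)"]
            norm_triangle_ineq4[of "ho S (z q) - ho S (z s) - (ho S (z p) - ho S (z s))" "x q - x s"]
            norm_triangle_ineq4[of "ho S (z q) - ho S (z s) - (ho S (z p) - ho S (z s)) - (x q - x s)" "x s - x p"] by linarith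
        also have "\<dots> \<le> L1 * norm (?g q - ?g s) + L1 * norm (?g s - ?g p) + norm (?g q - ?g s) + norm (?g s - ?g p)"
          using zq zp g1 mult_left_mono[OF g1(1) L1(2)] mult_left_mono[OF g1(3) L1(2)] by linarith
        finally show ?thesis by (simp add: algebra_simps)
      qed
      ultimately have "dist (V (?e q)) (V (?e p)) \<le> L2 * ((L1 + 1) * ?X)"
        using L2(2) by (meson mult_left_mono order.trans)
      then show "V (?e q) - V (?e p) \<le> L2 * (L1 + 1) * ?X" unfolding dist_real_def mult.assoc by linarith
    qed (use L1 L2 d1 d2 in auto)
  next
    have "AE s in lebesgue. s \<in> {0..<T} \<longrightarrow> (z has_vector_derivative fo S (z s) (y s)) (at s within {0..<T})"
      "AE s in lebesgue. s \<in> {0..} \<longrightarrow> (x has_vector_derivative fp S (x s) 0) (at s within {0..})"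
      using z x by (simp_all add: ode_solution_def)
    then show "AE s in lebesgue. s \<in> ?I \<longrightarrow> upper_rate ?I (\<lambda>s. V (?e s)) s 0"
    proof (eventually_elim, intro impI)
      fix s assume h: "s \<in> {0..<T} \<longrightarrow> (z has_vector_derivative fo S (z s) (y s)) (at s within {0..<T})"
        "s \<in> {0..} \<longrightarrow> (x has_vector_derivative fp S (x s) 0) (at s within {0..})" and s: "s \<in> ?I"
      have zd: "(z has_vector_derivative fo S (z s) (y s)) (at s within ?I)"
        using h(1) s sub(1) by (blast intro: has_vector_derivative_within_subset)
      have xd: "(x has_vector_derivative fp S (x s) 0) (at s within ?I)"
        using h(2) s sub(2) by (blast intro: has_vector_derivative_within_subset)
      let ?D = "frechet_derivative (ho S) (at (z s))"
      have hz: "((\<lambda>s. ho S (z s)) has_vector_derivative ?D (fo S (z s) (y s))) (at s within ?I)"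
        using vector_derivative_diff_chain_within[OF zd has_derivative_at_withinI[OF ho_deriv]] by (simp add: o_def)
      \<comment> \<open>The sample takes up the whole difference between the received output and the
        plant output, so with zero sampling error \<open>f_z\<close> is the actual velocity of
        \<open>z\<close>.\<close>
      define wh where "wh = y s - hp S (x s)"
      have fz: "f_z S (z s) (?e s) 0 wh = fo S (z s) (y s)" by (simp add: f_z_def wh_def)
      have "(?e has_vector_derivative f_e S (z s) (?e s) 0 wh 0) (at s within ?I)"
        using has_vector_derivative_diff[OF hz xd] by (simp add: f_e_def fz)
      moreover have "dir_rate V (?e s) (f_e S (z s) (?e s) 0 wh 0) (- \<alpha> (norm (?e s)) + \<zeta> (norm (0::real^'p, 0::real^'m)) +
        (\<Sum>i\<in>UNIV. - rho P i (norm (q_i S i (z s) (?e s) 0)) - (H i (z s) (?e s) wh 0)\<^sup>2 + ((gam P i)\<^sup>2 - \<mu> i) * (Wi i 0)\<^sup>2))"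
        by (rule V_dir_rate)
      ultimately have "upper_rate ?I (\<lambda>s. V (?e s)) s (- \<alpha> (norm (?e s)) + \<zeta> (norm (0::real^'p, 0::real^'m)) +
        (\<Sum>i\<in>UNIV. - rho P i (norm (q_i S i (z s) (?e s) 0)) - (H i (z s) (?e s) wh 0)\<^sup>2 + ((gam P i)\<^sup>2 - \<mu> i) * (Wi i 0)\<^sup>2))"
        by (rule upper_rate_compose[OF V_facts(1) _ s])
      then show "upper_rate ?I (\<lambda>s. V (?e s)) s 0"
      proof (rule upper_rate_mono)
        have "(\<Sum>i\<in>UNIV. - rho P i (norm (q_i S i (z s) (?e s) 0)) - (H i (z s) (?e s) wh 0)\<^sup>2 + ((gam P i)\<^sup>2 - \<mu> i) * (Wi i 0)\<^sup>2) \<le> 0"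
        proof (rule sum_nonpos)
          fix i
          have "0 \<le> rho P i (norm (q_i S i (z s) (?e s) 0))" using V_facts(7)[of i] unfolding pos_semidefinite_def by simp
          moreover have "0 \<le> (H i (z s) (?e s) wh 0)\<^sup>2" by simp
          moreover have "((gam P i)\<^sup>2 - \<mu> i) * (Wi i 0)\<^sup>2 = 0" by (simp add: W_0)
          ultimately show "- rho P i (norm (q_i S i (z s) (?e s) 0)) - (H i (z s) (?e s) wh 0)\<^sup>2 + ((gam P i)\<^sup>2 - \<mu> i) * (Wi i 0)\<^sup>2 \<le> 0"
            by linarith
        qed
        moreover have "0 \<le> \<alpha> (norm (?e s))" by (rule class_K_nonneg[OF class_K_infD[OF V_facts(3)]]) simp
        ultimately show "- \<alpha> (norm (?e s)) + \<zeta> (norm (0::real^'p, 0::real^'m)) +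
        (\<Sum>i\<in>UNIV. - rho P i (norm (q_i S i (z s) (?e s) 0)) - (H i (z s) (?e s) wh 0)\<^sup>2 + ((gam P i)\<^sup>2 - \<mu> i) * (Wi i 0)\<^sup>2) \<le> 0"
          using class_K_0[OF class_K_infD[OF V_facts(6)]] by (simp add: norm_Pair)
      qed
    qed
  qed (use t in auto)
  then have "V (?e t) \<le> 0" using x0 V_0 by simp
  then have "\<alpha>l (norm (?e t)) \<le> 0" using V_facts(10)[of "?e t"] by simp
  then have "norm (?e t) = 0"
    using class_K_pos[OF class_K_infD[OF V_facts(4)], of "norm (?e t)"] by (metis linorder_not_le norm_ge_zero order.antisym linorder_not_less)
  then show ?thesis by simp
qed

lemma plant_solution:
  obtains x where "x 0 = x0" "ode_solution (fp S) (\<lambda>_. 0) {0..} x"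
proof -
  have "Linf_signal (\<lambda>_::real. 0::real^'p)" unfolding Linf_signal_def by (auto intro!: exI[of _ 0])
  then show ?thesis using plant that unfolding plant_forward_complete_def unique_global_solution_def by blast
qed

lemma hp_lipschitz:
  obtains B where "B \<ge> 0" "\<And>x y. norm x \<le> R \<Longrightarrow> norm y \<le> R \<Longrightarrow> norm (hp S x - hp S y) \<le> B * norm (x - y)"
proof -
  have "\<exists>B\<ge>0. \<forall>x y. norm x \<le> R \<longrightarrow> norm y \<le> R \<longrightarrow> norm (hpi S i x - hpi S i y) \<le> B * norm (x - y)" for i
  proof -
    obtain D where D: "\<And>x. (hpi S i has_derivative blinfun_apply (D x)) (at x)" "continuous_on UNIV D"
      using hpi_deriv[of i] by metis
    obtain B where B: "B \<ge> 0" "\<And>x. norm x \<le> R \<Longrightarrow> norm (D x) \<le> B" using bounded_on_cball[OF D(2)] by blast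
    have "norm (hpi S i x - hpi S i y) \<le> B * norm (x - y)" if "norm x \<le> R" "norm y \<le> R" for x y
    proof (rule differentiable_bound[of "cball 0 R" "hpi S i" "\<lambda>x. blinfun_apply (D x)"])
      show "(hpi S i has_derivative blinfun_apply (D x)) (at x within cball 0 R)" for x
        by (rule has_derivative_at_withinI[OF D(1)])
      show "onorm (blinfun_apply (D x)) \<le> B" if "x \<in> cball 0 R" for x
        using B(2)[of x] that by (simp add: norm_blinfun.rep_eq)
    qed (use that in auto)
    then show ?thesis using B(1) by blast
  qed
  then obtain B where B: "\<And>i. B i \<ge> 0" "\<And>i x y. norm x \<le> R \<Longrightarrow> norm y \<le> R \<Longrightarrow> norm (hpi S i x - hpi S i y) \<le> B i * norm (x - y)"
    by metis
  show ?thesis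
  proof (rule that[of "\<Sum>i\<in>UNIV. B i"])
    show "0 \<le> (\<Sum>i\<in>UNIV. B i)" by (intro sum_nonneg B)
    fix x y :: "real^'n" assume "norm x \<le> R" "norm y \<le> R"
    then have "norm (hp S x - hp S y) \<le> (\<Sum>i\<in>UNIV. B i * norm (x - y))"
      unfolding hp_sum sum_subtractf[symmetric] by (intro sum_norm_le B)
    then show "norm (hp S x - hp S y) \<le> (\<Sum>i\<in>UNIV. B i) * norm (x - y)" by (simp add: sum_distrib_right)
  qed
qed


section \<open>Closing a flow that is open at its end\<close>

lemma diss_nonneg: "x \<in> state_space \<Longrightarrow> 0 \<le> diss x"
proof -
  assume x: "x \<in> state_space"
  obtain \<psi> where "class_K_inf \<psi>" "\<And>x. x \<in> state_space \<Longrightarrow> \<psi> (lyap x) \<le> diss x" using diss_bound by metis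
  then show ?thesis using class_K_nonneg[OF class_K_infD lyap_lower(6)[OF x]] x by (meson order.trans)
qed

text \<open>Both sides are derivatives of one and the same function. Applied to the trajectory that
  the estimate follows, this eliminates \<open>fo\<close> from \<open>f_e\<close>, which becomes a
  difference of two plant velocities.\<close>

lemma ho_flow_derivative:
  assumes z: "(z has_vector_derivative dz) (at t within I)" and ch: "(ch has_vector_derivative dch) (at t within I)"
    and eq: "\<And>s. s \<in> I \<Longrightarrow> ho S (z s) = ch s" and t: "t \<in> I" and nb: "at t within I \<noteq> bot"
  shows "frechet_derivative (ho S) (at (z t)) dz = dch"
proof (rule vector_derivative_unique_within[OF nb])
  show "(ch has_vector_derivative dch) (at t within I)" by (rule ch)
  have "((\<lambda>s. ho S (z s)) has_vector_derivative frechet_derivative (ho S) (at (z t)) dz) (at t within I)"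
    using vector_derivative_diff_chain_within[OF z has_derivative_at_withinI[OF ho_deriv]] by (simp add: o_def)
  then show "(ch has_vector_derivative frechet_derivative (ho S) (at (z t)) dz) (at t within I)"
    by (rule has_vector_derivative_transform[OF t, rotated]) (use eq in auto)
qed

text \<open>Only \<open>snd d\<close> is bounded, since the velocity of \<open>z\<close> is a value
  of the arbitrary map \<open>fo\<close>. In the velocity of \<open>e\<close> that map is removed by
  the last hypothesis, and everything else is continuous on bounded sets.\<close>

lemma flow_speed_bound:
  assumes R: "0 \<le> R"
  obtains C where "\<And>x u d. d \<in> flow_map \<H> x u \<Longrightarrow> x \<in> state_space \<Longrightarrow> norm u \<le> R \<Longrightarrow> norm (st_e x) \<le> R \<Longrightarrow> norm (st_eps x) \<le> R \<Longrightarrow>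
    norm (st_eta x) \<le> R \<Longrightarrow> norm (st_wh x) \<le> R \<Longrightarrow> norm (ho S (st_z x)) \<le> R \<Longrightarrow>
    frechet_derivative (ho S) (at (st_z x)) (st_z d) = fp S (ho S (st_z x)) 0 \<Longrightarrow> norm (snd d) \<le> C"
proof -
  \<comment> \<open>The plant state \<open>ho z - e\<close> has norm at most \<open>2 * R\<close>
    and the disturbance at most \<open>R\<close>, so their pair lies in the ball of radius
    \<open>3 * R\<close>.\<close>
  obtain Bf where Bf: "Bf \<ge> 0" "\<And>x. norm x \<le> 3 * R \<Longrightarrow> norm (fp S (fst x) (snd x)) \<le> Bf" using bounded_on_cball[OF cont_fp] by blast
  have fpb: "norm (fp S a b) \<le> Bf" if "norm a \<le> 2 * R" "norm b \<le> R" for a b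
    using Bf(2)[of "(a, b)"] norm_Pair_le[of a b] that by simp
  have "\<exists>B\<ge>0. \<forall>x. norm x \<le> 2 * R \<longrightarrow> (\<forall>v. norm (frechet_derivative (hpi S i) (at x) v) \<le> B * norm v)" for i
  proof -
    obtain D where D: "continuous_on UNIV D" "\<And>x. frechet_derivative (hpi S i) (at x) = blinfun_apply (D x)"
      using hpi_deriv[of i] by metis
    obtain B where B: "B \<ge> 0" "\<And>x. norm x \<le> 2 * R \<Longrightarrow> norm (D x) \<le> B" using bounded_on_cball[OF D(1)] by blast
    have "norm (blinfun_apply (D x) v) \<le> B * norm v" if "norm x \<le> 2 * R" for x v
      using norm_blinfun[of "D x" v] B(2)[OF that] by (meson mult_right_mono norm_ge_zero order.trans)
    then show ?thesis using B(1) D(2) by auto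
  qed
  then obtain Bd where Bd: "\<And>i. Bd i \<ge> 0" "\<And>i x v. norm x \<le> 2 * R \<Longrightarrow> norm (frechet_derivative (hpi S i) (at x) v) \<le> Bd i * norm v"
    by metis
  have "\<exists>B\<ge>0. \<forall>x. norm x \<le> 2 * R \<longrightarrow> norm (hpi S i x) \<le> B" for i
    using bounded_on_cball[OF cont_hpi[of i], of "2 * R"] by metis
  then obtain Bh where Bh: "\<And>i. Bh i \<ge> 0" "\<And>i x. norm x \<le> 2 * R \<Longrightarrow> norm (hpi S i x) \<le> Bh i" by metis
  have "\<exists>B. \<forall>s\<in>{0..2 * Bh i + R}. \<bar>rho P i s\<bar> \<le> B" for i
  proof -
    have "bounded (rho P i ` {0..2 * Bh i + R})"
    proof (intro compact_imp_bounded compact_continuous_image compact_Icc)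
      have "continuous_on {0..} (rho P i)" using V_facts(7)[of i] unfolding pos_semidefinite_def by blast
      then show "continuous_on {0..2 * Bh i + R} (rho P i)" by (rule continuous_on_subset) auto
    qed
    then show ?thesis unfolding bounded_iff by auto
  qed
  then obtain Br where Br: "\<And>i s. s \<in> {0..2 * Bh i + R} \<Longrightarrow> \<bar>rho P i s\<bar> \<le> Br i" by metis
  define Be where "Be i = Br i + gam_bar P i * beta_ratio P i * (bup P i * (3 * R))\<^sup>2 + sig P i R + spar P i" for i
  define C where "C = 2 * Bf + (\<Sum>i\<in>UNIV. 2 * (Bd i * Bf)) + norm (\<chi> i::'k. (1::real)) + (\<Sum>i\<in>UNIV. Be i)"
  show ?thesis
  proof (rule that[of C])
    fix x u d
    assume d: "d \<in> flow_map \<H> x u" and x: "x \<in> state_space" and u: "norm u \<le> R"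
      and b: "norm (st_e x) \<le> R" "norm (st_eps x) \<le> R" "norm (st_eta x) \<le> R" "norm (st_wh x) \<le> R" "norm (ho S (st_z x)) \<le> R"
      and hz: "frechet_derivative (ho S) (at (st_z x)) (st_z d) = fp S (ho S (st_z x)) 0"
    have dd: "st_z d = f_z S (st_z x) (st_e x) (st_eps x) (st_wh x)"
      "st_e d = f_e S (st_z x) (st_e x) (st_eps x) (st_wh x) (fst u)"
      "st_eps d = (\<Sum>i\<in>UNIV. g_i S i (st_z x) (st_e x) (fst u))" "st_wh d = 0" "st_tau d = (\<chi> i. 1)"
      "\<And>i. \<exists>\<omega>\<in>omega (tMIET P i) (st_tau x $ i). st_eta d $ i = eta_flow i x u \<omega>"
      using d by (simp_all add: flow_map_iff)
    have v: "norm (fst u) \<le> R" and w: "norm (snd u) \<le> R" using u norm_le_norm_fst[of u] norm_le_norm_snd[of u] by linarith+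
    have xx: "norm (ho S (st_z x) - st_e x) \<le> 2 * R" using norm_triangle_ineq4[of "ho S (st_z x)" "st_e x"] b by linarith
    have hh: "norm (ho S (st_z x)) \<le> 2 * R" using b R by linarith
    have f1: "norm (fp S (ho S (st_z x)) 0) \<le> Bf" by (rule fpb) (use hh R in auto)
    have f2: "norm (fp S (ho S (st_z x) - st_e x) (fst u)) \<le> Bf" by (rule fpb[OF xx v])
    have "st_e d = fp S (ho S (st_z x)) 0 - fp S (ho S (st_z x) - st_e x) (fst u)"
      using hz unfolding dd f_e_def by simp
    then have 1: "norm (st_e d) \<le> 2 * Bf"
      using f1 f2 norm_triangle_ineq4[of "fp S (ho S (st_z x)) 0" "fp S (ho S (st_z x) - st_e x) (fst u)"] by simp
    have "norm (g_i S i (st_z x) (st_e x) (fst u)) \<le> 2 * (Bd i * Bf)" for i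
    proof -
      have "norm (g_i S i (st_z x) (st_e x) (fst u)) \<le> Bd i * norm (fp S (ho S (st_z x)) 0) + Bd i * norm (fp S (ho S (st_z x) - st_e x) (fst u))"
        unfolding g_i_def by (rule order.trans[OF norm_triangle_ineq4 add_mono[OF Bd(2)[OF hh] Bd(2)[OF xx]]])
      also have "\<dots> \<le> Bd i * Bf + Bd i * Bf" by (intro add_mono mult_left_mono f1 f2 Bd(1))
      finally show ?thesis by (simp only: mult_2)
    qed
    then have 2: "norm (st_eps d) \<le> (\<Sum>i\<in>UNIV. 2 * (Bd i * Bf))" unfolding dd by (rule sum_norm_le)
    have "\<bar>st_eta d $ i\<bar> \<le> Be i" for i
    proof -
      obtain \<omega> where om: "\<omega> \<in> omega (tMIET P i) (st_tau x $ i)" "st_eta d $ i = eta_flow i x u \<omega>" using dd(6) by blast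
      have q: "norm (q_i S i (st_z x) (st_e x) (snd u)) \<le> 2 * Bh i + R"
      proof -
        have "norm (q_i S i (st_z x) (st_e x) (snd u)) \<le> norm (hpi S i (ho S (st_z x))) + norm (hpi S i (ho S (st_z x) - st_e x)) + norm (blk i (snd u))"
          unfolding q_i_def using norm_triangle_ineq4[of "hpi S i (ho S (st_z x)) - hpi S i (ho S (st_z x) - st_e x)" "blk i (snd u)"]
            norm_triangle_ineq4[of "hpi S i (ho S (st_z x))" "hpi S i (ho S (st_z x) - st_e x)"] by linarith
        then show ?thesis using Bh(2)[OF hh, of i] Bh(2)[OF xx, of i] norm_block_le[of "node S" i "snd u"] w by linarith
      qed
      have A: "\<bar>rho P i (norm (q_i S i (st_z x) (st_e x) (snd u)))\<bar> \<le> Br i" by (rule Br) (use q in auto)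
      have "norm (blk i (st_eps x + st_wh x - snd u)) \<le> norm (st_eps x + st_wh x - snd u)" by (rule norm_block_le)
      also have "\<dots> \<le> 3 * R"
        using norm_triangle_ineq4[of "st_eps x + st_wh x" "snd u"] norm_triangle_ineq[of "st_eps x" "st_wh x"] b w by linarith
      finally have "bup P i * norm (blk i (st_eps x + st_wh x - snd u)) \<le> bup P i * (3 * R)" using W_facts(3)[of i] by (intro mult_left_mono) auto
      then have "Wi i (st_eps x + st_wh x - snd u) \<le> bup P i * (3 * R)" using W_facts(6)[of i "st_eps x + st_wh x - snd u"] by linarith
      then have W: "(Wi i (st_eps x + st_wh x - snd u))\<^sup>2 \<le> (bup P i * (3 * R))\<^sup>2" by (intro power_mono W_nonneg)
      have cb: "0 \<le> gam_bar P i * beta_ratio P i" using gam_bar_nonneg[of i] by (simp add: beta_ratio_def)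
      let ?T = "gam_bar P i * beta_ratio P i * (Wi i (st_eps x + st_wh x - snd u))\<^sup>2"
      have T: "0 \<le> ?T" "?T \<le> gam_bar P i * beta_ratio P i * (bup P i * (3 * R))\<^sup>2" using cb W by (auto intro: mult_left_mono)
      have "\<omega> * ?T \<le> ?T" by (rule mult_left_le_one_le[OF T(1) omega_cases(1,2)[OF om(1)]])
      moreover have "0 \<le> \<omega> * ?T" by (rule mult_nonneg_nonneg[OF omega_cases(1)[OF om(1)] T(1)])
      ultimately have B: "0 \<le> \<omega> * ?T" "\<omega> * ?T \<le> gam_bar P i * beta_ratio P i * (bup P i * (3 * R))\<^sup>2" using T(2) by linarith+
      have "0 \<le> st_eta x $ i" "st_eta x $ i \<le> R"
        using x component_le_norm_cart[of "st_eta x" i] b(3) by (auto simp: state_space_iff)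
      then have D: "0 \<le> sig P i (st_eta x $ i)" "sig P i (st_eta x $ i) \<le> sig P i R"
        using class_K_nonneg[OF class_K_infD[OF sig]] class_K_mono[OF class_K_infD[OF sig]] by blast+
      have "st_eta d $ i = rho P i (norm (q_i S i (st_z x) (st_e x) (snd u))) - \<omega> * ?T - sig P i (st_eta x $ i) + spar P i"
        unfolding om(2) eta_flow_def by (simp add: mult.assoc)
      then show ?thesis using A B D spar[of i] unfolding Be_def abs_le_iff by linarith
    qed
    then have 3: "norm (st_eta d) \<le> (\<Sum>i\<in>UNIV. Be i)"
      by (intro order.trans[OF norm_le_l1_cart] sum_mono)
    have "norm (snd d) \<le> norm (st_e d) + (norm (st_eps d) + (norm (st_wh d) + (norm (st_tau d) + norm (st_eta d))))"
      using norm_le_fst_snd[of "snd d"] norm_le_fst_snd[of "snd (snd d)"] norm_le_fst_snd[of "snd (snd (snd d))"]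
        norm_le_fst_snd[of "snd (snd (snd (snd d)))"] by linarith
    then show "norm (snd d) \<le> C" using 1 2 3 unfolding C_def dd(4,5) by simp
  qed
qed

text \<open>Two different arguments for the limit at \<open>T\<close>. The component
  \<open>z\<close> coincides with a global observer solution, which has a value at \<open>T\<close>.
  All other components have bounded speed, because the Lyapunov bound and the estimated trajectory
  confine the state; a Lipschitz function extends to the closure of its domain.\<close>

lemma flow_arc_close:
  assumes T: "T > 0" and ac: "\<And>r. r < T \<Longrightarrow> abs_cont_on {0..r} x"
    and fl: "AE t in lebesgue. t \<in> {0..<T} \<longrightarrow> (x t, u t) \<in> flow_set \<H> \<and>
       (\<exists>d\<in>flow_map \<H> (x t) (u t). (x has_vector_derivative d) (at t within {0..<T}))"
    and st: "\<And>t. t \<in> {0..<T} \<Longrightarrow> x t \<in> state_space"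
    and ub: "AE t in lebesgue. t \<in> {0..<T} \<longrightarrow> norm (u t) \<le> N"
  shows "\<exists>y. abs_cont_on {0..T} y \<and> (\<forall>t\<in>{0..<T}. y t = x t)"
proof -
  have fa: "flow_arc \<H> 0 r x u" if "r < T" for r
    unfolding flow_arc_def
  proof
    show "abs_cont_on {0..r} x" by (rule ac[OF that])
    show "AE t in lebesgue. t \<in> {0..r} \<longrightarrow> (x t, u t) \<in> flow_set \<H> \<and>
       (\<exists>d\<in>flow_map \<H> (x t) (u t). (x has_vector_derivative d) (at t within {0..r}))"
      using fl
    proof eventually_elim
      case (elim t)
      have "{0..r} \<subseteq> {0..<T}" using that by auto
      then show ?case using elim by (blast intro: has_vector_derivative_within_subset)
    qed
  qed
  have wh: "st_wh (x t) = st_wh (x 0)" if "t \<in> {0..<T}" for t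
    using flow_wh[OF fa, of t] that by auto
  \<comment> \<open>The initial sample is arbitrary here, so its own norm enters the bound on the
    supply next to that of the input.\<close>
  define r0 where "r0 = max (max N 0) (norm (st_wh (x 0)))"
  have r0: "0 \<le> r0" "N \<le> r0" "norm (st_wh (x 0)) \<le> r0" by (auto simp: r0_def)
  define C0 where "C0 = noise_gain r0 + (\<Sum>i\<in>UNIV. spar P i)"
  have C0: "0 \<le> C0" unfolding C0_def using spar by (intro add_nonneg_nonneg class_K_nonneg[OF noise_gain_K] sum_nonneg r0) auto
  define U1 where "U1 = lyap (x 0) + C0 * T"
  have U: "lyap (x t) \<le> U1" if t: "t \<in> {0..<T}" for t
  proof -
    have "lyap (x t) - lyap (x 0) \<le> C0 * (t - 0)"
    proof (rule lyap_increment[OF fa])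
      show "x s \<in> state_space" if "s \<in> {0..t}" for s by (rule st) (use that t in auto)
      show "AE s in lebesgue. s \<in> {0..t} \<longrightarrow> - diss (x s) + supply_rate (x s) (u s) \<le> C0"
        using ub
      proof (eventually_elim, intro impI)
        fix s assume h: "s \<in> {0..<T} \<longrightarrow> norm (u s) \<le> N" "s \<in> {0..t}"
        then have s: "s \<in> {0..<T}" using t by auto
        have "norm (blk i (st_wh (x s))) \<le> r0" for i
          using norm_block_le[of "node S" i "st_wh (x s)"] wh[OF s] r0(3) by simp
        then have "supply_rate (x s) (u s) \<le> C0" unfolding C0_def using h s r0(2) by (intro supply_rate_le) auto
        then show "- diss (x s) + supply_rate (x s) (u s) \<le> C0" using diss_nonneg[OF st[OF s]] by linarith
      qed
    qed (use t in auto)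
    also have "C0 * (t - 0) \<le> C0 * T" using t C0 by (intro mult_left_mono) auto
    finally show ?thesis by (simp add: U1_def)
  qed
  obtain \<theta> where \<theta>: "class_K \<theta>"
    "\<And>x. x \<in> state_space \<Longrightarrow> norm (st_e x) + norm (st_eps x) + norm (st_eta x) \<le> \<theta> (lyap x)"
    using lyap_bounds by metis
  have bnd: "norm (st_e (x t)) + norm (st_eps (x t)) + norm (st_eta (x t)) \<le> \<theta> U1" if "t \<in> {0..<T}" for t
    using \<theta>(2)[OF st[OF that]] class_K_mono[OF \<theta>(1) lyap_lower(6)[OF st[OF that]] U[OF that]] by linarith
  have cx: "continuous_on {0..<T} x" by (intro continuous_on_half_openI abs_cont_on_imp_continuous_on ac)
  define g where "g t = hp S (ho S (st_z (x t)) - st_e (x t)) + st_eps (x t) + st_wh (x t)" for t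
  \<comment> \<open>Observer completeness speaks of signals on all nonnegative times. Continuing the
    held output by 0 keeps it measurable and does not influence the solution before
    \<open>T\<close>.\<close>
  define y where "y t = (if t \<in> {0..<T} then g t else 0)" for t
  have "continuous_on {0..<T} (\<lambda>t. ho S (st_z (x t)) - st_e (x t))"
    by (intro continuous_on_diff continuous_on_fst continuous_on_snd cx continuous_on_compose2[OF cont_ho]) auto
  then have "continuous_on {0..<T} (\<lambda>t. hp S (ho S (st_z (x t)) - st_e (x t)))"
    by (intro continuous_on_compose2[OF cont_hp]) auto
  then have "continuous_on {0..<T} g" unfolding g_def by (intro continuous_intros cx)
  then have "g \<in> borel_measurable (lebesgue_on {0..<T})" by (rule continuous_imp_measurable_on_sets_lebesgue) auto
  then have "(\<lambda>t. if t \<in> {0..<T} then g t else 0) \<in> borel_measurable (lebesgue_on ({0..} \<union> {0..<T}))"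
    by (intro borel_measurable_lebesgue_on_Un_if) auto
  moreover have "{0..} \<union> {0..<T} = {0..}" by auto
  ultimately have ym: "y \<in> borel_measurable (lebesgue_on {0..})" unfolding y_def by simp
  have zsol: "ode_solution (fo S) y {0..<T} (\<lambda>t. st_z (x t))"
    unfolding ode_solution_def locally_abs_cont_on_def
  proof (intro conjI allI impI)
    fix c d assume cd: "{c..d} \<subseteq> {0..<T}"
    have "abs_cont_on {c..d} x"
      \<comment> \<open>If \<open>{c..d}\<close> is empty, nothing is known about \<open>d\<close>;
        0 then serves as an end point below \<open>T\<close>.\<close>
      by (rule abs_cont_on_subset[OF ac[of "if c \<le> d then d else 0"]]) (use cd T in auto)
    then show "abs_cont_on {c..d} (\<lambda>t. st_z (x t))"
      by (rule abs_cont_on_bounded[of _ _ _ 1]) (metis fst_diff mult_1 state_norms(1))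
  next
    show "AE t in lebesgue. t \<in> {0..<T} \<longrightarrow> ((\<lambda>t. st_z (x t)) has_vector_derivative fo S (st_z (x t)) (y t)) (at t within {0..<T})"
      using fl
    proof (eventually_elim, intro impI)
      fix t assume h: "t \<in> {0..<T} \<longrightarrow> (x t, u t) \<in> flow_set \<H> \<and>
       (\<exists>d\<in>flow_map \<H> (x t) (u t). (x has_vector_derivative d) (at t within {0..<T}))" "t \<in> {0..<T}"
      then obtain d where d: "d \<in> flow_map \<H> (x t) (u t)" "(x has_vector_derivative d) (at t within {0..<T})" by blast
      have "st_z d = fo S (st_z (x t)) (y t)" using d(1) h(2) by (simp add: flow_map_iff f_z_def y_def g_def)
      then show "((\<lambda>t. st_z (x t)) has_vector_derivative fo S (st_z (x t)) (y t)) (at t within {0..<T})"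
        using has_vector_derivative_fst[OF d(2)] by simp
    qed
  qed
  have "unique_global_solution (fo S) y (st_z (x 0))" using observer ym unfolding observer_forward_complete_def by blast
  then obtain zg where zg: "ode_solution (fo S) y {0..} zg"
    and uniq: "\<forall>T>0. \<forall>x'. x' 0 = st_z (x 0) \<and> ode_solution (fo S) y {0..<T} x' \<longrightarrow> (\<forall>t\<in>{0..<T}. x' t = zg t)"
    unfolding unique_global_solution_def by blast
  have zg_eq: "st_z (x t) = zg t" if "t \<in> {0..<T}" for t
    using uniq[rule_format, of T "\<lambda>t. st_z (x t)"] T zsol that by simp
  obtain ch where ch: "ch 0 = ho S (st_z (x 0))" "ode_solution (fp S) (\<lambda>_. 0) {0..} ch" using plant_solution by blast
  have hz: "ho S (st_z (x t)) = ch t" if "t \<in> {0..<T}" for t by (rule observer_tracks_plant[OF zsol ch(2,1) that])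
  have "continuous_on {0..T} ch" by (intro abs_cont_on_imp_continuous_on ode_solution_abs_cont[OF ch(2)]) auto
  then have "bounded (ch ` {0..T})" by (intro compact_imp_bounded compact_continuous_image compact_Icc)
  then obtain Bc where Bc: "\<forall>v\<in>ch ` {0..T}. norm v \<le> Bc" unfolding bounded_iff by blast
  define R where "R = Max {r0, \<theta> U1, Bc}"
  have R: "r0 \<le> R" "\<theta> U1 \<le> R" "Bc \<le> R" by (auto simp: R_def)
  have R0: "0 \<le> R" using r0 R by linarith
  obtain C where C: "\<And>x u d. d \<in> flow_map \<H> x u \<Longrightarrow> x \<in> state_space \<Longrightarrow> norm u \<le> R \<Longrightarrow> norm (st_e x) \<le> R \<Longrightarrow> norm (st_eps x) \<le> R \<Longrightarrow>
    norm (st_eta x) \<le> R \<Longrightarrow> norm (st_wh x) \<le> R \<Longrightarrow> norm (ho S (st_z x)) \<le> R \<Longrightarrow>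
    frechet_derivative (ho S) (at (st_z x)) (st_z d) = fp S (ho S (st_z x)) 0 \<Longrightarrow> norm (snd d) \<le> C"
    by (rule flow_speed_bound[OF R0]) blast
  have "AE t in lebesgue. t \<in> {0..} \<longrightarrow> (ch has_vector_derivative fp S (ch t) 0) (at t within {0..})"
    using ch(2) by (simp add: ode_solution_def)
  with fl ub have spd: "AE t in lebesgue. t \<in> {0..<T} \<longrightarrow> (\<exists>d. norm d \<le> C \<and> ((\<lambda>t. snd (x t)) has_vector_derivative d) (at t within {0..<T}))"
  proof (eventually_elim, intro impI)
    fix t assume h: "t \<in> {0..<T} \<longrightarrow> (x t, u t) \<in> flow_set \<H> \<and>
       (\<exists>d\<in>flow_map \<H> (x t) (u t). (x has_vector_derivative d) (at t within {0..<T}))"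
      "t \<in> {0..<T} \<longrightarrow> norm (u t) \<le> N" "t \<in> {0..} \<longrightarrow> (ch has_vector_derivative fp S (ch t) 0) (at t within {0..})" and t: "t \<in> {0..<T}"
    then obtain d where d: "d \<in> flow_map \<H> (x t) (u t)" "(x has_vector_derivative d) (at t within {0..<T})" by blast
    have "(ch has_vector_derivative fp S (ch t) 0) (at t within {0..})" using h(3) t by simp
    then have c': "(ch has_vector_derivative fp S (ch t) 0) (at t within {0..<T})"
      by (rule has_vector_derivative_within_subset) auto
    have "frechet_derivative (ho S) (at (st_z (x t))) (st_z d) = fp S (ch t) 0"
      by (rule ho_flow_derivative[OF has_vector_derivative_fst[OF d(2)] c' hz t at_within_neq_bot_half_open[OF t]])
    moreover have "norm (ch t) \<le> R" using Bc R(3) t by (meson atLeastAtMost_iff atLeastLessThan_iff imageI less_imp_le order.trans)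
    moreover have "norm (st_e (x t)) \<le> R" "norm (st_eps (x t)) \<le> R" "norm (st_eta (x t)) \<le> R"
      using bnd[OF t] R(2) norm_ge_zero[of "st_e (x t)"] norm_ge_zero[of "st_eps (x t)"] norm_ge_zero[of "st_eta (x t)"] by linarith+
    moreover have "norm (u t) \<le> R" "norm (st_wh (x t)) \<le> R" using R(1) r0 h(2) t wh[OF t] by auto
    ultimately have "norm (snd d) \<le> C" by (intro C[OF d(1) st[OF t]]) (simp_all add: hz[OF t])
    then show "\<exists>d. norm d \<le> C \<and> ((\<lambda>t. snd (x t)) has_vector_derivative d) (at t within {0..<T})"
      using has_vector_derivative_snd[OF d(2)] by blast
  qed
  have inc: "norm (snd (x q) - snd (x p)) \<le> C * (q - p)" if "0 \<le> p" "p \<le> q" "q < T" for p q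
  proof (rule norm_increment_le[OF that(2)])
    have "abs_cont_on {p..q} x" by (rule abs_cont_on_subset[OF ac[OF that(3)]]) (use that in auto)
    then show "abs_cont_on {p..q} (\<lambda>t. snd (x t))"
      by (rule abs_cont_on_bounded[of _ _ _ 1]) (metis snd_diff mult_1 norm_le_norm_snd)
    show "AE t in lebesgue. t \<in> {p..q} \<longrightarrow> (\<exists>d. norm d \<le> C \<and> ((\<lambda>t. snd (x t)) has_vector_derivative d) (at t within {p..q}))"
      using spd
    proof eventually_elim
      case (elim t)
      have "{p..q} \<subseteq> {0..<T}" using that by auto
      then show ?case using elim by (blast intro: has_vector_derivative_within_subset)
    qed
  qed
  have "(max C 0)-lipschitz_on {0..<T} (\<lambda>t. snd (x t))"
  proof (rule lipschitz_onI)
    fix p q assume pq: "p \<in> {0..<T}" "q \<in> {0..<T}"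
    have "norm (snd (x (max p q)) - snd (x (min p q))) \<le> C * (max p q - min p q)" using pq by (intro inc) auto
    also have "\<dots> \<le> max C 0 * (max p q - min p q)" by (intro mult_right_mono) auto
    finally show "dist (snd (x p)) (snd (x q)) \<le> max C 0 * dist p q"
      by (auto simp: dist_norm max_def min_def norm_minus_commute split: if_splits)
  qed simp
  from lipschitz_extend_closure[OF this] obtain k where k: "(max C 0)-lipschitz_on (closure {0..<T}) k" "\<And>t. t \<in> {0..<T} \<Longrightarrow> k t = snd (x t)"
    by blast
  have "closure {0..<T} = {0..T}" using T by simp
  then have "abs_cont_on {0..T} k" using k(1) by (intro abs_cont_on_lipschitz) simp
  moreover have "abs_cont_on {0..T} zg" by (rule ode_solution_abs_cont[OF zg]) auto
  ultimately have "abs_cont_on {0..T} (\<lambda>t. (zg t, k t))" by (intro abs_cont_on_Pair)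
  moreover have "(zg t, k t) = x t" if "t \<in> {0..<T}" for t using k(2)[OF that] zg_eq[OF that] by (metis prod.collapse)
  ultimately show ?thesis by blast
qed

end

section \<open>Continuing a flow beyond its last point\<close>

lemma borel_measurable_lebesgue_on_point:
  fixes f :: "real \<Rightarrow> 'b::euclidean_space"
  assumes f: "f \<in> borel_measurable (lebesgue_on S)" and S: "S \<in> sets lebesgue"
  shows "(\<lambda>t. if t = p then c else f t) \<in> borel_measurable (lebesgue_on (insert p S))"
proof -
  have "(\<lambda>t. if t \<in> {p} then c else f t) \<in> borel_measurable (lebesgue_on (S \<union> {p}))"
    by (rule borel_measurable_lebesgue_on_Un_if[OF f _ S]) auto
  then show ?thesis by simp
qed

lemma has_vector_derivative_vec_lambda:
  fixes f :: "'i::finite \<Rightarrow> real \<Rightarrow> real"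
  assumes "\<And>i. (f i has_vector_derivative f' i) (at t within I)"
  shows "((\<lambda>s. (\<chi> i. f i s)) has_vector_derivative (\<chi> i. f' i)) (at t within I)"
proof -
  have e: "(\<chi> i. c i) = (\<Sum>i\<in>UNIV. c i *\<^sub>R axis i 1)" for c :: "'i \<Rightarrow> real"
    by (simp add: vec_eq_iff axis_def if_distrib cong: if_cong)
  have "((\<lambda>s. f i s *\<^sub>R (axis i 1 :: real^'i)) has_vector_derivative f' i *\<^sub>R axis i 1) (at t within I)" for i
    by (rule bounded_linear.has_vector_derivative[OF bounded_linear_scaleR_left assms])
  then show ?thesis unfolding e by (intro has_vector_derivative_sum)
qed

lemma borel_measurable_lebesgue_on_shift:
  fixes f :: "real \<Rightarrow> 'b::euclidean_space"
  assumes f: "f \<in> borel_measurable (lebesgue_on {a..b})"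
  shows "(\<lambda>t. f (t + c)) \<in> borel_measurable (lebesgue_on {a - c..b - c})"
proof -
  let ?g = "\<lambda>t. if t \<in> {a..b} then f t else 0"
  have g: "?g \<in> borel_measurable lebesgue" by (rule borel_measurable_if[THEN iffD2, OF _ f]) simp
  have "(\<lambda>t::real. t + c) \<in> lebesgue \<rightarrow>\<^sub>M lebesgue"
    using lebesgue_affine_measurable[of "\<lambda>_. 1" c] by (simp add: add.commute)
  from measurable_compose[OF this g] have "(\<lambda>t. ?g (t + c)) \<in> borel_measurable lebesgue" .
  moreover have "?g (t + c) = (if t \<in> {a - c..b - c} then f (t + c) else 0)" for t by auto
  ultimately have "(\<lambda>t. if t \<in> {a - c..b - c} then f (t + c) else 0) \<in> borel_measurable lebesgue" by simp
  then show ?thesis by (rule borel_measurable_if[THEN iffD1, rotated]) simp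
qed

context estimation_model
begin

text \<open>The estimate \<open>ch\<close> and the plant state \<open>X\<close> do not depend on \<open>fo\<close>, so the held output \<open>yh\<close> is
  known beforehand and the loop is opened. The continuation uses the noise \<open>w = \<epsilon> + wh\<close>: then the
  negative term of the trigger dynamics vanishes, \<open>q\<^sub>i\<close> is constant, and \<open>\<eta>\<^sub>i\<close> satisfies an
  autonomous scalar equation that keeps \<open>\<eta>\<^sub>i \<ge> 0\<close>.\<close>

lemma flow_continuation:
  assumes x0: "x0 \<in> state_space"
  obtains \<delta> x u B where "0 < \<delta>" "x 0 = x0" "u 0 = c" "flow_arc \<H> 0 \<delta> x u" "u \<in> borel_measurable (lebesgue_on {0..\<delta>})"
    "AE t in lebesgue. t \<in> {0..\<delta>} \<longrightarrow> norm (u t) \<le> B"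
proof -
  define z0 e0 eps0 wh0 tau0 eta0 where defs: "z0 = st_z x0" "e0 = st_e x0" "eps0 = st_eps x0" "wh0 = st_wh x0" "tau0 = st_tau x0" "eta0 = st_eta x0"
  have tau0: "0 \<le> tau0 $ i" and eta0: "0 \<le> eta0 $ i" for i using x0 by (auto simp: state_space_iff defs)
  obtain ch where ch: "ch 0 = ho S z0" "ode_solution (fp S) (\<lambda>_. 0) {0..} ch" using plant_solution by blast
  obtain X where X: "X 0 = ho S z0 - e0" "ode_solution (fp S) (\<lambda>_. 0) {0..} X" using plant_solution by blast
  have cont: "continuous_on {0..b} f" if "ode_solution (fp S) (\<lambda>_. 0) {0..} f" for f b
    by (intro abs_cont_on_imp_continuous_on ode_solution_abs_cont[OF that]) auto
  \<comment> \<open>Starts at output plus sampling error plus sample. Between transmissions the held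
    output follows the output map along the undisturbed model, so it gains the increment of
    \<open>hp S (ch t)\<close>.\<close>
  define yh where "yh t = hp S (X 0) + eps0 + wh0 + (hp S (ch t) - hp S (ch 0))" for t
  have hpc: "continuous_on {0..b} (\<lambda>t. hp S (f t))" if "ode_solution (fp S) (\<lambda>_. 0) {0..} f" for f b
    by (rule continuous_on_compose2[OF cont_hp cont[OF that]]) auto
  have cyh: "continuous_on {0..b} yh" for b unfolding yh_def by (intro continuous_intros hpc[OF ch(2)])
  have "continuous_on {0..} yh" by (rule continuous_on_atLeastI) (rule cyh)
  then have "yh \<in> borel_measurable (lebesgue_on {0..})" by (rule continuous_imp_measurable_on_sets_lebesgue) auto
  then have "unique_global_solution (fo S) yh z0" using observer unfolding observer_forward_complete_def by blast
  then obtain Z where Z: "Z 0 = z0" "ode_solution (fo S) yh {0..} Z" unfolding unique_global_solution_def by blast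
  have hz: "ho S (Z t) = ch t" if "0 \<le> t" for t
    by (rule observer_tracks_plant[OF ode_solution_subset[OF Z(2), of "{0..<t + 1}"] ch(2)]) (use that Z(1) ch(1) in auto)
  \<comment> \<open>With \<open>w = yh t - hp S (X t)\<close> the argument of \<open>rho\<close> in
    the trigger dynamics is the block of \<open>hp S (ch t) - yh t\<close>, in which the
    time-dependent terms cancel. This leaves its initial value.\<close>
  define r where "r i = rho P i (norm (blk i (hp S (ch 0) - hp S (X 0) - eps0 - wh0)))" for i
  have r0: "0 \<le> r i" for i unfolding r_def using V_facts(7)[of i] by (simp add: pos_semidefinite_def)
  have "\<exists>\<delta> h B. 0 < \<delta> \<and> h 0 = eta0 $ i \<and> (\<forall>t\<in>{0..\<delta>}. 0 \<le> h t) \<and> B-lipschitz_on {0..\<delta>} h \<and>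
    (\<forall>t\<in>{0<..<\<delta>}. (h has_real_derivative r i + spar P i - sig P i (h t)) (at t))" for i
  proof (rule autonomous_nonneg[OF _ _ eta0, of "\<lambda>s. r i + spar P i - sig P i s"])
    have sK: "class_K (sig P i)" by (rule class_K_infD[OF sig])
    show "continuous_on {0..} (\<lambda>s. r i + spar P i - sig P i s)" using sK by (intro continuous_intros) (simp add: class_K_def)
    show "0 \<le> r i + spar P i - sig P i 0" using r0[of i] spar[of i] class_K_0[OF sK] by simp
  qed
  then obtain dl h Bl where h: "\<And>i. 0 < dl i" "\<And>i. h i 0 = eta0 $ i" "\<And>i t. t \<in> {0..dl i} \<Longrightarrow> 0 \<le> h i t"
    "\<And>i. (Bl i)-lipschitz_on {0..dl i} (h i)"
    "\<And>i t. t \<in> {0<..<dl i} \<Longrightarrow> (h i has_real_derivative r i + spar P i - sig P i (h i t)) (at t)"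
    by metis
  define \<delta> where "\<delta> = Min (range dl)"
  have \<delta>: "0 < \<delta>" "\<And>i. \<delta> \<le> dl i" unfolding \<delta>_def using h(1) by (auto simp: Min_gr_iff)
  define ep where "ep t = yh t - wh0 - hp S (X t)" for t
  define x where "x t = (Z t, ch t - X t, ep t, wh0, tau0 + t *\<^sub>R (\<chi> i. 1), (\<chi> i. h i t))" for t
  define u0 where "u0 t = (0 :: real^'p, yh t - hp S (X t))" for t
  \<comment> \<open>The value at the junction is dictated by the given solution pair. As a single
    time it does not affect the flow.\<close>
  define u where "u t = (if t = 0 then c else u0 t)" for t
  have x00: "x 0 = x0"
    by (simp add: x_def Z(1) ch(1) X(1) ep_def yh_def h(2) defs prod_eq_iff vec_eq_iff)
  have cu: "continuous_on {0..\<delta>} u0" unfolding u0_def by (intro continuous_intros cyh hpc[OF X(2)])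
  have "u0 \<in> borel_measurable (lebesgue_on {0..\<delta>})" by (rule continuous_imp_measurable_on_sets_lebesgue[OF cu]) auto
  from borel_measurable_lebesgue_on_point[OF this, of 0 c] have um: "u \<in> borel_measurable (lebesgue_on {0..\<delta>})"
    unfolding u_def using \<delta>(1) by (simp add: insert_absorb)
  have "bounded (u0 ` {0..\<delta>})" by (intro compact_imp_bounded compact_continuous_image cu compact_Icc)
  then obtain B where "\<forall>v\<in>u0 ` {0..\<delta>}. norm v \<le> B" unfolding bounded_iff by blast
  then have B: "norm (u0 t) \<le> B" if "t \<in> {0..\<delta>}" for t using that by blast
  have ub: "AE t in lebesgue. t \<in> {0..\<delta>} \<longrightarrow> norm (u t) \<le> B"
    using AE_lebesgue_neq[of 0] by eventually_elim (auto simp: u_def B)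
  have acs: "abs_cont_on {0..\<delta>} f" if "ode_solution F w {0..} f" for F :: "'z::real_normed_vector \<Rightarrow> 'w \<Rightarrow> 'z" and w f
    by (rule ode_solution_abs_cont[OF that]) auto
  have ace: "abs_cont_on {0..\<delta>} ep"
  proof -
    \<comment> \<open>On a ball that contains both trajectories the output map is Lipschitz, so
      \<open>ep\<close> inherits absolute continuity from them.\<close>
    have "bounded (ch ` {0..\<delta>} \<union> X ` {0..\<delta>})"
      by (intro bounded_Un[THEN iffD2] conjI compact_imp_bounded compact_continuous_image cont ch X compact_Icc)
    then obtain R where R: "\<forall>v\<in>ch ` {0..\<delta>} \<union> X ` {0..\<delta>}. norm v \<le> R" unfolding bounded_iff by blast
    obtain Bh where Bh: "Bh \<ge> 0" "\<And>x y. norm x \<le> R \<Longrightarrow> norm y \<le> R \<Longrightarrow> norm (hp S x - hp S y) \<le> Bh * norm (x - y)"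
      using hp_lipschitz by blast
    show ?thesis
    proof (rule abs_cont_on_bounded2[OF acs[OF ch(2)] acs[OF X(2)], of ep Bh])
      fix p q assume pq: "p \<in> {0..\<delta>}" "q \<in> {0..\<delta>}"
      have "ep q - ep p = (hp S (ch q) - hp S (ch p)) - (hp S (X q) - hp S (X p))" by (simp add: ep_def yh_def)
      then have "norm (ep q - ep p) \<le> norm (hp S (ch q) - hp S (ch p)) + norm (hp S (X q) - hp S (X p))"
        using norm_triangle_ineq4 by metis
      also have "\<dots> \<le> Bh * norm (ch q - ch p) + Bh * norm (X q - X p)"
        by (intro add_mono Bh(2)) (use R pq in auto)
      finally show "norm (ep q - ep p) \<le> Bh * (norm (ch q - ch p) + norm (X q - X p))" by (simp add: distrib_left)
    qed
  qed
  have act: "abs_cont_on {0..\<delta>} (\<lambda>t. tau0 + t *\<^sub>R (\<chi> i::'k. (1::real)))"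
    by (rule abs_cont_on_bounded[OF abs_cont_on_id, of _ _ "norm (\<chi> i::'k. (1::real))"])
      (simp add: scaleR_diff_left[symmetric])
  have ach: "abs_cont_on {0..\<delta>} (\<lambda>t. (\<chi> i. h i t))"
  proof (rule abs_cont_on_bounded[OF abs_cont_on_id, of _ _ "\<Sum>i\<in>UNIV. Bl i"])
    fix p q assume pq: "p \<in> {0..\<delta>}" "q \<in> {0..\<delta>}" "p \<le> q"
    have "norm ((\<chi> i. h i q) - (\<chi> i. h i p)) \<le> (\<Sum>i\<in>UNIV. \<bar>h i q - h i p\<bar>)"
      using norm_le_l1_cart[of "(\<chi> i. h i q) - (\<chi> i. h i p)"] by simp
    also have "\<dots> \<le> (\<Sum>i\<in>UNIV. Bl i * \<bar>q - p\<bar>)"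
    proof (rule sum_mono)
      fix i
      have "p \<in> {0..dl i}" "q \<in> {0..dl i}" using pq \<delta>(2)[of i] by auto
      from lipschitz_onD[OF h(4) this(2,1)] show "\<bar>h i q - h i p\<bar> \<le> Bl i * \<bar>q - p\<bar>" by (simp add: dist_real_def)
    qed
    finally show "norm ((\<chi> i. h i q) - (\<chi> i. h i p)) \<le> (\<Sum>i\<in>UNIV. Bl i) * norm (q - p)" by (simp add: sum_distrib_right)
  qed
  have acc: "abs_cont_on {0..\<delta>} (\<lambda>t. wh0)" by (rule abs_cont_on_bounded[OF abs_cont_on_id, of _ _ 0]) simp
  have acx: "abs_cont_on {0..\<delta>} x" unfolding x_def
    by (intro abs_cont_on_Pair abs_cont_on_diff acs[OF Z(2)] acs[OF ch(2)] acs[OF X(2)] ace acc act ach)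
  have fa: "flow_arc \<H> 0 \<delta> x u"
    unfolding flow_arc_def
  proof (intro conjI acx)
    have "AE t in lebesgue. t \<in> {0..} \<longrightarrow> (ch has_vector_derivative fp S (ch t) 0) (at t within {0..})"
      "AE t in lebesgue. t \<in> {0..} \<longrightarrow> (X has_vector_derivative fp S (X t) 0) (at t within {0..})"
      "AE t in lebesgue. t \<in> {0..} \<longrightarrow> (Z has_vector_derivative fo S (Z t) (yh t)) (at t within {0..})"
      using ch(2) X(2) Z(2) by (simp_all add: ode_solution_def)
    then show "AE t in lebesgue. t \<in> {0..\<delta>} \<longrightarrow> (x t, u t) \<in> flow_set \<H> \<and>
       (\<exists>d\<in>flow_map \<H> (x t) (u t). (x has_vector_derivative d) (at t within {0..\<delta>}))"
      using AE_lebesgue_neq[of 0] AE_lebesgue_neq[of \<delta>]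
    proof (eventually_elim, intro impI)
      fix t
      assume d: "t \<in> {0..} \<longrightarrow> (ch has_vector_derivative fp S (ch t) 0) (at t within {0..})"
        "t \<in> {0..} \<longrightarrow> (X has_vector_derivative fp S (X t) 0) (at t within {0..})"
        "t \<in> {0..} \<longrightarrow> (Z has_vector_derivative fo S (Z t) (yh t)) (at t within {0..})"
        and ne: "t \<noteq> 0" "t \<noteq> \<delta>" and t: "t \<in> {0..\<delta>}"
      let ?I = "{0..\<delta>}"
      have t0: "t \<in> {0..}" and sub: "?I \<subseteq> {0..}" using t by auto
      have dch: "(ch has_vector_derivative fp S (ch t) 0) (at t within ?I)"
        and dX: "(X has_vector_derivative fp S (X t) 0) (at t within ?I)"
        and dZ: "(Z has_vector_derivative fo S (Z t) (yh t)) (at t within ?I)"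
        using d t0 sub by (blast intro: has_vector_derivative_within_subset)+
      have nb: "at t within ?I \<noteq> bot" using t \<delta>(1) by (simp add: trivial_limit_within islimpt_Icc)
      have hd: "frechet_derivative (ho S) (at (Z t)) (fo S (Z t) (yh t)) = fp S (ch t) 0"
        by (rule ho_flow_derivative[OF dZ dch _ t nb]) (simp add: hz)
      have hXt: "ho S (Z t) - (ch t - X t) = X t" using hz[of t] t by simp
      have fz: "f_z S (Z t) (ch t - X t) (ep t) wh0 = fo S (Z t) (yh t)"
        unfolding f_z_def hXt by (simp add: ep_def)
      have dhp: "((\<lambda>s. hp S (f s)) has_vector_derivative (\<Sum>i\<in>UNIV. frechet_derivative (hpi S i) (at (f t)) f')) (at t within ?I)"
        if "(f has_vector_derivative f') (at t within ?I)" for f f'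
      proof -
        have "((\<lambda>s. hpi S i (f s)) has_vector_derivative frechet_derivative (hpi S i) (at (f t)) f') (at t within ?I)" for i
        proof -
          have "(hpi S i has_derivative frechet_derivative (hpi S i) (at (f t))) (at (f t) within f ` ?I)"
            using hpi_deriv[of i] by (metis has_derivative_at_withinI)
          from vector_derivative_diff_chain_within[OF that this] show ?thesis by (simp add: o_def)
        qed
        then show ?thesis unfolding hp_sum by (intro has_vector_derivative_sum)
      qed
      have dep: "(ep has_vector_derivative (\<Sum>i\<in>UNIV. g_i S i (Z t) (ch t - X t) 0)) (at t within ?I)"
      proof -
        have "(ep has_vector_derivative (0 + ((\<Sum>i\<in>UNIV. frechet_derivative (hpi S i) (at (ch t)) (fp S (ch t) 0)) - 0) - 0
           - (\<Sum>i\<in>UNIV. frechet_derivative (hpi S i) (at (X t)) (fp S (X t) 0)))) (at t within ?I)"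
          unfolding ep_def yh_def
          by (intro has_vector_derivative_diff has_vector_derivative_add has_vector_derivative_const dhp dch dX)
        then show ?thesis using t by (simp add: g_i_def hXt hz sum_subtractf)
      qed
      have dh: "((\<lambda>s. (\<chi> i. h i s)) has_vector_derivative (\<chi> i. r i + spar P i - sig P i (h i t))) (at t within ?I)"
      proof -
        have "(h i has_vector_derivative r i + spar P i - sig P i (h i t)) (at t within ?I)" for i
        proof -
          have "t \<in> {0<..<dl i}" using t ne \<delta>(2)[of i] by auto
          from h(5)[OF this] show ?thesis
            by (simp add: has_real_derivative_iff_has_vector_derivative has_vector_derivative_at_within)
        qed
        then show ?thesis by (rule has_vector_derivative_vec_lambda)
      qed
      define d where "d = (fo S (Z t) (yh t), fp S (ch t) 0 - fp S (X t) 0, \<Sum>i\<in>UNIV. g_i S i (Z t) (ch t - X t) 0, 0 :: real^'m,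
         (\<chi> i::'k. (1::real)), (\<chi> i. r i + spar P i - sig P i (h i t)))"
      have dx: "(x has_vector_derivative d) (at t within ?I)" unfolding x_def d_def
      proof (intro has_vector_derivative_Pair dZ dh dep has_vector_derivative_diff dch dX has_vector_derivative_const)
        show "((\<lambda>t. tau0 + t *\<^sub>R (\<chi> i::'k. (1::real))) has_vector_derivative (\<chi> i. 1)) (at t within ?I)"
          by (auto intro!: derivative_eq_intros)
      qed
      have ut: "u t = u0 t" using ne by (simp add: u_def)
      have "d \<in> flow_map \<H> (x t) (u t)"
        unfolding flow_map_iff ut
      proof (intro conjI allI)
        show "st_z d = f_z S (st_z (x t)) (st_e (x t)) (st_eps (x t)) (st_wh (x t))" by (simp add: d_def x_def fz)
        show "st_e d = f_e S (st_z (x t)) (st_e (x t)) (st_eps (x t)) (st_wh (x t)) (fst (u0 t))"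
          by (simp add: d_def x_def f_e_def fz hd hXt u0_def)
        show "st_eps d = (\<Sum>i\<in>UNIV. g_i S i (st_z (x t)) (st_e (x t)) (fst (u0 t)))" by (simp add: d_def x_def u0_def)
        show "st_wh d = 0" "st_tau d = (\<chi> i. 1)" by (simp_all add: d_def)
        fix i
        \<comment> \<open>At the threshold \<open>omega\<close> is the whole unit interval, so 1 is
          allowed there. The flow does not depend on this choice, as \<open>\<omega>\<close>
          multiplies the square of \<open>W\<close> at 0.\<close>
        define \<omega> :: real where "\<omega> = (if st_tau (x t) $ i < tMIET P i then 0 else 1)"
        have "\<omega> \<in> omega (tMIET P i) (st_tau (x t) $ i)" by (simp add: \<omega>_def omega_def)
        moreover have "st_eta d $ i = eta_flow i (x t) (u0 t) \<omega>"
        proof -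
          have 1: "st_eps (x t) + st_wh (x t) - snd (u0 t) = 0" by (simp add: x_def u0_def ep_def)
          have "q_i S i (Z t) (ch t - X t) (yh t - hp S (X t)) = blk i (hp S (ch 0) - hp S (X 0) - eps0 - wh0)"
            unfolding q_i_def hXt hpi_def block_diff[symmetric] using hz[of t] t by (simp add: yh_def algebra_simps)
          then have 2: "q_i S i (st_z (x t)) (st_e (x t)) (snd (u0 t)) = blk i (hp S (ch 0) - hp S (X 0) - eps0 - wh0)"
            by (simp add: x_def u0_def)
          show ?thesis unfolding eta_flow_def 1 2 by (simp add: W_0 d_def x_def r_def)
        qed
        ultimately show "\<exists>\<omega>\<in>omega (tMIET P i) (st_tau (x t) $ i). st_eta d $ i = eta_flow i (x t) (u0 t) \<omega>" by blast
      qed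
      moreover have "x t \<in> state_space"
      proof -
        have "0 \<le> h i t" for i using h(3)[of t i] t \<delta>(2)[of i] by auto
        then show ?thesis using tau0 t by (simp add: x_def state_space_iff)
      qed
      ultimately show "(x t, u t) \<in> flow_set \<H> \<and> (\<exists>d\<in>flow_map \<H> (x t) (u t). (x has_vector_derivative d) (at t within ?I))"
        using dx flow_set_iff by blast
    qed
  qed
  show ?thesis by (rule that[OF \<delta>(1) x00 _ fa um ub]) (simp add: u_def)
qed

text \<open>Both extensions go through \<open>solution_pair_extend\<close>. Its conditions on the
  other slices dictate which slice is prolonged, as the one with the largest index need not be the
  one that lasts longest.\<close>

lemma persistent_flow: "persistently_flowing \<H> (admissible_input S P)"
  unfolding persistently_flowing_def
proof (intro allI impI notI)
  fix E and \<xi> :: "real \<Rightarrow> nat \<Rightarrow> ('n, 'm, 'q, 'k) state" and \<nu> :: "real \<Rightarrow> nat \<Rightarrow> ('m, 'p) input"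
  assume h: "maximal_solution_pair \<H> E \<xi> \<nu> \<and> admissible_input S P E \<nu>" and bd: "bdd_above (fst ` E)"
  have sp: "solution_pair \<H> E \<xi> \<nu>" using h by (simp add: maximal_solution_pair_def)
  have L: "hybrid_Linf E \<nu>" using h by (simp add: admissible_input_def)
  have E: "hybrid_time_domain E" using sp by (simp add: solution_pair_def hybrid_arc_def)
  have no_ext: False if "solution_pair \<H> (E \<union> {a..b} \<times> {j}) (\<lambda>t i. if i = j \<and> t \<in> {a..b} then x t else \<xi> t i)
     (\<lambda>t i. if i = j \<and> t \<in> {a..b} then u t else \<nu> t i)" "a \<le> b" "(b, j) \<notin> E"
     "\<And>s. s \<in> {a..b} \<Longrightarrow> (s, j) \<in> E \<Longrightarrow> x s = \<xi> s j" "\<And>s. s \<in> {a..b} \<Longrightarrow> (s, j) \<in> E \<Longrightarrow> u s = \<nu> s j" for a b j x u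
  proof -
    note agree_x = that(4) and agree_u = that(5)
    have "(b, j) \<in> E \<union> {a..b} \<times> {j}" using that(2) by simp
    then have larger: "E \<subset> E \<union> {a..b} \<times> {j}" using that(3) by blast
    have same: "\<forall>(t, i)\<in>E. (if i = j \<and> t \<in> {a..b} then x t else \<xi> t i) = \<xi> t i \<and> (if i = j \<and> t \<in> {a..b} then u t else \<nu> t i) = \<nu> t i"
    proof (clarify, intro conjI)
      fix t i assume ti: "(t, i) \<in> E"
      have "x t = \<xi> t j \<and> u t = \<nu> t j" if "i = j" "t \<in> {a..b}"
        using agree_x[OF that(2)] agree_u[OF that(2)] ti that(1) by blast
      then show "(if i = j \<and> t \<in> {a..b} then x t else \<xi> t i) = \<xi> t i" "(if i = j \<and> t \<in> {a..b} then u t else \<nu> t i) = \<nu> t i"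
        by (metis (full_types))+
    qed
    have "\<not> (\<exists>E' \<xi>' \<nu>'. solution_pair \<H> E' \<xi>' \<nu>' \<and> E \<subset> E' \<and> (\<forall>(t, j)\<in>E. \<xi>' t j = \<xi> t j \<and> \<nu>' t j = \<nu> t j))"
      using h unfolding maximal_solution_pair_def by blast
    then show False by (rule notE) (intro exI conjI, rule that(1), rule larger, rule same)
  qed
  obtain Tb where "\<forall>s\<in>fst ` E. s \<le> Tb" using bd unfolding bdd_above_def by blast
  then have Tb: "t \<le> Tb" if "(t, j) \<in> E" for t j using that by force
  obtain c where c: "c > 0" "\<And>t j. (t, j) \<in> E \<Longrightarrow> c * real j \<le> real CARD('k) * (c + t)" using jumps_bounded[OF sp] by metis
  define Js where "Js = {j. time_slice E j \<noteq> {}}"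
  have "j \<le> nat \<lceil>real CARD('k) * (c + Tb) / c\<rceil>" if jJ: "j \<in> Js" for j
  proof -
    obtain t where t: "(t, j) \<in> E" using jJ by (auto simp: Js_def time_slice_def)
    have "c * real j \<le> real CARD('k) * (c + Tb)"
      using c(2)[OF t] Tb[OF t] by (meson add_left_mono mult_left_mono of_nat_0_le_iff order.trans)
    then have "real j \<le> real CARD('k) * (c + Tb) / c" using c(1) by (simp add: field_simps)
    then show ?thesis by linarith
  qed
  then have finJ: "finite Js" by (meson finite_nat_set_iff_bounded_le)
  have bds: "bdd_above (time_slice E j)" for j using Tb by (auto simp: bdd_above_def time_slice_def)
  have Jne: "Js \<noteq> {}" using hybrid_time_domain_0[OF E] by (auto simp: Js_def time_slice_def)
  define Ts where "Ts = Max ((\<lambda>j. Sup (time_slice E j)) ` Js)"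
  \<comment> \<open>Among the slices that reach the final time the last one is taken; slices of
    larger index then end strictly before \<open>Ts\<close>, as the closing step requires.\<close>
  define j where "j = Max {j \<in> Js. Sup (time_slice E j) = Ts}"
  have "Ts \<in> (\<lambda>j. Sup (time_slice E j)) ` Js" unfolding Ts_def using finJ Jne by (intro Max_in) auto
  then have "{j \<in> Js. Sup (time_slice E j) = Ts} \<noteq> {}" by auto
  then have "j \<in> {j \<in> Js. Sup (time_slice E j) = Ts}" unfolding j_def using finJ by (intro Max_in) auto
  then have j: "j \<in> Js" "Sup (time_slice E j) = Ts" by auto
  have le: "t \<le> Ts" if "(t, i) \<in> E" for t i
  proof -
    have "i \<in> Js" "t \<in> time_slice E i" using that by (auto simp: Js_def time_slice_def)
    then have "t \<le> Sup (time_slice E i)" "Sup (time_slice E i) \<le> Ts"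
      using bds finJ by (auto simp: Ts_def intro: cSup_upper)
    then show ?thesis by simp
  qed
  have lt: "t < Ts" if "(t, i) \<in> E" "j < i" for t i
  proof -
    have i: "i \<in> Js" "t \<in> time_slice E i" using that by (auto simp: Js_def time_slice_def)
    then have "t \<le> Sup (time_slice E i)" "Sup (time_slice E i) \<le> Ts"
      using bds finJ by (auto simp: Ts_def intro: cSup_upper)
    moreover have "Sup (time_slice E i) \<noteq> Ts"
    proof
      assume "Sup (time_slice E i) = Ts"
      then have "i \<le> j" unfolding j_def using i finJ by (intro Max_ge) auto
      then show False using that by simp
    qed
    ultimately show ?thesis by simp
  qed
  show False
  proof (cases "(Ts, j) \<in> E")
    case True
    obtain \<delta> x u B where x: "0 < \<delta>" "x 0 = \<xi> Ts j" "u 0 = \<nu> Ts j" "flow_arc \<H> 0 \<delta> x u" "u \<in> borel_measurable (lebesgue_on {0..\<delta>})"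
      "AE t in lebesgue. t \<in> {0..\<delta>} \<longrightarrow> norm (u t) \<le> B"
      using flow_continuation[OF state_space_invariant[OF sp True], of "\<nu> Ts j"] by blast
    let ?x = "\<lambda>t. x (t + - Ts)" and ?u = "\<lambda>t. u (t + - Ts)"
    have fa: "flow_arc \<H> Ts (Ts + \<delta>) ?x ?u" using flow_arc_shift[OF x(4), of "- Ts"] by (simp add: add.commute)
    have nE: "(s, j) \<notin> E" if "s > Ts" for s using le[of s j] that by auto
    have ag: "?x s = \<xi> s j" "?u s = \<nu> s j" if "s \<in> {Ts..Ts + \<delta>}" "(s, j) \<in> E" for s
    proof -
      have "s = Ts" using le[OF that(2)] that(1) by simp
      then show "?x s = \<xi> s j" "?u s = \<nu> s j" using x by simp_all
    qed
    have "solution_pair \<H> (E \<union> {Ts..Ts + \<delta>} \<times> {j}) (\<lambda>t i. if i = j \<and> t \<in> {Ts..Ts + \<delta>} then ?x t else \<xi> t i)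
     (\<lambda>t i. if i = j \<and> t \<in> {Ts..Ts + \<delta>} then ?u t else \<nu> t i)"
    proof (rule solution_pair_extend[OF sp True])
      show "Ts \<le> Ts + \<delta>" "(Ts + \<delta>, j) \<notin> E" using x(1) nE by auto
      show "s \<le> Ts" if "(s, i) \<in> E" "i < j" for s i by (rule le[OF that(1)])
      show "r < s" if "s \<in> {Ts..Ts + \<delta>}" "(s, j) \<notin> E" "(r, i) \<in> E" "j \<le> i" for s r i
        using le[OF that(3)] that(1,2) True by (cases "s = Ts") auto
      show "abs_cont_on {Ts..Ts + \<delta>} ?x" "AE t in lebesgue. t \<in> {Ts..Ts + \<delta>} \<longrightarrow> (?x t, ?u t) \<in> flow_set \<H> \<and>
       (\<exists>d\<in>flow_map \<H> (?x t) (?u t). (?x has_vector_derivative d) (at t within {Ts..Ts + \<delta>}))"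
        using fa by (simp_all add: flow_arc_def)
      show "?u \<in> borel_measurable (lebesgue_on {Ts..Ts + \<delta>})"
        using borel_measurable_lebesgue_on_shift[OF x(5), of "- Ts"] by (simp add: add.commute)
      show "AE t in lebesgue. t \<in> {Ts..Ts + \<delta>} \<longrightarrow> norm (?u t) \<le> B"
        using AE_lebesgue_shift[OF x(6), of "- Ts"] by eventually_elim auto
    qed (use ag in auto)
    from no_ext[OF this _ _ ag] show False using x(1) nE by auto
  next
    case False
    have ne: "time_slice E j \<noteq> {}" using j(1) by (simp add: Js_def)
    obtain a0 where a0: "(a0, j) \<in> E" using ne by (auto simp: time_slice_def)
    have a0T: "a0 < Ts" using le[OF a0] a0 False by (cases "a0 = Ts") auto
    \<comment> \<open>An open end leaves a second point of the slice above \<open>a0\<close>. With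
      both points \<open>earlier_slices_le\<close> excludes that an earlier slice runs beyond
      \<open>a\<close>.\<close>
    then obtain a where a: "(a, j) \<in> E" "a0 < a" using j(2) less_cSup_iff[OF ne bds, of a0] by (auto simp: time_slice_def)
    have aT: "a < Ts" using le[OF a(1)] a False by (cases "a = Ts") auto
    have sl: "{a..<Ts} \<subseteq> time_slice E j"
    proof
      fix s assume s: "s \<in> {a..<Ts}"
      then obtain s' where s': "(s', j) \<in> E" "s < s'" using j(2) less_cSup_iff[OF ne bds, of s] by (auto simp: time_slice_def)
      show "s \<in> time_slice E j" using time_slice_interval[OF E a(1) s'(1)] s s'(2) by auto
    qed
    let ?T = "Ts - a" and ?N = "enn2real (hybrid_norm E \<nu>)"
    have flow: "AE t in lebesgue. t \<in> time_slice E j \<longrightarrow> (\<xi> t j, \<nu> t j) \<in> flow_set \<H> \<and>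
        (\<exists>d\<in>flow_map \<H> (\<xi> t j) (\<nu> t j). ((\<lambda>s. \<xi> s j) has_vector_derivative d) (at t within time_slice E j))"
      using sp unfolding solution_pair_def by blast
    have "\<exists>y. abs_cont_on {0..?T} y \<and> (\<forall>t\<in>{0..<?T}. y t = \<xi> (t + a) j)"
    proof (rule flow_arc_close[of ?T "\<lambda>t. \<xi> (t + a) j" "\<lambda>t. \<nu> (t + a) j" ?N])
      show "0 < ?T" using aT by simp
      show "abs_cont_on {0..r} (\<lambda>t. \<xi> (t + a) j)" if "r < ?T" for r
      proof -
        have "{a..a + r} \<subseteq> time_slice E j" using sl that by auto
        then have "abs_cont_on {a..a + r} (\<lambda>t. \<xi> t j)" using flow_arc_of_solution_pair[OF sp] unfolding flow_arc_def by blast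
        from abs_cont_on_shift[OF this, of a] show ?thesis by (simp add: add.commute)
      qed
      have mem: "t + a \<in> time_slice E j" if "t \<in> {0..<?T}" for t
      proof -
        have "t + a \<in> {a..<Ts}" using that by auto
        then show ?thesis using sl by blast
      qed
      show "\<xi> (t + a) j \<in> state_space" if "t \<in> {0..<?T}" for t
        by (rule state_space_invariant[OF sp]) (use mem[OF that] in \<open>simp add: time_slice_def\<close>)
      show "AE t in lebesgue. t \<in> {0..<?T} \<longrightarrow> norm (\<nu> (t + a) j) \<le> ?N"
        using AE_lebesgue_shift[OF hybrid_Linf_bound(1)[OF L, of j], of a] by eventually_elim (use mem in auto)
      have im: "(\<lambda>s. s - a) ` {a..<Ts} = {0..<?T}"
      proof (intro equalityI subsetI)
        fix s assume "s \<in> {0..<?T}"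
        then show "s \<in> (\<lambda>s. s - a) ` {a..<Ts}" by (intro image_eqI[of _ _ "s + a"]) auto
      qed auto
      show "AE t in lebesgue. t \<in> {0..<?T} \<longrightarrow> (\<xi> (t + a) j, \<nu> (t + a) j) \<in> flow_set \<H> \<and>
        (\<exists>d\<in>flow_map \<H> (\<xi> (t + a) j) (\<nu> (t + a) j). ((\<lambda>t. \<xi> (t + a) j) has_vector_derivative d) (at t within {0..<?T}))"
        using AE_lebesgue_shift[OF flow, of a]
      proof (eventually_elim, intro impI)
        fix t assume h: "t + a \<in> time_slice E j \<longrightarrow> (\<xi> (t + a) j, \<nu> (t + a) j) \<in> flow_set \<H> \<and>
          (\<exists>d\<in>flow_map \<H> (\<xi> (t + a) j) (\<nu> (t + a) j). ((\<lambda>s. \<xi> s j) has_vector_derivative d) (at (t + a) within time_slice E j))"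
          "t \<in> {0..<?T}"
        then obtain d where d: "(\<xi> (t + a) j, \<nu> (t + a) j) \<in> flow_set \<H>" "d \<in> flow_map \<H> (\<xi> (t + a) j) (\<nu> (t + a) j)"
          "((\<lambda>s. \<xi> s j) has_vector_derivative d) (at (t + a) within time_slice E j)" using mem by blast
        have "((\<lambda>s. \<xi> s j) has_vector_derivative d) (at (t + a) within {a..<Ts})" using d(3) sl by (rule has_vector_derivative_within_subset)
        from has_vector_derivative_shift[OF this] have "((\<lambda>t. \<xi> (t + a) j) has_vector_derivative d) (at t within {0..<?T})" unfolding im .
        then show "(\<xi> (t + a) j, \<nu> (t + a) j) \<in> flow_set \<H> \<and>
        (\<exists>d\<in>flow_map \<H> (\<xi> (t + a) j) (\<nu> (t + a) j). ((\<lambda>t. \<xi> (t + a) j) has_vector_derivative d) (at t within {0..<?T}))"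
          using d by blast
      qed
    qed
    then obtain y where y: "abs_cont_on {0..?T} y" "\<And>t. t \<in> {0..<?T} \<Longrightarrow> y t = \<xi> (t + a) j" by blast
    \<comment> \<open>The point \<open>(Ts, j)\<close> is not in the domain, so the input there may
      take any value; 0 is chosen.\<close>
    let ?x = "\<lambda>t. y (- a + t)" and ?u = "\<lambda>t. if t = Ts then 0 else \<nu> t j"
    have ag: "?x s = \<xi> s j" "?u s = \<nu> s j" if "s \<in> {a..Ts}" "(s, j) \<in> E" for s
      using that False y(2)[of "s - a"] by (cases "s = Ts", auto)
    have xeq: "\<xi> s j = ?x s" if "s \<in> {a..<Ts}" for s using y(2)[of "s - a"] that by auto
    have "solution_pair \<H> (E \<union> {a..Ts} \<times> {j}) (\<lambda>t i. if i = j \<and> t \<in> {a..Ts} then ?x t else \<xi> t i)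
     (\<lambda>t i. if i = j \<and> t \<in> {a..Ts} then ?u t else \<nu> t i)"
    proof (rule solution_pair_extend[OF sp a(1)])
      show "a \<le> Ts" "(Ts, j) \<notin> E" using aT False by auto
      show "s \<le> a" if "(s, i) \<in> E" "i < j" for s i by (rule earlier_slices_le[OF E a0 a(1,2) that])
      show "r < s" if s: "s \<in> {a..Ts}" "(s, j) \<notin> E" and r: "(r, i) \<in> E" "j \<le> i" for s r i
      proof -
        have "s = Ts" using s sl by (force simp: time_slice_def)
        moreover have "r < Ts"
        proof (cases "i = j")
          case True then show ?thesis using le[OF r(1)] r(1) False by (cases "r = Ts") auto
        next
          case False then show ?thesis using lt[OF r(1)] r(2) by simp
        qed
        ultimately show ?thesis by simp
      qed
      show "abs_cont_on {a..Ts} ?x" using abs_cont_on_shift[OF y(1), of "- a"] by simp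
      show "AE t in lebesgue. t \<in> {a..Ts} \<longrightarrow> (?x t, ?u t) \<in> flow_set \<H> \<and>
       (\<exists>d\<in>flow_map \<H> (?x t) (?u t). (?x has_vector_derivative d) (at t within {a..Ts}))"
        using flow AE_lebesgue_neq[of a] AE_lebesgue_neq[of Ts]
      proof (eventually_elim, intro impI)
        fix t assume h: "t \<in> time_slice E j \<longrightarrow> (\<xi> t j, \<nu> t j) \<in> flow_set \<H> \<and>
        (\<exists>d\<in>flow_map \<H> (\<xi> t j) (\<nu> t j). ((\<lambda>s. \<xi> s j) has_vector_derivative d) (at t within time_slice E j))"
          and ne: "t \<noteq> a" "t \<noteq> Ts" and t: "t \<in> {a..Ts}"
        have t': "t \<in> {a..<Ts}" "a < t" using t ne by auto
        then obtain d where d: "(\<xi> t j, \<nu> t j) \<in> flow_set \<H>" "d \<in> flow_map \<H> (\<xi> t j) (\<nu> t j)"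
          "((\<lambda>s. \<xi> s j) has_vector_derivative d) (at t within time_slice E j)" using h sl by blast
        have "((\<lambda>s. \<xi> s j) has_vector_derivative d) (at t within {a..<Ts})" using d(3) sl by (rule has_vector_derivative_within_subset)
        then have "(?x has_vector_derivative d) (at t within {a..<Ts})"
          by (rule has_vector_derivative_transform[OF t'(1), rotated]) (use xeq in auto)
        moreover have "at t within {a..<Ts} = at t within {a..Ts}"
          by (rule at_within_nhd[of t "{..<Ts}"]) (use t' in auto)
        ultimately have "(?x has_vector_derivative d) (at t within {a..Ts})" by simp
        moreover have e: "?x t = \<xi> t j" "?u t = \<nu> t j" using xeq[OF t'(1)] ne by auto
        ultimately show "(?x t, ?u t) \<in> flow_set \<H> \<and> (\<exists>d\<in>flow_map \<H> (?x t) (?u t). (?x has_vector_derivative d) (at t within {a..Ts}))"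
          unfolding e using d by blast
      qed
      show "?u \<in> borel_measurable (lebesgue_on {a..Ts})"
      proof -
        have "(\<lambda>t. \<nu> t j) \<in> borel_measurable (lebesgue_on (time_slice E j))"
          using L unfolding hybrid_Linf_def hybrid_input_def by blast
        then have "(\<lambda>t. \<nu> t j) \<in> borel_measurable (lebesgue_on {a..<Ts})"
          by (rule measurable_restrict_mono[OF _ sl])
        from borel_measurable_lebesgue_on_point[OF this, of Ts 0]
        have "?u \<in> borel_measurable (lebesgue_on (insert Ts {a..<Ts}))" by simp
        moreover have "insert Ts {a..<Ts} = {a..Ts}" using aT by auto
        ultimately show ?thesis by simp
      qed
      show "AE t in lebesgue. t \<in> {a..Ts} \<longrightarrow> norm (?u t) \<le> ?N"
        using hybrid_Linf_bound(1)[OF L, of j] AE_lebesgue_neq[of Ts]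
      proof eventually_elim
        case (elim t)
        then show ?case using sl by (auto simp: subset_iff)
      qed
    qed (use ag in auto)
    from no_ext[OF this _ _ ag] show False using aT False by auto
  qed
qed

end

theorem corollary6:
  fixes S :: "('n::finite, 'm::finite, 'p::finite, 'q::finite, 'k::finite) estimation_setup"
    and P :: "('m, 'k) trigger"
    and H :: "'k \<Rightarrow> real^'q \<Rightarrow> real^'n \<Rightarrow> real^'m \<Rightarrow> real^'p \<Rightarrow> real"
    and V :: "real^'n \<Rightarrow> real"
    and \<alpha> \<alpha>l \<alpha>u \<zeta> :: "real \<Rightarrow> real"
    and \<mu> :: "'k \<Rightarrow> real"
  assumes "cont_differentiable (\<lambda>(x, v). fp S x v)"
    and "\<And>i. cont_differentiable (hpi S i)"
    and "\<And>z. ho S differentiable (at z)"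
    and "plant_forward_complete S"
    and "observer_forward_complete S"
    and "assumption_W S P H"
    and "assumption_V S P H V \<alpha> \<alpha>l \<alpha>u \<zeta> \<mu>"
    and "\<And>i. 0 \<le> wbar P i"
    and "\<And>i. 0 < lam P i \<and> lam P i < 1"
    and "\<And>i. is_MIET (Lc P i) (gam P i) (lam P i) (tMIET P i)"
    and "\<And>i. 0 < tmin P i \<and> tmin P i \<le> tMIET P i"
    and "\<And>i. class_K_inf (sig P i)"
    and "\<And>i. 0 \<le> spar P i"
  shows "persistently_flowing (estimation_system S P) (admissible_input S P) \<and>
    ((\<forall>i. spar P i = 0) \<longrightarrow>
       ISS (estimation_system S P) (admissible_input S P) (sampled_noise_init S P) target_set) \<and>
    ((\<exists>i. spar P i > 0) \<longrightarrow>
       ISpS (estimation_system S P) (admissible_input S P) (sampled_noise_init S P) target_set)"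
proof -
  interpret estimation_model S P H V \<alpha> \<alpha>l \<alpha>u \<zeta> \<mu>
    by unfold_locales (use assms in auto)
  obtain d where "d \<ge> 0" "stability_estimate \<H> (admissible_input S P) (sampled_noise_init S P) target_set d"
    "(\<forall>i. spar P i = 0) \<Longrightarrow> d = 0" using stability by blast
  then show ?thesis
    using persistent_flow closed_target_set target_set_nonempty unfolding ISS_def ISpS_def by blast
qed

end
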